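(* Let $V$ be a vector space of finite dimension $n$ with basis $e_1,\dots,e_n$, and let $$\Delta_{\max}:e_k\mapsto\sum_{i,j\,\mid\,\max(i,j)=k}e_i\otimes e_j .$$ The operad $\bigvee_{\mathrm{Lie}}^{n+1}\mathrm{PreLie}$ is isomorphic to $\mathrm{Greg}^{(V,\Delta_{\max})}$. Moreover, $\bigvee_{\mathrm{Lie}}^{n+1}\mathrm{PreLie}$ is filtered by the grading of the rooted Greg trees by the number of black vertices, and the associated graded operad is $\mathrm{Greg}_n=\mathrm{Greg}^{(V,0)}$.
   Context: The base field has characteristic $0$. $\mathrm{Lie}$ is the operad of Lie algebras, generated by the skew-symmetric bracket $l$. $\mathrm{PreLie}$ is generated by one binary operation $x$ without symmetries with the relation $(x\circ_1x-x\circ_2x)=(x\circ_1x-x\circ_2x).(2\;3)$, and $\mathrm{Lie}\to\mathrm{PreLie}$ is $l\mapsto x-x.(1\;2)$. $\bigvee_{\mathrm{Lie}}^{m}\mathrm{PreLie}$ is the fibered coproduct (in operads) of $m$ copies of $\mathrm{PreLie}$ over $\mathrm{Lie}$. The operad $\mathrm{Greg}^C$, for $C=(V,\Delta)$ with $V$ finite-dimensional and $\Delta$ a coassociative cocommutative coproduct. A rooted Greg tree is a (non-planar) rooted tree whose vertices are white or black, the white vertices being in bijection with a finite set of labels and the black vertices being unlabelled with at least two children each. $G_k(m)$ is the set of rooted Greg trees with white vertices labelled by $\{1,\dots,m\}$ and $k$ black vertices; $BV(\tau)$ is the set of black vertices of $\tau$. Put $\mathcal{G}^V_k(m)=\bigoplus_{\tau\in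 G_k(m)}V^{\otimes BV(\tau)}$, $\mathcal{G}^V(m)=\bigoplus_k\mathcal{G}^V_k(m)$, $\mathcal{G}^V=\bigoplus_m\mathcal{G}^V(m)$. So $\mathcal{G}^V(m)$ has a basis of rooted Greg trees whose black vertices are labelled by a basis of $V$. The symmetric groups act by permuting the labels of the white vertices. Deformed fall product. For $S,T\in\mathcal{G}^V$ trees with disjoint white labels, $S\star^\Delta T$ is the sum of: (i) for every vertex $v$ of $S$, the tree obtained by grafting the root of $T$ as a new child of $v$; (ii) for every black vertex $v$ of $S$, with label $c\in V$, forest of children $FS$ and $\Delta(c)=c_{(1)}\otimes c_{(2)}$ (Sweedler notation), and every decomposition $FS=FS_{(1)}\sqcup FS_{(2)}$, the tree obtained from $S$ by replacing $v$ by two black vertices: a lower one, labelled $c_{(1)}$, in the position of $v$, with children the trees of $FS_{(1)}$ and the upper vertex; and an upper one, labelled $c_{(2)}$, with children the trees of $FS_{(2)}$ and $T$. Braces: $Br^\Delta(S)=S$, $Br^\Delta(S;T)=S\star^\Delta T$, $Br^\Delta(S;T_1,\dots,T_{r+1})=Br^\Delta(S;T_1,\dots,T_r)\star^\Delta T_{r+1}-\sum_{i=1}^rBr^\Delta(S;T_1,\dots,T_i\star^\Delta T_{r+1},\dots,T_r)$. Partial compositions. For a white vertex $v$ of $T$ labelled $i$, with $FT$ the forest of subtrees at the children of $v$, $T\circ_i^\Delta S$ is obtained by replacing in $T$ the whole subtree rooted at $v$ by $Br^\Delta(S;FT)$ (its root is attached to the parent of $v$, if any, and $v$ is removed). $\mathrm{Greg}^C$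 is the operad $(\mathcal{G}^V,\{\circ_i^\Delta\})$. $\mathrm{Greg}_n=\mathrm{Greg}^{(V,0)}$ is the case of the zero coproduct.
   Formalization: In clause (ii) of the deformed fall product only decompositions with FS(2) a single tree are summed; with all decompositions the result contains black vertices with one child, and dropping those breaks the pre-Lie identity (n=1, associator of e(1,2), 3, 4), so no operad results. *)

theory Defs
  imports
    "HOL-Algebra.Algebraic_Closure_Type"
    "HOL-Library.Poly_Mapping"
    "HOL-Combinatorics.Permutations"
begin

section \<open>Symmetric operads over a field\<close>

abbreviation scalars :: "'k::field ring" where
  "scalars \<equiv> ring_of_type_algebra"

text \<open>
  The arity-\<open>m\<close> component is a vector space carrying a right action of the permutations of
  \<open>{1..m}\<close>; \<open>pcomp P m n i x y\<close> is the partial composition of \<open>x\<close> of arity \<open>m\<close> with \<open>y\<close> of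
  arity \<open>n\<close> at the input \<open>i\<close>.  (The ring multiplication and unit which the library's record type
  for modules inherits from rings play no role.)
\<close>

record ('k, 'a) operad =
  sp :: "nat \<Rightarrow> ('k, 'a) module"
  act :: "nat \<Rightarrow> 'a \<Rightarrow> (nat \<Rightarrow> nat) \<Rightarrow> 'a"
  pcomp :: "nat \<Rightarrow> nat \<Rightarrow> nat \<Rightarrow> 'a \<Rightarrow> 'a \<Rightarrow> 'a"
  ident :: 'a

abbreviation els :: "('k, 'a, 'z) operad_scheme \<Rightarrow> nat \<Rightarrow> 'a set" where
  "els P m \<equiv> carrier (sp P m)"

definition linear_space :: "'a set \<Rightarrow> 'a \<Rightarrow> ('a \<Rightarrow> 'a \<Rightarrow> 'a) \<Rightarrow> ('k \<Rightarrow> 'a \<Rightarrow> 'a) \<Rightarrow> ('k, 'a) module" where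
  "linear_space A z p s =
     \<lparr>carrier = A, monoid.mult = undefined, one = undefined, zero = z, add = p, module.smult = s\<rparr>"

text \<open>
  When an operation with \<open>n\<close> inputs is inserted at the input \<open>i\<close>, an input \<open>j \<noteq> i\<close> of the outer
  operation becomes the input \<open>shift i n j\<close>, and an input \<open>k\<close> of the inner one becomes
  \<open>i - 1 + k\<close>.  The permutation \<open>perm_comp n i \<sigma> \<tau>\<close> carries these blocks (for \<open>i\<close>) to the
  corresponding blocks for \<open>\<sigma> i\<close>, permuting the outer inputs by \<open>\<sigma>\<close> and the inner ones by \<open>\<tau>\<close>.
\<close>

definition shift :: "nat \<Rightarrow> nat \<Rightarrow> nat \<Rightarrow> nat" where
  "shift i n j = (if j < i then j else j + n - 1)"

definition perm_comp :: "nat \<Rightarrow> nat \<Rightarrow> (nat \<Rightarrow> nat) \<Rightarrow> (nat \<Rightarrow> nat) \<Rightarrow> nat \<Rightarrow> nat" where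
  "perm_comp n i \<sigma> \<tau> r =
     (if r < i then shift (\<sigma> i) n (\<sigma> r)
      else if r < i + n then \<sigma> i - 1 + \<tau> (r - (i - 1))
      else shift (\<sigma> i) n (\<sigma> (r + 1 - n)))"

locale operad =
  fixes P :: "('k::field, 'a) operad"
  assumes module_sp: "\<And>m. Module.module scalars (sp P m)"
    and act_closed: "\<And>m x \<sigma>. x \<in> els P m \<Longrightarrow> \<sigma> permutes {1..m} \<Longrightarrow> act P m x \<sigma> \<in> els P m"
    and act_add: "\<And>m x y \<sigma>. x \<in> els P m \<Longrightarrow> y \<in> els P m \<Longrightarrow> \<sigma> permutes {1..m} \<Longrightarrow>
      act P m (x \<oplus>\<^bsub>sp P m\<^esub> y) \<sigma> = act P m x \<sigma> \<oplus>\<^bsub>sp P m\<^esub> act P m y \<sigma>"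
    and act_smult: "\<And>m c x \<sigma>. x \<in> els P m \<Longrightarrow> \<sigma> permutes {1..m} \<Longrightarrow>
      act P m (c \<odot>\<^bsub>sp P m\<^esub> x) \<sigma> = c \<odot>\<^bsub>sp P m\<^esub> act P m x \<sigma>"
    and act_id: "\<And>m x. x \<in> els P m \<Longrightarrow> act P m x id = x"
    and act_act: "\<And>m x \<sigma> \<tau>. x \<in> els P m \<Longrightarrow> \<sigma> permutes {1..m} \<Longrightarrow> \<tau> permutes {1..m} \<Longrightarrow>
      act P m (act P m x \<sigma>) \<tau> = act P m x (\<sigma> \<circ> \<tau>)"
    and pcomp_closed: "\<And>m n i x y. x \<in> els P m \<Longrightarrow> y \<in> els P n \<Longrightarrow> i \<in> {1..m} \<Longrightarrow>
      pcomp P m n i x y \<in> els P (m + n - 1)"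
    and pcomp_add_left: "\<And>m n i x x' y. x \<in> els P m \<Longrightarrow> x' \<in> els P m \<Longrightarrow> y \<in> els P n \<Longrightarrow> i \<in> {1..m} \<Longrightarrow>
      pcomp P m n i (x \<oplus>\<^bsub>sp P m\<^esub> x') y
        = pcomp P m n i x y \<oplus>\<^bsub>sp P (m + n - 1)\<^esub> pcomp P m n i x' y"
    and pcomp_add_right: "\<And>m n i x y y'. x \<in> els P m \<Longrightarrow> y \<in> els P n \<Longrightarrow> y' \<in> els P n \<Longrightarrow> i \<in> {1..m} \<Longrightarrow>
      pcomp P m n i x (y \<oplus>\<^bsub>sp P n\<^esub> y')
        = pcomp P m n i x y \<oplus>\<^bsub>sp P (m + n - 1)\<^esub> pcomp P m n i x y'"
    and pcomp_smult_left: "\<And>m n i c x y. x \<in> els P m \<Longrightarrow> y \<in> els P n \<Longrightarrow> i \<in> {1..m} \<Longrightarrow>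
      pcomp P m n i (c \<odot>\<^bsub>sp P m\<^esub> x) y = c \<odot>\<^bsub>sp P (m + n - 1)\<^esub> pcomp P m n i x y"
    and pcomp_smult_right: "\<And>m n i c x y. x \<in> els P m \<Longrightarrow> y \<in> els P n \<Longrightarrow> i \<in> {1..m} \<Longrightarrow>
      pcomp P m n i x (c \<odot>\<^bsub>sp P n\<^esub> y) = c \<odot>\<^bsub>sp P (m + n - 1)\<^esub> pcomp P m n i x y"
    and ident_closed: "ident P \<in> els P 1"
    and ident_left: "\<And>n y. y \<in> els P n \<Longrightarrow> pcomp P 1 n 1 (ident P) y = y"
    and ident_right: "\<And>m i x. x \<in> els P m \<Longrightarrow> i \<in> {1..m} \<Longrightarrow> pcomp P m 1 i x (ident P) = x"
    and sequential: "\<And>m n p i j x y z. x \<in> els P m \<Longrightarrow> y \<in> els P n \<Longrightarrow> z \<in> els P p \<Longrightarrow>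
      i \<in> {1..m} \<Longrightarrow> j \<in> {1..n} \<Longrightarrow>
      pcomp P (m + n - 1) p (i - 1 + j) (pcomp P m n i x y) z
        = pcomp P m (n + p - 1) i x (pcomp P n p j y z)"
    and parallel: "\<And>m n p i k x y z. x \<in> els P m \<Longrightarrow> y \<in> els P n \<Longrightarrow> z \<in> els P p \<Longrightarrow>
      i \<in> {1..m} \<Longrightarrow> k \<in> {1..m} \<Longrightarrow> i < k \<Longrightarrow>
      pcomp P (m + n - 1) p (k - 1 + n) (pcomp P m n i x y) z
        = pcomp P (m + p - 1) n i (pcomp P m p k x z) y"
    and equivariant: "\<And>m n i x y \<sigma> \<tau>. x \<in> els P m \<Longrightarrow> y \<in> els P n \<Longrightarrow> i \<in> {1..m} \<Longrightarrow>
      \<sigma> permutes {1..m} \<Longrightarrow> \<tau> permutes {1..n} \<Longrightarrow>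
      pcomp P m n i (act P m x \<sigma>) (act P n y \<tau>)
        = act P (m + n - 1) (pcomp P m n (\<sigma> i) x y) (perm_comp n i \<sigma> \<tau>)"

lemma perm_comp_permutes:
  assumes \<sigma>: "\<sigma> permutes {1..m}" and \<tau>: "\<tau> permutes {1..n}" and i: "i \<in> {1..m}"
  shows "perm_comp n i \<sigma> \<tau> permutes {1..m + n - 1}"
proof -
  have s1: "1 \<le> \<sigma> x \<and> \<sigma> x \<le> m \<longleftrightarrow> 1 \<le> x \<and> x \<le> m" for x
    using permutes_in_image[OF \<sigma>, of x] by simp
  have t1: "1 \<le> \<tau> x \<and> \<tau> x \<le> n \<longleftrightarrow> 1 \<le> x \<and> x \<le> n" for x
    using permutes_in_image[OF \<tau>, of x] by simp
  have inj_s: "\<sigma> x = \<sigma> y \<Longrightarrow> x = y" for x y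
    using permutes_inj[OF \<sigma>] by (simp add: inj_eq)
  have inj_t: "\<tau> x = \<tau> y \<Longrightarrow> x = y" for x y
    using permutes_inj[OF \<tau>] by (simp add: inj_eq)
  have si: "1 \<le> \<sigma> i" "\<sigma> i \<le> m" using s1[of i] i by auto
  let ?\<pi> = "perm_comp n i \<sigma> \<tau>"
  have maps: "?\<pi> r \<in> {1..m + n - 1}" if "r \<in> {1..m + n - 1}" for r
  proof -
    consider "r < i" | "i \<le> r" "r < i + n" | "i + n \<le> r" by linarith
    then show ?thesis
    proof cases
      case 1
      have a: "1 \<le> \<sigma> r" "\<sigma> r \<le> m" using s1[of r] that i 1 by auto
      have b: "\<sigma> r \<noteq> \<sigma> i" using inj_s[of r i] 1 by auto
      have "?\<pi> r = shift (\<sigma> i) n (\<sigma> r)" using 1 by (simp add: perm_comp_def)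
      then show ?thesis using a b si by (auto simp: shift_def)
    next
      case 2
      have a: "1 \<le> \<tau> (r - (i - 1))" "\<tau> (r - (i - 1)) \<le> n" using t1[of "r - (i - 1)"] 2 i by auto
      have "?\<pi> r = \<sigma> i - 1 + \<tau> (r - (i - 1))" using 2 by (simp add: perm_comp_def)
      then show ?thesis using a si unfolding atLeastAtMost_iff by linarith
    next
      case 3
      have a: "1 \<le> \<sigma> (r + 1 - n)" "\<sigma> (r + 1 - n) \<le> m" using s1[of "r + 1 - n"] that i 3 by auto
      have b: "\<sigma> (r + 1 - n) \<noteq> \<sigma> i" using inj_s[of "r + 1 - n" i] 3 by auto
      have "?\<pi> r = shift (\<sigma> i) n (\<sigma> (r + 1 - n))" using 3 by (simp add: perm_comp_def)
      then show ?thesis using a b si by (auto simp: shift_def)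
    qed
  qed
  have out: "?\<pi> r = r" if "r \<notin> {1..m + n - 1}" for r
  proof (cases "r = 0")
    case True
    then show ?thesis using i si permutes_not_in[OF \<sigma>, of 0] by (simp add: perm_comp_def shift_def)
  next
    case False
    then have r: "m + n - 1 < r" using that by auto
    have "\<sigma> (r + 1 - n) = r + 1 - n" by (rule permutes_not_in[OF \<sigma>]) (use r in auto)
    then show ?thesis using r i si by (auto simp: perm_comp_def shift_def)
  qed
  have inj: "inj_on ?\<pi> {1..m + n - 1}"
  proof (rule inj_onI)
    fix r s assume r: "r \<in> {1..m + n - 1}" and s: "s \<in> {1..m + n - 1}" and e: "?\<pi> r = ?\<pi> s"
    define d where "d x = (if x < i then x else x + 1 - n)" for x
    have outer: "?\<pi> x = shift (\<sigma> i) n (\<sigma> (d x))" "d x \<noteq> i" "1 \<le> d x" "d x \<le> m"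
      if "x \<in> {1..m + n - 1}" "\<not> (i \<le> x \<and> x < i + n)" for x
      using that i by (auto simp: perm_comp_def d_def)
    have d_inj: "x = y" if "d x = d y" "x \<in> {1..m + n - 1}" "y \<in> {1..m + n - 1}"
        "\<not> (i \<le> x \<and> x < i + n)" "\<not> (i \<le> y \<and> y < i + n)" for x y
      using that i by (auto simp: d_def split: if_splits)
    have inner: "?\<pi> x = \<sigma> i - 1 + \<tau> (x - (i - 1))" "\<sigma> i \<le> ?\<pi> x" "?\<pi> x < \<sigma> i + n"
      if "i \<le> x" "x < i + n" for x
      using that i si t1[of "x - (i - 1)"] by (auto simp: perm_comp_def)
    have outer2: "\<not> (\<sigma> i \<le> ?\<pi> x \<and> ?\<pi> x < \<sigma> i + n)"
      if "x \<in> {1..m + n - 1}" "\<not> (i \<le> x \<and> x < i + n)" for x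
    proof -
      have "\<sigma> (d x) \<noteq> \<sigma> i" using inj_s outer(2)[OF that] by blast
      then show ?thesis using outer(1)[OF that] si by (auto simp: shift_def)
    qed
    show "r = s"
    proof (cases "i \<le> r \<and> r < i + n")
      case True
      then have T2: "i \<le> s \<and> s < i + n" using e inner outer2 s by metis
      then have "\<tau> (r - (i - 1)) = \<tau> (s - (i - 1))" using e inner(1) True by simp
      then have "r - (i - 1) = s - (i - 1)" by (rule inj_t)
      then show ?thesis using True T2 i by auto
    next
      case False
      then have F2: "\<not> (i \<le> s \<and> s < i + n)" using e inner outer2 r by metis
      have "\<sigma> (d r) \<noteq> \<sigma> i" "\<sigma> (d s) \<noteq> \<sigma> i"
        using inj_s outer(2)[OF r False] outer(2)[OF s F2] by blast+
      moreover have "shift (\<sigma> i) n (\<sigma> (d r)) = shift (\<sigma> i) n (\<sigma> (d s))"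
        using e outer(1) r s False F2 by simp
      ultimately have "\<sigma> (d r) = \<sigma> (d s)" by (auto simp: shift_def split: if_splits)
      then show ?thesis using d_inj[OF _ r s False F2] inj_s by blast
    qed
  qed
  show ?thesis
    by (rule bij_imp_permutes)
       (use maps out inj endo_inj_surj[of "{1..m + n - 1}" ?\<pi>] in \<open>auto simp: bij_betw_def image_subset_iff\<close>)
qed

definition operad_hom ::
    "('k, 'a) operad \<Rightarrow> ('k, 'b) operad \<Rightarrow> (nat \<Rightarrow> 'a \<Rightarrow> 'b) \<Rightarrow> bool" where
  "operad_hom P Q \<phi> \<longleftrightarrow>
     (\<forall>m. \<phi> m \<in> els P m \<rightarrow> els Q m) \<and>
     (\<forall>m. \<forall>x\<in>els P m. \<forall>y\<in>els P m. \<phi> m (x \<oplus>\<^bsub>sp P m\<^esub> y) = \<phi> m x \<oplus>\<^bsub>sp Q m\<^esub> \<phi> m y) \<and>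
     (\<forall>m c. \<forall>x\<in>els P m. \<phi> m (c \<odot>\<^bsub>sp P m\<^esub> x) = c \<odot>\<^bsub>sp Q m\<^esub> \<phi> m x) \<and>
     (\<forall>m \<sigma>. \<sigma> permutes {1..m} \<longrightarrow> (\<forall>x\<in>els P m. \<phi> m (act P m x \<sigma>) = act Q m (\<phi> m x) \<sigma>)) \<and>
     (\<forall>m n. \<forall>i\<in>{1..m}. \<forall>x\<in>els P m. \<forall>y\<in>els P n.
        \<phi> (m + n - 1) (pcomp P m n i x y) = pcomp Q m n i (\<phi> m x) (\<phi> n y)) \<and>
     \<phi> 1 (ident P) = ident Q"

definition operad_iso ::
    "('k, 'a) operad \<Rightarrow> ('k, 'b) operad \<Rightarrow> (nat \<Rightarrow> 'a \<Rightarrow> 'b) \<Rightarrow> bool" where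
  "operad_iso P Q \<phi> \<longleftrightarrow> operad_hom P Q \<phi> \<and> (\<forall>m. bij_betw (\<phi> m) (els P m) (els Q m))"


section \<open>Operads presented by generators and relations\<close>

text \<open>
  The operad generated by a set \<open>E\<close> of generators (the generator \<open>g\<close> having arity \<open>a g\<close>) subject to
  a set \<open>R\<close> of relations \<open>(s, t)\<close>, read \<open>s = t\<close>, is the set of well-formed operadic expressions
  modulo the smallest congruence containing \<open>R\<close> and all instances of the axioms of an operad.  Its
  universal property is proved below.
\<close>

datatype ('k, 'g) oterm =
    TGen 'g
  | TId
  | TComp nat "('k, 'g) oterm" "('k, 'g) oterm"
  | TAct "('k, 'g) oterm" "nat \<Rightarrow> nat"
  | TZero nat
  | TAdd "('k, 'g) oterm" "('k, 'g) oterm"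
  | TScal 'k "('k, 'g) oterm"

abbreviation TSub :: "('k::field, 'g) oterm \<Rightarrow> ('k, 'g) oterm \<Rightarrow> ('k, 'g) oterm" where
  "TSub s t \<equiv> TAdd s (TScal (-1) t)"

primrec arity :: "('g \<Rightarrow> nat) \<Rightarrow> ('k, 'g) oterm \<Rightarrow> nat" where
  "arity a (TGen g) = a g"
| "arity a TId = 1"
| "arity a (TComp i s t) = arity a s + arity a t - 1"
| "arity a (TAct t \<sigma>) = arity a t"
| "arity a (TZero m) = m"
| "arity a (TAdd s t) = arity a s"
| "arity a (TScal c t) = arity a t"

primrec wf_oterm :: "'g set \<Rightarrow> ('g \<Rightarrow> nat) \<Rightarrow> ('k, 'g) oterm \<Rightarrow> bool" where
  "wf_oterm E a (TGen g) \<longleftrightarrow> g \<in> E"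
| "wf_oterm E a TId \<longleftrightarrow> True"
| "wf_oterm E a (TComp i s t) \<longleftrightarrow> wf_oterm E a s \<and> wf_oterm E a t \<and> i \<in> {1..arity a s}"
| "wf_oterm E a (TAct t \<sigma>) \<longleftrightarrow> wf_oterm E a t \<and> \<sigma> permutes {1..arity a t}"
| "wf_oterm E a (TZero m) \<longleftrightarrow> True"
| "wf_oterm E a (TAdd s t) \<longleftrightarrow> wf_oterm E a s \<and> wf_oterm E a t \<and> arity a s = arity a t"
| "wf_oterm E a (TScal c t) \<longleftrightarrow> wf_oterm E a t"

inductive operad_law :: "('g \<Rightarrow> nat) \<Rightarrow> ('k::field, 'g) oterm \<Rightarrow> ('k, 'g) oterm \<Rightarrow> bool"
  for a where
  "operad_law a (TAdd (TAdd r s) t) (TAdd r (TAdd s t))"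
| "operad_law a (TAdd s t) (TAdd t s)"
| "operad_law a (TAdd t (TZero (arity a t))) t"
| "operad_law a (TAdd t (TScal (-1) t)) (TZero (arity a t))"
| "operad_law a (TScal c (TAdd s t)) (TAdd (TScal c s) (TScal c t))"
| "operad_law a (TScal (c + d) t) (TAdd (TScal c t) (TScal d t))"
| "operad_law a (TScal (c * d) t) (TScal c (TScal d t))"
| "operad_law a (TScal 1 t) t"
| "operad_law a (TAct (TAdd s t) \<sigma>) (TAdd (TAct s \<sigma>) (TAct t \<sigma>))"
| "operad_law a (TAct (TScal c t) \<sigma>) (TScal c (TAct t \<sigma>))"
| "operad_law a (TAct t id) t"
| "operad_law a (TAct (TAct t \<sigma>) \<tau>) (TAct t (\<sigma> \<circ> \<tau>))"
| "operad_law a (TComp i (TAdd r s) t) (TAdd (TComp i r t) (TComp i s t))"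
| "operad_law a (TComp i r (TAdd s t)) (TAdd (TComp i r s) (TComp i r t))"
| "operad_law a (TComp i (TScal c s) t) (TScal c (TComp i s t))"
| "operad_law a (TComp i s (TScal c t)) (TScal c (TComp i s t))"
| "operad_law a (TComp 1 TId t) t"
| "operad_law a (TComp i t TId) t"
| "operad_law a (TComp (i - 1 + j) (TComp i r s) t) (TComp i r (TComp j s t))"
| "i < k \<Longrightarrow> operad_law a (TComp (k - 1 + arity a s) (TComp i r s) t) (TComp i (TComp k r t) s)"
| "operad_law a (TComp i (TAct s \<sigma>) (TAct t \<tau>))
     (TAct (TComp (\<sigma> i) s t) (perm_comp (arity a t) i \<sigma> \<tau>))"

inductive oequiv ::
    "'g set \<Rightarrow> ('g \<Rightarrow> nat) \<Rightarrow> (('k::field, 'g) oterm \<times> ('k, 'g) oterm) set \<Rightarrow>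
     ('k, 'g) oterm \<Rightarrow> ('k, 'g) oterm \<Rightarrow> bool"
  for E a R where
  base: "operad_law a s t \<or> (s, t) \<in> R \<Longrightarrow> wf_oterm E a s \<Longrightarrow> wf_oterm E a t \<Longrightarrow>
    arity a s = arity a t \<Longrightarrow> oequiv E a R s t"
| refl: "wf_oterm E a t \<Longrightarrow> oequiv E a R t t"
| sym: "oequiv E a R s t \<Longrightarrow> oequiv E a R t s"
| trans: "oequiv E a R r s \<Longrightarrow> oequiv E a R s t \<Longrightarrow> oequiv E a R r t"
| comp: "oequiv E a R s s' \<Longrightarrow> oequiv E a R t t' \<Longrightarrow> i \<in> {1..arity a s} \<Longrightarrow>
    oequiv E a R (TComp i s t) (TComp i s' t')"
| act: "oequiv E a R t t' \<Longrightarrow> \<sigma> permutes {1..arity a t} \<Longrightarrow>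
    oequiv E a R (TAct t \<sigma>) (TAct t' \<sigma>)"
| add: "oequiv E a R s s' \<Longrightarrow> oequiv E a R t t' \<Longrightarrow> arity a s = arity a t \<Longrightarrow>
    oequiv E a R (TAdd s t) (TAdd s' t')"
| scal: "oequiv E a R t t' \<Longrightarrow> oequiv E a R (TScal c t) (TScal c t')"

definition oclass ::
    "'g set \<Rightarrow> ('g \<Rightarrow> nat) \<Rightarrow> (('k::field, 'g) oterm \<times> ('k, 'g) oterm) set \<Rightarrow>
     ('k, 'g) oterm \<Rightarrow> ('k, 'g) oterm set" where
  "oclass E a R t = {s. oequiv E a R t s}"

definition rep :: "'a set \<Rightarrow> 'a" where
  "rep A = (SOME x. x \<in> A)"

definition presented_operad ::
    "'g set \<Rightarrow> ('g \<Rightarrow> nat) \<Rightarrow> (('k::field, 'g) oterm \<times> ('k, 'g) oterm) set \<Rightarrow>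
     ('k, ('k, 'g) oterm set) operad" where
  "presented_operad E a R =
     \<lparr>sp = (\<lambda>m. linear_space {oclass E a R t | t. wf_oterm E a t \<and> arity a t = m}
              (oclass E a R (TZero m))
              (\<lambda>A B. oclass E a R (TAdd (rep A) (rep B)))
              (\<lambda>c A. oclass E a R (TScal c (rep A)))),
      act = (\<lambda>m A \<sigma>. oclass E a R (TAct (rep A) \<sigma>)),
      pcomp = (\<lambda>m n i A B. oclass E a R (TComp i (rep A) (rep B))),
      ident = oclass E a R TId\<rparr>"

primrec oeval :: "('k, 'a) operad \<Rightarrow> ('g \<Rightarrow> nat) \<Rightarrow> ('g \<Rightarrow> 'a) \<Rightarrow> ('k, 'g) oterm \<Rightarrow> 'a" where
  "oeval Q a h (TGen g) = h g"
| "oeval Q a h TId = ident Q"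
| "oeval Q a h (TComp i s t) = pcomp Q (arity a s) (arity a t) i (oeval Q a h s) (oeval Q a h t)"
| "oeval Q a h (TAct t \<sigma>) = act Q (arity a t) (oeval Q a h t) \<sigma>"
| "oeval Q a h (TZero m) = \<zero>\<^bsub>sp Q m\<^esub>"
| "oeval Q a h (TAdd s t) = oeval Q a h s \<oplus>\<^bsub>sp Q (arity a s)\<^esub> oeval Q a h t"
| "oeval Q a h (TScal c t) = c \<odot>\<^bsub>sp Q (arity a t)\<^esub> oeval Q a h t"

text \<open>The morphism from a presented operad to \<open>Q\<close> determined by the images \<open>h g\<close> of the generators.\<close>

definition presented_hom ::
    "('k, 'a) operad \<Rightarrow> ('g \<Rightarrow> nat) \<Rightarrow> ('g \<Rightarrow> 'a) \<Rightarrow> nat \<Rightarrow> ('k, 'g) oterm set \<Rightarrow> 'a" where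
  "presented_hom Q a h m A = oeval Q a h (rep A)"


lemma oequiv_wf: "oequiv E a R s t \<Longrightarrow> wf_oterm E a s \<and> wf_oterm E a t \<and> arity a s = arity a t"
  by (induction rule: oequiv.induct) auto

lemma oclass_eqI: "oequiv E a R s t \<Longrightarrow> oclass E a R s = oclass E a R t"
  by (auto simp: oclass_def intro: oequiv.sym oequiv.trans)

lemma rep_oclass: "wf_oterm E a t \<Longrightarrow> oequiv E a R t (rep (oclass E a R t))"
  unfolding rep_def oclass_def mem_Collect_eq by (rule someI[of _ t]) (rule oequiv.refl)

context
  fixes E :: "'g set" and a :: "'g \<Rightarrow> nat" and R :: "(('k::field, 'g) oterm \<times> ('k, 'g) oterm) set"
begin

private abbreviation "Pr \<equiv> presented_operad E a R"
private abbreviation "cl \<equiv> oclass E a R"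
private abbreviation "wft t \<equiv> wf_oterm E a t"

lemma rep_facts:
  assumes "wft t"
  shows "oequiv E a R (rep (cl t)) t" "wft (rep (cl t))" "arity a (rep (cl t)) = arity a t"
  using rep_oclass[OF assms] oequiv_wf[OF rep_oclass[OF assms]] by (auto intro: oequiv.sym)

lemma els_presented: "els Pr m = {cl t | t. wft t \<and> arity a t = m}"
  by (simp add: presented_operad_def linear_space_def)

lemma oclass_in_els: "wft t \<Longrightarrow> arity a t = m \<Longrightarrow> cl t \<in> els Pr m"
  by (auto simp: els_presented)

lemma els_presentedE:
  assumes "A \<in> els Pr m"
  obtains t where "wft t" "arity a t = m" "A = cl t"
  using assms by (auto simp: els_presented)

lemma presented_zero: "\<zero>\<^bsub>sp Pr m\<^esub> = cl (TZero m)"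
  by (simp add: presented_operad_def linear_space_def)

lemma presented_ident: "ident Pr = cl TId"
  by (simp add: presented_operad_def)

lemma presented_add:
  assumes "wft s" "wft t" "arity a s = arity a t"
  shows "cl s \<oplus>\<^bsub>sp Pr m\<^esub> cl t = cl (TAdd s t)"
  by (simp add: presented_operad_def linear_space_def)
     (rule oclass_eqI, rule oequiv.add, simp_all add: rep_facts assms)

lemma presented_smult:
  assumes "wft t"
  shows "c \<odot>\<^bsub>sp Pr m\<^esub> cl t = cl (TScal c t)"
  by (simp add: presented_operad_def linear_space_def)
     (rule oclass_eqI, rule oequiv.scal, simp_all add: rep_facts assms)

lemma presented_act:
  assumes "wft t" "\<sigma> permutes {1..arity a t}"
  shows "act Pr m (cl t) \<sigma> = cl (TAct t \<sigma>)"
  by (simp add: presented_operad_def)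
     (rule oclass_eqI, rule oequiv.act, simp_all only: rep_facts assms)

lemma presented_pcomp:
  assumes "wft s" "wft t" "i \<in> {1..arity a s}"
  shows "pcomp Pr m n i (cl s) (cl t) = cl (TComp i s t)"
  by (simp add: presented_operad_def)
     (rule oclass_eqI, rule oequiv.comp, simp_all only: rep_facts assms)

lemma oclass_lawI:
  assumes "operad_law a s t" "wft s" "wft t" "arity a s = arity a t"
  shows "cl s = cl t"
  using assms by (intro oclass_eqI oequiv.base) auto

lemmas presented_ops =
  presented_zero presented_ident presented_add presented_smult presented_act presented_pcomp

lemma module_presented: "Module.module scalars (sp Pr m)"
proof -
  have grp: "abelian_group (sp Pr m)"
  proof (rule abelian_groupI)
    show "A \<oplus>\<^bsub>sp Pr m\<^esub> B \<in> els Pr m" if A: "A \<in> els Pr m" and B: "B \<in> els Pr m" for A B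
      using A B by (elim els_presentedE) (simp add: presented_ops oclass_in_els)
    show "\<zero>\<^bsub>sp Pr m\<^esub> \<in> els Pr m" by (simp add: presented_ops oclass_in_els)
    show "A \<oplus>\<^bsub>sp Pr m\<^esub> B \<oplus>\<^bsub>sp Pr m\<^esub> C = A \<oplus>\<^bsub>sp Pr m\<^esub> (B \<oplus>\<^bsub>sp Pr m\<^esub> C)"
      if A: "A \<in> els Pr m" and B: "B \<in> els Pr m" and C: "C \<in> els Pr m" for A B C
      using A B C by (elim els_presentedE) (simp add: presented_ops, rule oclass_lawI, auto intro: operad_law.intros)
    show "A \<oplus>\<^bsub>sp Pr m\<^esub> B = B \<oplus>\<^bsub>sp Pr m\<^esub> A" if A: "A \<in> els Pr m" and B: "B \<in> els Pr m" for A B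
      using A B by (elim els_presentedE) (simp add: presented_ops, rule oclass_lawI, auto intro: operad_law.intros)
    show "\<zero>\<^bsub>sp Pr m\<^esub> \<oplus>\<^bsub>sp Pr m\<^esub> A = A" if A: "A \<in> els Pr m" for A
    proof -
      obtain t where t: "wft t" "arity a t = m" "A = cl t" using A by (rule els_presentedE)
      have "cl (TAdd (TZero m) t) = cl (TAdd t (TZero m))"
        using t by (intro oclass_lawI) (auto intro: operad_law.intros)
      also have "\<dots> = cl t"
        using t operad_law.intros(3)[of a t] by (intro oclass_lawI) auto
      finally show ?thesis using t by (simp add: presented_ops)
    qed
    show "\<exists>B\<in>els Pr m. B \<oplus>\<^bsub>sp Pr m\<^esub> A = \<zero>\<^bsub>sp Pr m\<^esub>" if A: "A \<in> els Pr m" for A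
    proof -
      obtain t where t: "wft t" "arity a t = m" "A = cl t" using A by (rule els_presentedE)
      have "cl (TAdd (TScal (-1) t) t) = cl (TAdd t (TScal (-1) t))"
        using t by (intro oclass_lawI) (auto intro: operad_law.intros)
      also have "\<dots> = cl (TZero m)"
        using t operad_law.intros(4)[of a t] by (intro oclass_lawI) auto
      finally show ?thesis using t
        by (intro bexI[of _ "cl (TScal (-1) t)"]) (simp_all add: presented_ops oclass_in_els)
    qed
  qed
  show ?thesis
  proof (rule Module.moduleI)
    show "cring (scalars :: 'k ring)" by (rule cring_from_type_algebra)
    show "abelian_group (sp Pr m)" by (rule grp)
    fix c d :: 'k and A B
    assume "A \<in> els Pr m"
    then obtain t where t: "wft t" "arity a t = m" "A = cl t" by (rule els_presentedE)
    show "c \<odot>\<^bsub>sp Pr m\<^esub> A \<in> els Pr m"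
      using t by (simp add: presented_ops oclass_in_els)
    show "(c \<oplus>\<^bsub>scalars\<^esub> d) \<odot>\<^bsub>sp Pr m\<^esub> A
        = c \<odot>\<^bsub>sp Pr m\<^esub> A \<oplus>\<^bsub>sp Pr m\<^esub> d \<odot>\<^bsub>sp Pr m\<^esub> A"
      using t by (simp add: presented_ops ring_of_type_algebra_def)
        (rule oclass_lawI, auto intro: operad_law.intros)
    show "(c \<otimes>\<^bsub>scalars\<^esub> d) \<odot>\<^bsub>sp Pr m\<^esub> A = c \<odot>\<^bsub>sp Pr m\<^esub> (d \<odot>\<^bsub>sp Pr m\<^esub> A)"
      using t by (simp add: presented_ops ring_of_type_algebra_def)
        (rule oclass_lawI, auto intro: operad_law.intros)
    show "\<one>\<^bsub>scalars\<^esub> \<odot>\<^bsub>sp Pr m\<^esub> A = A"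
      using t by (simp add: presented_ops ring_of_type_algebra_def)
        (rule oclass_lawI, auto intro: operad_law.intros)
    assume "B \<in> els Pr m"
    then obtain s where s: "wft s" "arity a s = m" "B = cl s" by (rule els_presentedE)
    show "c \<odot>\<^bsub>sp Pr m\<^esub> (A \<oplus>\<^bsub>sp Pr m\<^esub> B)
        = c \<odot>\<^bsub>sp Pr m\<^esub> A \<oplus>\<^bsub>sp Pr m\<^esub> c \<odot>\<^bsub>sp Pr m\<^esub> B"
      using t s by (simp add: presented_ops)
        (rule oclass_lawI, auto intro: operad_law.intros)
  qed
qed

lemma operad_presented: "operad Pr"
proof (rule operad.intro)
  fix m
  show "Module.module scalars (sp Pr m)" by (rule module_presented)
next
  fix m and A and \<sigma> :: "nat \<Rightarrow> nat"
  assume "A \<in> els Pr m" and \<sigma>: "\<sigma> permutes {1..m}"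
  then obtain t where t: "wft t" "arity a t = m" "A = cl t" by (elim els_presentedE)
  note \<sigma>' = \<sigma>[folded t(2)]
  show "act Pr m A \<sigma> \<in> els Pr m"
    using t \<sigma>' by (simp add: presented_ops oclass_in_els del: atLeastAtMost_iff)
  show "act Pr m (c \<odot>\<^bsub>sp Pr m\<^esub> A) \<sigma> = c \<odot>\<^bsub>sp Pr m\<^esub> act Pr m A \<sigma>" for c
    unfolding t(3) using t \<sigma>'
    by (simp add: presented_ops del: One_nat_def) (rule oclass_lawI, auto intro: operad_law.intros)
  show "act Pr m (act Pr m A \<sigma>) \<tau> = act Pr m A (\<sigma> \<circ> \<tau>)" if "\<tau> permutes {1..m}" for \<tau>
    unfolding t(3) using t \<sigma>' that[folded t(2)] permutes_compose[OF that \<sigma>, folded t(2)]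
    by (simp add: presented_ops del: One_nat_def) (rule oclass_lawI, auto intro: operad_law.intros)
  fix B assume "B \<in> els Pr m"
  then obtain s where s: "wft s" "arity a s = m" "B = cl s" by (elim els_presentedE)
  show "act Pr m (A \<oplus>\<^bsub>sp Pr m\<^esub> B) \<sigma> = act Pr m A \<sigma> \<oplus>\<^bsub>sp Pr m\<^esub> act Pr m B \<sigma>"
    unfolding t(3) s(3) using t s \<sigma>'
    by (simp add: presented_ops del: One_nat_def) (rule oclass_lawI, auto intro: operad_law.intros)
next
  fix m A assume "A \<in> els Pr m"
  then obtain t where t: "wft t" "arity a t = m" "A = cl t" by (elim els_presentedE)
  show "act Pr m A id = A"
    using t by (simp add: presented_ops permutes_id) (rule oclass_lawI, auto intro: operad_law.intros permutes_id)
next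
  show "ident Pr \<in> els Pr 1" by (simp add: presented_ops oclass_in_els)
next
  fix n B assume "B \<in> els Pr n"
  then obtain t where t: "wft t" "arity a t = n" "B = cl t" by (elim els_presentedE)
  show "pcomp Pr 1 n 1 (ident Pr) B = B"
  proof -
    have "cl (TComp 1 TId t) = cl t"
      using t operad_law.intros(17)[of a t] by (intro oclass_lawI) simp_all
    then show ?thesis unfolding t(3) presented_ident using t by (subst presented_pcomp) simp_all
  qed
next
  fix m i A assume "A \<in> els Pr m" and i: "i \<in> {1..m}"
  then obtain t where t: "wft t" "arity a t = m" "A = cl t" by (elim els_presentedE)
  show "pcomp Pr m 1 i A (ident Pr) = A"
  proof -
    have "cl (TComp i t TId) = cl t"
      using t i operad_law.intros(18)[of a i t] by (intro oclass_lawI) simp_all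
    then show ?thesis unfolding t(3) presented_ident using t i by (subst presented_pcomp) simp_all
  qed
next
  fix m n i A B
  assume "A \<in> els Pr m" and "B \<in> els Pr n" and i: "i \<in> {1..m}"
  then obtain s t where s: "wft s" "arity a s = m" "A = cl s" and t: "wft t" "arity a t = n" "B = cl t"
    by (elim els_presentedE)
  show "pcomp Pr m n i A B \<in> els Pr (m + n - 1)"
    using s t i by (simp add: presented_ops oclass_in_els)
  show "pcomp Pr m n i (c \<odot>\<^bsub>sp Pr m\<^esub> A) B = c \<odot>\<^bsub>sp Pr (m + n - 1)\<^esub> pcomp Pr m n i A B" for c
    unfolding s(3) t(3) using s t i by (simp add: presented_ops) (rule oclass_lawI, auto intro: operad_law.intros)
  show "pcomp Pr m n i A (c \<odot>\<^bsub>sp Pr n\<^esub> B) = c \<odot>\<^bsub>sp Pr (m + n - 1)\<^esub> pcomp Pr m n i A B" for c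
    unfolding s(3) t(3) using s t i by (simp add: presented_ops) (rule oclass_lawI, auto intro: operad_law.intros)
  show "pcomp Pr m n i (act Pr m A \<sigma>) (act Pr n B \<tau>)
      = act Pr (m + n - 1) (pcomp Pr m n (\<sigma> i) A B) (perm_comp n i \<sigma> \<tau>)"
    if \<sigma>: "\<sigma> permutes {1..m}" and \<tau>: "\<tau> permutes {1..n}" for \<sigma> \<tau>
  proof -
    note perms = \<sigma>[folded s(2)] \<tau>[folded t(2)] perm_comp_permutes[OF \<sigma> \<tau> i, folded s(2) t(2)]
    have si: "\<sigma> i \<in> {1..m}" using permutes_in_image[OF \<sigma>] i by blast
    have "pcomp Pr m n i (act Pr m A \<sigma>) (act Pr n B \<tau>) = cl (TComp i (TAct s \<sigma>) (TAct t \<tau>))"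
      unfolding s(3) t(3) using s t i perms by (simp add: presented_ops del: One_nat_def)
    also have "\<dots> = cl (TAct (TComp (\<sigma> i) s t) (perm_comp n i \<sigma> \<tau>))"
      using operad_law.intros(21)[of a i s \<sigma> t \<tau>] s t i si perms
      by (intro oclass_lawI) (simp_all del: One_nat_def)
    also have "\<dots> = act Pr (m + n - 1) (pcomp Pr m n (\<sigma> i) A B) (perm_comp n i \<sigma> \<tau>)"
      unfolding s(3) t(3) using s t i si perms by (simp add: presented_ops del: One_nat_def)
    finally show ?thesis .
  qed
  fix C
  show "pcomp Pr m n i (A \<oplus>\<^bsub>sp Pr m\<^esub> C) B
      = pcomp Pr m n i A B \<oplus>\<^bsub>sp Pr (m + n - 1)\<^esub> pcomp Pr m n i C B" if C: "C \<in> els Pr m"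
  proof -
    obtain u where u: "wft u" "arity a u = m" "C = cl u" using C by (rule els_presentedE)
    show ?thesis
      unfolding s(3) t(3) u(3) using s t u i by (simp add: presented_ops) (rule oclass_lawI, auto intro: operad_law.intros)
  qed
  show "pcomp Pr m n i A (B \<oplus>\<^bsub>sp Pr n\<^esub> C)
      = pcomp Pr m n i A B \<oplus>\<^bsub>sp Pr (m + n - 1)\<^esub> pcomp Pr m n i A C" if C: "C \<in> els Pr n"
  proof -
    obtain u where u: "wft u" "arity a u = n" "C = cl u" using C by (rule els_presentedE)
    show ?thesis
      unfolding s(3) t(3) u(3) using s t u i by (simp add: presented_ops) (rule oclass_lawI, auto intro: operad_law.intros)
  qed
  fix p
  assume "C \<in> els Pr p"
  then obtain u where u: "wft u" "arity a u = p" "C = cl u" by (elim els_presentedE)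
  show "pcomp Pr (m + n - 1) p (i - 1 + j) (pcomp Pr m n i A B) C
      = pcomp Pr m (n + p - 1) i A (pcomp Pr n p j B C)" if j: "j \<in> {1..n}" for j
  proof -
    have ij: "i - 1 + j \<in> {1..m + n - 1}" using i j by auto
    have "cl (TComp (i - 1 + j) (TComp i s t) u) = cl (TComp i s (TComp j t u))"
      using s t u i j ij by (intro oclass_lawI operad_law.intros(19)) auto
    then show ?thesis
      unfolding s(3) t(3) u(3) using s t u i j ij by (simp add: presented_ops)
  qed
  show "pcomp Pr (m + n - 1) p (k - 1 + n) (pcomp Pr m n i A B) C
      = pcomp Pr (m + p - 1) n i (pcomp Pr m p k A C) B" if k: "k \<in> {1..m}" "i < k" for k
  proof -
    have kn: "k - 1 + n \<in> {1..m + n - 1}" "i \<in> {1..m + p - 1}" using i k by auto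
    have "cl (TComp (k - 1 + n) (TComp i s t) u) = cl (TComp i (TComp k s u) t)"
      using s t u i k kn operad_law.intros(20)[of i k a t s u] by (intro oclass_lawI) auto
    then show ?thesis
      unfolding s(3) t(3) u(3) using s t u i k kn by (simp add: presented_ops)
  qed
qed

end

lemma operad_homI:
  assumes "\<And>m x. x \<in> els P m \<Longrightarrow> \<phi> m x \<in> els Q m"
    and "\<And>m x y. x \<in> els P m \<Longrightarrow> y \<in> els P m \<Longrightarrow> \<phi> m (x \<oplus>\<^bsub>sp P m\<^esub> y) = \<phi> m x \<oplus>\<^bsub>sp Q m\<^esub> \<phi> m y"
    and "\<And>m c x. x \<in> els P m \<Longrightarrow> \<phi> m (c \<odot>\<^bsub>sp P m\<^esub> x) = c \<odot>\<^bsub>sp Q m\<^esub> \<phi> m x"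
    and "\<And>m x \<sigma>. x \<in> els P m \<Longrightarrow> \<sigma> permutes {1..m} \<Longrightarrow> \<phi> m (act P m x \<sigma>) = act Q m (\<phi> m x) \<sigma>"
    and "\<And>m n i x y. x \<in> els P m \<Longrightarrow> y \<in> els P n \<Longrightarrow> i \<in> {1..m} \<Longrightarrow>
      \<phi> (m + n - 1) (pcomp P m n i x y) = pcomp Q m n i (\<phi> m x) (\<phi> n y)"
    and "\<phi> 1 (ident P) = ident Q"
  shows "operad_hom P Q \<phi>"
  using assms unfolding operad_hom_def by blast

lemma operad_homD:
  assumes "operad_hom P Q \<phi>"
  shows "\<And>m x. x \<in> els P m \<Longrightarrow> \<phi> m x \<in> els Q m"
    and "\<And>m x y. x \<in> els P m \<Longrightarrow> y \<in> els P m \<Longrightarrow> \<phi> m (x \<oplus>\<^bsub>sp P m\<^esub> y) = \<phi> m x \<oplus>\<^bsub>sp Q m\<^esub> \<phi> m y"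
    and "\<And>m c x. x \<in> els P m \<Longrightarrow> \<phi> m (c \<odot>\<^bsub>sp P m\<^esub> x) = c \<odot>\<^bsub>sp Q m\<^esub> \<phi> m x"
    and "\<And>m x \<sigma>. x \<in> els P m \<Longrightarrow> \<sigma> permutes {1..m} \<Longrightarrow> \<phi> m (act P m x \<sigma>) = act Q m (\<phi> m x) \<sigma>"
    and "\<And>m n i x y. x \<in> els P m \<Longrightarrow> y \<in> els P n \<Longrightarrow> i \<in> {1..m} \<Longrightarrow>
      \<phi> (m + n - 1) (pcomp P m n i x y) = pcomp Q m n i (\<phi> m x) (\<phi> n y)"
    and "\<phi> 1 (ident P) = ident Q"
  using assms unfolding operad_hom_def by (blast | auto)+

lemma abelian_group_sp:
  assumes "operad P" shows "abelian_group (sp P m)"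
  using operad.module_sp[OF assms, of m] by (simp add: Module.module_def)

lemma operad_minus_one:
  assumes "operad P" and x: "x \<in> els P m"
  shows "x \<oplus>\<^bsub>sp P m\<^esub> ((-1) \<odot>\<^bsub>sp P m\<^esub> x) = \<zero>\<^bsub>sp P m\<^esub>"
proof -
  interpret M: Module.module scalars "sp P m" using operad.module_sp[OF assms(1)] .
  have "x \<oplus>\<^bsub>sp P m\<^esub> ((-1) \<odot>\<^bsub>sp P m\<^esub> x) = (1 \<oplus>\<^bsub>scalars\<^esub> (-1)) \<odot>\<^bsub>sp P m\<^esub> x"
    using M.smult_l_distr[of 1 "-1" x] M.smult_one[OF x] x by (simp add: ring_of_type_algebra_def)
  also have "\<dots> = \<zero>\<^bsub>sp P m\<^esub>"
    using M.smult_l_null[OF x] by (simp add: ring_of_type_algebra_def)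
  finally show ?thesis .
qed

context
  fixes E :: "'g set" and a :: "'g \<Rightarrow> nat" and R :: "(('k::field, 'g) oterm \<times> ('k, 'g) oterm) set"
    and Q :: "('k, 'a) operad" and h :: "'g \<Rightarrow> 'a"
  assumes Q: "operad Q" and h: "\<And>g. g \<in> E \<Longrightarrow> h g \<in> els Q (a g)"
begin

private abbreviation "ev \<equiv> oeval Q a h"

lemma eval_closed: "wf_oterm E a t \<Longrightarrow> ev t \<in> els Q (arity a t)"
proof (induction t)
  case (TZero m)
  interpret abelian_group "sp Q m" by (rule abelian_group_sp[OF Q])
  show ?case by simp
next
  case (TAdd s t)
  interpret abelian_group "sp Q (arity a s)" by (rule abelian_group_sp[OF Q])
  have "ev s \<in> els Q (arity a s)" "ev t \<in> els Q (arity a s)" using TAdd by auto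
  then show ?case by simp
next
  case (TScal c t)
  interpret Module.module scalars "sp Q (arity a t)" using operad.module_sp[OF Q] .
  show ?case using TScal smult_closed[of c "ev t"] by (simp add: ring_of_type_algebra_def)
next
  case TId
  then show ?case using operad.ident_closed[OF Q] by simp
next
  case (TComp i s t)
  then show ?case
    using operad.pcomp_closed[OF Q, of "ev s" "arity a s" "ev t" "arity a t" i] by simp
qed (auto simp: h operad.act_closed[OF Q])

lemma eval_law:
  assumes "operad_law a s t" "wf_oterm E a s" "wf_oterm E a t" "arity a s = arity a t"
  shows "ev s = ev t"
  using assms
proof (induction rule: operad_law.induct)
  case (1 r s t)
  interpret abelian_group "sp Q (arity a r)" by (rule abelian_group_sp[OF Q])
  have "ev r \<in> els Q (arity a r)" "ev s \<in> els Q (arity a r)" "ev t \<in> els Q (arity a r)"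
    using 1 eval_closed[of r] eval_closed[of s] eval_closed[of t] by auto
  then show ?case using 1 a_assoc[of "ev r" "ev s" "ev t"] by simp
next
  case (2 s t)
  interpret abelian_group "sp Q (arity a s)" by (rule abelian_group_sp[OF Q])
  show ?case using 2 a_comm[of "ev s" "ev t"] eval_closed[of s] eval_closed[of t] by simp
next
  case (3 t)
  interpret abelian_group "sp Q (arity a t)" by (rule abelian_group_sp[OF Q])
  show ?case using 3 eval_closed[of t] by simp
next
  case (4 t)
  show ?case using 4 operad_minus_one[OF Q eval_closed[of t]] by simp
next
  case (5 c s t)
  interpret Module.module scalars "sp Q (arity a s)" using operad.module_sp[OF Q] .
  show ?case using 5 smult_r_distr[of c "ev s" "ev t"] eval_closed[of s] eval_closed[of t]
    by (simp add: ring_of_type_algebra_def)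
next
  case (6 c d t)
  interpret Module.module scalars "sp Q (arity a t)" using operad.module_sp[OF Q] .
  show ?case using 6 smult_l_distr[of c d "ev t"] eval_closed[of t]
    by (simp add: ring_of_type_algebra_def)
next
  case (7 c d t)
  interpret Module.module scalars "sp Q (arity a t)" using operad.module_sp[OF Q] .
  show ?case using 7 smult_assoc1[of c d "ev t"] eval_closed[of t]
    by (simp add: ring_of_type_algebra_def)
next
  case (8 t)
  interpret Module.module scalars "sp Q (arity a t)" using operad.module_sp[OF Q] .
  show ?case using 8 smult_one[of "ev t"] eval_closed[of t]
    by (simp add: ring_of_type_algebra_def)
next
  case (9 s t \<sigma>)
  then show ?case using operad.act_add[OF Q] eval_closed[of s] eval_closed[of t] by simp
next
  case (10 c t \<sigma>)
  then show ?case using operad.act_smult[OF Q] eval_closed[of t] by simp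
next
  case (11 t)
  then show ?case using operad.act_id[OF Q] eval_closed[of t] by simp
next
  case (12 t \<sigma> \<tau>)
  then show ?case using operad.act_act[OF Q] eval_closed[of t] by simp
next
  case (13 i r s t)
  then show ?case
    using operad.pcomp_add_left[OF Q, of "ev r" "arity a r" "ev s" "ev t" "arity a t" i]
      eval_closed[of r] eval_closed[of s] eval_closed[of t] by simp
next
  case (14 i r s t)
  then show ?case
    using operad.pcomp_add_right[OF Q, of "ev r" "arity a r" "ev s" "arity a s" "ev t" i]
      eval_closed[of r] eval_closed[of s] eval_closed[of t] by simp
next
  case (15 i c s t)
  then show ?case
    using operad.pcomp_smult_left[OF Q, of "ev s" "arity a s" "ev t" "arity a t" i c]
      eval_closed[of s] eval_closed[of t] by simp
next
  case (16 i s c t)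
  then show ?case
    using operad.pcomp_smult_right[OF Q, of "ev s" "arity a s" "ev t" "arity a t" i c]
      eval_closed[of s] eval_closed[of t] by simp
next
  case (17 t)
  then show ?case using operad.ident_left[OF Q] eval_closed[of t] by simp
next
  case (18 i t)
  then show ?case using operad.ident_right[OF Q] eval_closed[of t] by simp
next
  case (19 i j r s t)
  then show ?case
    using operad.sequential[OF Q, of "ev r" "arity a r" "ev s" "arity a s" "ev t" "arity a t" i j]
      eval_closed[of r] eval_closed[of s] eval_closed[of t] by simp
next
  case (20 i k s r t)
  then show ?case
    using operad.parallel[OF Q, of "ev r" "arity a r" "ev s" "arity a s" "ev t" "arity a t" i k]
      eval_closed[of r] eval_closed[of s] eval_closed[of t] by simp
next
  case (21 i s \<sigma> t \<tau>)
  then show ?case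
    using operad.equivariant[OF Q, of "ev s" "arity a s" "ev t" "arity a t" i \<sigma> \<tau>]
      eval_closed[of s] eval_closed[of t] by simp
qed

context
  assumes R: "\<And>s t. (s, t) \<in> R \<Longrightarrow> wf_oterm E a s \<Longrightarrow> wf_oterm E a t \<Longrightarrow> arity a s = arity a t \<Longrightarrow> ev s = ev t"
begin

lemma eval_oequiv: "oequiv E a R s t \<Longrightarrow> ev s = ev t"
proof (induction rule: oequiv.induct)
  case (base s t)
  then show ?case using eval_law R by blast
next
  case (comp s s' t t' i)
  then show ?case by (simp add: oequiv_wf[OF comp.hyps(1)] oequiv_wf[OF comp.hyps(2)])
qed (auto dest: oequiv_wf)

lemma presented_hom_oclass: "wf_oterm E a t \<Longrightarrow> presented_hom Q a h m (oclass E a R t) = ev t"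
  unfolding presented_hom_def by (rule eval_oequiv[OF rep_facts(1)])

lemma operad_hom_presented: "operad_hom (presented_operad E a R) Q (presented_hom Q a h)"
proof (rule operad_homI)
  fix m and A assume "A \<in> els (presented_operad E a R) m"
  then obtain t where t: "wf_oterm E a t" "arity a t = m" "A = oclass E a R t" by (elim els_presentedE)
  show "presented_hom Q a h m A \<in> els Q m" using t eval_closed[of t] by (simp add: presented_hom_oclass)
  show "presented_hom Q a h m (c \<odot>\<^bsub>sp (presented_operad E a R) m\<^esub> A) = c \<odot>\<^bsub>sp Q m\<^esub> presented_hom Q a h m A" for c
    using t by (simp add: presented_hom_oclass presented_smult)
  show "presented_hom Q a h m (act (presented_operad E a R) m A \<sigma>) = act Q m (presented_hom Q a h m A) \<sigma>"
    if "\<sigma> permutes {1..m}" for \<sigma>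
    unfolding t(3) using t that[folded t(2)] by (simp add: presented_hom_oclass presented_act del: One_nat_def)
  fix n and B assume "B \<in> els (presented_operad E a R) n"
  then obtain s where s: "wf_oterm E a s" "arity a s = n" "B = oclass E a R s" by (elim els_presentedE)
  show "presented_hom Q a h (m + n - 1) (pcomp (presented_operad E a R) m n i A B)
      = pcomp Q m n i (presented_hom Q a h m A) (presented_hom Q a h n B)" if "i \<in> {1..m}" for i
    unfolding t(3) s(3) using t s that by (simp add: presented_hom_oclass presented_pcomp)
next
  fix m and A B assume "A \<in> els (presented_operad E a R) m" "B \<in> els (presented_operad E a R) m"
  then obtain s t where t: "wf_oterm E a t" "arity a t = m" "A = oclass E a R t"
    and s: "wf_oterm E a s" "arity a s = m" "B = oclass E a R s" by (elim els_presentedE)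
  show "presented_hom Q a h m (A \<oplus>\<^bsub>sp (presented_operad E a R) m\<^esub> B)
      = presented_hom Q a h m A \<oplus>\<^bsub>sp Q m\<^esub> presented_hom Q a h m B"
    using t s by (simp add: presented_hom_oclass presented_add)
next
  show "presented_hom Q a h 1 (ident (presented_operad E a R)) = ident Q"
    by (simp add: presented_hom_oclass presented_ident)
qed

end

lemma operad_hom_presented_unique:
  assumes \<phi>: "operad_hom (presented_operad E a R) Q \<phi>"
    and gens: "\<And>g. g \<in> E \<Longrightarrow> \<phi> (a g) (oclass E a R (TGen g)) = h g"
  shows "wf_oterm E a t \<Longrightarrow> \<phi> (arity a t) (oclass E a R t) = ev t"
proof (induction t)
  case (TZero m)
  let ?z = "oclass E a R (TZero m)"
  interpret M: Module.module scalars "sp Q m" using operad.module_sp[OF Q] .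
  interpret N: Module.module scalars "sp (presented_operad E a R) m" by (rule module_presented)
  have z: "?z \<in> els (presented_operad E a R) m" by (simp add: oclass_in_els)
  have "?z = 0 \<odot>\<^bsub>sp (presented_operad E a R) m\<^esub> ?z"
    using N.smult_l_null[OF z] by (simp add: ring_of_type_algebra_def presented_zero)
  then have "\<phi> m ?z = 0 \<odot>\<^bsub>sp Q m\<^esub> \<phi> m ?z"
    using operad_homD(3)[OF \<phi> z, of 0] by simp
  also have "\<dots> = \<zero>\<^bsub>sp Q m\<^esub>"
    using M.smult_l_null[OF operad_homD(1)[OF \<phi> z]] by (simp add: ring_of_type_algebra_def)
  finally show ?case by simp
next
  case (TAdd s t)
  then show ?case
    using operad_homD(2)[OF \<phi>, of "oclass E a R s" "arity a s" "oclass E a R t"]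
    by (simp add: oclass_in_els presented_add)
next
  case (TScal c t)
  then show ?case
    using operad_homD(3)[OF \<phi>, of "oclass E a R t" "arity a t" c]
    by (simp add: oclass_in_els presented_smult)
next
  case (TAct t \<sigma>)
  then show ?case
    using operad_homD(4)[OF \<phi>, of "oclass E a R t" "arity a t" \<sigma>]
    by (simp add: oclass_in_els presented_act del: One_nat_def)
next
  case (TComp i s t)
  then show ?case
    using operad_homD(5)[OF \<phi>, of "oclass E a R s" "arity a s" "oclass E a R t" "arity a t" i]
    by (simp add: oclass_in_els presented_pcomp)
next
  case TId
  then show ?case using operad_homD(6)[OF \<phi>] by (simp add: presented_ident)
qed (simp add: gens)

end

text \<open>The universal property of a presented operad.\<close>

theorem presented_operad_universal:
  assumes "operad Q" "\<And>g. g \<in> E \<Longrightarrow> h g \<in> els Q (a g)"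
    and "\<And>s t. (s, t) \<in> R \<Longrightarrow> wf_oterm E a s \<Longrightarrow> wf_oterm E a t \<Longrightarrow> arity a s = arity a t \<Longrightarrow>
      oeval Q a h s = oeval Q a h t"
  shows "operad_hom (presented_operad E a R) Q (presented_hom Q a h)"
    and "\<And>g. g \<in> E \<Longrightarrow> presented_hom Q a h (a g) (oclass E a R (TGen g)) = h g"
    and "\<And>\<phi> m x. operad_hom (presented_operad E a R) Q \<phi> \<Longrightarrow>
      (\<And>g. g \<in> E \<Longrightarrow> \<phi> (a g) (oclass E a R (TGen g)) = h g) \<Longrightarrow>
      x \<in> els (presented_operad E a R) m \<Longrightarrow> \<phi> m x = presented_hom Q a h m x"
proof -
  show "operad_hom (presented_operad E a R) Q (presented_hom Q a h)"
    by (rule operad_hom_presented) (use assms in auto)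
  have ev: "presented_hom Q a h m (oclass E a R t) = oeval Q a h t" if "wf_oterm E a t" for m t
    by (rule presented_hom_oclass) (use assms that in auto)
  then show "presented_hom Q a h (a g) (oclass E a R (TGen g)) = h g" if "g \<in> E" for g
    using that by simp
  show "\<phi> m x = presented_hom Q a h m x"
    if \<phi>: "operad_hom (presented_operad E a R) Q \<phi>"
      and g: "\<And>g. g \<in> E \<Longrightarrow> \<phi> (a g) (oclass E a R (TGen g)) = h g"
      and x: "x \<in> els (presented_operad E a R) m" for \<phi> m x
  proof -
    obtain t where t: "wf_oterm E a t" "arity a t = m" "x = oclass E a R t"
      using x by (rule els_presentedE)
    show ?thesis
      using operad_hom_presented_unique[OF assms(1,2) \<phi> g t(1)] t ev by simp
  qed
qed


section \<open>The operads Lie and PreLie, and fibered coproducts\<close>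

abbreviation bin :: "('k, unit) oterm" where
  "bin \<equiv> TGen ()"

definition Lie :: "('k::field, ('k, unit) oterm set) operad" where
  "Lie = presented_operad UNIV (\<lambda>_. 2)
     (let J = TComp 1 bin bin; c = transpose 1 2 \<circ> transpose 2 3
      in {(TAct bin (transpose 1 2), TScal (-1) bin),
          (TAdd J (TAdd (TAct J c) (TAct J (c \<circ> c))), TZero 3)})"

definition PreLie_rels :: "(('k::field, unit) oterm \<times> ('k, unit) oterm) set" where
  "PreLie_rels =
     (let A = TSub (TComp 1 bin bin) (TComp 2 bin bin) in {(A, TAct A (transpose 2 3))})"

definition PreLie :: "('k::field, ('k, unit) oterm set) operad" where
  "PreLie = presented_operad UNIV (\<lambda>_. 2) PreLie_rels"

definition Lie_to_PreLie :: "nat \<Rightarrow> ('k::field, unit) oterm set \<Rightarrow> ('k, unit) oterm set" where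
  "Lie_to_PreLie = presented_hom PreLie (\<lambda>_. 2)
     (\<lambda>_. oclass UNIV (\<lambda>_. 2) PreLie_rels (TSub bin (TAct bin (transpose 1 2))))"

text \<open>
  For a nonempty index set \<open>I\<close> and morphisms \<open>f i\<close> from \<open>L\<close> to \<open>P i\<close>, the fibered coproduct of the
  \<open>P i\<close> over \<open>L\<close> (the colimit of the \<open>f i\<close>) is generated by one generator \<open>(i, m, x)\<close> for each
  element \<open>x\<close> of arity \<open>m\<close> of \<open>P i\<close>.  The relations make \<open>x \<mapsto> (i, m, x)\<close> a morphism for each \<open>i\<close>
  and identify the images of \<open>L\<close>.  Its universal property is proved below.
\<close>

definition coproduct_gens :: "'i set \<Rightarrow> ('i \<Rightarrow> ('k, 'a) operad) \<Rightarrow> ('i \<times> nat \<times> 'a) set" where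
  "coproduct_gens I P = {(i, m, x) | i m x. i \<in> I \<and> x \<in> els (P i) m}"

inductive_set fibered_coproduct_rels ::
    "'i set \<Rightarrow> ('k::field, 'b) operad \<Rightarrow> ('i \<Rightarrow> ('k, 'a) operad) \<Rightarrow> ('i \<Rightarrow> nat \<Rightarrow> 'b \<Rightarrow> 'a) \<Rightarrow>
     (('k, 'i \<times> nat \<times> 'a) oterm \<times> ('k, 'i \<times> nat \<times> 'a) oterm) set"
  for I L P f where
  add: "i \<in> I \<Longrightarrow> x \<in> els (P i) m \<Longrightarrow> y \<in> els (P i) m \<Longrightarrow>
    (TGen (i, m, x \<oplus>\<^bsub>sp (P i) m\<^esub> y), TAdd (TGen (i, m, x)) (TGen (i, m, y)))
      \<in> fibered_coproduct_rels I L P f"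
| smult: "i \<in> I \<Longrightarrow> x \<in> els (P i) m \<Longrightarrow>
    (TGen (i, m, c \<odot>\<^bsub>sp (P i) m\<^esub> x), TScal c (TGen (i, m, x))) \<in> fibered_coproduct_rels I L P f"
| act: "i \<in> I \<Longrightarrow> x \<in> els (P i) m \<Longrightarrow> \<sigma> permutes {1..m} \<Longrightarrow>
    (TGen (i, m, act (P i) m x \<sigma>), TAct (TGen (i, m, x)) \<sigma>) \<in> fibered_coproduct_rels I L P f"
| pcomp: "i \<in> I \<Longrightarrow> x \<in> els (P i) m \<Longrightarrow> y \<in> els (P i) n \<Longrightarrow> j \<in> {1..m} \<Longrightarrow>
    (TGen (i, m + n - 1, pcomp (P i) m n j x y), TComp j (TGen (i, m, x)) (TGen (i, n, y)))
      \<in> fibered_coproduct_rels I L P f"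
| ident: "i \<in> I \<Longrightarrow> (TGen (i, 1, ident (P i)), TId) \<in> fibered_coproduct_rels I L P f"
| glue: "i \<in> I \<Longrightarrow> j \<in> I \<Longrightarrow> z \<in> els L m \<Longrightarrow>
    (TGen (i, m, f i m z), TGen (j, m, f j m z)) \<in> fibered_coproduct_rels I L P f"

definition fibered_coproduct ::
    "'i set \<Rightarrow> ('k::field, 'b) operad \<Rightarrow> ('i \<Rightarrow> ('k, 'a) operad) \<Rightarrow> ('i \<Rightarrow> nat \<Rightarrow> 'b \<Rightarrow> 'a) \<Rightarrow>
     ('k, ('k, 'i \<times> nat \<times> 'a) oterm set) operad" where
  "fibered_coproduct I L P f =
     presented_operad (coproduct_gens I P) (\<lambda>(i, m, x). m) (fibered_coproduct_rels I L P f)"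

definition coproduct_incl ::
    "'i set \<Rightarrow> ('k::field, 'b) operad \<Rightarrow> ('i \<Rightarrow> ('k, 'a) operad) \<Rightarrow> ('i \<Rightarrow> nat \<Rightarrow> 'b \<Rightarrow> 'a) \<Rightarrow>
     'i \<Rightarrow> nat \<Rightarrow> 'a \<Rightarrow> ('k, 'i \<times> nat \<times> 'a) oterm set" where
  "coproduct_incl I L P f i m x =
     oclass (coproduct_gens I P) (\<lambda>(i, m, x). m) (fibered_coproduct_rels I L P f) (TGen (i, m, x))"

definition PreLie_coproduct ::
    "nat \<Rightarrow> ('k::field, ('k, nat \<times> nat \<times> ('k, unit) oterm set) oterm set) operad" where
  "PreLie_coproduct m = fibered_coproduct {1..m} Lie (\<lambda>_. PreLie) (\<lambda>_. Lie_to_PreLie)"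


context
  fixes I :: "'i set" and L :: "('k::field, 'b) operad" and P :: "'i \<Rightarrow> ('k, 'a) operad"
    and f :: "'i \<Rightarrow> nat \<Rightarrow> 'b \<Rightarrow> 'a"
  assumes P: "\<And>i. i \<in> I \<Longrightarrow> operad (P i)" and f: "\<And>i. i \<in> I \<Longrightarrow> operad_hom L (P i) (f i)"
begin

private abbreviation "E \<equiv> coproduct_gens I P"
private abbreviation "ar \<equiv> (\<lambda>(i, m, x). m) :: 'i \<times> nat \<times> 'a \<Rightarrow> nat"
private abbreviation "R \<equiv> fibered_coproduct_rels I L P f"
private abbreviation "FC \<equiv> fibered_coproduct I L P f"
private abbreviation "incl \<equiv> coproduct_incl I L P f"

private lemma gen: "i \<in> I \<Longrightarrow> x \<in> els (P i) m \<Longrightarrow> wf_oterm E ar (TGen (i, m, x) :: ('k, _) oterm)"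
  by (simp add: coproduct_gens_def)

lemma operad_fibered_coproduct: "operad FC"
  unfolding fibered_coproduct_def by (rule operad_presented)

lemma operad_hom_coproduct_incl:
  assumes i: "i \<in> I"
  shows "operad_hom (P i) FC (incl i)"
proof -
  interpret operad "P i" by (rule P[OF i])
  have relI: "oclass E ar R s = oclass E ar R t"
    if "(s, t) \<in> R" "wf_oterm E ar s" "wf_oterm E ar t" "arity ar s = arity ar t" for s t
    by (rule oclass_eqI) (use that in \<open>blast intro: oequiv.base\<close>)
  show ?thesis
    unfolding fibered_coproduct_def coproduct_incl_def
  proof (rule operad_homI)
    fix m x assume x: "x \<in> els (P i) m"
    interpret M: Module.module scalars "sp (P i) m" by (rule module_sp)
    show "oclass E ar R (TGen (i, m, x)) \<in> els (presented_operad E ar R) m"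
      using gen[OF i x] by (simp add: oclass_in_els)
    show "oclass E ar R (TGen (i, m, c \<odot>\<^bsub>sp (P i) m\<^esub> x))
        = c \<odot>\<^bsub>sp (presented_operad E ar R) m\<^esub> oclass E ar R (TGen (i, m, x))" for c
    proof -
      have "c \<odot>\<^bsub>sp (P i) m\<^esub> x \<in> els (P i) m"
        using M.smult_closed[of c x] x by (simp add: ring_of_type_algebra_def)
      then have "oclass E ar R (TGen (i, m, c \<odot>\<^bsub>sp (P i) m\<^esub> x)) = oclass E ar R (TScal c (TGen (i, m, x)))"
        using gen[OF i] x by (intro relI fibered_coproduct_rels.smult[OF i]) auto
      then show ?thesis using gen[OF i x] by (simp add: presented_smult)
    qed
    show "oclass E ar R (TGen (i, m, act (P i) m x \<sigma>))
        = act (presented_operad E ar R) m (oclass E ar R (TGen (i, m, x))) \<sigma>"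
      if "\<sigma> permutes {1..m}" for \<sigma>
    proof -
      have "act (P i) m x \<sigma> \<in> els (P i) m" by (rule act_closed[OF x that])
      then have "oclass E ar R (TGen (i, m, act (P i) m x \<sigma>)) = oclass E ar R (TAct (TGen (i, m, x)) \<sigma>)"
        using gen[OF i] x that by (intro relI fibered_coproduct_rels.act[OF i]) auto
      then show ?thesis using gen[OF i x] that by (simp add: presented_act del: One_nat_def)
    qed
    show "oclass E ar R (TGen (i, m, x \<oplus>\<^bsub>sp (P i) m\<^esub> y))
        = oclass E ar R (TGen (i, m, x)) \<oplus>\<^bsub>sp (presented_operad E ar R) m\<^esub> oclass E ar R (TGen (i, m, y))"
      if y: "y \<in> els (P i) m" for y
    proof -
      have "x \<oplus>\<^bsub>sp (P i) m\<^esub> y \<in> els (P i) m" using x y by simp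
      then have "oclass E ar R (TGen (i, m, x \<oplus>\<^bsub>sp (P i) m\<^esub> y))
          = oclass E ar R (TAdd (TGen (i, m, x)) (TGen (i, m, y)))"
        using gen[OF i] x y by (intro relI fibered_coproduct_rels.add[OF i]) auto
      then show ?thesis using gen[OF i x] gen[OF i y] by (simp add: presented_add)
    qed
    show "oclass E ar R (TGen (i, m + n - 1, pcomp (P i) m n j x y))
        = pcomp (presented_operad E ar R) m n j (oclass E ar R (TGen (i, m, x))) (oclass E ar R (TGen (i, n, y)))"
      if y: "y \<in> els (P i) n" and j: "j \<in> {1..m}" for n j y
    proof -
      have "pcomp (P i) m n j x y \<in> els (P i) (m + n - 1)" by (rule pcomp_closed[OF x y j])
      then have "oclass E ar R (TGen (i, m + n - 1, pcomp (P i) m n j x y))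
          = oclass E ar R (TComp j (TGen (i, m, x)) (TGen (i, n, y)))"
        using gen[OF i] x y j by (intro relI fibered_coproduct_rels.pcomp[OF i]) auto
      then show ?thesis using gen[OF i x] gen[OF i y] j by (simp add: presented_pcomp)
    qed
  next
    show "oclass E ar R (TGen (i, 1, ident (P i))) = ident (presented_operad E ar R)"
      unfolding presented_ident
      using gen[OF i ident_closed] by (intro relI fibered_coproduct_rels.ident[OF i]) auto
  qed
qed

lemma coproduct_incl_glue:
  assumes "i \<in> I" "j \<in> I" "z \<in> els L m"
  shows "incl i m (f i m z) = incl j m (f j m z)"
  unfolding coproduct_incl_def
  by (rule oclass_eqI, rule oequiv.base)
     (use assms gen operad_homD(1)[OF f] fibered_coproduct_rels.glue[OF assms, of f P] in auto)

text \<open>The universal property of the fibered coproduct.\<close>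

theorem fibered_coproduct_universal:
  assumes Q: "operad Q" and g: "\<And>i. i \<in> I \<Longrightarrow> operad_hom (P i) Q (g i)"
    and glue: "\<And>i j m z. i \<in> I \<Longrightarrow> j \<in> I \<Longrightarrow> z \<in> els L m \<Longrightarrow> g i m (f i m z) = g j m (f j m z)"
  shows "\<exists>\<phi>. operad_hom FC Q \<phi> \<and> (\<forall>i\<in>I. \<forall>m. \<forall>x\<in>els (P i) m. \<phi> m (incl i m x) = g i m x) \<and>
    (\<forall>\<psi>. operad_hom FC Q \<psi> \<and> (\<forall>i\<in>I. \<forall>m. \<forall>x\<in>els (P i) m. \<psi> m (incl i m x) = g i m x) \<longrightarrow>
      (\<forall>m. \<forall>x\<in>els FC m. \<psi> m x = \<phi> m x))"
proof -
  let ?h = "\<lambda>(i, m, x). g i m x"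
  have h: "?h e \<in> els Q (ar e)" if "e \<in> E" for e
    using that operad_homD(1)[OF g] by (auto simp: coproduct_gens_def)
  have R: "oeval Q ar ?h s = oeval Q ar ?h t" if "(s, t) \<in> R" for s t
    using that
  proof cases
    case (pcomp i x m y n j)
    then show ?thesis using operad_homD(5)[OF g[OF pcomp(3)], of x m y n j] by simp
  next
    case (ident i)
    then show ?thesis using operad_homD(6)[OF g] by simp
  qed (auto simp: operad_homD(2-4)[OF g] intro: glue)
  have univ:
    "operad_hom FC Q (presented_hom Q ar ?h)"
    "\<And>e. e \<in> E \<Longrightarrow> presented_hom Q ar ?h (ar e) (oclass E ar R (TGen e)) = ?h e"
    "\<And>\<psi> m x. operad_hom FC Q \<psi> \<Longrightarrow> (\<And>e. e \<in> E \<Longrightarrow> \<psi> (ar e) (oclass E ar R (TGen e)) = ?h e) \<Longrightarrow>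
      x \<in> els FC m \<Longrightarrow> \<psi> m x = presented_hom Q ar ?h m x"
    unfolding fibered_coproduct_def
    using presented_operad_universal[where E = E and a = ar and R = R and h = ?h, OF Q h R] by blast+
  show ?thesis
  proof (intro exI[of _ "presented_hom Q ar ?h"] conjI allI ballI impI)
    show "presented_hom Q ar ?h m (incl i m x) = g i m x" if "i \<in> I" "x \<in> els (P i) m" for i m x
      using univ(2)[of "(i, m, x)"] that by (simp add: coproduct_gens_def coproduct_incl_def)
    show "\<psi> m x = presented_hom Q ar ?h m x"
      if "operad_hom FC Q \<psi> \<and> (\<forall>i\<in>I. \<forall>m. \<forall>x\<in>els (P i) m. \<psi> m (incl i m x) = g i m x)"
        and "x \<in> els FC m" for \<psi> m x
      by (rule univ(3)) (use that in \<open>auto simp: coproduct_gens_def coproduct_incl_def\<close>)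
  qed (rule univ(1))
qed

end

lemma operad_PreLie: "operad PreLie" and operad_Lie: "operad Lie"
  unfolding PreLie_def Lie_def Let_def by (rule operad_presented)+

context
begin

private abbreviation (input) "p12 \<equiv> transpose 1 (2::nat)"
private abbreviation (input) "p13 \<equiv> transpose 1 (3::nat)"
private abbreviation (input) "p23 \<equiv> transpose 2 (3::nat)"
private abbreviation (input) "cyc \<equiv> transpose 1 2 \<circ> transpose 2 (3::nat)"

context
  fixes P :: "('k::field, 'a) operad" and x
  assumes P: "operad P" and x: "x \<in> els P 2"
begin

interpretation operad P by (rule P)

private abbreviation "u \<equiv> pcomp P 2 2 1 x x"
private abbreviation "v \<equiv> pcomp P 2 2 2 x x"
private abbreviation "l \<equiv> x \<oplus>\<^bsub>sp P 2\<^esub> ((-1) \<odot>\<^bsub>sp P 2\<^esub> act P 2 x p12)"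
private abbreviation "J \<equiv> pcomp P 2 2 1 l l"

private lemma perm2: "p12 permutes {1..2}" by (rule permutes_swap_id) auto
private lemma perm3: "p12 permutes {1..3}" "p13 permutes {1..3}" "p23 permutes {1..3}" "cyc permutes {1..3}"
  "cyc \<circ> cyc permutes {1..3}"
  by (auto intro!: permutes_swap_id permutes_compose)

private lemma bracket_closed: "l \<in> els P 2"
proof -
  interpret M: Module.module scalars "sp P 2" by (rule module_sp)
  show ?thesis using x act_closed[OF x perm2] M.smult_closed[of "-1"]
    by (simp add: ring_of_type_algebra_def)
qed

lemma bracket_skew: "act P 2 l p12 = (-1) \<odot>\<^bsub>sp P 2\<^esub> l"
proof -
  interpret M: Module.module scalars "sp P 2" by (rule module_sp)
  let ?y = "act P 2 x p12"
  have y: "?y \<in> els P 2" by (rule act_closed[OF x perm2])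
  have sc: "c \<odot>\<^bsub>sp P 2\<^esub> z \<in> els P 2" if "z \<in> els P 2" for c :: 'k and z
    using that M.smult_closed[of c] by (simp add: ring_of_type_algebra_def)
  have "act P 2 l p12 = ?y \<oplus>\<^bsub>sp P 2\<^esub> ((-1) \<odot>\<^bsub>sp P 2\<^esub> act P 2 ?y p12)"
    using act_add[OF x sc[OF y] perm2] act_smult[OF y perm2] by simp
  also have "act P 2 ?y p12 = x"
    using act_act[OF x perm2 perm2] act_id[OF x] by (simp add: id_def[symmetric])
  also have "?y \<oplus>\<^bsub>sp P 2\<^esub> ((-1) \<odot>\<^bsub>sp P 2\<^esub> x) = (-1) \<odot>\<^bsub>sp P 2\<^esub> l"
  proof -
    have "(-1) \<odot>\<^bsub>sp P 2\<^esub> ((-1) \<odot>\<^bsub>sp P 2\<^esub> ?y) = ?y"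
      using M.smult_assoc1[of "-1" "-1" ?y] M.smult_one[OF y] y by (simp add: ring_of_type_algebra_def)
    then show ?thesis
      using M.smult_r_distr[of "-1" x "(-1) \<odot>\<^bsub>sp P 2\<^esub> ?y"] x y sc M.a_comm[of ?y "(-1) \<odot>\<^bsub>sp P 2\<^esub> x"]
      by (simp add: ring_of_type_algebra_def)
  qed
  finally show ?thesis .
qed

lemma bracket_jacobi:
  assumes rel: "u \<oplus>\<^bsub>sp P 3\<^esub> ((-1) \<odot>\<^bsub>sp P 3\<^esub> v)
    = act P 3 (u \<oplus>\<^bsub>sp P 3\<^esub> ((-1) \<odot>\<^bsub>sp P 3\<^esub> v)) p23"
  shows "J \<oplus>\<^bsub>sp P 3\<^esub> (act P 3 J cyc \<oplus>\<^bsub>sp P 3\<^esub> act P 3 J (cyc \<circ> cyc)) = \<zero>\<^bsub>sp P 3\<^esub>"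
proof -
  interpret M: Module.module scalars "sp P 3" by (rule module_sp)
  interpret M2: Module.module scalars "sp P 2" by (rule module_sp)
  have sc: "c \<odot>\<^bsub>sp P 3\<^esub> z \<in> els P 3" if "z \<in> els P 3" for c :: 'k and z
    using that M.smult_closed[of c] by (simp add: ring_of_type_algebra_def)
  have sc2: "c \<odot>\<^bsub>sp P 2\<^esub> z \<in> els P 2" if "z \<in> els P 2" for c :: 'k and z
    using that M2.smult_closed[of c] by (simp add: ring_of_type_algebra_def)
  have distr: "c \<odot>\<^bsub>sp P 3\<^esub> (y \<oplus>\<^bsub>sp P 3\<^esub> z) = c \<odot>\<^bsub>sp P 3\<^esub> y \<oplus>\<^bsub>sp P 3\<^esub> c \<odot>\<^bsub>sp P 3\<^esub> z"
    if "y \<in> els P 3" "z \<in> els P 3" for c :: 'k and y z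
    using that M.smult_r_distr[of c y z] by (simp add: ring_of_type_algebra_def)
  have neg_neg: "(-1) \<odot>\<^bsub>sp P 3\<^esub> ((-1) \<odot>\<^bsub>sp P 3\<^esub> z) = z" if "z \<in> els P 3" for z
    using M.smult_assoc1[of "-1" "-1" z] M.smult_one[OF that] that by (simp add: ring_of_type_algebra_def)
  have uv: "u \<in> els P 3" "v \<in> els P 3"
    using pcomp_closed[OF x x, of 1] pcomp_closed[OF x x, of 2] by simp_all
  define U where "U \<sigma> = act P 3 u \<sigma>" for \<sigma>
  define V where "V \<sigma> = (-1) \<odot>\<^bsub>sp P 3\<^esub> act P 3 v \<sigma>" for \<sigma>
  define A where "A \<sigma> = U \<sigma> \<oplus>\<^bsub>sp P 3\<^esub> V \<sigma>" for \<sigma>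
  have UV: "U \<sigma> \<in> els P 3" "V \<sigma> \<in> els P 3" if "\<sigma> permutes {1..3}" for \<sigma>
    unfolding U_def V_def using that uv by (simp_all add: act_closed sc)
  have A_cl: "A \<sigma> \<in> els P 3" if "\<sigma> permutes {1..3}" for \<sigma>
    unfolding A_def using UV[OF that] by simp
  have actU: "act P 3 (U \<sigma>) \<tau> = U (\<sigma> \<circ> \<tau>)" and actV: "act P 3 (V \<sigma>) \<tau> = V (\<sigma> \<circ> \<tau>)"
    if "\<sigma> permutes {1..3}" "\<tau> permutes {1..3}" for \<sigma> \<tau>
    unfolding U_def V_def using that uv by (simp_all add: act_smult act_closed act_act)
  have actA: "act P 3 (A \<sigma>) \<tau> = A (\<sigma> \<circ> \<tau>)" if "\<sigma> permutes {1..3}" "\<tau> permutes {1..3}" for \<sigma> \<tau>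
    unfolding A_def using that UV by (simp add: act_add actU actV)
  have rel': "A id = A p23"
    using rel uv actA[OF permutes_id perm3(3)] unfolding A_def U_def V_def by (simp add: act_id)
  have swap: "A \<sigma> = A (p23 \<circ> \<sigma>)" if "\<sigma> permutes {1..3}" for \<sigma>
    using actA[OF permutes_id that] actA[OF perm3(3) that] rel' by simp

  let ?y = "act P 2 x p12"
  have y: "?y \<in> els P 2" by (rule act_closed[OF x perm2])
  have pc: "perm_comp 2 1 id p12 = p12" "perm_comp 2 1 p12 id = cyc" "perm_comp 2 1 p12 p12 = p13"
    by (rule ext, auto simp: perm_comp_def shift_def transpose_def)+
  have p1: "pcomp P 2 2 1 x ?y = U p12"
    using equivariant[OF x x, of 1 id p12] perm2 permutes_id act_id[OF x] pc by (simp add: U_def)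
  have p2: "pcomp P 2 2 1 ?y x = act P 3 v cyc"
    using equivariant[OF x x, of 1 p12 id] perm2 permutes_id act_id[OF x] pc by simp
  have p3: "pcomp P 2 2 1 ?y ?y = act P 3 v p13"
    using equivariant[OF x x, of 1 p12 p12] perm2 pc by simp
  have p0: "pcomp P 2 2 1 x x = U id"
    unfolding U_def by (rule act_id[OF uv(1), symmetric])
  have J: "J = U id \<oplus>\<^bsub>sp P 3\<^esub> (-1) \<odot>\<^bsub>sp P 3\<^esub> U p12
      \<oplus>\<^bsub>sp P 3\<^esub> (V cyc \<oplus>\<^bsub>sp P 3\<^esub> (-1) \<odot>\<^bsub>sp P 3\<^esub> V p13)"
  proof -
    have "J = pcomp P 2 2 1 x l \<oplus>\<^bsub>sp P 3\<^esub> (-1) \<odot>\<^bsub>sp P 3\<^esub> pcomp P 2 2 1 ?y l"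
      using pcomp_add_left[OF x sc2[OF y] bracket_closed, of 1] pcomp_smult_left[OF y bracket_closed, of 1 "-1"]
      by simp
    also have "pcomp P 2 2 1 x l = U id \<oplus>\<^bsub>sp P 3\<^esub> (-1) \<odot>\<^bsub>sp P 3\<^esub> U p12"
      using pcomp_add_right[OF x x sc2[OF y], of 1] pcomp_smult_right[OF x y, of 1 "-1"] p0 p1 by simp
    also have "pcomp P 2 2 1 ?y l = act P 3 v cyc \<oplus>\<^bsub>sp P 3\<^esub> (-1) \<odot>\<^bsub>sp P 3\<^esub> act P 3 v p13"
      using pcomp_add_right[OF y x sc2[OF y], of 1] pcomp_smult_right[OF y y, of 1 "-1"] p2 p3 by simp
    finally show ?thesis
      using uv perm3 by (simp add: V_def distr act_closed sc id_def)
  qed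
  have actJ: "act P 3 J \<tau> = U \<tau> \<oplus>\<^bsub>sp P 3\<^esub> (-1) \<odot>\<^bsub>sp P 3\<^esub> U (p12 \<circ> \<tau>)
      \<oplus>\<^bsub>sp P 3\<^esub> (V (cyc \<circ> \<tau>) \<oplus>\<^bsub>sp P 3\<^esub> (-1) \<odot>\<^bsub>sp P 3\<^esub> V (p13 \<circ> \<tau>))" if "\<tau> permutes {1..3}" for \<tau>
    unfolding J using that UV perm3 permutes_id[of "{1..3}"]
    by (simp add: act_add act_smult actU actV sc)
  have g: "p12 \<circ> cyc = p23" "cyc \<circ> (cyc \<circ> cyc) = id" "p13 \<circ> cyc = p12"
      "p12 \<circ> (cyc \<circ> cyc) = p13" "p13 \<circ> (cyc \<circ> cyc) = p23"
      "p23 \<circ> cyc = p13" "p23 \<circ> (cyc \<circ> cyc) = p12"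
    by (rule ext, auto simp: transpose_def)+
  note cl = UV[OF permutes_id] UV[OF perm3(1)] UV[OF perm3(2)] UV[OF perm3(3)] UV[OF perm3(4)] UV[OF perm3(5)]
  have "J \<oplus>\<^bsub>sp P 3\<^esub> (act P 3 J cyc \<oplus>\<^bsub>sp P 3\<^esub> act P 3 J (cyc \<circ> cyc))
    = (A id \<oplus>\<^bsub>sp P 3\<^esub> (-1) \<odot>\<^bsub>sp P 3\<^esub> A p23) \<oplus>\<^bsub>sp P 3\<^esub>
      ((A cyc \<oplus>\<^bsub>sp P 3\<^esub> (-1) \<odot>\<^bsub>sp P 3\<^esub> A p13) \<oplus>\<^bsub>sp P 3\<^esub>
       (A (cyc \<circ> cyc) \<oplus>\<^bsub>sp P 3\<^esub> (-1) \<odot>\<^bsub>sp P 3\<^esub> A p12))"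
    unfolding actJ[OF perm3(4)] actJ[OF perm3(5)] unfolding g unfolding J A_def
    using cl by (simp add: distr sc M.a_ac)
  also have "\<dots> = \<zero>\<^bsub>sp P 3\<^esub>"
    using swap[OF permutes_id] swap[OF perm3(4)] swap[OF perm3(5)]
      operad_minus_one[OF P A_cl[OF perm3(3)]] operad_minus_one[OF P A_cl[OF perm3(2)]]
      operad_minus_one[OF P A_cl[OF perm3(1)]]
    unfolding g by simp
  finally show ?thesis .
qed

end

theorem operad_hom_Lie_to_PreLie:
  "operad_hom Lie PreLie (Lie_to_PreLie :: nat \<Rightarrow> ('k::field, unit) oterm set \<Rightarrow> _)"
proof -
  let ?cl = "oclass UNIV (\<lambda>_. 2) PreLie_rels :: ('k, unit) oterm \<Rightarrow> _"
  let ?P = "PreLie :: ('k, _) operad"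
  let ?x = "?cl bin"
  have x: "?x \<in> els ?P 2" unfolding PreLie_def by (rule oclass_in_els) auto
  have p12: "p12 permutes {1..2}" by (rule permutes_swap_id) auto
  have p23: "p23 permutes {1..3}" by (rule permutes_swap_id) auto
  have l: "?cl (TSub bin (TAct bin p12)) = ?x \<oplus>\<^bsub>sp ?P 2\<^esub> ((-1) \<odot>\<^bsub>sp ?P 2\<^esub> act ?P 2 ?x p12)"
    unfolding PreLie_def using p12 by (simp add: presented_act presented_smult presented_add del: One_nat_def)
  let ?A = "TSub (TComp 1 bin bin) (TComp 2 bin bin) :: ('k, unit) oterm"
  have "?cl ?A = ?cl (TAct ?A p23)"
    by (rule oclass_eqI, rule oequiv.base) (use p23 in \<open>auto simp: PreLie_rels_def Let_def\<close>)
  moreover have "?cl ?A = pcomp ?P 2 2 1 ?x ?x \<oplus>\<^bsub>sp ?P 3\<^esub> ((-1) \<odot>\<^bsub>sp ?P 3\<^esub> pcomp ?P 2 2 2 ?x ?x)"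
    unfolding PreLie_def by (simp add: presented_pcomp presented_smult presented_add)
  moreover have "?cl (TAct ?A p23) = act ?P 3 (?cl ?A) p23"
    unfolding PreLie_def using p23 by (simp add: presented_act del: One_nat_def)
  ultimately have rel: "pcomp ?P 2 2 1 ?x ?x \<oplus>\<^bsub>sp ?P 3\<^esub> ((-1) \<odot>\<^bsub>sp ?P 3\<^esub> pcomp ?P 2 2 2 ?x ?x)
      = act ?P 3 (pcomp ?P 2 2 1 ?x ?x \<oplus>\<^bsub>sp ?P 3\<^esub> ((-1) \<odot>\<^bsub>sp ?P 3\<^esub> pcomp ?P 2 2 2 ?x ?x)) p23"
    by simp
  show ?thesis
    unfolding Lie_def Lie_to_PreLie_def Let_def
  proof (rule presented_operad_universal(1)[OF operad_PreLie])
    show "?cl (TSub bin (TAct bin p12)) \<in> els ?P 2"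
      unfolding PreLie_def using p12 by (intro oclass_in_els) auto
  qed (use bracket_skew[OF operad_PreLie x] bracket_jacobi[OF operad_PreLie x rel] l in
        \<open>auto simp del: One_nat_def\<close>)
qed

end


section \<open>Rooted Greg trees\<close>

text \<open>
  The children of a vertex form a multiset, so these trees are non-planar.  In a Greg tree the white
  labels are pairwise distinct and every leaf is white; hence the subtrees are pairwise distinct
  and each forest of children is in fact a set.
\<close>

datatype ('w, 'c) gtree =
    White 'w "('w, 'c) gtree multiset"
  | Black 'c "('w, 'c) gtree multiset"

abbreviation relabel :: "('w \<Rightarrow> 'v) \<Rightarrow> ('w, 'c) gtree \<Rightarrow> ('v, 'c) gtree" where
  "relabel g \<equiv> map_gtree g id"

primrec white_labels :: "('w, 'c) gtree \<Rightarrow> 'w multiset" where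
  "white_labels (White w F) = add_mset w (\<Sum>\<^sub># (image_mset white_labels F))"
| "white_labels (Black c F) = \<Sum>\<^sub># (image_mset white_labels F)"

primrec num_black :: "('w, 'c) gtree \<Rightarrow> nat" where
  "num_black (White w F) = \<Sum>\<^sub># (image_mset num_black F)"
| "num_black (Black c F) = Suc (\<Sum>\<^sub># (image_mset num_black F))"

inductive greg :: "'c set \<Rightarrow> ('w, 'c) gtree \<Rightarrow> bool" for B where
  "(\<And>s. s \<in># F \<Longrightarrow> greg B s) \<Longrightarrow> greg B (White w F)"
| "c \<in> B \<Longrightarrow> 2 \<le> size F \<Longrightarrow> (\<And>s. s \<in># F \<Longrightarrow> greg B s) \<Longrightarrow> greg B (Black c F)"

definition greg_trees :: "'c set \<Rightarrow> 'w set \<Rightarrow> ('w, 'c) gtree set" where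
  "greg_trees B W = {t. greg B t \<and> white_labels t = mset_set W}"


section \<open>Deformed fall product, braces and the operads Greg\<close>

definition lscale :: "'k::semiring_0 \<Rightarrow> ('a \<Rightarrow>\<^sub>0 'k) \<Rightarrow> ('a \<Rightarrow>\<^sub>0 'k)" where
  "lscale c p = Poly_Mapping.map ((*) c) p"

definition lin :: "('a \<Rightarrow> ('b \<Rightarrow>\<^sub>0 'k)) \<Rightarrow> ('a \<Rightarrow>\<^sub>0 'k) \<Rightarrow> ('b \<Rightarrow>\<^sub>0 'k::semiring_0)" where
  "lin g p = (\<Sum>t\<in>Poly_Mapping.keys p. lscale (Poly_Mapping.lookup p t) (g t))"

abbreviation basis :: "'a \<Rightarrow> ('a \<Rightarrow>\<^sub>0 'k::zero_neq_one)" where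
  "basis t \<equiv> Poly_Mapping.single t 1"

text \<open>
  A pair \<open>(V, \<Delta>)\<close> is given by a finite set \<open>B\<close> indexing a basis \<open>(e\<^sub>b)\<close> of \<open>V\<close> and by the elements
  \<open>\<Delta> b\<close> of \<open>V \<otimes> V\<close>, the images of the \<open>e\<^sub>b\<close>, written in the basis \<open>(e\<^sub>i \<otimes> e\<^sub>j)\<close>.
\<close>

type_synonym ('c, 'k) coproduct = "'c \<Rightarrow> ('c \<times> 'c \<Rightarrow>\<^sub>0 'k)"

definition coassoc_cocomm :: "'c set \<Rightarrow> ('c, 'k::field) coproduct \<Rightarrow> bool" where
  "coassoc_cocomm B \<Delta> \<longleftrightarrow> finite B \<and>
     (\<forall>b\<in>B. Poly_Mapping.keys (\<Delta> b) \<subseteq> B \<times> B) \<and>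
     (\<forall>b\<in>B. \<forall>i\<in>B. \<forall>j\<in>B. Poly_Mapping.lookup (\<Delta> b) (i, j) =
       Poly_Mapping.lookup (\<Delta> b) (j, i)) \<and>
     (\<forall>b\<in>B.
        lin (\<lambda>(s, t). lin (\<lambda>(i, j). basis (i, j, t)) (\<Delta> s)) (\<Delta> b)
        = lin (\<lambda>(s, t). lin (\<lambda>(i, j). basis (s, i, j)) (\<Delta> t)) (\<Delta> b))"

definition in_forest ::
    "(('w, 'c) gtree multiset \<Rightarrow> ('w, 'c) gtree) \<Rightarrow> ('w, 'c) gtree multiset \<Rightarrow> ('w, 'c) gtree \<Rightarrow>
     (('w, 'c) gtree \<Rightarrow>\<^sub>0 'k::field) \<Rightarrow> (('w, 'c) gtree \<Rightarrow>\<^sub>0 'k)" where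
  "in_forest node F s p = lin (\<lambda>s'. basis (node (F - {#s#} + {#s'#}))) p"

text \<open>
  The deformed fall product.  For a black vertex \<open>v\<close> with label \<open>c\<close> and forest of children \<open>F\<close>,
  the second sum has one term for each decomposition of \<open>F\<close> into \<open>F - {s}\<close> and \<open>{s}\<close>: the lower
  vertex keeps the trees of \<open>F - {s}\<close>, and the upper vertex carries \<open>s\<close> and \<open>T\<close>.  In other words
  \<open>T\<close> is grafted on the edge joining \<open>s\<close> to \<open>v\<close>.

  Only decompositions into \<open>F1\<close> (below) and \<open>F2\<close> (above) with \<open>F2\<close> a single tree may occur.  If
  \<open>F1\<close> or \<open>F2\<close> is empty, one of the new black vertices has a single child and the result is not a
  Greg tree.  If larger \<open>F2\<close> were admitted, the fall product would not satisfy the pre-Lie identity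
  and partial compositions would not be associative: let \<open>\<Delta> e = e \<otimes> e\<close> and let \<open>S = e(1, 2)\<close>
  be a black vertex with two white leaves; if all decompositions into nonempty parts contributed,
  the associator of \<open>S\<close>, \<open>3\<close>, \<open>4\<close> would contain \<open>e(3, e(1, 2, 4))\<close>, coming from the part
  \<open>e(1, 2, 3)\<close> of the product of \<open>S\<close> and \<open>3\<close>, but not \<open>e(4, e(1, 2, 3))\<close>.
\<close>

lemma size_gtree_less: "s \<in># F \<Longrightarrow> size s < Suc (size_multiset size F)"
  by (auto dest!: multi_member_split)

function fall ::
    "('c, 'k::field) coproduct \<Rightarrow> ('w, 'c) gtree \<Rightarrow> ('w, 'c) gtree \<Rightarrow> (('w, 'c) gtree \<Rightarrow>\<^sub>0 'k)" where
  "fall \<Delta> (White w F) T =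
     basis (White w (F + {#T#}))
     + (\<Sum>s\<in>#F. in_forest (White w) F s (fall \<Delta> s T))"
| "fall \<Delta> (Black c F) T =
     basis (Black c (F + {#T#}))
     + (\<Sum>s\<in>#F. lin (\<lambda>(c1, c2). basis (Black c1 (F - {#s#} + {#Black c2 {#s, T#}#}))) (\<Delta> c))
     + (\<Sum>s\<in>#F. in_forest (Black c) F s (fall \<Delta> s T))"
  by pat_completeness auto
termination
  by (relation "measure (\<lambda>(_, S, _). size S)") (auto simp: size_gtree_less)

function brace ::
    "('c, 'k::field) coproduct \<Rightarrow> ('w, 'c) gtree \<Rightarrow> ('w, 'c) gtree list \<Rightarrow> (('w, 'c) gtree \<Rightarrow>\<^sub>0 'k)" where
  "brace \<Delta> S [] = basis S"
| "brace \<Delta> S (Ts @ [T]) =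
     lin (\<lambda>U. fall \<Delta> U T) (brace \<Delta> S Ts)
     - (\<Sum>i<length Ts. lin (\<lambda>U. brace \<Delta> S (Ts[i := U])) (fall \<Delta> (Ts ! i) T))"
  by (metis rev_exhaust surj_pair) auto
termination
  by (relation "measure (\<lambda>(_, _, Ts). length Ts)") auto

text \<open>
  \<open>insert_tree \<Delta> i S T\<close> replaces the subtree of \<open>T\<close> at the white vertex \<open>i\<close>, with children \<open>F\<close>,
  by the brace of \<open>S\<close> with the trees of \<open>F\<close>.  The order in which the trees are listed is immaterial,
  since the fall product is pre-Lie.
\<close>

function insert_tree ::
    "('c, 'k::field) coproduct \<Rightarrow> 'w \<Rightarrow> ('w, 'c) gtree \<Rightarrow> ('w, 'c) gtree \<Rightarrow> (('w, 'c) gtree \<Rightarrow>\<^sub>0 'k)"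
  where
  "insert_tree \<Delta> i S (White w F) =
     (if w = i then brace \<Delta> S (SOME Ts. mset Ts = F)
      else \<Sum>s\<in>#{#s \<in># F. i \<in># white_labels s#}. in_forest (White w) F s (insert_tree \<Delta> i S s))"
| "insert_tree \<Delta> i S (Black c F) =
     (\<Sum>s\<in>#{#s \<in># F. i \<in># white_labels s#}. in_forest (Black c) F s (insert_tree \<Delta> i S s))"
  by pat_completeness auto
termination
  by (relation "measure (\<lambda>(_, _, _, T). size T)") (auto simp: size_gtree_less)

text \<open>
  The right action of \<open>\<sigma>\<close> relabels the white vertices by the inverse of \<open>\<sigma>\<close>.  For the partial
  composition at \<open>i\<close> the labels of the two trees are first shifted apart (the vertex of \<open>T\<close> to be
  replaced keeps its label \<open>i\<close>).
\<close>

definition greg_operad ::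
    "'c set \<Rightarrow> ('c, 'k::field) coproduct \<Rightarrow> ('k, (nat, 'c) gtree \<Rightarrow>\<^sub>0 'k) operad" where
  "greg_operad B \<Delta> =
     \<lparr>sp = (\<lambda>m. linear_space {p. Poly_Mapping.keys p \<subseteq> greg_trees B {1..m}} 0 (+) lscale),
      act = (\<lambda>m p \<sigma>. lin (\<lambda>t. basis (relabel (Hilbert_Choice.inv \<sigma>) t)) p),
      pcomp = (\<lambda>m n i p q.
        lin (\<lambda>T. lin (\<lambda>S.
          insert_tree \<Delta> i (relabel (\<lambda>k. i - 1 + k) S) (relabel ((shift i n)(i := i)) T)) q) p),
      ident = basis (White 1 {#})\<rparr>"

definition delta_max :: "nat \<Rightarrow> (nat, 'k::field) coproduct" where
  "delta_max n k = (\<Sum>(i, j) | i \<in> {1..n} \<and> j \<in> {1..n} \<and> max i j = k. basis (i, j))"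


lemma coassoc_cocomm_zero: "finite B \<Longrightarrow> coassoc_cocomm B (\<lambda>_. 0)"
  by (simp add: coassoc_cocomm_def lin_def)

lemma lookup_lscale: "Poly_Mapping.lookup (lscale c q) x = c * Poly_Mapping.lookup q x"
  by (simp add: lscale_def Poly_Mapping.map.rep_eq when_def)

lemma lookup_lin:
  "Poly_Mapping.lookup (lin g p) x =
     (\<Sum>t\<in>Poly_Mapping.keys p. Poly_Mapping.lookup p t * Poly_Mapping.lookup (g t) x)"
  by (simp add: lin_def lookup_sum lookup_lscale)

lemma lookup_delta_max:
  "Poly_Mapping.lookup (delta_max n k) (i, j) =
     (if i \<in> {1..n} \<and> j \<in> {1..n} \<and> max i j = k then 1 else 0)"
proof -
  let ?A = "{(i, j). i \<in> {1..n} \<and> j \<in> {1..n} \<and> max i j = k}"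
  have fin: "finite ?A" by (rule finite_subset[of _ "{1..n} \<times> {1..n}"]) auto
  have "Poly_Mapping.lookup (delta_max n k) (i, j) = (\<Sum>p\<in>?A. if p = (i, j) then 1 else 0)"
    unfolding delta_max_def lookup_sum
    by (intro sum.cong) (auto simp: lookup_single when_def)
  also have "\<dots> = (if (i, j) \<in> ?A then 1 else 0)"
    using fin by (simp add: sum.delta')
  finally show ?thesis by simp
qed

lemma lookup_lin_delta_max:
  fixes g :: "nat \<times> nat \<Rightarrow> ('a \<Rightarrow>\<^sub>0 'k::field)"
  shows "Poly_Mapping.lookup (lin g (delta_max n b)) x
    = (\<Sum>p\<in>{1..n} \<times> {1..n}. if max (fst p) (snd p) = b then Poly_Mapping.lookup (g p) x else 0)"
proof -
  have keys: "Poly_Mapping.keys (delta_max n b :: _ \<Rightarrow>\<^sub>0 'k)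
      = {p \<in> {1..n} \<times> {1..n}. max (fst p) (snd p) = b}"
    by (auto simp: in_keys_iff lookup_delta_max split: if_splits)
  have "Poly_Mapping.lookup (lin g (delta_max n b)) x
      = (\<Sum>p | p \<in> {1..n} \<times> {1..n} \<and> max (fst p) (snd p) = b. Poly_Mapping.lookup (g p) x)"
    unfolding lookup_lin keys
    proof (rule sum.cong, simp)
    fix p assume "p \<in> {p \<in> {1..n} \<times> {1..n}. max (fst p) (snd p) = b}"
    then show "Poly_Mapping.lookup (delta_max n b) p * Poly_Mapping.lookup (g p) x = Poly_Mapping.lookup (g p) x"
      by (cases p) (auto simp: lookup_delta_max)
  qed
  also have "\<dots> = (\<Sum>p\<in>{1..n} \<times> {1..n}. if max (fst p) (snd p) = b then Poly_Mapping.lookup (g p) x else 0)"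
    by (rule sum.inter_filter) simp
  finally show ?thesis .
qed

lemma coassoc_cocomm_delta_max: "coassoc_cocomm {1..n} (delta_max n :: (nat, 'k::field) coproduct)"
proof -
  let ?D = "delta_max n :: (nat, 'k) coproduct"
  let ?L = "\<lambda>b. lin (\<lambda>(s, t). lin (\<lambda>(i, j). basis (i, j, t)) (?D s)) (?D b)"
  let ?R = "\<lambda>b. lin (\<lambda>(s, t). lin (\<lambda>(i, j). basis (s, i, j)) (?D t)) (?D b)"
  let ?N = "{1..n} \<times> {1..n}"
  have L1: "Poly_Mapping.lookup (lin (\<lambda>(i, j). basis (i, j, t)) (?D s)) (x, y, z)
      = (if (x, y) \<in> ?N \<and> t = z \<and> max x y = s then 1 else 0)" for s t x y z
  proof -
    have "Poly_Mapping.lookup (lin (\<lambda>(i, j). basis (i, j, t)) (?D s)) (x, y, z)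
      = (\<Sum>p\<in>?N. if p = (x, y) then (if t = z \<and> max x y = s then 1 else 0) else 0)"
      unfolding lookup_lin_delta_max by (rule sum.cong) (auto simp: lookup_single when_def split: if_splits)
    then show ?thesis by (simp add: sum.delta')
  qed
  have L: "Poly_Mapping.lookup (?L b) (x, y, z)
      = (if x \<in> {1..n} \<and> y \<in> {1..n} \<and> z \<in> {1..n} \<and> max x (max y z) = b then 1 else 0)" for b x y z
  proof -
    have "Poly_Mapping.lookup (?L b) (x, y, z)
      = (\<Sum>p\<in>?N. if p = (max x y, z) then
            (if x \<in> {1..n} \<and> y \<in> {1..n} \<and> max (max x y) z = b then 1 else 0) else 0)"
      unfolding lookup_lin_delta_max by (rule sum.cong) (auto simp: L1 split: if_splits)
    also have "\<dots> = (if x \<in> {1..n} \<and> y \<in> {1..n} \<and> z \<in> {1..n} \<and> max x (max y z) = b then 1 else 0)"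
      by (simp add: sum.delta' max.assoc) (simp add: max_def)
    finally show ?thesis .
  qed
  have R1: "Poly_Mapping.lookup (lin (\<lambda>(i, j). basis (s, i, j)) (?D t)) (x, y, z)
      = (if (y, z) \<in> ?N \<and> s = x \<and> max y z = t then 1 else 0)" for s t x y z
  proof -
    have "Poly_Mapping.lookup (lin (\<lambda>(i, j). basis (s, i, j)) (?D t)) (x, y, z)
      = (\<Sum>p\<in>?N. if p = (y, z) then (if s = x \<and> max y z = t then 1 else 0) else 0)"
      unfolding lookup_lin_delta_max by (rule sum.cong) (auto simp: lookup_single when_def split: if_splits)
    then show ?thesis by (simp add: sum.delta')
  qed
  have R: "Poly_Mapping.lookup (?R b) (x, y, z)
      = (if x \<in> {1..n} \<and> y \<in> {1..n} \<and> z \<in> {1..n} \<and> max x (max y z) = b then 1 else 0)" for b x y z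
  proof -
    have "Poly_Mapping.lookup (?R b) (x, y, z)
      = (\<Sum>p\<in>?N. if p = (x, max y z) then
            (if y \<in> {1..n} \<and> z \<in> {1..n} \<and> max x (max y z) = b then 1 else 0) else 0)"
      unfolding lookup_lin_delta_max by (rule sum.cong) (auto simp: R1 split: if_splits)
    also have "\<dots> = (if x \<in> {1..n} \<and> y \<in> {1..n} \<and> z \<in> {1..n} \<and> max x (max y z) = b then 1 else 0)"
      by (simp add: sum.delta') (simp add: max_def)
    finally show ?thesis .
  qed
  have "?L b = ?R b" for b
  proof (rule poly_mapping_eqI)
    fix k :: "nat \<times> nat \<times> nat"
    obtain x y z where k: "k = (x, y, z)" by (cases k)
    show "Poly_Mapping.lookup (?L b) k = Poly_Mapping.lookup (?R b) k"
      unfolding k L R ..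
  qed
  moreover have "Poly_Mapping.keys (?D b) \<subseteq> ?N" for b
    by (auto simp: in_keys_iff lookup_delta_max split: if_splits)
  moreover have "Poly_Mapping.lookup (?D b) (i, j) = Poly_Mapping.lookup (?D b) (j, i)" for b i j
    by (simp add: lookup_delta_max max.commute conj_ac)
  ultimately show ?thesis
    unfolding coassoc_cocomm_def by blast
qed


section \<open>Filtrations and associated graded operads\<close>

text \<open>
  \<open>F k m\<close> is the \<open>k\<close>-th step of the filtration in arity \<open>m\<close>.  Filtrations are decreasing: splitting
  a black vertex in the deformed fall product can only increase the number of black vertices.
\<close>

definition operad_filtration ::
    "('k::field, 'a) operad \<Rightarrow> (nat \<Rightarrow> nat \<Rightarrow> 'a set) \<Rightarrow> bool" where
  "operad_filtration P F \<longleftrightarrow>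
     (\<forall>m. F 0 m = els P m) \<and>
     (\<forall>k m. F (Suc k) m \<subseteq> F k m) \<and>
     (\<forall>k m. submodule (F k m) scalars (sp P m)) \<and>
     (\<forall>k m \<sigma>. \<sigma> permutes {1..m} \<longrightarrow> (\<forall>x\<in>F k m. act P m x \<sigma> \<in> F k m)) \<and>
     (\<forall>k l m n. \<forall>i\<in>{1..m}. \<forall>x\<in>F k m. \<forall>y\<in>F l n. pcomp P m n i x y \<in> F (k + l) (m + n - 1))"

text \<open>
  An element of arity \<open>m\<close> of the associated graded operad is a finitely supported sequence whose
  \<open>k\<close>-th entry is a coset of \<open>F (k + 1) m\<close> in \<open>F k m\<close>.
\<close>

definition gr_class ::
    "('k, 'a) operad \<Rightarrow> (nat \<Rightarrow> nat \<Rightarrow> 'a set) \<Rightarrow> nat \<Rightarrow> nat \<Rightarrow> 'a \<Rightarrow> 'a set" where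
  "gr_class P F k m x = F (Suc k) m +>\<^bsub>sp P m\<^esub> x"

definition gr_operad ::
    "('k::field, 'a) operad \<Rightarrow> (nat \<Rightarrow> nat \<Rightarrow> 'a set) \<Rightarrow> ('k, nat \<Rightarrow> 'a set) operad" where
  "gr_operad P F =
     \<lparr>sp = (\<lambda>m. linear_space
              {u. (\<forall>k. u k \<in> gr_class P F k m ` F k m) \<and> finite {k. u k \<noteq> F (Suc k) m}}
              (\<lambda>k. F (Suc k) m)
              (\<lambda>u v k. gr_class P F k m (rep (u k) \<oplus>\<^bsub>sp P m\<^esub> rep (v k)))
              (\<lambda>c u k. gr_class P F k m (c \<odot>\<^bsub>sp P m\<^esub> rep (u k)))),
      act = (\<lambda>m u \<sigma> k. gr_class P F k m (act P m (rep (u k)) \<sigma>)),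
      pcomp = (\<lambda>m n i u v k. gr_class P F k (m + n - 1)
        (\<Oplus>\<^bsub>sp P (m + n - 1)\<^esub>p\<in>{..k}. pcomp P m n i (rep (u p)) (rep (v (k - p))))),
      ident = (\<lambda>k. if k = 0 then gr_class P F 0 1 (ident P) else F (Suc k) 1)\<rparr>"

text \<open>
  The filtration by the number of black vertices, transported along an isomorphism \<open>\<Phi>\<close> from \<open>P\<close> to
  an operad of Greg trees.
\<close>

definition black_filtration ::
    "('k::field, 'a) operad \<Rightarrow> (nat \<Rightarrow> 'a \<Rightarrow> ((nat, 'c) gtree \<Rightarrow>\<^sub>0 'k)) \<Rightarrow> nat \<Rightarrow> nat \<Rightarrow> 'a set" where
  "black_filtration P \<Phi> k m =
     {x \<in> els P m. \<forall>t \<in> Poly_Mapping.keys (\<Phi> m x). k \<le> num_black t}"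

text \<open>The map \<open>\<Psi>\<close> out of an associated graded operad respects the gradings.\<close>

definition preserves_black_grading ::
    "('k::field, 'a) operad \<Rightarrow> (nat \<Rightarrow> nat \<Rightarrow> 'a set) \<Rightarrow>
     (nat \<Rightarrow> (nat \<Rightarrow> 'a set) \<Rightarrow> ((nat, 'c) gtree \<Rightarrow>\<^sub>0 'k)) \<Rightarrow> bool" where
  "preserves_black_grading P F \<Psi> \<longleftrightarrow>
     (\<forall>m k. \<forall>u \<in> els (gr_operad P F) m. (\<forall>l. l \<noteq> k \<longrightarrow> u l = F (Suc l) m) \<longrightarrow>
        (\<forall>t \<in> Poly_Mapping.keys (\<Psi> m u). num_black t = k))"

end

theory Submission
  imports Defs
begin

text \<open>
  Consider vector spaces with pre-Lie products \<open>x\<^sub>0, \<dots>, x\<^sub>n\<close> that have the same commutator: these are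
  the algebras over the fibered coproduct.  The differences \<open>g\<^sub>k = x\<^sub>k - x\<^sub>0\<close> are symmetric.  Put
  \<open>e\<^sub>k = g\<^sub>k - g\<^sub>k\<^sub>-\<^sub>1\<close>, so that \<open>g\<^sub>k = e\<^sub>1 + \<dots> + e\<^sub>k\<close>; in this basis the maximum coproduct is
  group-like, \<open>\<Delta> g\<^sub>k = g\<^sub>k \<otimes> g\<^sub>k\<close>.  A Greg tree can be evaluated in every such algebra, once its white
  vertices carry elements: a black vertex labelled \<open>g\<^sub>k\<close> with two children is \<open>g\<^sub>k\<close> applied to them,
  and vertices with more children are forced by the recursion
  \<open>x\<^sub>0(N(F), T) = N(F, T) + \<Sum>\<^sub>s N(F - s, x\<^sub>k(s, T))\<close>, where \<open>N\<close> is the node, \<open>F\<close> its children, and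
  \<open>k = 0\<close> if the node is white.  For a group-like label this is the deformed fall product:
  splitting the vertex puts \<open>g\<^sub>k(s, T)\<close> in the place of the child \<open>s\<close>, grafting in the child puts
  \<open>x\<^sub>0(s, T)\<close> there, and the two add up to \<open>x\<^sub>k(s, T)\<close>.  The recursion is symmetric in the children
  (\<open>tower_swap\<close>) because each product is pre-Lie and the commutators agree.

  Conversely the Greg trees, with \<open>x\<^sub>k(S, T)\<close> the fall product of \<open>S\<close> and \<open>T\<close> plus the tree with
  root \<open>g\<^sub>k\<close> and children \<open>S\<close>, \<open>T\<close>, form such an algebra (\<open>shared_bracket_gprod\<close>), evaluation is a
  homomorphism on it (\<open>hom_gprod\<close>), and every tree is its own value at the one-vertex trees
  (\<open>tree_eval_dot\<close>).  So the trees are the free algebra.  Inserting a tree at a white vertex is an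
  evaluation (\<open>insert_tree_eq_tree_eval\<close>), and therefore the axioms of an operad follow from the fact
  that evaluations compose (\<open>operad_gop\<close>).

  By its universal property the coproduct operad maps to the operad of Greg trees.  Its elements
  are combinations of iterated products of the \<open>x\<^sub>k\<close> with permuted inputs.  If such a combination
  vanishes on trees, evaluate in the algebra given by generators and relations: it lies in the
  ideal of relations (\<open>term_eval_kernel\<close>), and the relations hold in the coproduct operad
  (\<open>polynomial_op_relations\<close>).  The map is onto because every tree is built from one-vertex trees
  by the products (\<open>tree_generated\<close>).

  Splitting a black vertex adds one black vertex, and every other term of a fall product has as
  many black vertices as its two factors together.  The terms of lowest degree in a partial
  composition are thus those for the zero coproduct (\<open>leading_pcomp\<close>), and taking the lowest terms
  identifies the associated graded operad (\<open>operad_iso_\<Psi>\<close>).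
\<close>


section \<open>Linear maps on spaces with a basis\<close>

text \<open>
  For a vector space with scalar multiplication \<open>s\<close>: the linear map out of the space with basis \<open>'x\<close>
  that sends the basis vector \<open>t\<close> to \<open>g t\<close>.
\<close>

definition lext :: "('k::field \<Rightarrow> 'a::ab_group_add \<Rightarrow> 'a) \<Rightarrow> ('x \<Rightarrow> 'a) \<Rightarrow> ('x \<Rightarrow>\<^sub>0 'k) \<Rightarrow> 'a" where
  "lext s g p = (\<Sum>t\<in>Poly_Mapping.keys p. s (Poly_Mapping.lookup p t) (g t))"

abbreviation lmap :: "('k::field \<Rightarrow> 'a::ab_group_add \<Rightarrow> 'a) \<Rightarrow> ('k \<Rightarrow> 'b::ab_group_add \<Rightarrow> 'b) \<Rightarrow> ('a \<Rightarrow> 'b) \<Rightarrow> bool" where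
  "lmap \<equiv> Vector_Spaces.linear"

lemma lin_eq_lext: "lin g p = lext lscale g p"
  by (simp add: lin_def lext_def)

lemma vector_space_lscale: "vector_space (lscale :: 'k::field \<Rightarrow> _)"
  by unfold_locales (auto intro!: poly_mapping_eqI simp: lookup_lscale lookup_add algebra_simps)

lemma lmapI:
  assumes "vector_space s1" "vector_space s2" "\<And>a b. H (a + b) = H a + H b" "\<And>c a. H (s1 c a) = s2 c (H a)"
  shows "lmap s1 s2 H"
  using assms by (simp add: Vector_Spaces.linear_iff)

lemma
  assumes "lmap s1 s2 H"
  shows lmap_add: "H (a + b) = H a + H b"
    and lmap_scale: "H (s1 c a) = s2 c (H a)"
    and lmap_diff: "H (a - b) = H a - H b"
    and lmap_minus: "H (- a) = - H a"
    and lmap_zero: "H 0 = 0"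
    and lmap_sum: "H (\<Sum>x\<in>S. g x) = (\<Sum>x\<in>S. H (g x))"
proof -
  interpret Vector_Spaces.linear s1 s2 H by fact
  show "H (a + b) = H a + H b" "H (s1 c a) = s2 c (H a)" "H (a - b) = H a - H b" "H (- a) = - H a" "H 0 = 0"
    "H (\<Sum>x\<in>S. g x) = (\<Sum>x\<in>S. H (g x))"
    by (rule add scale diff neg zero sum)+
qed

lemma lmap_vs: "lmap s1 s2 H \<Longrightarrow> vector_space s1 \<and> vector_space s2"
  by (simp add: Vector_Spaces.linear_iff)

lemma lmap_sum_mset:
  assumes "lmap s1 s2 H" shows "H (\<Sum>x\<in>#M. g x) = (\<Sum>x\<in>#M. H (g x))"
  by (induction M) (simp_all add: lmap_add[OF assms] lmap_zero[OF assms])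

context vector_space
begin

lemma lext_superset:
  assumes "finite S" "Poly_Mapping.keys p \<subseteq> S"
  shows "lext scale g p = (\<Sum>t\<in>S. scale (Poly_Mapping.lookup p t) (g t))"
  unfolding lext_def
  by (rule sum.mono_neutral_left) (use assms in \<open>auto simp: in_keys_iff\<close>)

lemma lext_add: "lext scale g (p + q) = lext scale g p + lext scale g q"
proof -
  let ?S = "Poly_Mapping.keys p \<union> Poly_Mapping.keys q"
  have "Poly_Mapping.keys (p + q) \<subseteq> ?S" by (rule keys_add)
  then show ?thesis
    by (simp add: lext_superset[of ?S] lookup_add scale_left_distrib sum.distrib)
qed

lemma lext_lscale: "lext scale g (lscale c p) = scale c (lext scale g p)"
proof -
  have "Poly_Mapping.keys (lscale c p) \<subseteq> Poly_Mapping.keys p"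
    by (auto simp: in_keys_iff lookup_lscale)
  then show ?thesis
    by (simp add: lext_superset[of "Poly_Mapping.keys p"] lookup_lscale scale_sum_right)
qed

lemma lmap_lext: "lmap lscale scale (lext scale g)"
  by (rule lmapI) (simp_all add: vector_space_lscale vector_space_axioms lext_add lext_lscale)

lemma lext_basis [simp]: "lext scale g (basis t) = g t"
  by (simp add: lext_def)

lemma lext_zero [simp]: "lext scale g 0 = 0"
  by (simp add: lext_def)

lemma lext_compose: "lext scale g (lext lscale h p) = lext scale (\<lambda>t. lext scale g (h t)) p"
  unfolding lext_def[of lscale h] lext_def[of scale "\<lambda>t. lext scale g (h t)"]
  by (simp add: lmap_sum[OF lmap_lext] lext_lscale)

lemma lext_cong: "(\<And>t. t \<in> Poly_Mapping.keys p \<Longrightarrow> g t = h t) \<Longrightarrow> lext scale g p = lext scale h p"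
  by (simp add: lext_def)

lemma lext_pointwise_add: "lext scale (\<lambda>t. g t + h t) p = lext scale g p + lext scale h p"
  by (simp add: lext_def scale_right_distrib sum.distrib)

lemma lext_pointwise_diff: "lext scale (\<lambda>t. g t - h t) p = lext scale g p - lext scale h p"
  by (simp add: lext_def scale_right_diff_distrib sum_subtractf)

lemma lext_pointwise_scale: "lext scale (\<lambda>t. scale c (g t)) p = scale c (lext scale g p)"
  by (simp add: lext_def scale_sum_right mult.commute)

lemma lext_pointwise_sum: "lext scale (\<lambda>t. \<Sum>x\<in>S. g x t) p = (\<Sum>x\<in>S. lext scale (g x) p)"
  by (simp add: lext_def scale_sum_right) (rule sum.swap)

lemma lext_swap: "lext scale (\<lambda>s. lext scale (g s) q) p = lext scale (\<lambda>t. lext scale (\<lambda>s. g s t) p) q"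
  unfolding lext_def by (simp add: scale_sum_right mult.commute) (rule sum.swap)

lemma lmap_id [intro]: "lmap scale scale (\<lambda>a. a)"
  by (rule lmapI) (auto intro: vector_space_axioms)

end

lemma lmap_compose: "lmap s1 s2 g \<Longrightarrow> lmap s2 s3 h \<Longrightarrow> lmap s1 s3 (\<lambda>a. h (g a))"
  by (rule lmapI) (auto dest: lmap_vs simp: lmap_add lmap_scale)

lemma lmap_fun_diff:
  assumes "lmap s1 s2 g" "lmap s1 s2 h" shows "lmap s1 s2 (\<lambda>a. g a - h a)"
proof -
  interpret vector_space s2 using lmap_vs[OF assms(1)] by simp
  show ?thesis
    by (rule lmapI) (use lmap_vs[OF assms(1)] in
      \<open>auto simp: lmap_add[OF assms(1)] lmap_add[OF assms(2)] lmap_scale[OF assms(1)] lmap_scale[OF assms(2)]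
        scale_right_diff_distrib\<close>)
qed

lemma lmap_fun_add:
  assumes "lmap s1 s2 g" "lmap s1 s2 h" shows "lmap s1 s2 (\<lambda>a. g a + h a)"
proof -
  interpret vector_space s2 using lmap_vs[OF assms(1)] by simp
  show ?thesis
    by (rule lmapI) (use lmap_vs[OF assms(1)] in
      \<open>auto simp: lmap_add[OF assms(1)] lmap_add[OF assms(2)] lmap_scale[OF assms(1)] lmap_scale[OF assms(2)]
        scale_right_distrib\<close>)
qed

lemma lmap_fun_sum:
  assumes "vector_space s1" "vector_space s2" "\<And>x. x \<in> S \<Longrightarrow> lmap s1 s2 (g x)"
  shows "lmap s1 s2 (\<lambda>a. \<Sum>x\<in>S. g x a)"
proof -
  interpret vector_space s2 by fact
  show ?thesis
  proof (intro lmapI assms(1,2))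
    show "(\<Sum>x\<in>S. g x (a + b)) = (\<Sum>x\<in>S. g x a) + (\<Sum>x\<in>S. g x b)" for a b
      by (simp add: lmap_add[OF assms(3)] sum.distrib cong: sum.cong)
    show "(\<Sum>x\<in>S. g x (s1 c a)) = s2 c (\<Sum>x\<in>S. g x a)" for c a
      by (simp add: lmap_scale[OF assms(3)] scale_sum_right cong: sum.cong)
  qed
qed

lemma lmap_eq_lext:
  assumes "lmap lscale s H"
  shows "H p = lext s (\<lambda>t. H (basis t)) p"
proof -
  interpret vector_space s using lmap_vs[OF assms] by simp
  have "p = lext lscale basis p"
    by (rule poly_mapping_eqI)
       (auto simp: lext_def lookup_sum lookup_lscale lookup_single when_def in_keys_iff if_distrib sum.delta
          cong: if_cong)
  then have "H p = H (lext lscale basis p)" by simp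
  also have "\<dots> = lext s (\<lambda>t. H (basis t)) p"
    by (simp add: lext_def lmap_sum[OF assms] lmap_scale[OF assms])
  finally show ?thesis .
qed

lemma lext_lscale_basis [simp]: "lext lscale basis p = p"
  using lmap_eq_lext[OF vector_space.lmap_id[OF vector_space_lscale], of p] by simp

lemma sum_mset_nth: "(\<Sum>x\<in>#mset L. g x) = (\<Sum>i<length L. g (L ! i))"
proof -
  have "(\<Sum>x\<in>#mset L. g x) = sum_list (map g L)" by (metis mset_map sum_mset_sum_list)
  then show ?thesis by (simp add: sum_list_sum_nth atLeast0LessThan)
qed

section \<open>Pre-Lie products sharing a Lie bracket\<close>

text \<open>
  The products are indexed by all natural numbers, so that the same locale serves for every number
  of products; finitely many products are prolonged to a sequence by repeating the last one.
\<close>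

locale shared_bracket = vector_space scale
  for scale :: "'k::field \<Rightarrow> 'a::ab_group_add \<Rightarrow> 'a" +
  fixes pr :: "nat \<Rightarrow> 'a \<Rightarrow> 'a \<Rightarrow> 'a"
  assumes lmap_pr_left: "lmap scale scale (\<lambda>a. pr k a b)"
    and lmap_pr_right: "lmap scale scale (pr k a)"
    and prelie: "pr k (pr k a b) c - pr k a (pr k b c) = pr k (pr k a c) b - pr k a (pr k c b)"
    and bracket: "pr k a b - pr k b a = pr 0 a b - pr 0 b a"
begin

lemmas pr_simps =
  lmap_add[OF lmap_pr_left] lmap_add[OF lmap_pr_right] lmap_diff[OF lmap_pr_left] lmap_diff[OF lmap_pr_right]
  lmap_zero[OF lmap_pr_left] lmap_zero[OF lmap_pr_right] lmap_minus[OF lmap_pr_left] lmap_minus[OF lmap_pr_right]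
  lmap_sum[OF lmap_pr_left] lmap_sum[OF lmap_pr_right]

lemmas vs = vector_space_axioms

definition multilinear :: "('a list \<Rightarrow> 'a) \<Rightarrow> bool" where
  "multilinear f \<longleftrightarrow> (\<forall>L i. i < length L \<longrightarrow> lmap scale scale (\<lambda>a. f (L[i := a])))"

text \<open>
  The operator by which \<open>h\<close> acts on functions of several arguments as a derivation, on one argument
  at a time.
\<close>

definition deriv :: "('a \<Rightarrow> 'a) \<Rightarrow> ('a list \<Rightarrow> 'a) \<Rightarrow> 'a list \<Rightarrow> 'a" where
  "deriv h f L = (\<Sum>i<length L. f (L[i := h (L ! i)]))"

lemma multilinear_diff:
  assumes "multilinear f" "i < length L"
  shows "f (L[i := a - b]) = f (L[i := a]) - f (L[i := b])"
  by (rule lmap_diff) (use assms in \<open>auto simp: multilinear_def\<close>)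

lemma deriv_diff:
  assumes "multilinear f"
  shows "deriv (\<lambda>s. h s - g s) f L = deriv h f L - deriv g f L"
  unfolding deriv_def sum_subtractf[symmetric]
  by (rule sum.cong) (simp_all add: multilinear_diff[OF assms])

text \<open>
  The terms in which \<open>g\<close> and \<open>h\<close> act on different arguments occur in both orders and cancel.
\<close>

lemma deriv_commutator:
  assumes f: "multilinear f"
  shows "deriv g (deriv h f) L - deriv h (deriv g f) L = deriv (\<lambda>s. h (g s) - g (h s)) f L"
proof -
  let ?n = "length L"
  have split: "deriv g (deriv h f) L = (\<Sum>j<?n. f (L[j := h (g (L ! j))]))
      + (\<Sum>j<?n. \<Sum>i\<in>{..<?n} - {j}. f (L[j := g (L ! j), i := h (L ! i)]))" for g h
  proof -
    have "(\<Sum>i<?n. f (L[j := g (L ! j), i := h (L[j := g (L ! j)] ! i)]))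
      = f (L[j := h (g (L ! j))]) + (\<Sum>i\<in>{..<?n} - {j}. f (L[j := g (L ! j), i := h (L ! i)]))"
      if "j < ?n" for j
    proof -
      have "(\<Sum>i<?n. f (L[j := g (L ! j), i := h (L[j := g (L ! j)] ! i)]))
        = f (L[j := g (L ! j), j := h (L[j := g (L ! j)] ! j)])
          + (\<Sum>i\<in>{..<?n} - {j}. f (L[j := g (L ! j), i := h (L[j := g (L ! j)] ! i)]))"
        using that by (intro sum.remove) auto
      then show ?thesis using that by (simp cong: sum.cong) (intro sum.cong, auto)
    qed
    then show ?thesis by (simp add: deriv_def sum.distrib)
  qed
  have "(\<Sum>j<?n. \<Sum>i\<in>{..<?n} - {j}. f (L[j := g (L ! j), i := h (L ! i)]))
      = (\<Sum>j<?n. \<Sum>i\<in>{i \<in> {..<?n}. i \<noteq> j}. f (L[j := g (L ! j), i := h (L ! i)]))"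
    by (intro sum.cong) auto
  also have "\<dots> = (\<Sum>i<?n. \<Sum>j\<in>{j \<in> {..<?n}. i \<noteq> j}. f (L[j := g (L ! j), i := h (L ! i)]))"
    by (rule sum.swap_restrict) auto
  also have "\<dots> = (\<Sum>i<?n. \<Sum>j\<in>{..<?n} - {i}. f (L[i := h (L ! i), j := g (L ! j)]))"
    by (intro sum.cong) (auto simp: list_update_swap)
  finally show ?thesis
    unfolding split deriv_diff[OF f] by (simp add: deriv_def)
qed

text \<open>
  Grafting \<open>a\<close> on a tree whose root has children \<open>L\<close> gives the tree with one more child \<open>a\<close> and the
  trees in which \<open>a\<close> is grafted in a child.  Solved for the tree with one more child, this is a
  recursion on the number of children; \<open>b\<close> gives the values for at most \<open>N\<close> children, and \<open>k\<close> is the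
  product by which \<open>a\<close> acts on the children.
\<close>

function tower :: "nat \<Rightarrow> nat \<Rightarrow> ('a list \<Rightarrow> 'a) \<Rightarrow> 'a list \<Rightarrow> 'a" where
  "tower k N b L =
     (if length L \<le> N then b L
      else pr 0 (tower k N b (butlast L)) (last L)
        - (\<Sum>i<length L - 1. tower k N b ((butlast L)[i := pr k (L ! i) (last L)])))"
  by pat_completeness auto
termination
  by (relation "measure (\<lambda>(_, _, _, L). length L)") auto

declare tower.simps [simp del]

lemma tower_base: "length L \<le> N \<Longrightarrow> tower k N b L = b L"
  by (simp add: tower.simps)

lemma tower_snoc:
  assumes "N \<le> length L"
  shows "tower k N b (L @ [a]) = pr 0 (tower k N b L) a - deriv (\<lambda>s. pr k s a) (tower k N b) L"
  using assms by (subst tower.simps) (auto simp: deriv_def nth_append intro!: sum.cong)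

lemma tower_multilinear:
  assumes b: "\<And>L i. length L \<le> N \<Longrightarrow> i < length L \<Longrightarrow> lmap scale scale (\<lambda>a. b (L[i := a]))"
  shows "multilinear (tower k N b)"
proof -
  let ?f = "tower k N b"
  have "\<forall>i<length L. lmap scale scale (\<lambda>a. ?f (L[i := a]))" for L
  proof (induction "length L" arbitrary: L)
    case (Suc n)
    show ?case
    proof (cases "length L \<le> N")
      case True
      then show ?thesis using b by (simp add: tower_base)
    next
      case False
      then obtain L' x where L: "L = L' @ [x]" by (cases L rule: rev_cases) auto
      have N: "N \<le> length L'" using False L by simp
      have IH: "lmap scale scale (\<lambda>a. ?f (M[i := a]))" if "length M = length L'" "i < length L'" for M i
        using Suc(1)[of M] Suc(2) that L by simp
      show ?thesis
      proof (intro allI impI)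
        fix i assume i: "i < length L"
        show "lmap scale scale (\<lambda>a. ?f (L[i := a]))"
        proof (cases "i = length L'")
          case True
          have "?f (L[i := a]) = pr 0 (?f L') a - (\<Sum>j<length L'. ?f (L'[j := pr k (L' ! j) a]))" for a
            using tower_snoc[OF N] True L by (simp add: deriv_def)
          then show ?thesis
            by simp (intro lmap_fun_diff lmap_fun_sum vs lmap_pr_right lmap_compose[OF lmap_pr_right IH], auto)
        next
          case False
          with i L have i': "i < length L'" by simp
          have eq: "?f (L[i := a]) = pr 0 (?f (L'[i := a])) x
              - (\<Sum>j<length L'. if j = i then ?f (L'[i := pr k a x]) else ?f (L'[j := pr k (L' ! j) x, i := a]))" for a
          proof -
            have "?f (L[i := a]) = ?f (L'[i := a] @ [x])" using i' L by (simp add: list_update_append)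
            also have "\<dots> = pr 0 (?f (L'[i := a])) x
                - (\<Sum>j<length L'. ?f (L'[i := a, j := pr k (L'[i := a] ! j) x]))"
              using N by (subst tower_snoc) (simp_all add: deriv_def)
            also have "(\<Sum>j<length L'. ?f (L'[i := a, j := pr k (L'[i := a] ! j) x]))
               = (\<Sum>j<length L'. if j = i then ?f (L'[i := pr k a x]) else ?f (L'[j := pr k (L' ! j) x, i := a]))"
              by (intro sum.cong) (auto simp: list_update_swap)
            finally show ?thesis .
          qed
          have summand: "lmap scale scale (\<lambda>a. if j = i then ?f (L'[i := pr k a x]) else ?f (L'[j := pr k (L' ! j) x, i := a]))" for j
            using i' by (cases "j = i") (auto intro: lmap_compose[OF lmap_pr_left IH] IH)
          show ?thesis
            unfolding eq
            by (intro lmap_fun_diff lmap_fun_sum vs lmap_compose[OF IH lmap_pr_left] summand) (use i' in auto)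
        qed
      qed
    qed
  qed simp
  then show ?thesis by (simp add: multilinear_def)
qed

text \<open>
  Exchanging the last two arguments \<open>x\<close> and \<open>y\<close> changes the second-order part by the commutator of
  the derivations \<open>s \<mapsto> pr k s x\<close> and \<open>s \<mapsto> pr k s y\<close>, which by the pre-Lie identity is the
  derivation given by right multiplication with a \<open>k\<close>-commutator of \<open>x\<close> and \<open>y\<close>.  It cancels against
  the change in the terms that contain \<open>pr k x y\<close> as one argument.  What remains is the pre-Lie
  identity of \<open>pr 0\<close> at the root, in which the two commutators may be identified.
\<close>

lemma tower_swap:
  assumes f: "multilinear (tower k N b)" and N: "N \<le> length L"
  shows "tower k N b (L @ [x, y]) = tower k N b (L @ [y, x])"
proof -
  let ?f = "tower k N b"
  let ?D = "\<lambda>a. deriv (\<lambda>s. pr k s a)"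
  have expand: "?f (L @ [x, y]) = pr 0 (pr 0 (?f L) x) y - pr 0 (?f L) (pr k x y)
      - pr 0 (?D x ?f L) y - pr 0 (?D y ?f L) x + ?D y (?D x ?f) L + ?D (pr k x y) ?f L" for x y
  proof -
    have "?f (L @ [x, y]) = ?f ((L @ [x]) @ [y])" by simp
    also have "\<dots> = pr 0 (?f (L @ [x])) y - ?D y ?f (L @ [x])"
      using N by (intro tower_snoc) simp
    also have "?D y ?f (L @ [x]) = (\<Sum>i<length L. ?f (L[i := pr k (L ! i) y] @ [x])) + ?f (L @ [pr k x y])"
      by (simp add: deriv_def nth_append list_update_append)
    also have "(\<Sum>i<length L. ?f (L[i := pr k (L ! i) y] @ [x])) = pr 0 (?D y ?f L) x - ?D y (?D x ?f) L"
      using N by (simp add: tower_snoc deriv_def[of "\<lambda>s. pr k s y"] sum_subtractf pr_simps)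
    also have "?f (L @ [pr k x y]) = pr 0 (?f L) (pr k x y) - ?D (pr k x y) ?f L"
      using N by (rule tower_snoc)
    also have "?f (L @ [x]) = pr 0 (?f L) x - ?D x ?f L"
      using N by (rule tower_snoc)
    finally show ?thesis by (simp add: pr_simps)
  qed
  have D_diff: "?D a ?f L - ?D b ?f L = ?D (a - b) ?f L" for a b
    using deriv_diff[OF f, of "\<lambda>s. pr k s a" "\<lambda>s. pr k s b" L] by (simp add: pr_simps)
  have "?D y (?D x ?f) L - ?D x (?D y ?f) L = deriv (\<lambda>s. pr k (pr k s y) x - pr k (pr k s x) y) ?f L"
    by (rule deriv_commutator[OF f])
  also have "(\<lambda>s. pr k (pr k s y) x - pr k (pr k s x) y) = (\<lambda>s. pr k s (pr k y x - pr k x y))"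
    using prelie[of k _ x y] by (auto simp: fun_eq_iff pr_simps algebra_simps)
  finally have "?D y (?D x ?f) L - ?D x (?D y ?f) L = ?D (pr k y x) ?f L - ?D (pr k x y) ?f L"
    by (simp add: D_diff)
  moreover have "pr 0 (pr 0 (?f L) x) y - pr 0 (?f L) (pr k x y) = pr 0 (pr 0 (?f L) y) x - pr 0 (?f L) (pr k y x)"
  proof -
    have "pr 0 (?f L) (pr k x y) - pr 0 (?f L) (pr k y x) = pr 0 (?f L) (pr 0 x y) - pr 0 (?f L) (pr 0 y x)"
      unfolding lmap_diff[OF lmap_pr_right, symmetric] bracket[of k x y] ..
    moreover have "pr 0 (pr 0 (?f L) x) y - pr 0 (pr 0 (?f L) y) x = pr 0 (?f L) (pr 0 x y) - pr 0 (?f L) (pr 0 y x)"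
      using prelie[of 0 "?f L" x y] by (simp add: algebra_simps)
    ultimately have "pr 0 (pr 0 (?f L) x) y - pr 0 (pr 0 (?f L) y) x = pr 0 (?f L) (pr k x y) - pr 0 (?f L) (pr k y x)"
      by simp
    then show ?thesis by (simp add: algebra_simps)
  qed
  ultimately show ?thesis unfolding expand[of x y] expand[of y x] by (simp add: algebra_simps)
qed

text \<open>
  A permutation is composed of permutations fixing the last argument and of the exchange of the last
  two.  For the former, the derivation in the recursion is a sum over the multiset of arguments.
\<close>

lemma tower_perm:
  assumes f: "multilinear (tower k N b)"
    and base: "\<And>L L'. length L \<le> Suc N \<Longrightarrow> mset L = mset L' \<Longrightarrow> tower k N b L = tower k N b L'"
    and "mset L = mset L'"
  shows "tower k N b L = tower k N b L'"
  using assms(3)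
proof (induction "length L" arbitrary: L L' rule: less_induct)
  case less
  let ?f = "tower k N b"
  show ?case
  proof (cases "length L \<le> Suc N")
    case True
    then show ?thesis using base less.prems by blast
  next
    case False
    have len: "length L' = length L" using less.prems by (metis size_mset)
    obtain M x where L: "L = M @ [x]" using False by (cases L rule: rev_cases) auto
    obtain M' y where L': "L' = M' @ [y]" using False len by (cases L' rule: rev_cases) auto
    have NM: "N < length M" "N < length M'" using False L L' len by auto
    have same_last: "?f (K @ [z]) = ?f (K' @ [z])"
      if K: "mset K = mset K'" "length K = length M" for K K' z
    proof -
      have lK: "length K' = length K" using K by (metis size_mset)
      have IH: "?f U = ?f U'" if "mset U = mset U'" "length U = length M" for U U'
        using less.hyps[of U U'] that L by simp
      have der: "deriv h ?f U = (\<Sum>s\<in>#mset U. ?f (SOME V. mset V = add_mset (h s) (mset U - {#s#})))"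
        if U: "length U = length M" for U h
      proof -
        have "?f (U[i := h (U ! i)]) = ?f (SOME V. mset V = add_mset (h (U ! i)) (mset U - {#U ! i#}))"
          if i: "i < length U" for i
        proof (rule IH)
          have "mset (U[i := h (U ! i)]) = add_mset (h (U ! i)) (mset U - {#U ! i#})"
            using i by (rule mset_update)
          then show "mset (U[i := h (U ! i)])
              = mset (SOME V. mset V = add_mset (h (U ! i)) (mset U - {#U ! i#}))"
            by (metis (mono_tags, lifting) someI)
        qed (use U in simp)
        then show ?thesis unfolding sum_mset_nth by (simp add: deriv_def)
      qed
      have "?f K = ?f K'" using IH K by blast
      moreover have "deriv h ?f K = deriv h ?f K'" for h
        using der[of K h] der[of K' h] K lK by simp
      ultimately show ?thesis using K lK NM by (simp add: tower_snoc)
    qed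
    show ?thesis
    proof (cases "x = y")
      case True
      then show ?thesis using same_last[of M M' x] less.prems L L' by simp
    next
      case neq: False
      \<comment> \<open>Both lists can be rearranged so that they end in the two letters, in opposite orders.\<close>
      have eq: "add_mset x (mset M) = add_mset y (mset M')" using less.prems L L' by simp
      obtain W where W: "mset M = add_mset y W" "mset M' = add_mset x W"
        using eq neq by (metis add_eq_conv_ex)
      obtain K where K: "mset K = W" using ex_mset by blast
      have lK: "Suc (length K) = length M" using W(1) K by (metis size_add_mset size_mset)
      have "?f L = ?f ((K @ [y]) @ [x])" unfolding L by (rule same_last[symmetric]) (use W K lK in auto)
      also have "\<dots> = ?f (K @ [y, x])" by simp
      also have "\<dots> = ?f (K @ [x, y])" by (rule tower_swap[OF f]) (use lK NM in simp)
      also have "\<dots> = ?f ((K @ [x]) @ [y])" by simp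
      also have "\<dots> = ?f L'" unfolding L' by (rule same_last) (use W K lK in auto)
      finally show ?thesis .
    qed
  qed
qed

text \<open>
  The symmetric brace of the pre-Lie product \<open>pr 0\<close>; by \<open>tower_perm\<close> the choice of the list is
  immaterial.
\<close>

definition white_brace :: "'a \<Rightarrow> 'a multiset \<Rightarrow> 'a" where
  "white_brace z M = tower 0 0 (\<lambda>_. z) (SOME L. mset L = M)"

text \<open>
  The value of a black vertex with label \<open>e\<^sub>1 + \<dots> + e\<^sub>k\<close> and children \<open>M\<close>.  The value \<open>- a\<close> at a single
  child is a fictitious start: with it the recursion gives \<open>pr k a b - pr 0 a b\<close> for two children.
\<close>

definition black_brace :: "nat \<Rightarrow> 'a multiset \<Rightarrow> 'a" where
  "black_brace k M = tower k 1 (\<lambda>L. - sum_list L) (SOME L. mset L = M)"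

lemma multilinear_w: "multilinear (tower 0 0 (\<lambda>_. z))"
  by (rule tower_multilinear) simp

lemma multilinear_b: "multilinear (tower k 1 (\<lambda>L. - sum_list L))"
proof (rule tower_multilinear)
  fix L :: "'a list" and i
  assume "length L \<le> 1" "i < length L"
  then obtain x where "L = [x]" "i = 0" by (cases L) auto
  then show "lmap scale scale (\<lambda>a. - sum_list (L[i := a]))"
    by (intro lmapI vs) auto
qed

lemma pr_diff_commute: "pr k a b - pr 0 a b = pr k b a - pr 0 b a"
  using bracket[of k a b] by (simp add: algebra_simps)

lemma tower_b_pair: "tower k 1 (\<lambda>L. - sum_list L) [a, b] = pr k a b - pr 0 a b"
  using tower_snoc[of 1 "[a]" k "\<lambda>L. - sum_list L" b] by (simp add: deriv_def tower_base pr_simps)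

lemma white_brace_mset: "white_brace z (mset L) = tower 0 0 (\<lambda>_. z) L"
  unfolding white_brace_def
proof (rule tower_perm[OF multilinear_w])
  fix L L' :: "'a list"
  assume "length L \<le> Suc 0" and eq: "mset L = mset L'"
  then have "L = L'" by (cases L) auto
  then show "tower 0 0 (\<lambda>_. z) L = tower 0 0 (\<lambda>_. z) L'" by simp
qed (metis (mono_tags, lifting) someI)

lemma black_brace_mset: "black_brace k (mset L) = tower k 1 (\<lambda>L. - sum_list L) L"
  unfolding black_brace_def
proof (rule tower_perm[OF multilinear_b])
  fix L L' :: "'a list"
  assume len: "length L \<le> Suc 1" and eq: "mset L = mset L'"
  have len': "length L' = length L" using eq by (metis size_mset)
  consider "length L \<le> 1" | "length L = 2" using len by linarith
  then show "tower k 1 (\<lambda>L. - sum_list L) L = tower k 1 (\<lambda>L. - sum_list L) L'"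
  proof cases
    case 1
    then have "L = L'" using eq by (cases L) auto
    then show ?thesis by simp
  next
    case 2
    then obtain a b where L: "L = [a, b]" by (auto simp: length_Suc_conv numeral_2_eq_2)
    obtain c d where L': "L' = [c, d]" using 2 len' by (auto simp: length_Suc_conv numeral_2_eq_2)
    show ?thesis using eq pr_diff_commute[of k a b] unfolding L L' tower_b_pair
      by (auto simp: add_eq_conv_ex)
  qed
qed (metis (mono_tags, lifting) someI)

lemma white_brace_empty [simp]: "white_brace z {#} = z"
  using white_brace_mset[of z "[]"] by (simp add: tower_base)

lemma black_brace_pair: "black_brace k {#a, b#} = pr k a b - pr 0 a b"
  using black_brace_mset[of k "[b, a]"] tower_b_pair[of k b a] pr_diff_commute[of k a b]
  by (simp add: add_mset_commute[of a b])

lemma lmap_white_brace: "lmap scale scale (\<lambda>a. white_brace z (add_mset a M))"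
proof -
  obtain L where L: "mset L = M" using ex_mset by blast
  \<comment> \<open>The head of the list is a placeholder for the argument.\<close>
  have "white_brace z (add_mset a M) = tower 0 0 (\<lambda>_. z) ((undefined # L)[0 := a])" for a
    using white_brace_mset[of z "a # L"] L by simp
  moreover have "lmap scale scale (\<lambda>a. tower 0 0 (\<lambda>_. z) ((undefined # L)[0 := a]))"
    using multilinear_w[of z] unfolding multilinear_def by (metis length_greater_0_conv list.distinct(1))
  ultimately show ?thesis by simp
qed

lemma lmap_black_brace: "lmap scale scale (\<lambda>a. black_brace k (add_mset a M))"
proof -
  obtain L where L: "mset L = M" using ex_mset by blast
  \<comment> \<open>The head of the list is a placeholder for the argument.\<close>
  have "black_brace k (add_mset a M) = tower k 1 (\<lambda>L. - sum_list L) ((undefined # L)[0 := a])" for a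
    using black_brace_mset[of k "a # L"] L by simp
  moreover have "lmap scale scale (\<lambda>a. tower k 1 (\<lambda>L. - sum_list L) ((undefined # L)[0 := a]))"
    using multilinear_b[of k] unfolding multilinear_def by (metis length_greater_0_conv list.distinct(1))
  ultimately show ?thesis by simp
qed

lemma deriv_mset:
  assumes "\<And>L. F (mset L) = f L"
  shows "deriv h f L = (\<Sum>s\<in>#mset L. F (add_mset (h s) (mset L - {#s#})))"
  unfolding sum_mset_nth deriv_def by (intro sum.cong) (auto simp: assms[symmetric] mset_update)

lemma white_brace_add: "white_brace z (add_mset a M) = pr 0 (white_brace z M) a - (\<Sum>s\<in>#M. white_brace z (add_mset (pr 0 s a) (M - {#s#})))"
proof -
  obtain L where L: "mset L = M" using ex_mset by blast
  then show ?thesis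
    using white_brace_mset[of z "L @ [a]"] tower_snoc[of 0 L 0 "\<lambda>_. z" a] deriv_mset[of "white_brace z" "tower 0 0 (\<lambda>_. z)" "\<lambda>s. pr 0 s a" L, OF white_brace_mset]
    by (simp add: white_brace_mset[symmetric])
qed

lemma black_brace_add:
  assumes "M \<noteq> {#}"
  shows "black_brace k (add_mset a M) = pr 0 (black_brace k M) a - (\<Sum>s\<in>#M. black_brace k (add_mset (pr k s a) (M - {#s#})))"
proof -
  obtain L where L: "mset L = M" using ex_mset by blast
  then have "1 \<le> length L" using assms by (cases L) auto
  then show ?thesis
    using L black_brace_mset[of k L] black_brace_mset[of k "L @ [a]"] tower_snoc[of 1 L k "\<lambda>L. - sum_list L" a] deriv_mset[of "black_brace k" "tower k 1 (\<lambda>L. - sum_list L)" "\<lambda>s. pr k s a" L, OF black_brace_mset]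
    by simp
qed

text \<open>
  The label \<open>e\<^sub>1 + \<dots> + e\<^sub>k\<close> vanishes for \<open>k = 0\<close>.
\<close>

lemma black_brace_0: "2 \<le> size M \<Longrightarrow> black_brace 0 M = 0"
proof (induction "size M" arbitrary: M rule: less_induct)
  case less
  then obtain a M' where M: "M = add_mset a M'" by (cases M) auto
  show ?case
  proof (cases "size M' = 1")
    case True
    then obtain b where "M' = {#b#}" by (metis size_1_singleton_mset)
    then show ?thesis using M by (simp add: black_brace_pair)
  next
    case False
    with less.prems M have sz: "2 \<le> size M'" by simp
    then have "M' \<noteq> {#}" by auto
    have "black_brace 0 (add_mset (pr 0 s a) (M' - {#s#})) = 0" if "s \<in># M'" for s
      by (rule less.hyps) (use that sz M in \<open>auto simp: size_Suc_Diff1\<close>)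
    then have "(\<Sum>s\<in>#M'. black_brace 0 (add_mset (pr 0 s a) (M' - {#s#}))) = 0"
      by (simp cong: image_mset_cong)
    then show ?thesis using black_brace_add[OF \<open>M' \<noteq> {#}\<close>, of 0 a] less.hyps[of M'] sz M by (simp add: pr_simps)
  qed
qed

end


lemma sum_list_add_update:
  fixes ms :: "'m::comm_monoid_add list"
  shows "i < length ms \<Longrightarrow> sum_list (ms[i := ms ! i + m]) = sum_list ms + m"
  by (induction ms arbitrary: i) (auto split: nat.split simp: add_ac)

lemma lmap_basis_eqI:
  assumes "lmap lscale s f" "lmap lscale s g" "\<And>t. f (basis t) = g (basis t)"
  shows "f p = g p"
  using lmap_eq_lext[OF assms(1), of p] lmap_eq_lext[OF assms(2), of p] assms(3) by simp

lemma sum_mset_subtractf: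
  fixes f g :: "'b \<Rightarrow> 'a::ab_group_add"
  shows "(\<Sum>s\<in>#F. f s - g s) = (\<Sum>s\<in>#F. f s) - (\<Sum>s\<in>#F. g s)"
  by (induction F) auto

lemma sum_mset_diff_swap:
  fixes h :: "'b \<Rightarrow> 'b \<Rightarrow> 'a::ab_group_add"
  shows "(\<Sum>s\<in>#F. \<Sum>r\<in>#F - {#s#}. h s r) = (\<Sum>s\<in>#F. \<Sum>r\<in>#F - {#s#}. h r s)"
proof -
  have eq: "(\<Sum>s\<in>#F. \<Sum>r\<in>#F - {#s#}. h s r) = (\<Sum>s\<in>#F. \<Sum>r\<in>#F. h s r) - (\<Sum>s\<in>#F. h s s)" for h :: "'b \<Rightarrow> 'b \<Rightarrow> 'a"
  proof -
    have "(\<Sum>r\<in>#F - {#s#}. h s r) = (\<Sum>r\<in>#F. h s r) - h s s" if "s \<in># F" for s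
      using that by (auto dest!: multi_member_split)
    then have "(\<Sum>s\<in>#F. \<Sum>r\<in>#F - {#s#}. h s r) = (\<Sum>s\<in>#F. (\<Sum>r\<in>#F. h s r) - h s s)"
      by (simp cong: image_mset_cong)
    also have "\<dots> = (\<Sum>s\<in>#F. \<Sum>r\<in>#F. h s r) - (\<Sum>s\<in>#F. h s s)"
      by (rule sum_mset_subtractf)
    finally show ?thesis .
  qed
  show ?thesis unfolding eq[of h] eq[of "\<lambda>s r. h r s"] using sum_mset.swap[of h F F] by simp
qed

context shared_bracket
begin

text \<open>
  Degrees lie in an arbitrary commutative monoid: multisets of labels are the degrees for the
  algebra of trees, and a constant family \<open>gr\<close> gives closure under \<open>tower\<close>.
\<close>

lemma tower_graded:
  fixes gr :: "'m::comm_monoid_add \<Rightarrow> 'a set"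
  assumes diff: "\<And>m a b. a \<in> gr m \<Longrightarrow> b \<in> gr m \<Longrightarrow> a - b \<in> gr m"
    and pr: "\<And>l m m' a b. a \<in> gr m \<Longrightarrow> b \<in> gr m' \<Longrightarrow> pr l a b \<in> gr (m + m')"
    and base: "\<And>L ms. length L \<le> N \<Longrightarrow> list_all2 (\<lambda>a m. a \<in> gr m) L ms \<Longrightarrow> b L \<in> gr (m0 + sum_list ms)"
    and "list_all2 (\<lambda>a m. a \<in> gr m) L ms"
  shows "tower k N b L \<in> gr (m0 + sum_list ms)"
  using assms(4)
proof (induction "length L" arbitrary: L ms rule: less_induct)
  case less
  show ?case
  proof (cases "length L \<le> N")
    case True
    then show ?thesis using base less.prems by (simp add: tower_base)
  next
    case False
    then obtain L' x where L: "L = L' @ [x]" by (cases L rule: rev_cases) auto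
    then obtain ms' m where ms: "ms = ms' @ [m]" "list_all2 (\<lambda>a m. a \<in> gr m) L' ms'" "x \<in> gr m"
      using less.prems by (auto simp: list_all2_append1 list_all2_Cons1)
    have len: "length ms' = length L'" using list_all2_lengthD[OF ms(2)] by simp
    have eq: "m0 + sum_list ms = m0 + sum_list ms' + m" by (simp add: ms add.assoc)
    have 1: "pr 0 (tower k N b L') x \<in> gr (m0 + sum_list ms)"
      unfolding eq using less.hyps[OF _ ms(2)] L ms(3) by (intro pr) auto
    have 2: "tower k N b (L'[i := pr k (L' ! i) x]) \<in> gr (m0 + sum_list ms)" if "i < length L'" for i
    proof -
      have "list_all2 (\<lambda>a m. a \<in> gr m) (L'[i := pr k (L' ! i) x]) (ms'[i := ms' ! i + m])"
        using ms(2,3) that by (intro list_all2_update_cong) (auto simp: list_all2_conv_all_nth intro: pr)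
      then have "tower k N b (L'[i := pr k (L' ! i) x]) \<in> gr (m0 + sum_list (ms'[i := ms' ! i + m]))"
        using L by (intro less.hyps) auto
      then show ?thesis using that len by (simp add: sum_list_add_update eq add.assoc)
    qed
    have zero: "0 \<in> gr m" if "a \<in> gr m" for a m using diff[OF that that] by simp
    have plus: "a + b \<in> gr m" if "a \<in> gr m" "b \<in> gr m" for a b m
      using diff[OF that(1) diff[OF zero[OF that(2)] that(2)]] by simp
    have "deriv (\<lambda>s. pr k s x) (tower k N b) L' \<in> gr (m0 + sum_list ms)"
    proof -
      have "(\<Sum>i\<in>S. tower k N b (L'[i := pr k (L' ! i) x])) \<in> gr (m0 + sum_list ms)" if "finite S" "S \<subseteq> {..<length L'}" for S
        using that by (induction S) (auto intro: plus 2 zero[OF 1])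
      then show ?thesis by (simp add: deriv_def)
    qed
    then show ?thesis using diff[OF 1] False L by (simp add: tower_snoc)
  qed
qed

lemma tower_closed:
  assumes "\<And>a b. a \<in> Y \<Longrightarrow> b \<in> Y \<Longrightarrow> a - b \<in> Y" "\<And>l a b. a \<in> Y \<Longrightarrow> b \<in> Y \<Longrightarrow> pr l a b \<in> Y"
    and "\<And>L. length L \<le> N \<Longrightarrow> set L \<subseteq> Y \<Longrightarrow> b L \<in> Y" and "set L \<subseteq> Y"
  shows "tower k N b L \<in> Y"
proof -
  have "list_all2 (\<lambda>a m. a \<in> Y) L (replicate (length L) (0::nat))"
    using assms(4) by (auto simp: list_all2_conv_all_nth)
  moreover have "set L' \<subseteq> Y" if "list_all2 (\<lambda>a m. a \<in> Y) L' ms" for L' and ms :: "nat list"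
    using that by (induction rule: list_all2_induct) auto
  ultimately have "tower k N b L \<in> (\<lambda>_. Y) (0 + sum_list (replicate (length L) (0::nat)))"
    by (intro tower_graded) (use assms(1-3) in \<open>simp_all\<close>)
  then show ?thesis by simp
qed

lemma tower_hom:
  assumes Y: "\<And>a b. a \<in> Y \<Longrightarrow> b \<in> Y \<Longrightarrow> a - b \<in> Y" "\<And>l a b. a \<in> Y \<Longrightarrow> b \<in> Y \<Longrightarrow> pr l a b \<in> Y"
    and bY: "\<And>L. length L \<le> N \<Longrightarrow> set L \<subseteq> Y \<Longrightarrow> b L \<in> Y"
    and H: "lmap scale scale H" "\<And>l a b. a \<in> Y \<Longrightarrow> b \<in> Y \<Longrightarrow> H (pr l a b) = pr l (H a) (H b)"
    and base: "\<And>L. length L \<le> N \<Longrightarrow> set L \<subseteq> Y \<Longrightarrow> H (b L) = b' (map H L)" and "set L \<subseteq> Y"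
  shows "H (tower k N b L) = tower k N b' (map H L)"
  using assms(7)
proof (induction "length L" arbitrary: L rule: less_induct)
  case less
  show ?case
  proof (cases "length L \<le> N")
    case True
    then show ?thesis using base less.prems by (simp add: tower_base)
  next
    case False
    then obtain L' x where L: "L = L' @ [x]" by (cases L rule: rev_cases) auto
    have L'Y: "set L' \<subseteq> Y" "x \<in> Y" using less.prems L by auto
    have N: "N \<le> length L'" using False L by simp
    have tX: "tower k N b L' \<in> Y" by (rule tower_closed[OF Y bY L'Y(1)])
    have "H (tower k N b (L'[i := pr k (L' ! i) x])) = tower k N b' ((map H L')[i := pr k (map H L' ! i) (H x)])"
      if i: "i < length L'" for i
    proof -
      have mem: "L' ! i \<in> Y" using i L'Y by auto
      have "set (L'[i := pr k (L' ! i) x]) \<subseteq> Y"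
        using set_update_subset_insert[of L' i] Y(2)[OF mem L'Y(2), of k] L'Y by blast
      then have "H (tower k N b (L'[i := pr k (L' ! i) x])) = tower k N b' (map H (L'[i := pr k (L' ! i) x]))"
        using L by (intro less.hyps) auto
      then show ?thesis using i mem L'Y by (simp add: map_update H(2))
    qed
    then have "H (deriv (\<lambda>s. pr k s x) (tower k N b) L') = deriv (\<lambda>s. pr k s (H x)) (tower k N b') (map H L')"
      by (simp add: deriv_def lmap_sum[OF H(1)])
    moreover have "H (pr 0 (tower k N b L') x) = pr 0 (tower k N b' (map H L')) (H x)"
      using H(2)[OF tX L'Y(2)] less.hyps[of L'] L L'Y by simp
    ultimately show ?thesis
      using N L by (simp add: tower_snoc lmap_diff[OF H(1)])
  qed
qed

lemma lmap_white_brace_root: "lmap scale scale (\<lambda>z. white_brace z M)"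
proof -
  have "lmap scale scale (\<lambda>z. tower 0 0 (\<lambda>_. z) L)" for L
  proof (induction "length L" arbitrary: L rule: less_induct)
    case less
    show ?case
    proof (cases L rule: rev_cases)
      case Nil
      then show ?thesis using lmap_id by (simp add: tower_base)
    next
      case (snoc L' x)
      have eq: "tower 0 0 (\<lambda>_. z) L = pr 0 (tower 0 0 (\<lambda>_. z) L') x
          - (\<Sum>i<length L'. tower 0 0 (\<lambda>_. z) (L'[i := pr 0 (L' ! i) x]))" for z
        unfolding snoc by (simp add: tower_snoc deriv_def)
      show ?thesis
        unfolding eq
        by (intro lmap_fun_diff lmap_fun_sum vs lmap_compose[OF less lmap_pr_left] less) (auto simp: snoc)
    qed
  qed
  then show ?thesis unfolding white_brace_def .
qed

section \<open>Evaluation of Greg trees\<close>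

text \<open>
  A black vertex labelled \<open>e\<^sub>c\<close> is the difference of those labelled \<open>e\<^sub>1 + \<dots> + e\<^sub>c\<close> and
  \<open>e\<^sub>1 + \<dots> + e\<^sub>c\<^sub>-\<^sub>1\<close>.
\<close>

primrec tree_eval :: "('w \<Rightarrow> 'a) \<Rightarrow> ('w, nat) gtree \<Rightarrow> 'a" where
  "tree_eval f (White w F) = white_brace (f w) (image_mset (tree_eval f) F)"
| "tree_eval f (Black c F) = black_brace c (image_mset (tree_eval f) F) - black_brace (c - 1) (image_mset (tree_eval f) F)"

lemma tree_eval_cong: "(\<And>w. w \<in># white_labels T \<Longrightarrow> f w = g w) \<Longrightarrow> tree_eval f T = tree_eval g T"
proof (induction T)
  case (White w F)
  then have "image_mset (tree_eval f) F = image_mset (tree_eval g) F" by (intro image_mset_cong) auto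
  then show ?case using White.prems by simp
next
  case (Black c F)
  then have "image_mset (tree_eval f) F = image_mset (tree_eval g) F" by (intro image_mset_cong) auto
  then show ?case by simp
qed

end

lemma count_sum_mset_eq_1:
  assumes "count (\<Sum>\<^sub># (image_mset white_labels F)) w = 1"
  obtains s F' where "F = add_mset s F'" "count (white_labels s) w = 1" "\<And>r. r \<in># F' \<Longrightarrow> w \<notin># white_labels r"
proof -
  have "w \<in># \<Sum>\<^sub># (image_mset white_labels F)" using assms by (metis count_inI zero_neq_one)
  then obtain s where s: "s \<in># F" "w \<in># white_labels s" by auto
  then obtain F' where F: "F = add_mset s F'" by (auto dest: multi_member_split)
  have "count (white_labels s) w + count (\<Sum>\<^sub># (image_mset white_labels F')) w = 1" using assms F by simp
  moreover have "count (white_labels s) w > 0" using s(2) by simp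
  ultimately have "count (white_labels s) w = 1" "count (\<Sum>\<^sub># (image_mset white_labels F')) w = 0" by linarith+
  moreover from this(2) have "w \<notin># white_labels r" if "r \<in># F'" for r
    using that by (auto dest!: multi_member_split simp: not_in_iff)
  ultimately show ?thesis using that[OF F] by blast
qed

context shared_bracket
begin

lemma tree_eval_upd_idle: "w \<notin># white_labels T \<Longrightarrow> tree_eval (f(w := a)) T = tree_eval f T"
  by (rule tree_eval_cong) auto

lemma lmap_tree_eval: "count (white_labels T) w = 1 \<Longrightarrow> lmap scale scale (\<lambda>a. tree_eval (f(w := a)) T)"
proof (induction T)
  case (White v F)
  show ?case
  proof (cases "v = w")
    case True
    then have "count (\<Sum>\<^sub># (image_mset white_labels F)) w = 0" using White.prems by simp
    then have "w \<notin># white_labels r" if "r \<in># F" for r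
      using that by (auto dest!: multi_member_split simp: not_in_iff)
    then have "image_mset (tree_eval (f(w := a))) F = image_mset (tree_eval f) F" for a
      by (intro image_mset_cong tree_eval_upd_idle)
    then show ?thesis using True lmap_white_brace_root by (simp del: fun_upd_apply add: fun_upd_same)
  next
    case False
    then have "count (\<Sum>\<^sub># (image_mset white_labels F)) w = 1" using White.prems by simp
    then obtain s F' where s: "F = add_mset s F'" "count (white_labels s) w = 1" "\<And>r. r \<in># F' \<Longrightarrow> w \<notin># white_labels r"
      by (rule count_sum_mset_eq_1) blast
    have "image_mset (tree_eval (f(w := a))) F' = image_mset (tree_eval f) F'" for a
      by (intro image_mset_cong tree_eval_upd_idle s(3))
    then show ?thesis using False lmap_compose[OF White.IH lmap_white_brace] s by (simp del: fun_upd_apply add: fun_upd_other)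
  qed
next
  case (Black c F)
  then have "count (\<Sum>\<^sub># (image_mset white_labels F)) w = 1" by simp
  then obtain s F' where s: "F = add_mset s F'" "count (white_labels s) w = 1" "\<And>r. r \<in># F' \<Longrightarrow> w \<notin># white_labels r"
    by (rule count_sum_mset_eq_1) blast
  have "image_mset (tree_eval (f(w := a))) F' = image_mset (tree_eval f) F'" for a
    by (intro image_mset_cong tree_eval_upd_idle s(3))
  then show ?case using lmap_fun_diff[OF lmap_compose[OF Black.IH lmap_black_brace] lmap_compose[OF Black.IH lmap_black_brace]] s
    by (simp del: fun_upd_apply)
qed

end

section \<open>The maximum coproduct and the fall product\<close>

context vector_space
begin

text \<open>
  The maximum coproduct is group-like on \<open>e\<^sub>1 + \<dots> + e\<^sub>k\<close>: the pairs in \<open>{1..k} \<times> {1..k}\<close> are grouped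
  by their maximum.
\<close>

lemma sum_lext_delta_max:
  assumes "k \<le> n"
  shows "(\<Sum>l\<in>{1..k}. lext scale g (delta_max n l)) = (\<Sum>i\<in>{1..k}. \<Sum>j\<in>{1..k}. g (i, j))"
proof -
  have "lext scale g (delta_max n l) = (\<Sum>p | p \<in> {1..k} \<times> {1..k} \<and> max (fst p) (snd p) = l. g p)" if l: "l \<in> {1..k}" for l
  proof -
    have "{(i, j). i \<in> {1..n} \<and> j \<in> {1..n} \<and> max i j = l} = {p \<in> {1..k} \<times> {1..k}. max (fst p) (snd p) = l}"
      using l assms by auto
    then have "(delta_max n l :: _ \<Rightarrow>\<^sub>0 'a) = (\<Sum>p | p \<in> {1..k} \<times> {1..k} \<and> max (fst p) (snd p) = l. basis p)"
      by (simp add: delta_max_def case_prod_beta)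
    then show ?thesis by (simp add: lmap_sum[OF lmap_lext])
  qed
  then have "(\<Sum>l\<in>{1..k}. lext scale g (delta_max n l))
      = (\<Sum>l\<in>{1..k}. \<Sum>p | p \<in> {1..k} \<times> {1..k} \<and> max (fst p) (snd p) = l. g p)"
    by (rule sum.cong[OF HOL.refl])
  also have "\<dots> = sum g ({1..k} \<times> {1..k})"
    by (rule sum.group) auto
  finally show ?thesis by (simp add: sum.cartesian_product)
qed

lemma lext_delta_max:
  assumes "c \<in> {1..n}"
  shows "lext scale g (delta_max n c)
    = (\<Sum>i\<in>{1..c}. \<Sum>j\<in>{1..c}. g (i, j)) - (\<Sum>i\<in>{1..c - 1}. \<Sum>j\<in>{1..c - 1}. g (i, j))"
proof -
  have "(\<Sum>l\<in>{1..c}. lext scale g (delta_max n l))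
      = lext scale g (delta_max n c) + (\<Sum>l\<in>{1..c - 1}. lext scale g (delta_max n l))"
    using assms by (cases c) (simp_all add: add.commute)
  moreover have "c \<le> n" "c - 1 \<le> n" using assms by auto
  ultimately show ?thesis by (simp only: sum_lext_delta_max) simp
qed

end

lemma in_forest_eq: "in_forest node F s p = lext lscale (\<lambda>t. basis (node (add_mset t (F - {#s#})))) p"
  by (simp add: in_forest_def lin_eq_lext)

context shared_bracket
begin

lemma telescope:
  fixes u :: "nat \<Rightarrow> 'a"
  shows "(\<Sum>i\<in>{1..c}. u i - u (i - 1)) = u c - u 0"
  by (induction c) auto

lemma tree_eval_black_pair: "tree_eval f (Black c {#S, T#}) = pr c (tree_eval f S) (tree_eval f T) - pr (c - 1) (tree_eval f S) (tree_eval f T)"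
  by (simp add: black_brace_pair)

lemma tree_eval_in_forest:
  assumes "\<And>s'. tree_eval f (node (add_mset s' (F - {#s#}))) = h (tree_eval f s')" "lmap scale scale h"
  shows "lext scale (tree_eval f) (in_forest node F s p) = h (lext scale (tree_eval f) p)"
proof -
  have "h (lext scale (tree_eval f) p) = lext scale (\<lambda>t. h (tree_eval f t)) p"
    using lmap_eq_lext[OF lmap_compose[OF lmap_lext assms(2)], of "tree_eval f" p] by simp
  then show ?thesis
    by (simp add: in_forest_eq lext_compose assms(1))
qed

text \<open>
  At a vertex the fall product satisfies the recursion that defines the brace there.  For a black
  vertex write its label as a difference of two group-like ones.  Splitting a vertex with the
  group-like label of index \<open>d\<close> puts \<open>pr d s T - pr 0 s T\<close> in the place of the child \<open>s\<close>; grafting in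
  the child contributes \<open>pr 0 s T\<close> by induction, and the sum is \<open>pr d s T\<close>.
\<close>

theorem tree_eval_fall:
  assumes "greg {1..n} S"
  shows "lext scale (tree_eval f) (fall (delta_max n) S T) = pr 0 (tree_eval f S) (tree_eval f T)"
  using assms
proof induction
  case (1 F w)
  let ?e = "tree_eval f" and ?M = "image_mset (tree_eval f)"
  note IH = "1.IH"
  have "lext scale ?e (in_forest (White w) F s (fall (delta_max n) s T))
      = white_brace (f w) (add_mset (pr 0 (?e s) (?e T)) (?M F - {#?e s#}))" if s: "s \<in># F" for s
    unfolding IH[OF s, symmetric]
    by (rule tree_eval_in_forest) (use s lmap_white_brace in \<open>auto simp: image_mset_Diff\<close>)
  then have "lext scale ?e (fall (delta_max n) (White w F) T) = white_brace (f w) (add_mset (?e T) (?M F))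
      + (\<Sum>s\<in>#F. white_brace (f w) (add_mset (pr 0 (?e s) (?e T)) (?M F - {#?e s#})))"
    by (simp add: lext_add lmap_sum_mset[OF lmap_lext] cong: image_mset_cong)
  also have "\<dots> = pr 0 (?e (White w F)) (?e T)"
    using white_brace_add[of "f w" "?e T" "?M F"] by (simp add: image_mset.compositionality comp_def)
  finally show ?case .
next
  case (2 c F)
  let ?e = "tree_eval f" and ?M = "image_mset (tree_eval f)"
  note c = "2.hyps"(1) and F = "2.hyps"(2) and IH = "2.IH"
  let ?b = "\<lambda>a M. black_brace c (add_mset a M) - black_brace (c - 1) (add_mset a M)"
  have Fne: "?M F \<noteq> {#}" using F by auto
  have lb: "lmap scale scale (\<lambda>a. ?b a M)" for M
    by (intro lmap_fun_diff lmap_black_brace)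
  have inner: "lext scale ?e (in_forest (Black c) F s (fall (delta_max n) s T))
      = ?b (pr 0 (?e s) (?e T)) (?M F - {#?e s#})" if s: "s \<in># F" for s
    unfolding IH[OF s, symmetric]
    by (rule tree_eval_in_forest[where h = "\<lambda>a. ?b a (?M F - {#?e s#})"]) (use s lb in \<open>auto simp: image_mset_Diff\<close>)
  \<comment> \<open>The sums over both labels of the split vertex telescope.\<close>
  have edge: "lext scale ?e (lin (\<lambda>(c1, c2). basis (Black c1 (add_mset (Black c2 {#s, T#}) (F - {#s#})))) (delta_max n c))
      = black_brace c (add_mset (pr c (?e s) (?e T) - pr 0 (?e s) (?e T)) (?M F - {#?e s#}))
        - black_brace (c - 1) (add_mset (pr (c - 1) (?e s) (?e T) - pr 0 (?e s) (?e T)) (?M F - {#?e s#}))" if s: "s \<in># F" for s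
  proof -
    have "lext scale ?e (lin (\<lambda>(c1, c2). basis (Black c1 (add_mset (Black c2 {#s, T#}) (F - {#s#})))) (delta_max n c))
        = lext scale (\<lambda>(c1, c2). ?e (Black c1 (add_mset (Black c2 {#s, T#}) (F - {#s#})))) (delta_max n c)"
      by (simp only: lin_eq_lext lext_compose case_prod_unfold lext_basis)
    moreover have "(\<Sum>i\<in>{1..d}. \<Sum>j\<in>{1..d}. ?e (Black i (add_mset (Black j {#s, T#}) (F - {#s#}))))
      = black_brace d (add_mset (pr d (?e s) (?e T) - pr 0 (?e s) (?e T)) (?M F - {#?e s#}))" for d
    proof -
      let ?u = "\<lambda>j. pr j (?e s) (?e T)"
      have "(\<Sum>j\<in>{1..d}. ?e (Black i (add_mset (Black j {#s, T#}) (F - {#s#}))))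
          = (\<Sum>j\<in>{1..d}. black_brace i (add_mset (?u j - ?u (j - 1)) (?M F - {#?e s#}))
               - black_brace (i - 1) (add_mset (?u j - ?u (j - 1)) (?M F - {#?e s#})))" for i
        using s by (simp add: image_mset_Diff black_brace_pair)
      also have "\<dots> i = black_brace i (add_mset (?u d - ?u 0) (?M F - {#?e s#})) - black_brace (i - 1) (add_mset (?u d - ?u 0) (?M F - {#?e s#}))" for i
        using lmap_sum[OF lmap_fun_diff[OF lmap_black_brace[of i "?M F - {#?e s#}"] lmap_black_brace[of "i - 1" "?M F - {#?e s#}"]],
            of "\<lambda>j. ?u j - ?u (j - 1)" "{1..d}"] by (simp only: telescope[of ?u d])
      finally have "(\<Sum>i\<in>{1..d}. \<Sum>j\<in>{1..d}. ?e (Black i (add_mset (Black j {#s, T#}) (F - {#s#}))))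
          = black_brace d (add_mset (?u d - ?u 0) (?M F - {#?e s#})) - black_brace 0 (add_mset (?u d - ?u 0) (?M F - {#?e s#}))"
        using telescope[of "\<lambda>i. black_brace i (add_mset (?u d - ?u 0) (?M F - {#?e s#}))" d] by (simp only:)
      also have "black_brace 0 (add_mset (?u d - ?u 0) (?M F - {#?e s#})) = 0"
        using s F by (intro black_brace_0) (auto simp: size_Suc_Diff1)
      finally show ?thesis by simp
    qed
    ultimately show ?thesis by (simp add: lext_delta_max[OF c])
  qed
  have "lext scale ?e (fall (delta_max n) (Black c F) T) = ?b (?e T) (?M F)
      + (\<Sum>s\<in>#F. lext scale ?e (lin (\<lambda>(c1, c2). basis (Black c1 (add_mset (Black c2 {#s, T#}) (F - {#s#})))) (delta_max n c)))
      + (\<Sum>s\<in>#F. ?b (pr 0 (?e s) (?e T)) (?M F - {#?e s#}))"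
    by (simp add: lext_add lmap_sum_mset[OF lmap_lext] inner cong: image_mset_cong)
  also have "\<dots> = ?b (?e T) (?M F)
      + (\<Sum>s\<in>#F. black_brace c (add_mset (pr c (?e s) (?e T)) (?M F - {#?e s#}))
          - black_brace (c - 1) (add_mset (pr (c - 1) (?e s) (?e T)) (?M F - {#?e s#})))"
    by (simp add: edge lmap_diff[OF lmap_black_brace] sum_mset_subtractf cong: image_mset_cong)
  also have "\<dots> = pr 0 (?e (Black c F)) (?e T)"
    using black_brace_add[OF Fne, of c "?e T"] black_brace_add[OF Fne, of "c - 1" "?e T"]
    by (simp add: image_mset.compositionality comp_def pr_simps sum_mset_subtractf)
  finally show ?case .
qed

end


section \<open>Products on Greg trees\<close>

interpretation pm: vector_space "lscale :: 'k::field \<Rightarrow> ('x \<Rightarrow>\<^sub>0 'k) \<Rightarrow> ('x \<Rightarrow>\<^sub>0 'k)"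
  by (rule vector_space_lscale)

lemma lmap_fun_sum_mset:
  assumes "vector_space s1" "vector_space s2" "\<And>x. lmap s1 s2 (g x)"
  shows "lmap s1 s2 (\<lambda>a. \<Sum>x\<in>#M. g x a)"
proof (induction M)
  case empty
  interpret vector_space s2 by fact
  show ?case using assms(1,2) by (intro lmapI) auto
next
  case (add x M)
  then show ?case using lmap_fun_add[OF assms(3)] by simp
qed

abbreviation linop :: "(('x \<Rightarrow>\<^sub>0 'k::field) \<Rightarrow> ('y \<Rightarrow>\<^sub>0 'k)) \<Rightarrow> bool" where
  "linop \<equiv> lmap lscale lscale"

lemma sum_sum_mset_swap:
  fixes h :: "'b \<Rightarrow> 'c \<Rightarrow> 'a::comm_monoid_add"
  shows "(\<Sum>l\<in>A. \<Sum>s\<in>#F. h l s) = (\<Sum>s\<in>#F. \<Sum>l\<in>A. h l s)"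
  by (induction F) (simp_all add: sum.distrib)

text \<open>
  A black vertex with the group-like label \<open>e\<^sub>1 + \<dots> + e\<^sub>k\<close>.
\<close>

definition gblack :: "nat \<Rightarrow> ('w, nat) gtree multiset \<Rightarrow> (('w, nat) gtree \<Rightarrow>\<^sub>0 'k::field)" where
  "gblack k F = (\<Sum>l\<in>{1..k}. basis (Black l F))"

definition gprod ::
    "nat \<Rightarrow> nat \<Rightarrow> (('w, nat) gtree \<Rightarrow>\<^sub>0 'k::field) \<Rightarrow> (('w, nat) gtree \<Rightarrow>\<^sub>0 'k) \<Rightarrow> (('w, nat) gtree \<Rightarrow>\<^sub>0 'k)" where
  "gprod n k p q =
     lext lscale (\<lambda>S. lext lscale (\<lambda>T. fall (delta_max n) S T + gblack (min k n) {#S, T#}) q) p"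

text \<open>
  The node \<open>N\<close> with children \<open>M\<close> and one further child that is a linear combination of trees.
\<close>

definition slot :: "('t multiset \<Rightarrow> ('x \<Rightarrow>\<^sub>0 'k::field)) \<Rightarrow> 't multiset \<Rightarrow> ('t \<Rightarrow>\<^sub>0 'k) \<Rightarrow> ('x \<Rightarrow>\<^sub>0 'k)" where
  "slot N M p = lext lscale (\<lambda>t. N (add_mset t M)) p"

lemma linop_slot: "linop (slot N M)"
  unfolding slot_def[abs_def] by (rule pm.lmap_lext)

lemma slot_basis [simp]: "slot N M (basis t) = N (add_mset t M)"
  by (simp add: slot_def)

lemma linop_gprod_left: "linop (\<lambda>p. gprod n k p q)"
  unfolding gprod_def by (rule pm.lmap_lext)

lemma linop_gprod_right: "linop (gprod n k p)"
proof -
  have "gprod n k p = lext lscale (\<lambda>T. lext lscale (\<lambda>S. fall (delta_max n) S T + gblack (min k n) {#S, T#}) p)"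
    unfolding gprod_def by (rule ext, rule pm.lext_swap)
  then show ?thesis by (simp add: pm.lmap_lext)
qed

lemma gprod_basis: "gprod n k (basis S) (basis T) = fall (delta_max n) S T + gblack (min k n) {#S, T#}"
  by (simp add: gprod_def)

lemma gblack_0 [simp]: "gblack 0 F = 0"
  by (simp add: gblack_def)

text \<open>
  Two of the products differ by terms in which both factors are children of a common black root.
\<close>

lemma gprod_diff_commute: "gprod n k p q - gprod n 0 p q = gprod n k q p - gprod n 0 q p"
proof (rule lmap_basis_eqI[where s = lscale and f = "\<lambda>p. gprod n k p q - gprod n 0 p q" and g = "\<lambda>p. gprod n k q p - gprod n 0 q p"])
  fix S
  show "gprod n k (basis S) q - gprod n 0 (basis S) q = gprod n k q (basis S) - gprod n 0 q (basis S)"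
    by (rule lmap_basis_eqI[where s = lscale and f = "\<lambda>q. gprod n k (basis S) q - gprod n 0 (basis S) q"
          and g = "\<lambda>q. gprod n k q (basis S) - gprod n 0 q (basis S)"])
       (auto intro: lmap_fun_diff linop_gprod_left linop_gprod_right simp: gprod_basis add_mset_commute)
qed (intro lmap_fun_diff linop_gprod_left linop_gprod_right)+

text \<open>
  The node \<open>N\<close> obeys the recursion of \<open>tower\<close>, with the \<open>k\<close>-th product acting on its children.
\<close>

definition grafts :: "nat \<Rightarrow> nat \<Rightarrow> (('w, nat) gtree multiset \<Rightarrow> (('w, nat) gtree \<Rightarrow>\<^sub>0 'k::field)) \<Rightarrow> bool" where
  "grafts n k N \<longleftrightarrow> (\<forall>F T. gprod n 0 (N F) (basis T)
     = N (add_mset T F) + (\<Sum>s\<in>#F. slot N (F - {#s#}) (gprod n k (basis s) (basis T))))"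

lemma in_forest_slot: "in_forest node F s p = slot (\<lambda>M. basis (node M)) (F - {#s#}) p"
  by (simp add: in_forest_eq slot_def)

lemma grafts_White: "grafts n 0 (\<lambda>F. basis (White w F))"
  by (simp add: grafts_def gprod_basis in_forest_slot)

lemma delta_max_out: "c \<notin> {1..n} \<Longrightarrow> delta_max n c = 0"
proof -
  assume "c \<notin> {1..n}"
  then have "{(i, j). i \<in> {1..n} \<and> j \<in> {1..n} \<and> max i j = c} = {}" by (auto simp: max_def split: if_splits)
  then show ?thesis by (simp only: delta_max_def sum.empty)
qed

text \<open>
  A label outside \<open>{1..n}\<close> has zero coproduct, so that its vertex is never split.
\<close>

lemma grafts_Black_out: "c \<notin> {1..n} \<Longrightarrow> grafts n 0 (\<lambda>F. basis (Black c F))"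
  by (simp add: grafts_def gprod_basis in_forest_slot delta_max_out lin_eq_lext del: atLeastAtMost_iff)

lemma slot_gblack: "slot (gblack k) M p = (\<Sum>l\<in>{1..k}. slot (\<lambda>F. basis (Black l F)) M p)"
  unfolding slot_def gblack_def by (rule pm.lext_pointwise_sum)

text \<open>
  The vertices with group-like label are closed under splitting, and the split vertex is the
  difference between the \<open>k\<close>-th product and the fall product in the child.
\<close>

lemma grafts_gblack:
  assumes k: "k \<le> n"
  shows "grafts n k (gblack k :: _ \<Rightarrow> ('w, nat) gtree \<Rightarrow>\<^sub>0 'k::field)"
proof -
  have "gprod n 0 (gblack k F :: _ \<Rightarrow>\<^sub>0 'k) (basis T)
     = gblack k (add_mset T F) + (\<Sum>s\<in>#F. slot (gblack k) (F - {#s#}) (gprod n k (basis s) (basis T)))"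
    for F and T :: "('w, nat) gtree"
  proof -
    let ?D = "delta_max n"
    let ?E = "\<lambda>s (c1, c2). basis (Black c1 (add_mset (Black c2 {#s, T#}) (F - {#s#})))"
    have E: "(\<Sum>l\<in>{1..k}. lin (?E s) (?D l)) = slot (gblack k) (F - {#s#}) (gblack k {#s, T#})" for s
    proof -
      have "(\<Sum>l\<in>{1..k}. lin (?E s) (?D l)) = (\<Sum>i\<in>{1..k}. \<Sum>j\<in>{1..k}. ?E s (i, j))"
        unfolding lin_eq_lext by (rule pm.sum_lext_delta_max[OF k])
      also have "\<dots> = (\<Sum>i\<in>{1..k}. slot (\<lambda>F. basis (Black i F)) (F - {#s#}) (\<Sum>j\<in>{1..k}. basis (Black j {#s, T#})))"
        by (simp add: lmap_sum[OF linop_slot])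
      finally show ?thesis by (simp add: slot_gblack gblack_def)
    qed
    have "gprod n 0 (gblack k F) (basis T) = (\<Sum>l\<in>{1..k}. fall ?D (Black l F) T)"
      unfolding gblack_def lmap_sum[OF linop_gprod_left] by (simp add: gprod_basis)
    also have "\<dots> = gblack k (add_mset T F)
        + (\<Sum>l\<in>{1..k}. \<Sum>s\<in>#F. lin (?E s) (?D l))
        + (\<Sum>l\<in>{1..k}. \<Sum>s\<in>#F. slot (\<lambda>F. basis (Black l F)) (F - {#s#}) (fall ?D s T))"
      by (simp add: gblack_def sum.distrib in_forest_slot)
    also have "(\<Sum>l\<in>{1..k}. \<Sum>s\<in>#F. lin (?E s) (?D l)) = (\<Sum>s\<in>#F. slot (gblack k) (F - {#s#}) (gblack k {#s, T#}))"
      unfolding E[symmetric] by (rule sum_sum_mset_swap)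
    also have "(\<Sum>l\<in>{1..k}. \<Sum>s\<in>#F. slot (\<lambda>F. basis (Black l F)) (F - {#s#}) (fall ?D s T))
        = (\<Sum>s\<in>#F. slot (gblack k) (F - {#s#}) (fall ?D s T))"
      unfolding slot_gblack by (rule sum_sum_mset_swap)
    finally show ?thesis
      using k by (simp add: gprod_basis lmap_add[OF linop_slot] sum_mset.distrib min_absorb1 add_ac)
  qed
  then show ?thesis by (simp add: grafts_def)
qed

definition assoc :: "nat \<Rightarrow> nat \<Rightarrow> _ \<Rightarrow> _ \<Rightarrow> _ \<Rightarrow> (('w, nat) gtree \<Rightarrow>\<^sub>0 'k::field)" where
  "assoc n k p q r = gprod n k (gprod n k p q) r - gprod n k p (gprod n k q r)"

text \<open>
  A node with two further children that are linear combinations of trees.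
\<close>

definition slot2 where
  "slot2 N M p q = lext lscale (\<lambda>t. slot N (add_mset t M) q) p"

lemma slot2_commute: "slot2 N M p q = slot2 N M q p"
  unfolding slot2_def slot_def by (subst pm.lext_swap) (simp add: add_mset_commute)

lemma graft_right:
  assumes "grafts n k N"
  shows "gprod n 0 (N F) q = slot N F q + (\<Sum>s\<in>#F. slot N (F - {#s#}) (gprod n k (basis s) q))"
  by (rule lmap_basis_eqI[where s = lscale and f = "gprod n 0 (N F)"])
     (use assms in \<open>auto simp: grafts_def intro!: linop_gprod_right lmap_fun_add linop_slot lmap_fun_sum_mset
        vector_space_lscale lmap_compose[OF linop_gprod_right linop_slot]\<close>)

lemma graft_slot:
  assumes "grafts n k N"
  shows "gprod n 0 (slot N M p) (basis U) = slot N (add_mset U M) p + slot N M (gprod n k p (basis U))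
    + (\<Sum>r\<in>#M. slot2 N (M - {#r#}) p (gprod n k (basis r) (basis U)))"
proof (rule lmap_basis_eqI[where s = lscale and f = "\<lambda>p. gprod n 0 (slot N M p) (basis U)"])
  show "linop (\<lambda>p. gprod n 0 (slot N M p) (basis U))"
    by (rule lmap_compose[OF linop_slot linop_gprod_left])
  have "linop (\<lambda>p. slot2 N M' p q)" for M' q unfolding slot2_def by (rule pm.lmap_lext)
  then show "linop (\<lambda>p. slot N (add_mset U M) p + slot N M (gprod n k p (basis U))
    + (\<Sum>r\<in>#M. slot2 N (M - {#r#}) p (gprod n k (basis r) (basis U))))"
    by (intro lmap_fun_add linop_slot lmap_fun_sum_mset vector_space_lscale lmap_compose[OF linop_gprod_left linop_slot])
  fix t
  have "(\<Sum>s\<in>#M. slot N (add_mset t M - {#s#}) (gprod n k (basis s) (basis U)))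
      = (\<Sum>s\<in>#M. slot2 N (M - {#s#}) (basis t) (gprod n k (basis s) (basis U)))"
    by (rule arg_cong[of _ _ sum_mset], rule image_mset_cong) (simp add: slot2_def)
  then show "gprod n 0 (slot N M (basis t)) (basis U) = slot N (add_mset U M) (basis t) + slot N M (gprod n k (basis t) (basis U))
    + (\<Sum>r\<in>#M. slot2 N (M - {#r#}) (basis t) (gprod n k (basis r) (basis U)))"
    using assms by (simp add: grafts_def add_mset_commute add.assoc)
qed

text \<open>
  In the associator of a node with \<open>T\<close> and \<open>U\<close> there are the terms where both become children
  (\<open>A\<close>), where a product of the two becomes a child (\<open>B\<close>), where one becomes a child and the other
  goes into a child (\<open>C\<close>), where both go into the same child (\<open>D\<close>), and where they go into different
  children (\<open>E\<close>).  All but \<open>B\<close> and \<open>D\<close> are visibly symmetric.  In \<open>B\<close> the products \<open>0\<close> and \<open>k\<close> enter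
  through their difference, which is symmetric; \<open>D\<close> is symmetric by the pre-Lie identity in the child,
  in which the term with the product of \<open>T\<close> and \<open>U\<close> is corrected by the same difference.
\<close>

lemma assoc_node:
  fixes N :: "('w, nat) gtree multiset \<Rightarrow> (('w, nat) gtree \<Rightarrow>\<^sub>0 'k::field)"
  assumes N: "grafts n k N"
    and IH: "\<And>s. s \<in># F \<Longrightarrow> assoc n k (basis s) (basis T) (basis U) = (assoc n k (basis s) (basis U) (basis T) :: _ \<Rightarrow>\<^sub>0 'k)"
  shows "assoc n 0 (N F) (basis T) (basis U) = assoc n 0 (N F) (basis U) (basis T)"
proof -
  let ?T = "basis T :: _ \<Rightarrow>\<^sub>0 'k" and ?U = "basis U :: _ \<Rightarrow>\<^sub>0 'k"
  let ?x = "gprod n 0 :: (('w, nat) gtree \<Rightarrow>\<^sub>0 'k) \<Rightarrow> _" and ?y = "gprod n k :: (('w, nat) gtree \<Rightarrow>\<^sub>0 'k) \<Rightarrow> _"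
  define A where "A T U = N (add_mset U (add_mset T F))" for T U
  define B where "B T U = slot N F (?y (basis T) (basis U) - ?x (basis T) (basis U))" for T U
  define C where "C T U = (\<Sum>s\<in>#F. slot N (add_mset T (F - {#s#})) (?y (basis s) (basis U)))" for T U
  define D where "D T U = (\<Sum>s\<in>#F. slot N (F - {#s#}) (?y (?y (basis s) (basis T)) (basis U) - ?y (basis s) (?x (basis T) (basis U))))" for T U
  define E where "E T U = (\<Sum>s\<in>#F. \<Sum>r\<in>#F - {#s#}. slot2 N (F - {#s#} - {#r#}) (?y (basis s) (basis T)) (?y (basis r) (basis U)))" for T U
  have expand: "assoc n 0 (N F) (basis T) (basis U) = A T U + B T U + (C T U + C U T) + D T U + E T U" for T U
  proof -
    have "?x (?x (N F) (basis T)) (basis U) = ?x (N (add_mset T F)) (basis U)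
        + (\<Sum>s\<in>#F. ?x (slot N (F - {#s#}) (?y (basis s) (basis T))) (basis U))"
      using N by (simp add: grafts_def lmap_add[OF linop_gprod_left] lmap_sum_mset[OF linop_gprod_left])
    moreover have "?x (N (add_mset T F)) (basis U) = A T U + slot N F (?y (basis T) (basis U)) + C T U"
    proof -
      have "(\<Sum>s\<in>#F. slot N (add_mset T F - {#s#}) (?y (basis s) (basis U))) = C T U"
        unfolding C_def by (rule arg_cong[of _ _ sum_mset], rule image_mset_cong) simp
      then show ?thesis using N by (simp add: grafts_def A_def add.assoc)
    qed
    moreover have "(\<Sum>s\<in>#F. ?x (slot N (F - {#s#}) (?y (basis s) (basis T))) (basis U))
        = C U T + (\<Sum>s\<in>#F. slot N (F - {#s#}) (?y (?y (basis s) (basis T)) (basis U))) + E T U"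
      unfolding graft_slot[OF N] C_def E_def by (simp add: sum_mset.distrib)
    moreover have "?x (N F) (?x (basis T) (basis U)) = slot N F (?x (basis T) (basis U))
        + (\<Sum>s\<in>#F. slot N (F - {#s#}) (?y (basis s) (?x (basis T) (basis U))))"
      by (rule graft_right[OF N])
    ultimately show ?thesis
      by (simp add: assoc_def B_def D_def lmap_diff[OF linop_slot] sum_mset_subtractf)
  qed
  have "A T U = A U T" by (simp add: A_def add_mset_commute)
  moreover have "B T U = B U T" unfolding B_def gprod_diff_commute[of n k "basis T"] ..
  moreover have "D T U = D U T"
  proof -
    have "?y (?y (basis s) ?T) ?U - ?y (basis s) (?x ?T ?U) = ?y (?y (basis s) ?U) ?T - ?y (basis s) (?x ?U ?T)"
      if s: "s \<in># F" for s
    proof -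
      have "?y (basis s) (?y ?T ?U) - ?y (basis s) (?x ?T ?U) = ?y (basis s) (?y ?U ?T) - ?y (basis s) (?x ?U ?T)"
        unfolding lmap_diff[OF linop_gprod_right, symmetric] gprod_diff_commute[of n k ?T] ..
      from arg_cong2[OF IH[OF s, unfolded assoc_def] this, of "(+)"] show ?thesis by simp
    qed
    then show ?thesis unfolding D_def by (intro arg_cong[of _ _ sum_mset] image_mset_cong) simp
  qed
  moreover have "E T U = E U T"
  proof -
    have "E T U = (\<Sum>s\<in>#F. \<Sum>r\<in>#F - {#s#}. slot2 N (F - {#r#} - {#s#}) (?y (basis r) ?T) (?y (basis s) ?U))"
      unfolding E_def by (rule sum_mset_diff_swap)
    also have "\<dots> = E U T"
      unfolding E_def by (simp add: slot2_commute[of _ _ "?y _ ?T"] add_mset_commute)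
    finally show ?thesis .
  qed
  ultimately show ?thesis unfolding expand by (simp add: add_ac)
qed

lemma slot_gblack_single:
  assumes "k \<le> n"
  shows "slot (gblack k) {#b#} p = gprod n k p (basis b) - gprod n 0 p (basis b)"
  by (rule lmap_basis_eqI[where s = lscale and f = "slot (gblack k) {#b#}"])
     (auto intro: linop_slot lmap_fun_diff linop_gprod_left simp: gprod_basis min_absorb1[OF assms])

text \<open>
  The pre-Lie identity passes from the fall product to the \<open>k\<close>-th product.  The two associators
  differ by terms with the symmetric product \<open>g\<close>, and \<open>grafts_gblack\<close> for two children describes how
  \<open>g\<close> and the fall product interact.
\<close>

lemma assoc_shift:
  fixes S T U :: "('w, nat) gtree"
  assumes k: "k \<le> n" and 0: "assoc n 0 (basis S) (basis T) (basis U) = (assoc n 0 (basis S) (basis U) (basis T) :: _ \<Rightarrow>\<^sub>0 'k)"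
  shows "assoc n k (basis S) (basis T) (basis U) = (assoc n k (basis S) (basis U) (basis T) :: _ \<Rightarrow>\<^sub>0 'k::field)"
proof -
  let ?x = "gprod n 0" and ?y = "gprod n k"
  define g where "g p q = ?y p q - ?x p q" for p q :: "('w, nat) gtree \<Rightarrow>\<^sub>0 'k"
  have g_commute: "g p q = g q p" for p q
    unfolding g_def by (rule gprod_diff_commute)
  have expand: "assoc n k (basis S) (basis T) (basis U) = assoc n 0 (basis S) (basis T) (basis U)
      - ?x (basis S) (g (basis T) (basis U)) + gblack k {#U, S, T#}
      + (g (?y (basis S) (basis U)) (basis T) + g (?y (basis S) (basis T)) (basis U))" for T U
  proof -
    let ?S = "basis S" and ?T = "basis T" and ?U = "basis U"
    have g: "g ?S ?T = gblack k {#S, T#}" using k by (simp add: g_def gprod_basis min_absorb1)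
    have "{#S, T#} - {#T#} = {#S#}" by (simp add: add_mset_commute[of S T])
    then have 1: "?x (g ?S ?T) ?U = gblack k {#U, S, T#} + (g (?y ?S ?U) ?T + g (?y ?T ?U) ?S)"
      unfolding g
      by (simp add: grafts_gblack[OF k, unfolded grafts_def, rule_format] slot_gblack_single[OF k] g_def)
    have 2: "?y (?y ?S ?T) ?U = ?x (?x ?S ?T) ?U + ?x (g ?S ?T) ?U + g (?y ?S ?T) ?U"
      by (simp add: g_def lmap_diff[OF linop_gprod_left])
    have 3: "?y ?S (?y ?T ?U) = ?x ?S (?x ?T ?U) + ?x ?S (g ?T ?U) + g ?S (?y ?T ?U)"
      by (simp add: g_def lmap_diff[OF linop_gprod_right])
    show ?thesis
      unfolding assoc_def 2 3 1 g_commute[of ?S "?y ?T ?U"] by (simp add: algebra_simps)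
  qed
  have "{#U, S, T#} = {#T, S, U#}" by (simp add: add_mset_commute)
  then show ?thesis
    unfolding expand[of T U] expand[of U T] 0 g_commute[of "basis T" "basis U"] by (simp only: add.commute)
qed

lemma assoc_diff: "assoc n k (p - q) r s = assoc n k p r s - assoc n k q r s"
  by (simp add: assoc_def lmap_diff[OF linop_gprod_left])

text \<open>
  The induction is on the tree acted upon.  A black vertex is the difference of two group-like ones, and
  these need the identity in the children for the corresponding products, which \<open>assoc_shift\<close> provides.
\<close>

lemma assoc_basis:
  "assoc n 0 (basis S) (basis T) (basis U) = (assoc n 0 (basis S) (basis U) (basis T) :: _ \<Rightarrow>\<^sub>0 'k::field)"
proof (induction S)
  case (White w F)
  then show ?case by (intro assoc_node[OF grafts_White]) auto
next
  case (Black c F)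
  show ?case
  proof (cases "c \<in> {1..n}")
    case True
    have *: "assoc n 0 (gblack k F :: _ \<Rightarrow>\<^sub>0 'k) (basis T) (basis U) = assoc n 0 (gblack k F) (basis U) (basis T)" if "k \<le> n" for k
    proof (rule assoc_node[OF grafts_gblack[OF that]])
      fix s assume "s \<in># F"
      then show "assoc n k (basis s) (basis T) (basis U) = (assoc n k (basis s) (basis U) (basis T) :: _ \<Rightarrow>\<^sub>0 'k)"
        by (intro assoc_shift[OF that] Black)
    qed
    have eq: "(basis (Black c F) :: _ \<Rightarrow>\<^sub>0 'k) = gblack c F - gblack (c - 1) F"
      using True by (cases c) (simp_all add: gblack_def)
    have "c \<le> n" "c - 1 \<le> n" using True by auto
    then show ?thesis unfolding eq assoc_diff by (simp only: *)
  next
    case False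
    then show ?thesis using Black by (intro assoc_node[OF grafts_Black_out]) auto
  qed
qed

theorem shared_bracket_gprod: "shared_bracket (lscale :: 'k::field \<Rightarrow> (('w, nat) gtree \<Rightarrow>\<^sub>0 'k) \<Rightarrow> _) (gprod n)"
proof (intro shared_bracket.intro shared_bracket_axioms.intro vector_space_lscale)
  fix k and a b c :: "('w, nat) gtree \<Rightarrow>\<^sub>0 'k"
  show "linop (\<lambda>a. gprod n k a b)" by (rule linop_gprod_left)
  show "linop (gprod n k a)" by (rule linop_gprod_right)
  show "gprod n k a b - gprod n k b a = gprod n 0 a b - gprod n 0 b a"
    using gprod_diff_commute[of n k a b] by (simp add: algebra_simps)
  have clip: "gprod n k = gprod n (min k n)" by (simp add: gprod_def[abs_def] fun_eq_iff)
  have lin1: "linop (\<lambda>p. assoc n k p q r)" for q r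
    unfolding assoc_def by (intro lmap_fun_diff linop_gprod_left lmap_compose[OF linop_gprod_left linop_gprod_left])
  have lin2: "linop (\<lambda>q. assoc n k p q r)" for p r
    unfolding assoc_def by (intro lmap_fun_diff lmap_compose[OF linop_gprod_right linop_gprod_left]
        lmap_compose[OF linop_gprod_left linop_gprod_right])
  have lin3: "linop (\<lambda>r. assoc n k p q r)" for p q
    unfolding assoc_def by (intro lmap_fun_diff linop_gprod_right lmap_compose[OF linop_gprod_right linop_gprod_right])
  have 1: "assoc n k (basis S) (basis T) (basis U) = assoc n k (basis S) (basis U) (basis T)" for S T U :: "('w, nat) gtree"
    unfolding assoc_def clip using assoc_shift[OF min.cobounded2 assoc_basis] unfolding assoc_def .
  have 2: "assoc n k (basis S) (basis T) c = assoc n k (basis S) c (basis T)" for S T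
    by (rule lmap_basis_eqI[where s = lscale and f = "\<lambda>r. assoc n k (basis S) (basis T) r"
          and g = "\<lambda>r. assoc n k (basis S) r (basis T)"]) (rule lin3 lin2 1)+
  have 3: "assoc n k (basis S) b c = assoc n k (basis S) c b" for S
    by (rule lmap_basis_eqI[where s = lscale and f = "\<lambda>q. assoc n k (basis S) q c"
          and g = "\<lambda>q. assoc n k (basis S) c q"]) (rule lin3 lin2 2)+
  have "assoc n k a b c = assoc n k a c b"
    by (rule lmap_basis_eqI[where s = lscale and f = "\<lambda>p. assoc n k p b c"
          and g = "\<lambda>p. assoc n k p c b"]) (rule lin1 3)+
  then show "gprod n k (gprod n k a b) c - gprod n k a (gprod n k b c)
      = gprod n k (gprod n k a c) b - gprod n k a (gprod n k c b)"
    by (simp add: assoc_def)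
qed


section \<open>Greg trees as a free algebra\<close>

interpretation G: shared_bracket "lscale :: 'k::field \<Rightarrow> (('w, nat) gtree \<Rightarrow>\<^sub>0 'k) \<Rightarrow> (('w, nat) gtree \<Rightarrow>\<^sub>0 'k)" "gprod n" for n
  by (rule shared_bracket_gprod)

abbreviation dot :: "'w \<Rightarrow> (('w, nat) gtree \<Rightarrow>\<^sub>0 'k::field)" where
  "dot w \<equiv> basis (White w {#})"

text \<open>
  A multilinear symmetric function with the same recursion as a node agrees with the node once it does
  so for \<open>m\<close> children.
\<close>

lemma graft_recursion_unique:
  fixes N :: "('w, nat) gtree multiset \<Rightarrow> (('w, nat) gtree \<Rightarrow>\<^sub>0 'k::field)"
  assumes N: "grafts n k N"
    and lin: "\<And>M. linop (\<lambda>a. Q (add_mset a M))"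
    and rec: "\<And>a M. m \<le> size M \<Longrightarrow>
      Q (add_mset a M) = gprod n 0 (Q M) a - (\<Sum>s\<in>#M. Q (add_mset (gprod n k s a) (M - {#s#})))"
    and base: "\<And>F. size F = m \<Longrightarrow> Q (image_mset basis F) = N F"
    and "m \<le> size F"
  shows "Q (image_mset basis F) = N F"
  using assms(5)
proof (induction "size F" arbitrary: F rule: less_induct)
  case less
  show ?case
  proof (cases "size F = m")
    case False
    then obtain T F' where F: "F = add_mset T F'" using less.prems by (cases F) auto
    have m: "m \<le> size F'" using False less.prems F by simp
    have IH: "Q (image_mset basis F'') = N F''" if "size F'' = size F'" for F''
      using less.hyps[of F''] that m F by simp
    have slot: "Q (add_mset p (image_mset basis (F' - {#s#}))) = slot N (F' - {#s#}) p" if s: "s \<in># F'" for s p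
    proof (rule lmap_basis_eqI[where s = lscale and f = "\<lambda>p. Q (add_mset p (image_mset basis (F' - {#s#})))"])
      show "Q (add_mset (basis t) (image_mset basis (F' - {#s#}))) = slot N (F' - {#s#}) (basis t)" for t
        using IH[of "add_mset t (F' - {#s#})"] s by (simp add: size_Suc_Diff1)
    qed (rule lin linop_slot)+
    have "Q (image_mset basis F) = gprod n 0 (Q (image_mset basis F')) (basis T)
        - (\<Sum>s\<in>#F'. Q (add_mset (gprod n k (basis s) (basis T)) (image_mset basis F' - {#basis s#})))"
      using rec[of "image_mset basis F'" "basis T"] m by (simp add: F image_mset.compositionality comp_def)
    also have "(\<Sum>s\<in>#F'. Q (add_mset (gprod n k (basis s) (basis T)) (image_mset basis F' - {#basis s#})))
        = (\<Sum>s\<in>#F'. slot N (F' - {#s#}) (gprod n k (basis s) (basis T)))"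
      by (rule arg_cong[of _ _ sum_mset], rule image_mset_cong) (simp add: slot[symmetric] image_mset_Diff)
    finally show ?thesis using N by (simp add: F IH grafts_def)
  qed (rule base)
qed

lemma white_brace_dot: "G.white_brace n (dot w) (image_mset basis F) = basis (White w F)"
  by (rule graft_recursion_unique[OF grafts_White, where m = 0]) (auto intro: G.lmap_white_brace G.white_brace_add)

lemma black_brace_gblack:
  assumes "k \<le> n" "2 \<le> size F"
  shows "G.black_brace n k (image_mset basis F) = gblack k F"
proof (rule graft_recursion_unique[OF grafts_gblack[OF assms(1)], where m = 2])
  fix F :: "('a, nat) gtree multiset"
  assume "size F = 2"
  then obtain S F' where F': "F = add_mset S F'" "size F' = 1" by (cases F) auto
  then obtain T where "F = {#S, T#}" by (metis size_1_singleton_mset)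
  then show "G.black_brace n k (image_mset basis F) = gblack k F"
    using assms(1) by (simp add: G.black_brace_pair gprod_basis min_absorb1)
next
  fix a and M :: "(('a, nat) gtree \<Rightarrow>\<^sub>0 'b) multiset"
  assume "2 \<le> size M"
  then have "M \<noteq> {#}" by auto
  then show "G.black_brace n k (add_mset a M) = gprod n 0 (G.black_brace n k M) a
      - (\<Sum>s\<in>#M. G.black_brace n k (add_mset (gprod n k s a) (M - {#s#})))"
    by (rule G.black_brace_add)
qed (use assms in \<open>auto intro: G.lmap_black_brace\<close>)

lemma black_brace_Black:
  assumes "c \<in> {1..n}" "2 \<le> size F"
  shows "G.black_brace n c (image_mset basis F) - G.black_brace n (c - 1) (image_mset basis F) = basis (Black c F)"
proof -
  have "gblack c F = gblack (c - 1) F + (basis (Black c F) :: _ \<Rightarrow>\<^sub>0 'b)"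
    using assms(1) by (cases c) (simp_all add: gblack_def)
  moreover have "c \<le> n" "c - 1 \<le> n" using assms(1) by auto
  ultimately show ?thesis using assms(2) by (simp add: black_brace_gblack)
qed

lemma relabel_simps:
  "relabel r (White w F) = White (r w) (image_mset (relabel r) F)"
  "relabel r (Black c F) = Black c (image_mset (relabel r) F)"
  by simp_all

text \<open>
  In the algebra of trees a tree is its own value: braces and nodes satisfy the same recursion.
\<close>

theorem tree_eval_dot: "greg {1..n} T \<Longrightarrow> G.tree_eval n (\<lambda>w. dot (r w)) T = (basis (relabel r T) :: _ \<Rightarrow>\<^sub>0 'k::field)"
proof (induction rule: greg.induct)
  case (1 F w)
  then have "image_mset (G.tree_eval n (\<lambda>w. dot (r w))) F = image_mset (basis :: _ \<Rightarrow> _ \<Rightarrow>\<^sub>0 'k) (image_mset (relabel r) F)"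
    unfolding image_mset.compositionality by (intro image_mset_cong) (simp only: comp_apply)
  then show ?case by (simp only: G.tree_eval.simps relabel_simps white_brace_dot)
next
  case (2 c F)
  then have "image_mset (G.tree_eval n (\<lambda>w. dot (r w))) F = image_mset (basis :: _ \<Rightarrow> _ \<Rightarrow>\<^sub>0 'k) (image_mset (relabel r) F)"
    unfolding image_mset.compositionality by (intro image_mset_cong) (simp only: comp_apply)
  then show ?case
    using 2(1,2) by (simp only: G.tree_eval.simps relabel_simps size_image_mset black_brace_Black)
qed

lemma relabel_id [simp]: "relabel (\<lambda>w. w) T = T"
  using gtree.map_id[of T] unfolding id_def[abs_def] .

lemma tree_eval_dot_id: "greg {1..n} T \<Longrightarrow> G.tree_eval n dot T = basis T"
  using tree_eval_dot[of n T "\<lambda>w. w"] by simp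

lemma keys_lext: "t \<in> Poly_Mapping.keys (lext lscale g p) \<Longrightarrow> \<exists>s\<in>Poly_Mapping.keys p. t \<in> Poly_Mapping.keys (g s)"
proof -
  assume "t \<in> Poly_Mapping.keys (lext lscale g p)"
  then obtain s where "s \<in> Poly_Mapping.keys p" "t \<in> Poly_Mapping.keys (lscale (Poly_Mapping.lookup p s) (g s))"
    unfolding lext_def using keys_sum[of "\<lambda>s. lscale (Poly_Mapping.lookup p s) (g s)" "Poly_Mapping.keys p"] by blast
  then show ?thesis by (auto simp: in_keys_iff lookup_lscale)
qed

definition supported :: "'x set \<Rightarrow> ('x \<Rightarrow>\<^sub>0 'k::field) set" where
  "supported A = {p. Poly_Mapping.keys p \<subseteq> A}"

lemma supported_basis [simp]: "basis t \<in> supported A \<longleftrightarrow> t \<in> A"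
  by (simp add: supported_def)

lemma supported_add: "p \<in> supported A \<Longrightarrow> q \<in> supported A \<Longrightarrow> p + q \<in> supported A"
  using keys_add[of p q] by (auto simp: supported_def)

lemma supported_diff: "p \<in> supported A \<Longrightarrow> q \<in> supported A \<Longrightarrow> p - q \<in> supported A"
  using keys_diff[of p q] by (auto simp: supported_def)

lemma supported_lscale: "p \<in> supported A \<Longrightarrow> lscale c p \<in> supported A"
  by (auto simp: supported_def in_keys_iff lookup_lscale)

lemma supported_zero [simp]: "0 \<in> supported A"
  by (simp add: supported_def)

lemma supported_sum: "(\<And>x. x \<in> S \<Longrightarrow> g x \<in> supported A) \<Longrightarrow> sum g S \<in> supported A"
  by (induction S rule: infinite_finite_induct) (auto intro: supported_add)

lemma supported_sum_mset: "(\<And>x. x \<in># M \<Longrightarrow> g x \<in> supported A) \<Longrightarrow> (\<Sum>x\<in>#M. g x) \<in> supported A"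
  by (induction M) (auto intro: supported_add)

lemma supported_lext:
  assumes "p \<in> supported A" "\<And>t. t \<in> A \<Longrightarrow> g t \<in> supported B"
  shows "lext lscale g p \<in> supported B"
proof -
  have "t \<in> B" if t: "t \<in> Poly_Mapping.keys (lext lscale g p)" for t
  proof -
    obtain s where "s \<in> Poly_Mapping.keys p" "t \<in> Poly_Mapping.keys (g s)" using keys_lext[OF t] by blast
    then show ?thesis using assms(1) assms(2)[of s] by (auto simp: supported_def)
  qed
  then show ?thesis by (auto simp: supported_def)
qed

definition coproduct_on :: "'c set \<Rightarrow> ('c, 'k::field) coproduct \<Rightarrow> bool" where
  "coproduct_on B \<Delta> \<longleftrightarrow> (\<forall>b\<in>B. \<Delta> b \<in> supported (B \<times> B))"

lemma coproduct_on_delta_max: "coproduct_on {1..n} (delta_max n)"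
  using coassoc_cocomm_delta_max[of n] unfolding coproduct_on_def coassoc_cocomm_def supported_def by blast

text \<open>
  The number of black vertices is only bounded from below, since fall products may increase it.
\<close>

definition graded_trees :: "'c set \<Rightarrow> 'w multiset \<Rightarrow> nat \<Rightarrow> ('w, 'c) gtree set" where
  "graded_trees B M r = {t. greg B t \<and> white_labels t = M \<and> r \<le> num_black t}"

lemma greg_White_iff [simp]: "greg B (White w F) \<longleftrightarrow> (\<forall>s\<in>#F. greg B s)"
  by (auto intro: greg.intros elim: greg.cases)

lemma greg_Black_iff [simp]: "greg B (Black c F) \<longleftrightarrow> c \<in> B \<and> 2 \<le> size F \<and> (\<forall>s\<in>#F. greg B s)"
  by (auto intro: greg.intros elim: greg.cases)

lemma fall_supported:
  assumes "coproduct_on B \<Delta>" "greg B S" "greg B T"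
  shows "fall \<Delta> S T \<in> supported (graded_trees B (white_labels S + white_labels T) (num_black S + num_black T))"
  using assms(2)
proof induction
  case (1 F w)
  have "in_forest (White w) F s (fall \<Delta> s T)
      \<in> supported (graded_trees B (white_labels (White w F) + white_labels T) (num_black (White w F) + num_black T))"
    if s: "s \<in># F" for s
  proof -
    obtain F' where F: "F = add_mset s F'" using s by (auto dest: multi_member_split)
    show ?thesis unfolding in_forest_eq
      by (rule supported_lext[OF 1(2)[OF s]]) (use 1 in \<open>auto simp: graded_trees_def F\<close>)
  qed
  moreover have "White w (F + {#T#}) \<in> graded_trees B (white_labels (White w F) + white_labels T) (num_black (White w F) + num_black T)"
    using 1 assms(3) by (auto simp: graded_trees_def)
  ultimately show ?case by (auto intro!: supported_add supported_sum_mset)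
next
  case (2 c F)
  let ?A = "graded_trees B (white_labels (Black c F) + white_labels T) (num_black (Black c F) + num_black T)"
  have "in_forest (Black c) F s (fall \<Delta> s T) \<in> supported ?A" if s: "s \<in># F" for s
  proof -
    obtain F' where F: "F = add_mset s F'" using s by (auto dest: multi_member_split)
    show ?thesis unfolding in_forest_eq
      by (rule supported_lext[OF 2(4)[OF s]]) (use 2 in \<open>auto simp: graded_trees_def F\<close>)
  qed
  moreover have "lin (\<lambda>(c1, c2). basis (Black c1 (F - {#s#} + {#Black c2 {#s, T#}#}))) (\<Delta> c) \<in> supported ?A" if s: "s \<in># F" for s
  proof -
    obtain F' where F: "F = add_mset s F'" using s by (auto dest: multi_member_split)
    have "\<Delta> c \<in> supported (B \<times> B)" using assms(1) 2(1) by (simp add: coproduct_on_def)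
    then show ?thesis unfolding lin_eq_lext
      by (rule supported_lext) (use 2 assms(3) in \<open>auto simp: graded_trees_def F\<close>)
  qed
  moreover have "Black c (F + {#T#}) \<in> ?A"
    using 2 assms(3) by (auto simp: graded_trees_def)
  ultimately show ?case by (auto intro!: supported_add supported_sum_mset)
qed

lemma gprod_supported:
  assumes "p \<in> supported (graded_trees {1..n} M r)" "q \<in> supported (graded_trees {1..n} M' r')"
  shows "gprod n k p q \<in> supported (graded_trees {1..n} (M + M') (r + r'))"
  unfolding gprod_def
proof (rule supported_lext[OF assms(1)], rule supported_lext[OF assms(2)])
  fix S T :: "('a, nat) gtree"
  assume S: "S \<in> graded_trees {1..n} M r" and T: "T \<in> graded_trees {1..n} M' r'"
  have "graded_trees {1..n} (M + M') (num_black S + num_black T) \<subseteq> graded_trees {1..n} (M + M') (r + r')"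
    using S T by (auto simp: graded_trees_def)
  then have "fall (delta_max n) S T \<in> (supported (graded_trees {1..n} (M + M') (r + r')) :: (_ \<Rightarrow>\<^sub>0 'b) set)"
    using fall_supported[OF coproduct_on_delta_max, of n S T] S T by (auto simp: graded_trees_def supported_def)
  moreover have "gblack (min k n) {#S, T#} \<in> (supported (graded_trees {1..n} (M + M') (r + r')) :: (_ \<Rightarrow>\<^sub>0 'b) set)"
    unfolding gblack_def by (rule supported_sum) (use S T in \<open>auto simp: graded_trees_def\<close>)
  ultimately show "fall (delta_max n) S T + gblack (min k n) {#S, T#} \<in> (supported (graded_trees {1..n} (M + M') (r + r')) :: (_ \<Rightarrow>\<^sub>0 'b) set)"
    by (rule supported_add)
qed

text \<open>
  The type of trees also contains black vertices with foreign labels or with fewer than two children;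
  evaluation is a homomorphism only on the span of the Greg trees.
\<close>

definition greg_span :: "nat \<Rightarrow> (('w, nat) gtree \<Rightarrow>\<^sub>0 'k::field) set" where
  "greg_span n = supported {t. greg {1..n} t}"

lemma greg_span_basis: "basis t \<in> greg_span n \<longleftrightarrow> greg {1..n} t"
  by (simp add: greg_span_def)

lemma greg_span_diff: "p \<in> greg_span n \<Longrightarrow> q \<in> greg_span n \<Longrightarrow> p - q \<in> greg_span n"
  unfolding greg_span_def by (rule supported_diff)

lemma greg_span_minus: "p \<in> greg_span n \<Longrightarrow> - p \<in> greg_span n"
  using greg_span_diff[of 0 n p] by (simp add: greg_span_def)

lemma greg_span_sum_list: "set L \<subseteq> greg_span n \<Longrightarrow> sum_list L \<in> greg_span n"
  unfolding greg_span_def by (induction L) (auto intro: supported_add)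

lemma gprod_greg_span:
  assumes "p \<in> greg_span n" "q \<in> greg_span n"
  shows "gprod n k p q \<in> greg_span n"
  unfolding gprod_def greg_span_def
proof (rule supported_lext[OF assms(1)[unfolded greg_span_def]], rule supported_lext[OF assms(2)[unfolded greg_span_def]])
  fix S T :: "('a, nat) gtree"
  assume "S \<in> {t. greg {1..n} t}" "T \<in> {t. greg {1..n} t}"
  then have "gprod n k (basis S) (basis T) \<in> (supported (graded_trees {1..n} (white_labels S + white_labels T) (0 + 0)) :: (_ \<Rightarrow>\<^sub>0 'b) set)"
    by (intro gprod_supported) (auto simp: graded_trees_def)
  then show "fall (delta_max n) S T + gblack (min k n) {#S, T#} \<in> (supported {t. greg {1..n} t} :: (_ \<Rightarrow>\<^sub>0 'b) set)"
    by (auto simp: gprod_basis supported_def graded_trees_def)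
qed

context shared_bracket
begin

abbreviation hom :: "('w \<Rightarrow> 'a) \<Rightarrow> (('w, nat) gtree \<Rightarrow>\<^sub>0 'k) \<Rightarrow> 'a" where
  "hom f \<equiv> lext scale (tree_eval f)"

text \<open>
  By \<open>tree_eval_fall\<close> the fall product becomes \<open>pr 0\<close>, and the trees with a black root telescope to the
  difference of \<open>pr k\<close> and \<open>pr 0\<close>.
\<close>

theorem hom_gprod:
  fixes f :: "'w \<Rightarrow> 'a" and p q :: "('w, nat) gtree \<Rightarrow>\<^sub>0 'k"
  assumes "p \<in> greg_span n"
  shows "hom f (gprod n k p q) = pr (min k n) (hom f p) (hom f q)"
proof -
  have "hom f (gprod n k (basis S) q) = pr (min k n) (tree_eval f S) (hom f q)" if S: "greg {1..n} S" for S
  proof (rule lmap_basis_eqI[where s = scale and f = "\<lambda>q. hom f (gprod n k (basis S) q)"])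
    show "lmap lscale scale (\<lambda>q. hom f (gprod n k (basis S) q))"
      by (rule lmap_compose[OF linop_gprod_right lmap_lext])
    show "lmap lscale scale (\<lambda>q. pr (min k n) (tree_eval f S) (hom f q))"
      by (rule lmap_compose[OF lmap_lext lmap_pr_right])
    have "hom f (gblack j {#S, T#}) = pr j (tree_eval f S) (tree_eval f T) - pr 0 (tree_eval f S) (tree_eval f T)" for j T
      unfolding gblack_def lmap_sum[OF lmap_lext]
      using telescope[of "\<lambda>j. pr j (tree_eval f S) (tree_eval f T)" j] by (simp only: lext_basis tree_eval_black_pair)
    then show "hom f (gprod n k (basis S) (basis T)) = pr (min k n) (tree_eval f S) (hom f (basis T))" for T
      using S by (simp add: gprod_basis lext_add tree_eval_fall)
  qed
  note basis_case = this
  have "hom f (gprod n k p q) = lext scale (\<lambda>S. hom f (gprod n k (basis S) q)) p"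
    by (rule lmap_eq_lext[OF lmap_compose[OF linop_gprod_left lmap_lext]])
  also have "\<dots> = lext scale (\<lambda>S. pr (min k n) (tree_eval f S) (hom f q)) p"
    by (rule lext_cong, rule basis_case) (use assms in \<open>auto simp: supported_def greg_span_def\<close>)
  also have "\<dots> = lext scale (\<lambda>S. pr (min k n) (hom f (basis S)) (hom f q)) p" by simp
  also have "\<dots> = pr (min k n) (hom f p) (hom f q)"
    by (rule lmap_eq_lext[OF lmap_compose[OF lmap_lext lmap_pr_left], symmetric])
  finally show ?thesis .
qed

end

lemma gprod_clip: "gprod n (min k n) = gprod n k"
  by (simp add: gprod_def[abs_def] fun_eq_iff)

lemma tower_greg_span:
  fixes L :: "(('w, nat) gtree \<Rightarrow>\<^sub>0 'k::field) list"
  assumes "\<And>L. length L \<le> N \<Longrightarrow> set L \<subseteq> greg_span n \<Longrightarrow> b L \<in> greg_span n" "set L \<subseteq> greg_span n"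
  shows "G.tower n k N b L \<in> greg_span n"
  by (rule G.tower_closed[where Y = "greg_span n"]) (auto intro: greg_span_diff gprod_greg_span assms dest: subsetD[OF assms(2)])

lemma white_brace_greg_span:
  assumes "z \<in> greg_span n" "set_mset M \<subseteq> greg_span n"
  shows "G.white_brace n z M \<in> greg_span n"
proof -
  obtain L where "mset L = M" using ex_mset by blast
  then show ?thesis using assms unfolding G.white_brace_mset[symmetric] by (metis tower_greg_span G.white_brace_mset set_mset_mset)
qed

lemma black_brace_greg_span:
  assumes "set_mset M \<subseteq> greg_span n"
  shows "G.black_brace n k M \<in> greg_span n"
proof -
  obtain L where L: "mset L = M" using ex_mset by blast
  have "G.tower n k 1 (\<lambda>L. - sum_list L) L \<in> greg_span n"
    by (rule tower_greg_span) (use assms L in \<open>auto intro: greg_span_minus greg_span_sum_list\<close>)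
  then show ?thesis using L by (metis G.black_brace_mset)
qed

lemma tree_eval_greg_span:
  assumes "greg {1..n} T" "\<And>w. w \<in># white_labels T \<Longrightarrow> g w \<in> greg_span n"
  shows "G.tree_eval n g T \<in> greg_span n"
  using assms
proof induction
  case (1 F w)
  then have "G.tree_eval n g s \<in> greg_span n" if "s \<in># F" for s using that by auto
  then show ?case using 1(3)[of w] by (auto intro!: white_brace_greg_span)
next
  case (2 c F)
  then have "G.tree_eval n g s \<in> greg_span n" if "s \<in># F" for s using that by auto
  then show ?case by (auto intro!: greg_span_diff black_brace_greg_span)
qed

text \<open>
  A homomorphism commutes with braces, which are iterated products.
\<close>

theorem hom_tree_eval:
  fixes f g :: "'w \<Rightarrow> (('w, nat) gtree \<Rightarrow>\<^sub>0 'k::field)"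
  assumes "greg {1..n} T" "\<And>w. w \<in># white_labels T \<Longrightarrow> g w \<in> greg_span n"
  shows "G.hom n f (G.tree_eval n g T) = G.tree_eval n (\<lambda>w. G.hom n f (g w)) T"
  using assms
proof induction
  let ?H = "G.hom n f" and ?b = "\<lambda>L. - sum_list L :: ('w, nat) gtree \<Rightarrow>\<^sub>0 'k"
  have H: "?H (gprod n l a b) = gprod n l (?H a) (?H b)" if "a \<in> greg_span n" for l a b
    using G.hom_gprod[OF that, of n f l b] by (simp add: gprod_clip)
  have tower: "?H (G.tower n k N b L) = G.tower n k N b' (map ?H L)"
    if "\<And>L. length L \<le> N \<Longrightarrow> set L \<subseteq> greg_span n \<Longrightarrow> b L \<in> greg_span n"
      "\<And>L. length L \<le> N \<Longrightarrow> set L \<subseteq> greg_span n \<Longrightarrow> ?H (b L) = b' (map ?H L)" "set L \<subseteq> greg_span n" for k N b b' L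
    by (rule G.tower_hom[where Y = "greg_span n" and H = ?H and b' = b'])
       (simp_all add: greg_span_diff gprod_greg_span that H pm.lmap_lext)
  {
    case (1 F w)
    have IH: "image_mset ?H (image_mset (G.tree_eval n g) F) = image_mset (G.tree_eval n (\<lambda>w. ?H (g w))) F"
      unfolding image_mset.compositionality using 1 by (intro image_mset_cong) auto
    have sp: "G.tree_eval n g s \<in> greg_span n" if "s \<in># F" for s
      by (rule tree_eval_greg_span) (use 1 that in auto)
    obtain L where L: "mset L = image_mset (G.tree_eval n g) F" using ex_mset by blast
    have "?H (G.tower n 0 0 (\<lambda>_. g w) L) = G.tower n 0 0 (\<lambda>_. ?H (g w)) (map ?H L)"
    proof (rule tower)
      have "set L = G.tree_eval n g ` set_mset F" using arg_cong[OF L, of set_mset] by simp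
      then show "set L \<subseteq> greg_span n" using sp by auto
    qed (use 1(3)[of w] in auto)
    then show ?case
      by (simp add: IH[symmetric] L[symmetric] G.white_brace_mset flip: mset_map)
  next
    case (2 c F)
    have IH: "image_mset ?H (image_mset (G.tree_eval n g) F) = image_mset (G.tree_eval n (\<lambda>w. ?H (g w))) F"
      unfolding image_mset.compositionality using 2 by (intro image_mset_cong) auto
    have sp: "G.tree_eval n g s \<in> greg_span n" if "s \<in># F" for s
      by (rule tree_eval_greg_span) (use 2 that in auto)
    obtain L where L: "mset L = image_mset (G.tree_eval n g) F" using ex_mset by blast
    have base: "?H (?b K) = ?b (map ?H K)" if "length K \<le> 1" for K
      using that by (cases K) (auto simp: lmap_minus[OF pm.lmap_lext])
    have "?H (G.tower n k 1 ?b L) = G.tower n k 1 ?b (map ?H L)" for k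
    proof (rule tower)
      have "set L = G.tree_eval n g ` set_mset F" using arg_cong[OF L, of set_mset] by simp
      then show "set L \<subseteq> greg_span n" using sp by auto
    qed (simp_all add: greg_span_minus greg_span_sum_list base)
    then show ?case
      by (simp add: IH[symmetric] L[symmetric] G.black_brace_mset lmap_diff[OF pm.lmap_lext] flip: mset_map)
  }
qed

section \<open>Braces and insertion of trees\<close>

lemma brace_eq_tower:
  "(brace (delta_max n) S Ts :: ('w, nat) gtree \<Rightarrow>\<^sub>0 'k::field) = G.tower n 0 0 (\<lambda>_. basis S) (map basis Ts)"
proof (induction "delta_max n :: (nat, 'k) coproduct" S Ts rule: brace.induct)
  case (1 S)
  then show ?case by (simp add: G.tower_base)
next
  case (2 S Ts T)
  let ?t = "G.tower n 0 0 (\<lambda>_. basis S) :: (('w, nat) gtree \<Rightarrow>\<^sub>0 'k) list \<Rightarrow> _"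
  have fall0: "lin (\<lambda>U. fall (delta_max n) U T) p = gprod n 0 p (basis T)" for p :: "_ \<Rightarrow>\<^sub>0 'k"
    by (simp add: gprod_def lin_eq_lext)
  have "lin (\<lambda>U. brace (delta_max n) S (Ts[i := U])) (fall (delta_max n) (Ts ! i) T)
      = ?t ((map basis Ts)[i := gprod n 0 (basis (Ts ! i)) (basis T)])" if i: "i < length Ts" for i
  proof -
    have m: "linop (\<lambda>p :: _ \<Rightarrow>\<^sub>0 'k. ?t ((map basis Ts)[i := p]))"
      using G.multilinear_w[of n "basis S :: _ \<Rightarrow>\<^sub>0 'k"] i by (simp add: G.multilinear_def)
    show ?thesis
      using lmap_eq_lext[OF m, of "gprod n 0 (basis (Ts ! i)) (basis T)"] 2(2) i
      by (simp add: lin_eq_lext gprod_basis map_update)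
  qed
  then show ?case
    using 2(1) by (simp add: fall0 G.tower_snoc G.deriv_def)
qed

lemma white_brace_dot_slot: "G.white_brace n (dot w) (add_mset p (image_mset basis F)) = slot (\<lambda>M. basis (White w M)) F p"
proof (rule lmap_basis_eqI[where s = lscale and f = "\<lambda>p. G.white_brace n (dot w) (add_mset p (image_mset basis F))"])
  show "G.white_brace n (dot w) (add_mset (basis t) (image_mset basis F)) = slot (\<lambda>M. basis (White w M)) F (basis t)" for t
    using white_brace_dot[of n w "add_mset t F"] by simp
qed (rule G.lmap_white_brace linop_slot)+

lemma black_brace_Black_slot:
  assumes "c \<in> {1..n}" "F \<noteq> {#}"
  shows "G.black_brace n c (add_mset p (image_mset basis F)) - G.black_brace n (c - 1) (add_mset p (image_mset basis F))
    = slot (\<lambda>M. basis (Black c M)) F p"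
proof (rule lmap_basis_eqI[where s = lscale and
    f = "\<lambda>p. G.black_brace n c (add_mset p (image_mset basis F)) - G.black_brace n (c - 1) (add_mset p (image_mset basis F))"])
  have "2 \<le> size (add_mset t F)" for t using assms(2) by (cases F) auto
  then show "G.black_brace n c (add_mset (basis t) (image_mset basis F)) - G.black_brace n (c - 1) (add_mset (basis t) (image_mset basis F))
      = slot (\<lambda>M. basis (Black c M)) F (basis t)" for t
    using black_brace_Black[OF assms(1), of "add_mset t F"] by simp
qed (intro linop_slot lmap_fun_diff G.lmap_black_brace)+

text \<open>
  The label \<open>i\<close> occurs once, so only the vertices on the path to it are affected; subtrees off the path
  are their own values.
\<close>

theorem insert_tree_eq_tree_eval:
  fixes T S :: "('w, nat) gtree"
  assumes "greg {1..n} T" "count (white_labels T) i = 1"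
  shows "insert_tree (delta_max n) i S T = (G.tree_eval n (dot(i := basis S)) T :: _ \<Rightarrow>\<^sub>0 'k::field)"
  using assms
proof induction
  let ?e = "G.tree_eval n (dot(i := basis S)) :: _ \<Rightarrow> _ \<Rightarrow>\<^sub>0 'k"
  have id: "image_mset ?e F = image_mset basis F"
    if "\<And>s. s \<in># F \<Longrightarrow> greg {1..n} s" "\<And>s. s \<in># F \<Longrightarrow> i \<notin># white_labels s" for F :: "('w, nat) gtree multiset"
  proof (rule image_mset_cong)
    fix s assume s: "s \<in># F"
    show "?e s = basis s" by (simp only: G.tree_eval_upd_idle[OF that(2)[OF s]] tree_eval_dot_id[OF that(1)[OF s]])
  qed
  {
    case (1 F w)
    show ?case
    proof (cases "w = i")
      case True
      then have c0: "count (\<Sum>\<^sub># (image_mset white_labels F)) i = 0" using 1 by simp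
      have none: "i \<notin># white_labels s" if "s \<in># F" for s
        using c0 that by (auto dest!: multi_member_split simp: not_in_iff)
      have some: "mset (SOME Ts. mset Ts = F) = F" by (metis (mono_tags) ex_mset someI_ex)
      have "G.tower n 0 0 (\<lambda>_. basis S) (map basis (SOME Ts. mset Ts = F)) = (G.white_brace n (basis S) (image_mset basis F) :: _ \<Rightarrow>\<^sub>0 'k)"
        by (simp only: G.white_brace_mset[symmetric] mset_map some)
      then show ?thesis using True id[OF 1(1) none] by (simp add: brace_eq_tower del: fun_upd_apply add: fun_upd_same)
    next
      case False
      then have "count (\<Sum>\<^sub># (image_mset white_labels F)) i = 1" using 1 by simp
      then obtain s F' where s: "F = add_mset s F'" "count (white_labels s) i = 1" "\<And>r. r \<in># F' \<Longrightarrow> i \<notin># white_labels r"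
        by (rule count_sum_mset_eq_1) blast
      have "i \<in># white_labels s" using s(2) by (metis count_inI zero_neq_one)
      moreover have "filter_mset (\<lambda>s. i \<in># white_labels s) F' = {#}" using s(3) by simp
      ultimately have "{#s \<in># F. i \<in># white_labels s#} = {#s#}" by (simp add: s(1))
      moreover have "image_mset ?e F' = image_mset basis F'" by (rule id) (use 1 s in auto)
      ultimately show ?thesis
        using 1(2)[of s] s(1,2) False white_brace_dot_slot[of n w "?e s" F']
        by (simp add: in_forest_slot del: fun_upd_apply add: fun_upd_other)
    qed
  next
    case (2 c F)
    then have "count (\<Sum>\<^sub># (image_mset white_labels F)) i = 1" by simp
    then obtain s F' where s: "F = add_mset s F'" "count (white_labels s) i = 1" "\<And>r. r \<in># F' \<Longrightarrow> i \<notin># white_labels r"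
      by (rule count_sum_mset_eq_1) blast
    have "i \<in># white_labels s" using s(2) by (metis count_inI zero_neq_one)
    moreover have "filter_mset (\<lambda>s. i \<in># white_labels s) F' = {#}" using s(3) by simp
    ultimately have "{#s \<in># F. i \<in># white_labels s#} = {#s#}" by (simp add: s(1))
    moreover have "image_mset ?e F' = image_mset basis F'" by (rule id) (use 2 s in auto)
    moreover have "F' \<noteq> {#}" using 2(2) s(1) by auto
    ultimately show ?case
      using 2(4)[of s] s(1,2) black_brace_Black_slot[OF 2(1), of F' "?e s"]
      by (simp add: in_forest_slot del: fun_upd_apply)
  }
qed


section \<open>Substitution into Greg trees\<close>

lemma tree_eval_relabel: "G.tree_eval n f (relabel r T) = G.tree_eval n (\<lambda>w. f (r w)) T"
proof (induction T)
  case (White w F)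
  then have "image_mset (G.tree_eval n f) (image_mset (relabel r) F) = image_mset (G.tree_eval n (\<lambda>w. f (r w))) F"
    unfolding image_mset.compositionality by (intro image_mset_cong) (simp only: comp_apply)
  then show ?case by (simp only: G.tree_eval.simps relabel_simps)
next
  case (Black c F)
  then have "image_mset (G.tree_eval n f) (image_mset (relabel r) F) = image_mset (G.tree_eval n (\<lambda>w. f (r w))) F"
    unfolding image_mset.compositionality by (intro image_mset_cong) (simp only: comp_apply)
  then show ?case by (simp only: G.tree_eval.simps relabel_simps)
qed

lemma white_labels_relabel: "white_labels (relabel r T) = image_mset r (white_labels T)"
proof (induction T)
  case (White w F)
  then have "image_mset white_labels (image_mset (relabel r) F) = image_mset (\<lambda>s. image_mset r (white_labels s)) F"
    unfolding image_mset.compositionality by (intro image_mset_cong) (simp only: comp_apply)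
  moreover have "(\<Sum>s\<in>#F. image_mset r (white_labels s)) = image_mset r (\<Sum>\<^sub># (image_mset white_labels F))"
    by (induction F) auto
  ultimately show ?case by (simp only: white_labels.simps relabel_simps image_mset_add_mset)
next
  case (Black c F)
  then have "image_mset white_labels (image_mset (relabel r) F) = image_mset (\<lambda>s. image_mset r (white_labels s)) F"
    unfolding image_mset.compositionality by (intro image_mset_cong) (simp only: comp_apply)
  moreover have "(\<Sum>s\<in>#F. image_mset r (white_labels s)) = image_mset r (\<Sum>\<^sub># (image_mset white_labels F))"
    by (induction F) auto
  ultimately show ?case by (simp only: white_labels.simps relabel_simps)
qed

lemma num_black_relabel: "num_black (relabel r T) = num_black T"
proof (induction T)
  case (White w F)
  then have "image_mset num_black (image_mset (relabel r) F) = image_mset num_black F"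
    unfolding image_mset.compositionality by (intro image_mset_cong) (simp only: comp_apply)
  then show ?case by (simp only: num_black.simps relabel_simps)
next
  case (Black w F)
  then have "image_mset num_black (image_mset (relabel r) F) = image_mset num_black F"
    unfolding image_mset.compositionality by (intro image_mset_cong) (simp only: comp_apply)
  then show ?case by (simp only: num_black.simps relabel_simps)
qed

lemma greg_relabel: "greg B T \<Longrightarrow> greg B (relabel r T)"
  by (induction rule: greg.induct) (auto simp only: relabel_simps greg_White_iff greg_Black_iff size_image_mset set_image_mset)

lemma greg_labels_nonempty: "greg B T \<Longrightarrow> white_labels T \<noteq> {#}"
proof (induction rule: greg.induct)
  case (2 c F)
  then obtain s F' where "F = add_mset s F'" by (cases F) auto
  then show ?case using 2 by auto
qed simp

lemma white_brace_graded:
  fixes g :: "'b \<Rightarrow> (('w, nat) gtree \<Rightarrow>\<^sub>0 'k::field)"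
  assumes "z \<in> supported (graded_trees {1..n} M0 0)" "\<And>s. s \<in># F \<Longrightarrow> g s \<in> supported (graded_trees {1..n} (d s) 0)"
  shows "G.white_brace n z (image_mset g F) \<in> supported (graded_trees {1..n} (M0 + (\<Sum>s\<in>#F. d s)) 0)"
proof -
  obtain L where L: "mset L = F" using ex_mset by blast
  have "G.tower n 0 0 (\<lambda>_. z) (map g L) \<in> supported (graded_trees {1..n} (M0 + sum_list (map d L)) 0)"
  proof (rule G.tower_graded)
    show "list_all2 (\<lambda>a m. a \<in> supported (graded_trees {1..n} m 0)) (map g L) (map d L)"
      using assms(2) L by (auto simp: list_all2_conv_all_nth)
  qed (use assms(1) gprod_supported[where r = 0 and r' = 0] in \<open>auto intro: supported_diff\<close>)
  moreover have "sum_list (map d L) = (\<Sum>s\<in>#F. d s)"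
    by (metis L mset_map sum_mset_sum_list)
  ultimately show ?thesis using L by (simp add: G.white_brace_mset[symmetric])
qed

lemma black_brace_graded:
  fixes g :: "'b \<Rightarrow> (('w, nat) gtree \<Rightarrow>\<^sub>0 'k::field)"
  assumes "\<And>s. s \<in># F \<Longrightarrow> g s \<in> supported (graded_trees {1..n} (d s) 0)"
  shows "G.black_brace n k (image_mset g F) \<in> supported (graded_trees {1..n} (\<Sum>s\<in>#F. d s) 0)"
proof -
  obtain L where L: "mset L = F" using ex_mset by blast
  have "G.tower n k 1 (\<lambda>L. - sum_list L) (map g L) \<in> supported (graded_trees {1..n} ({#} + sum_list (map d L)) 0)"
  proof (rule G.tower_graded)
    show "list_all2 (\<lambda>a m. a \<in> supported (graded_trees {1..n} m 0)) (map g L) (map d L)"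
      using assms L by (auto simp: list_all2_conv_all_nth)
    fix L :: "(('w, nat) gtree \<Rightarrow>\<^sub>0 'k) list" and ms
    assume "length L \<le> 1" "list_all2 (\<lambda>a m. a \<in> supported (graded_trees {1..n} m 0)) L ms"
    then show "- sum_list L \<in> supported (graded_trees {1..n} ({#} + sum_list ms) 0)"
      using supported_diff[OF supported_zero] by (cases L; cases ms) fastforce+
  qed (use gprod_supported[where r = 0 and r' = 0] in \<open>auto intro: supported_diff\<close>)
  moreover have "sum_list (map d L) = (\<Sum>s\<in>#F. d s)"
    by (metis L mset_map sum_mset_sum_list)
  moreover have "G.black_brace n k (image_mset g F) = G.tower n k 1 (\<lambda>L. - sum_list L) (map g L)"
    by (simp only: G.black_brace_mset[symmetric] mset_map L)
  ultimately show ?thesis by simp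
qed

lemma sum_mset_Union: "(\<Sum>x\<in>#\<Sum>\<^sub># (image_mset l F). h x) = (\<Sum>s\<in>#F. \<Sum>x\<in>#l s. h x)"
  by (induction F) auto

lemma tree_eval_graded:
  fixes f :: "'w \<Rightarrow> (('w, nat) gtree \<Rightarrow>\<^sub>0 'k::field)"
  assumes "\<And>w. w \<in># white_labels T \<Longrightarrow> f w \<in> supported (graded_trees {1..n} (h w) 0)"
  shows "G.tree_eval n f T \<in> supported (graded_trees {1..n} (\<Sum>w\<in>#white_labels T. h w) 0)"
  using assms
proof (induction T)
  case (White w F)
  have "G.white_brace n (f w) (image_mset (G.tree_eval n f) F) \<in> supported (graded_trees {1..n} (h w + (\<Sum>s\<in>#F. \<Sum>w\<in>#white_labels s. h w)) 0)"
    by (rule white_brace_graded) (use White in auto)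
  then show ?case by (simp add: sum_mset_Union)
next
  case (Black c F)
  have "G.black_brace n k (image_mset (G.tree_eval n f) F) \<in> supported (graded_trees {1..n} (\<Sum>s\<in>#F. \<Sum>w\<in>#white_labels s. h w) 0)" for k
    by (rule black_brace_graded) (use Black in auto)
  then show ?case by (simp add: sum_mset_Union supported_diff)
qed

definition arity_space :: "nat \<Rightarrow> 'w set \<Rightarrow> (('w, nat) gtree \<Rightarrow>\<^sub>0 'k::field) set" where
  "arity_space n W = supported (greg_trees {1..n} W)"

lemma arity_space_graded_trees: "arity_space n W = supported (graded_trees {1..n} (mset_set W) 0)"
  by (simp add: arity_space_def greg_trees_def graded_trees_def)

lemma arity_spaceD: "p \<in> arity_space n W \<Longrightarrow> t \<in> Poly_Mapping.keys p \<Longrightarrow> greg {1..n} t \<and> white_labels t = mset_set W"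
  unfolding arity_space_def supported_def greg_trees_def by blast

lemma arity_space_greg_span: "p \<in> arity_space n W \<Longrightarrow> p \<in> greg_span n"
  unfolding arity_space_def greg_span_def supported_def greg_trees_def by blast

lemma hom_cong:
  assumes "p \<in> arity_space n W" "finite W" "\<And>w. w \<in> W \<Longrightarrow> f w = g w"
  shows "G.hom n f p = G.hom n g p"
  by (intro pm.lext_cong G.tree_eval_cong) (use assms arity_spaceD[OF assms(1)] in auto)

lemma hom_hom:
  fixes f g :: "'w \<Rightarrow> (('w, nat) gtree \<Rightarrow>\<^sub>0 'k::field)"
  assumes "p \<in> arity_space n W" "finite W" "\<And>w. w \<in> W \<Longrightarrow> g w \<in> greg_span n"
  shows "G.hom n f (G.hom n g p) = G.hom n (\<lambda>w. G.hom n f (g w)) p"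
  unfolding pm.lext_compose
  by (intro pm.lext_cong hom_tree_eval) (use assms arity_spaceD[OF assms(1)] in auto)

lemma hom_dot: "p \<in> greg_span n \<Longrightarrow> G.hom n dot p = p"
proof -
  assume "p \<in> greg_span n"
  then have "G.hom n dot p = lext lscale basis p"
    by (intro pm.lext_cong tree_eval_dot_id) (auto simp: greg_span_def supported_def)
  then show ?thesis by simp
qed

lemma dot_greg_span: "dot w \<in> greg_span n"
  by (simp add: greg_span_basis)

lemma hom_closed:
  fixes f :: "'w \<Rightarrow> (('w, nat) gtree \<Rightarrow>\<^sub>0 'k::field)"
  assumes "p \<in> arity_space n W" "finite W" "\<And>w. w \<in> W \<Longrightarrow> f w \<in> arity_space n (h w)"
    and "(\<Sum>w\<in>W. mset_set (h w)) = mset_set U"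
  shows "G.hom n f p \<in> arity_space n U"
  unfolding arity_space_graded_trees
proof (rule supported_lext[OF assms(1)[unfolded arity_space_graded_trees]])
  fix T assume T: "T \<in> graded_trees {1..n} (mset_set W) 0"
  have "G.tree_eval n f T \<in> supported (graded_trees {1..n} (\<Sum>w\<in>#white_labels T. mset_set (h w)) 0)"
    by (rule tree_eval_graded) (use T assms(2,3) in \<open>auto simp: graded_trees_def arity_space_graded_trees\<close>)
  moreover have "(\<Sum>w\<in>#white_labels T. mset_set (h w)) = mset_set U"
    using T assms(4) by (simp add: graded_trees_def sum_unfold_sum_mset)
  ultimately show "G.tree_eval n f T \<in> supported (graded_trees {1..n} (mset_set U) 0)" by simp
qed

lemma dot_arity_space: "dot w \<in> arity_space n {w}"
  by (simp add: arity_space_graded_trees graded_trees_def)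

section \<open>The operad of Greg trees\<close>

text \<open>
  The elements that are substituted for the white labels in a partial composition with \<open>q\<close> at \<open>i\<close>.
\<close>

definition plug :: "nat \<Rightarrow> nat \<Rightarrow> nat \<Rightarrow> ((nat, nat) gtree \<Rightarrow>\<^sub>0 'k::field) \<Rightarrow> nat \<Rightarrow> ((nat, nat) gtree \<Rightarrow>\<^sub>0 'k)" where
  "plug n k i q = (\<lambda>w. dot (shift i k w))(i := G.hom n (\<lambda>j. dot (i - 1 + j)) q)"

abbreviation gop :: "nat \<Rightarrow> ('k::field, (nat, nat) gtree \<Rightarrow>\<^sub>0 'k) operad" where
  "gop n \<equiv> greg_operad {1..n} (delta_max n)"

lemma greg_operad_simps:
  "els (greg_operad B \<Delta>) m = supported (greg_trees B {1..m})"
  "p \<oplus>\<^bsub>sp (greg_operad B \<Delta>) m\<^esub> q = p + q" "c \<odot>\<^bsub>sp (greg_operad B \<Delta>) m\<^esub> p = lscale c p"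
  "\<zero>\<^bsub>sp (greg_operad B \<Delta>) m\<^esub> = 0" "ident (greg_operad B \<Delta>) = dot 1"
  "act (greg_operad B \<Delta>) m p \<sigma> = lext lscale (\<lambda>t. basis (relabel (Hilbert_Choice.inv \<sigma>) t)) p"
  "pcomp (greg_operad B \<Delta>) m k i p q = lext lscale (\<lambda>T. lext lscale (\<lambda>S.
          insert_tree \<Delta> i (relabel (\<lambda>j. i - 1 + j) S) (relabel ((shift i k)(i := i)) T)) q) p"
  by (simp_all add: greg_operad_def linear_space_def supported_def lin_eq_lext)

lemma els_gop: "els (gop n) m = arity_space n {1..m}"
  by (simp only: greg_operad_simps arity_space_def)

lemma act_gop:
  assumes "p \<in> arity_space n {1..m}"
  shows "act (gop n) m p \<sigma> = G.hom n (\<lambda>w. dot (Hilbert_Choice.inv \<sigma> w)) p"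
  unfolding greg_operad_simps
  by (rule pm.lext_cong, rule tree_eval_dot[symmetric]) (use arity_spaceD[OF assms] in blast)

lemma pcomp_gop:
  fixes p q :: "(nat, nat) gtree \<Rightarrow>\<^sub>0 'k::field"
  assumes p: "p \<in> arity_space n {1..m}" and q: "q \<in> arity_space n {1..k}" and i: "i \<in> {1..m}"
  shows "pcomp (gop n) m k i p q = G.hom n (plug n k i q) p"
  unfolding greg_operad_simps
proof (rule pm.lext_cong)
  let ?h = "\<lambda>w. dot (shift i k w) :: _ \<Rightarrow>\<^sub>0 'k"
  fix T assume "T \<in> Poly_Mapping.keys p"
  then have T: "greg {1..n} T" "white_labels T = mset_set {1..m}" using arity_spaceD[OF p] by blast+
  have "insert_tree (delta_max n) i (relabel (\<lambda>j. i - 1 + j) S) (relabel ((shift i k)(i := i)) T)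
      = G.tree_eval n (?h(i := G.tree_eval n (\<lambda>j. dot (i - 1 + j)) S)) T" if S: "S \<in> Poly_Mapping.keys q" for S
  proof -
    have S': "greg {1..n} S" "white_labels S = mset_set {1..k}" using arity_spaceD[OF q S] by blast+
    then have k: "k \<ge> 1" using greg_labels_nonempty[OF S'(1)] by (cases k) auto
    let ?r = "(shift i k)(i := i)"
    have neq: "shift i k w \<noteq> i" if "w \<noteq> i" for w
      using that k by (auto simp: shift_def)
    have "count (white_labels (relabel ?r T)) i = 1"
    proof -
      have "{1..m} = insert i ({1..m} - {i})" using i by auto
      then have split: "mset_set {1..m} = add_mset i (mset_set ({1..m} - {i}))"
        by (metis Diff_iff finite_Diff finite_atLeastAtMost insertI1 mset_set.insert)
      have "count (image_mset ?r (mset_set ({1..m} - {i}))) i = 0"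
      proof -
        have "?r w \<noteq> i" if "w \<in> {1..m} - {i}" for w
          using that neq[of w] by (simp only: fun_upd_other Diff_iff singleton_iff not_False_eq_True)
        moreover have "set_mset (mset_set ({1..m} - {i})) = {1..m} - {i}"
          by (rule finite_set_mset_mset_set) simp
        ultimately show ?thesis
          by (simp only: count_eq_zero_iff set_image_mset image_iff) metis
      qed
      then show ?thesis
        unfolding white_labels_relabel T(2) split image_mset_add_mset fun_upd_same count_add_mset by simp
    qed
    then have "insert_tree (delta_max n) i (relabel (\<lambda>j. i - 1 + j) S) (relabel ?r T)
        = G.tree_eval n (\<lambda>w. (dot(i := basis (relabel (\<lambda>j. i - 1 + j) S))) (?r w)) T"
      unfolding tree_eval_relabel[symmetric] by (rule insert_tree_eq_tree_eval[OF greg_relabel[OF T(1)]])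
    also have "\<dots> = G.tree_eval n (?h(i := G.tree_eval n (\<lambda>j. dot (i - 1 + j)) S)) T"
      unfolding tree_eval_dot[OF S'(1)] by (rule G.tree_eval_cong) (use neq in auto)
    finally show ?thesis .
  qed
  then have "lext lscale (\<lambda>S. insert_tree (delta_max n) i (relabel (\<lambda>j. i - 1 + j) S) (relabel ((shift i k)(i := i)) T)) q
      = lext lscale (\<lambda>S. G.tree_eval n (?h(i := G.hom n (\<lambda>j. dot (i - 1 + j)) (basis S))) T) q"
    by (intro pm.lext_cong) simp
  also have "\<dots> = G.tree_eval n (plug n k i q) T"
  proof -
    have "count (white_labels T) i = 1" using T(2) i by simp
    note lmap_eq_lext[where H = "\<lambda>a. G.tree_eval n (?h(i := G.hom n (\<lambda>j. dot (i - 1 + j)) a)) T",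
      OF lmap_compose[OF pm.lmap_lext G.lmap_tree_eval[OF this]]]
    then show ?thesis unfolding plug_def by (rule HOL.sym)
  qed
  finally show "lext lscale (\<lambda>S. insert_tree (delta_max n) i (relabel (\<lambda>j. i - 1 + j) S) (relabel ((shift i k)(i := i)) T)) q
      = G.tree_eval n (plug n k i q) T" .
qed

lemma module_linear_space:
  fixes A :: "'x set"
  shows "Module.module scalars (linear_space (supported A) 0 (+) lscale :: ('k::field, 'x \<Rightarrow>\<^sub>0 'k) module)"
proof (rule Module.moduleI)
  let ?M = "linear_space (supported A) 0 (+) lscale :: ('k, 'x \<Rightarrow>\<^sub>0 'k) module"
  show "cring (scalars :: 'k ring)" by (rule cring_from_type_algebra)
  show "abelian_group ?M"
  proof (rule abelian_groupI)
    fix p assume p: "p \<in> carrier ?M"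
    show "\<exists>q\<in>carrier ?M. q \<oplus>\<^bsub>?M\<^esub> p = \<zero>\<^bsub>?M\<^esub>"
      using p supported_diff[OF supported_zero, of p A] by (intro bexI[of _ "- p"]) (simp_all add: linear_space_def)
  qed (auto simp: linear_space_def supported_add add_ac)
qed (auto simp: linear_space_def ring_of_type_algebra_def supported_lscale
      pm.scale_left_distrib pm.scale_right_distrib)

lemma perm_comp_inner:
  assumes "1 \<le> i" "1 \<le> v" "v \<le> n"
  shows "perm_comp n i \<sigma> \<tau> (i - 1 + v) = \<sigma> i - 1 + \<tau> v"
  using assms by (auto simp: perm_comp_def)

lemma perm_comp_outer:
  assumes "u \<noteq> i" shows "perm_comp n i \<sigma> \<tau> (shift i n u) = shift (\<sigma> i) n (\<sigma> u)"
  using assms by (auto simp: perm_comp_def shift_def)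

lemma shifted_arity:
  fixes q :: "(nat, nat) gtree \<Rightarrow>\<^sub>0 'k::field"
  assumes "q \<in> arity_space n {1..k}"
  shows "G.hom n (\<lambda>j. dot (a + j)) q \<in> arity_space n {a + 1..a + k}"
proof (rule hom_closed[OF assms, where h = "\<lambda>j. {a + j}"])
  have "(\<Sum>w = 1..k. {#a + w#}) = image_mset (\<lambda>w. a + w) (mset_set {1..k})"
    by (simp add: sum_unfold_sum_mset)
  also have "\<dots> = mset_set ((\<lambda>w. a + w) ` {1..k})" by (rule image_mset_mset_set) (auto simp: inj_on_def)
  finally show "(\<Sum>w = 1..k. mset_set {a + w}) = mset_set {a + 1..a + k}" by simp
qed (simp_all add: dot_arity_space)

lemma pcomp_gop_closed:
  assumes p: "p \<in> arity_space n {1..m}" and q: "q \<in> arity_space n {1..k}" and i: "i \<in> {1..m}"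
  shows "G.hom n (plug n k i q) p \<in> arity_space n {1..m + k - 1}"
proof (rule hom_closed[OF p, where h = "\<lambda>w. if w = i then {i..i - 1 + k} else {shift i k w}"])
  have ii: "i - 1 + 1 = i" using i by simp
  show "plug n k i q w \<in> arity_space n (if w = i then {i..i - 1 + k} else {shift i k w})" for w
    using shifted_arity[OF q, of "i - 1"] unfolding ii by (simp add: plug_def dot_arity_space)
  let ?U = "shift i k ` ({1..m} - {i})"
  have inj: "inj_on (shift i k) ({1..m} - {i})"
    by (auto simp: inj_on_def shift_def split: if_splits)
  have "(\<Sum>w\<in>{1..m}. mset_set (if w = i then {i..i - 1 + k} else {shift i k w}))
      = mset_set {i..i - 1 + k} + (\<Sum>w\<in>{1..m} - {i}. mset_set (if w = i then {i..i - 1 + k} else {shift i k w}))"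
    using i by (subst sum.remove[of _ i]) auto
  also have "(\<Sum>w\<in>{1..m} - {i}. mset_set (if w = i then {i..i - 1 + k} else {shift i k w}))
      = (\<Sum>w\<in>{1..m} - {i}. {#shift i k w#})"
    by (rule sum.cong) auto
  also have "\<dots> = image_mset (shift i k) (mset_set ({1..m} - {i}))"
    by (simp add: sum_unfold_sum_mset)
  also have "\<dots> = mset_set ?U" by (rule image_mset_mset_set[OF inj])
  also have "mset_set {i..i - 1 + k} + mset_set ?U = mset_set ({i..i - 1 + k} \<union> ?U)"
    by (rule mset_set_Union[symmetric]) (use i in \<open>auto simp: shift_def split: if_splits\<close>)
  also have "{i..i - 1 + k} \<union> ?U = {1..m + k - 1}"
  proof (intro equalityI subsetI)
    fix x assume x: "x \<in> {1..m + k - 1}"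
    consider "x < i" | "i \<le> x" "x \<le> i - 1 + k" | "i - 1 + k < x" by linarith
    then show "x \<in> {i..i - 1 + k} \<union> ?U"
    proof cases
      case 1
      then have "x = shift i k x" "x \<in> {1..m} - {i}" using x i by (auto simp: shift_def)
      then show ?thesis by blast
    next
      case 3
      then have "x = shift i k (x + 1 - k)" "x + 1 - k \<in> {1..m} - {i}" using x i by (auto simp: shift_def)
      then show ?thesis by blast
    qed simp
  qed (use i in \<open>auto simp: shift_def split: if_splits\<close>)
  finally show "(\<Sum>w = 1..m. mset_set (if w = i then {i..i - 1 + k} else {shift i k w})) = mset_set {1..m + k - 1}" .
qed simp

lemma plug_greg_span: "q \<in> arity_space n {1..k} \<Longrightarrow> plug n k i q w \<in> greg_span n"
  unfolding plug_def
  by (cases "w = i") (simp_all only: fun_upd_same fun_upd_other not_False_eq_True dot_greg_span arity_space_greg_span[OF shifted_arity])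

lemma dot_1_arity_space: "dot (1::nat) \<in> arity_space n {1..1}"
  unfolding atLeastAtMost_singleton by (rule dot_arity_space)

text \<open>
  The action and the partial compositions are evaluations in the algebra of trees.  In each axiom both
  sides are iterated evaluations, hence single ones by \<open>hom_hom\<close>; then \<open>hom_cong\<close> reduces the axiom
  to a comparison of what is substituted for each label, which is arithmetic of the shifts.
\<close>

theorem operad_gop: "operad (gop n :: ('k::field, _) operad)"
proof (rule operad.intro)
  let ?P = "gop n :: ('k, _) operad"
  let ?Q = "\<lambda>m. arity_space n {1..m} :: ((nat, nat) gtree \<Rightarrow>\<^sub>0 'k) set"
  note ops = els_gop greg_operad_simps(2-5)
  note Qspan = arity_space_greg_span
  have Qadd: "p + q \<in> ?Q m" "lscale c p \<in> ?Q m" if "p \<in> ?Q m" "q \<in> ?Q m" for p q m c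
    using that unfolding arity_space_def by (simp_all add: supported_add supported_lscale)
  show "Module.module scalars (sp ?P m)" for m
    using module_linear_space[of "greg_trees {1..n} {1..m} :: (nat, nat) gtree set", where ?'k = 'k] by (simp add: greg_operad_def supported_def)
  have actQ: "act ?P m x \<sigma> \<in> ?Q m" if x: "x \<in> ?Q m" and \<sigma>: "\<sigma> permutes {1..m}" for m x \<sigma>
    unfolding act_gop[OF x]
  proof (rule hom_closed[OF x, where h = "\<lambda>w. {Hilbert_Choice.inv \<sigma> w}"])
    have "(\<Sum>w = 1..m. {#Hilbert_Choice.inv \<sigma> w#}) = image_mset (Hilbert_Choice.inv \<sigma>) (mset_set {1..m})"
      by (simp add: sum_unfold_sum_mset)
    also have "\<dots> = mset_set (Hilbert_Choice.inv \<sigma> ` {1..m})"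
      by (rule image_mset_mset_set) (rule permutes_inj_on[OF permutes_inv[OF \<sigma>]])
    also have "Hilbert_Choice.inv \<sigma> ` {1..m} = {1..m}" by (rule permutes_image[OF permutes_inv[OF \<sigma>]])
    finally show "(\<Sum>w = 1..m. mset_set {Hilbert_Choice.inv \<sigma> w}) = mset_set {1..m}" by simp
  qed (simp_all add: dot_arity_space)
  have pcQ: "pcomp ?P m k i x y \<in> ?Q (m + k - 1)" if "x \<in> ?Q m" "y \<in> ?Q k" "i \<in> {1..m}" for m k i x y
    unfolding pcomp_gop[OF that] by (rule pcomp_gop_closed[OF that])
  {
    fix m x and \<sigma> :: "nat \<Rightarrow> nat"
    assume "x \<in> els ?P m" and \<sigma>: "\<sigma> permutes {1..m}"
    then have x: "x \<in> ?Q m" by (simp only: ops)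
    show "act ?P m x \<sigma> \<in> els ?P m" unfolding ops by (rule actQ[OF x \<sigma>])
    show "act ?P m (c \<odot>\<^bsub>sp ?P m\<^esub> x) \<sigma> = c \<odot>\<^bsub>sp ?P m\<^esub> act ?P m x \<sigma>" for c
      by (simp only: greg_operad_simps pm.lext_lscale)
    show "act ?P m (act ?P m x \<sigma>) \<tau> = act ?P m x (\<sigma> \<circ> \<tau>)" if \<tau>: "\<tau> permutes {1..m}" for \<tau>
      unfolding act_gop[OF actQ[OF x \<sigma>]] unfolding act_gop[OF x]
      by (subst hom_hom[OF x])
         (simp_all add: dot_greg_span o_inv_distrib[OF permutes_bij[OF \<sigma>] permutes_bij[OF \<tau>]])
    show "act ?P m (x \<oplus>\<^bsub>sp ?P m\<^esub> y) \<sigma> = act ?P m x \<sigma> \<oplus>\<^bsub>sp ?P m\<^esub> act ?P m y \<sigma>" for y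
      by (simp only: greg_operad_simps pm.lext_add)
  }
  show "act ?P m x id = x" if "x \<in> els ?P m" for m x
    unfolding greg_operad_simps inv_id gtree.map_id by (rule lext_lscale_basis)
  show "ident ?P \<in> els ?P 1"
    unfolding ops by (rule dot_1_arity_space)
  show "pcomp ?P 1 k 1 (ident ?P) y = y" if "y \<in> els ?P k" for k y
  proof -
    have y: "y \<in> ?Q k" using that by (simp only: ops)
    have 1: "dot 1 \<in> ?Q 1" by (rule dot_1_arity_space)
    show ?thesis
      unfolding greg_operad_simps(5) using pcomp_gop[OF 1 y, of 1] hom_dot[OF Qspan[OF y]] by (simp add: plug_def)
  qed
  show "pcomp ?P m 1 i x (ident ?P) = x" if "x \<in> els ?P m" "i \<in> {1..m}" for m i x
  proof -
    have x: "x \<in> ?Q m" using that(1) by (simp only: ops)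
    have 1: "dot 1 \<in> ?Q 1" by (rule dot_1_arity_space)
    have "plug n 1 i (dot 1) = (dot :: _ \<Rightarrow> _ \<Rightarrow>\<^sub>0 'k)"
      using that(2) by (auto simp: plug_def fun_eq_iff shift_def)
    then show ?thesis
      unfolding greg_operad_simps(5) pcomp_gop[OF x 1 that(2)] using hom_dot[OF Qspan[OF x]] by simp
  qed
  fix m k i x y
  assume "x \<in> els ?P m" "y \<in> els ?P k" and i: "i \<in> {1..m}"
  then have x: "x \<in> ?Q m" and y: "y \<in> ?Q k" by (simp_all only: ops)
  note pc = pcomp_gop[OF x y i] and pcc = pcQ[OF x y i]
  have i1: "1 \<le> i" using i by simp
  show "pcomp ?P m k i x y \<in> els ?P (m + k - 1)" unfolding ops by (rule pcc)
  show "pcomp ?P m k i (x \<oplus>\<^bsub>sp ?P m\<^esub> x') y = pcomp ?P m k i x y \<oplus>\<^bsub>sp ?P (m + k - 1)\<^esub> pcomp ?P m k i x' y" for x'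
    by (simp only: greg_operad_simps pm.lext_add)
  show "pcomp ?P m k i (c \<odot>\<^bsub>sp ?P m\<^esub> x) y = c \<odot>\<^bsub>sp ?P (m + k - 1)\<^esub> pcomp ?P m k i x y" for c
    by (simp only: greg_operad_simps pm.lext_lscale)
  show "pcomp ?P m k i x (c \<odot>\<^bsub>sp ?P k\<^esub> y) = c \<odot>\<^bsub>sp ?P (m + k - 1)\<^esub> pcomp ?P m k i x y" for c
    by (simp only: greg_operad_simps pm.lext_lscale pm.lext_pointwise_scale)
  show "pcomp ?P m k i x (y \<oplus>\<^bsub>sp ?P k\<^esub> y') = pcomp ?P m k i x y \<oplus>\<^bsub>sp ?P (m + k - 1)\<^esub> pcomp ?P m k i x y'" for y'
    by (simp only: greg_operad_simps pm.lext_add pm.lext_pointwise_add)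
  show "pcomp ?P m k i (act ?P m x \<sigma>) (act ?P k y \<tau>)
      = act ?P (m + k - 1) (pcomp ?P m k (\<sigma> i) x y) (perm_comp k i \<sigma> \<tau>)"
    if \<sigma>: "\<sigma> permutes {1..m}" and \<tau>: "\<tau> permutes {1..k}" for \<sigma> \<tau>
  proof -
    let ?\<pi> = "perm_comp k i \<sigma> \<tau>"
    have si: "\<sigma> i \<in> {1..m}" using permutes_in_image[OF \<sigma>] i by blast
    have \<pi>: "?\<pi> permutes {1..m + k - 1}" by (rule perm_comp_permutes[OF \<sigma> \<tau> i])
    have inv: "Hilbert_Choice.inv ?\<pi> u = v" if "?\<pi> v = u" for u v
      using permutes_inverses(2)[OF \<pi>, of v] that by simp
    have "pcomp ?P m k i (act ?P m x \<sigma>) (act ?P k y \<tau>)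
        = G.hom n (\<lambda>w. plug n k i (act ?P k y \<tau>) (Hilbert_Choice.inv \<sigma> w)) x"
      unfolding pcomp_gop[OF actQ[OF x \<sigma>] actQ[OF y \<tau>] i] unfolding act_gop[OF x]
      by (subst hom_hom[OF x]) (simp_all add: dot_greg_span)
    also have "\<dots> = G.hom n (\<lambda>w. G.hom n (\<lambda>v. dot (Hilbert_Choice.inv ?\<pi> v)) (plug n k (\<sigma> i) y w)) x"
    proof (rule hom_cong[OF x])
      fix w assume w: "w \<in> {1..m}"
      show "plug n k i (act ?P k y \<tau>) (Hilbert_Choice.inv \<sigma> w)
          = G.hom n (\<lambda>v. dot (Hilbert_Choice.inv ?\<pi> v)) (plug n k (\<sigma> i) y w)"
      proof (cases "w = \<sigma> i")
        case True
        then have wi: "Hilbert_Choice.inv \<sigma> w = i" using permutes_inverses(2)[OF \<sigma>] by simp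
        have "plug n k i (act ?P k y \<tau>) (Hilbert_Choice.inv \<sigma> w) = G.hom n (\<lambda>v. dot (i - 1 + Hilbert_Choice.inv \<tau> v)) y"
          unfolding wi act_gop[OF y] plug_def fun_upd_same by (subst hom_hom[OF y]) (simp_all add: dot_greg_span)
        also have "\<dots> = G.hom n (\<lambda>v. dot (Hilbert_Choice.inv ?\<pi> (\<sigma> i - 1 + v))) y"
        proof (rule hom_cong[OF y])
          fix v assume v: "v \<in> {1..k}"
          have "Hilbert_Choice.inv \<tau> v \<in> {1..k}" using permutes_in_image[OF permutes_inv[OF \<tau>]] v by blast
          then have "?\<pi> (i - 1 + Hilbert_Choice.inv \<tau> v) = \<sigma> i - 1 + v"
            using perm_comp_inner[OF i1] permutes_inverses(1)[OF \<tau>] by simp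
          then show "dot (i - 1 + Hilbert_Choice.inv \<tau> v) = dot (Hilbert_Choice.inv ?\<pi> (\<sigma> i - 1 + v))"
            by (simp add: inv)
        qed simp
        also have "\<dots> = G.hom n (\<lambda>v. dot (Hilbert_Choice.inv ?\<pi> v)) (plug n k (\<sigma> i) y w)"
          unfolding True plug_def fun_upd_same by (subst hom_hom[OF y]) (simp_all add: dot_greg_span)
        finally show ?thesis .
      next
        case False
        define u where "u = Hilbert_Choice.inv \<sigma> w"
        have su: "\<sigma> u = w" unfolding u_def using permutes_inverses(1)[OF \<sigma>] by simp
        then have "u \<noteq> i" using False by auto
        then have "Hilbert_Choice.inv ?\<pi> (shift (\<sigma> i) k w) = shift i k u"
          by (intro inv) (simp add: perm_comp_outer su)
        then show ?thesis using False \<open>u \<noteq> i\<close> by (simp add: plug_def u_def[symmetric])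
      qed
    qed simp
    also have "\<dots> = act ?P (m + k - 1) (pcomp ?P m k (\<sigma> i) x y) ?\<pi>"
      unfolding act_gop[OF pcQ[OF x y si]] unfolding pcomp_gop[OF x y si]
      by (subst hom_hom[OF x]) (simp_all add: plug_greg_span[OF y])
    finally show ?thesis .
  qed
  fix l z
  assume "z \<in> els ?P l"
  then have z: "z \<in> ?Q l" by (simp only: ops)
  show "pcomp ?P (m + k - 1) l (i - 1 + j) (pcomp ?P m k i x y) z
      = pcomp ?P m (k + l - 1) i x (pcomp ?P k l j y z)" if j: "j \<in> {1..k}" for j
  proof -
    have ij: "i - 1 + j \<in> {1..m + k - 1}" using i j by auto
    have "pcomp ?P (m + k - 1) l (i - 1 + j) (pcomp ?P m k i x y) z
        = G.hom n (\<lambda>w. G.hom n (plug n l (i - 1 + j) z) (plug n k i y w)) x"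
      unfolding pcomp_gop[OF pcc z ij] unfolding pc
      by (subst hom_hom[OF x]) (simp_all add: plug_greg_span[OF y])
    also have "\<dots> = G.hom n (plug n (k + l - 1) i (pcomp ?P k l j y z)) x"
    proof (rule hom_cong[OF x])
      fix w assume w: "w \<in> {1..m}"
      show "G.hom n (plug n l (i - 1 + j) z) (plug n k i y w) = plug n (k + l - 1) i (pcomp ?P k l j y z) w"
      proof (cases "w = i")
        case True
        have "G.hom n (plug n l (i - 1 + j) z) (plug n k i y w) = G.hom n (\<lambda>v. plug n l (i - 1 + j) z (i - 1 + v)) y"
          unfolding True plug_def[of n k] fun_upd_same by (subst hom_hom[OF y]) (simp_all add: dot_greg_span)
        also have "\<dots> = G.hom n (\<lambda>v. G.hom n (\<lambda>u. dot (i - 1 + u)) (plug n l j z v)) y"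
        proof (rule hom_cong[OF y])
          fix v assume v: "v \<in> {1..k}"
          show "plug n l (i - 1 + j) z (i - 1 + v) = G.hom n (\<lambda>u. dot (i - 1 + u)) (plug n l j z v)"
          proof (cases "v = j")
            case True
            have e: "i - 1 + j - 1 + u = i - 1 + (j - 1 + u)" for u using j by auto
            show ?thesis
              unfolding True plug_def fun_upd_same e
              by (subst hom_hom[OF z]) (simp_all add: dot_greg_span)
          next
            case False
            then have "shift (i - 1 + j) l (i - 1 + v) = i - 1 + shift j l v" "i - 1 + v \<noteq> i - 1 + j"
              using v i1 by (auto simp: shift_def)
            then show ?thesis using False by (simp add: plug_def)
          qed
        qed simp
        also have "\<dots> = plug n (k + l - 1) i (pcomp ?P k l j y z) w"
          unfolding True plug_def[of n "k + l - 1"] fun_upd_same pcomp_gop[OF y z j]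
          by (subst hom_hom[OF y]) (simp_all add: plug_greg_span[OF z])
        finally show ?thesis .
      next
        case False
        then have "shift (i - 1 + j) l (shift i k w) = shift i (k + l - 1) w" "shift i k w \<noteq> i - 1 + j"
          using i j w by (auto simp: shift_def)
        then show ?thesis using False by (simp add: plug_def)
      qed
    qed simp
    also have "\<dots> = pcomp ?P m (k + l - 1) i x (pcomp ?P k l j y z)"
      unfolding pcomp_gop[OF x pcQ[OF y z j] i] ..
    finally show ?thesis .
  qed
  show "pcomp ?P (m + k - 1) l (r - 1 + k) (pcomp ?P m k i x y) z
      = pcomp ?P (m + l - 1) k i (pcomp ?P m l r x z) y" if r: "r \<in> {1..m}" "i < r" for r
  proof -
    have rk: "r - 1 + k \<in> {1..m + k - 1}" "i \<in> {1..m + l - 1}" using i r by auto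
    have "pcomp ?P (m + k - 1) l (r - 1 + k) (pcomp ?P m k i x y) z
        = G.hom n (\<lambda>w. G.hom n (plug n l (r - 1 + k) z) (plug n k i y w)) x"
      unfolding pcomp_gop[OF pcc z rk(1)] unfolding pc
      by (subst hom_hom[OF x]) (simp_all add: plug_greg_span[OF y])
    also have "\<dots> = G.hom n (\<lambda>w. G.hom n (plug n k i y) (plug n l r z w)) x"
    proof (rule hom_cong[OF x])
      fix w assume w: "w \<in> {1..m}"
      consider "w = i" | "w = r" | "w \<noteq> i" "w \<noteq> r" by blast
      then show "G.hom n (plug n l (r - 1 + k) z) (plug n k i y w) = G.hom n (plug n k i y) (plug n l r z w)"
      proof cases
        case 1
        have "G.hom n (plug n l (r - 1 + k) z) (plug n k i y w) = G.hom n (\<lambda>v. plug n l (r - 1 + k) z (i - 1 + v)) y"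
          unfolding 1 plug_def[of n k] fun_upd_same by (subst hom_hom[OF y]) (simp_all add: dot_greg_span)
        also have "\<dots> = G.hom n (\<lambda>v. dot (i - 1 + v)) y"
        proof (rule hom_cong[OF y])
          fix v assume "v \<in> {1..k}"
          then have "shift (r - 1 + k) l (i - 1 + v) = i - 1 + v" "i - 1 + v \<noteq> r - 1 + k"
            using r i by (auto simp: shift_def)
          then show "plug n l (r - 1 + k) z (i - 1 + v) = dot (i - 1 + v)" by (simp add: plug_def)
        qed simp
        also have "\<dots> = G.hom n (plug n k i y) (plug n l r z w)"
          using 1 r(2) by (simp add: plug_def shift_def)
        finally show ?thesis .
      next
        case 2
        have "G.hom n (plug n k i y) (plug n l r z w) = G.hom n (\<lambda>v. plug n k i y (r - 1 + v)) z"
          unfolding 2 plug_def[of n l] fun_upd_same by (subst hom_hom[OF z]) (simp_all add: dot_greg_span)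
        also have "\<dots> = G.hom n (\<lambda>v. dot (r - 1 + k - 1 + v)) z"
        proof (rule hom_cong[OF z])
          fix v assume "v \<in> {1..l}"
          then have "shift i k (r - 1 + v) = r - 1 + k - 1 + v" "r - 1 + v \<noteq> i"
            using r i by (auto simp: shift_def)
          then show "plug n k i y (r - 1 + v) = dot (r - 1 + k - 1 + v)" by (simp add: plug_def)
        qed simp
        also have "\<dots> = G.hom n (plug n l (r - 1 + k) z) (plug n k i y w)"
        proof -
          have "shift i k w = r - 1 + k" "w \<noteq> i" using 2 r i by (auto simp: shift_def)
          then show ?thesis by (simp add: plug_def)
        qed
        finally show ?thesis ..
      next
        case 3
        then have "shift (r - 1 + k) l (shift i k w) = shift i k (shift r l w)"
          "shift i k w \<noteq> r - 1 + k" "shift r l w \<noteq> i"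
          using i r w by (auto simp: shift_def)
        then show ?thesis using 3 by (simp add: plug_def)
      qed
    qed simp
    also have "\<dots> = pcomp ?P (m + l - 1) k i (pcomp ?P m l r x z) y"
      unfolding pcomp_gop[OF pcQ[OF x z r(1)] y rk(2)] unfolding pcomp_gop[OF x z r(1)]
      by (subst hom_hom[OF x]) (simp_all add: plug_greg_span[OF z])
    finally show ?thesis .
  qed
qed


section \<open>The algebra of generators and relations\<close>

datatype monomial = Var nat | Prod nat monomial monomial

definition monomial_prod :: "nat \<Rightarrow> (monomial \<Rightarrow>\<^sub>0 'k::field) \<Rightarrow> (monomial \<Rightarrow>\<^sub>0 'k) \<Rightarrow> (monomial \<Rightarrow>\<^sub>0 'k)" where
  "monomial_prod k p q = lext lscale (\<lambda>s. lext lscale (\<lambda>t. basis (Prod k s t)) q) p"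

lemma linop_monomial_prod_left: "linop (\<lambda>p. monomial_prod k p q)"
  unfolding monomial_prod_def by (rule pm.lmap_lext)

lemma linop_monomial_prod_right: "linop (monomial_prod k p)"
proof -
  have "monomial_prod k p = lext lscale (\<lambda>t. lext lscale (\<lambda>s. basis (Prod k s t)) p)"
    unfolding monomial_prod_def by (rule ext, rule pm.lext_swap)
  then show ?thesis by (simp add: pm.lmap_lext)
qed

lemma monomial_prod_basis [simp]: "monomial_prod k (basis s) (basis t) = basis (Prod k s t)"
  by (simp add: monomial_prod_def)

text \<open>
  The ideal generated by the identities of \<open>shared_bracket\<close>.
\<close>

inductive_set relations :: "(monomial \<Rightarrow>\<^sub>0 'k::field) set" where
  rel_zero: "0 \<in> relations"
| rel_add: "p \<in> relations \<Longrightarrow> q \<in> relations \<Longrightarrow> p + q \<in> relations"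
| rel_scale: "p \<in> relations \<Longrightarrow> lscale c p \<in> relations"
| rel_left: "p \<in> relations \<Longrightarrow> monomial_prod k p (basis t) \<in> relations"
| rel_right: "p \<in> relations \<Longrightarrow> monomial_prod k (basis t) p \<in> relations"
| rel_prelie: "(basis (Prod k (Prod k a b) c) - basis (Prod k a (Prod k b c)))
    - (basis (Prod k (Prod k a c) b) - basis (Prod k a (Prod k c b))) \<in> relations"
| rel_bracket: "(basis (Prod k a b) - basis (Prod 0 a b)) - (basis (Prod k b a) - basis (Prod 0 b a)) \<in> relations"

lemma rel_minus: "p \<in> relations \<Longrightarrow> - p \<in> relations"
  using rel_scale[of p "-1"] by simp

lemma rel_diff: "p \<in> relations \<Longrightarrow> q \<in> relations \<Longrightarrow> p - q \<in> relations"
  using rel_add[OF _ rel_minus, of p q] by simp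

lemma rel_sum: "(\<And>x. x \<in> S \<Longrightarrow> g x \<in> relations) \<Longrightarrow> sum g S \<in> relations"
  by (induction S rule: infinite_finite_induct) (auto intro: rel_zero rel_add)

lemma rel_lext: "(\<And>t. g t \<in> relations) \<Longrightarrow> lext lscale g p \<in> relations"
  unfolding lext_def by (intro rel_sum rel_scale)

lemma rel_linop:
  assumes "linop H" "\<And>t. H (basis t) \<in> relations"
  shows "H p \<in> relations"
  unfolding lmap_eq_lext[OF assms(1), of p] by (rule rel_lext) (rule assms(2))

lemma rel_monomial_prod_left: "p \<in> relations \<Longrightarrow> monomial_prod k p q \<in> relations"
  by (rule rel_linop[OF linop_monomial_prod_right]) (rule rel_left)

lemma rel_monomial_prod_right: "q \<in> relations \<Longrightarrow> monomial_prod k p q \<in> relations"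
  by (rule rel_linop[OF linop_monomial_prod_left]) (rule rel_right)

text \<open>
  The free algebra on countably many generators, with a product for every natural number.  It is the
  test algebra which shows that the identities between one-vertex trees are consequences of the
  defining ones.
\<close>

quotient_type (overloaded) 'k free_algebra = "monomial \<Rightarrow>\<^sub>0 'k::field" / "\<lambda>p q. p - q \<in> relations"
proof (rule equivpI)
  show "reflp (\<lambda>p q :: monomial \<Rightarrow>\<^sub>0 'k. p - q \<in> relations)"
    by (rule reflpI) (simp add: rel_zero)
  show "symp (\<lambda>p q :: monomial \<Rightarrow>\<^sub>0 'k. p - q \<in> relations)"
    by (rule sympI) (drule rel_minus, simp)
  show "transp (\<lambda>p q :: monomial \<Rightarrow>\<^sub>0 'k. p - q \<in> relations)"
    by (rule transpI) (drule (1) rel_add, simp)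
qed

text \<open>
  The operations on the quotient are lifted from combinations of monomials, and not from the functions
  that represent these combinations.
\<close>

lifting_forget poly_mapping.lifting

instantiation free_algebra :: (field) ab_group_add
begin

lift_definition zero_free_algebra :: "'a free_algebra" is 0 .

lift_definition plus_free_algebra :: "'a free_algebra \<Rightarrow> 'a free_algebra \<Rightarrow> 'a free_algebra" is "(+)"
proof -
  fix p q p' q' :: "monomial \<Rightarrow>\<^sub>0 'a"
  assume "p - q \<in> relations" "p' - q' \<in> relations"
  from rel_add[OF this] show "p + p' - (q + q') \<in> relations" by (simp add: algebra_simps)
qed

lift_definition uminus_free_algebra :: "'a free_algebra \<Rightarrow> 'a free_algebra" is uminus
proof -
  fix p q :: "monomial \<Rightarrow>\<^sub>0 'a"
  assume "p - q \<in> relations"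
  from rel_minus[OF this] show "- p - - q \<in> relations" by (simp add: algebra_simps)
qed

lift_definition minus_free_algebra :: "'a free_algebra \<Rightarrow> 'a free_algebra \<Rightarrow> 'a free_algebra" is "(-)"
proof -
  fix p q p' q' :: "monomial \<Rightarrow>\<^sub>0 'a"
  assume "p - q \<in> relations" "p' - q' \<in> relations"
  from rel_diff[OF this] show "p - p' - (q - q') \<in> relations" by (simp add: algebra_simps)
qed

instance
  by standard (transfer; simp add: algebra_simps rel_zero)+

end

lift_definition fa_scale :: "'k::field \<Rightarrow> 'k free_algebra \<Rightarrow> 'k free_algebra" is lscale
  by (simp flip: pm.scale_right_diff_distrib add: rel_scale)

lift_definition fa_prod :: "nat \<Rightarrow> 'k::field free_algebra \<Rightarrow> 'k free_algebra \<Rightarrow> 'k free_algebra" is monomial_prod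
proof -
  fix k and p q p' q' :: "monomial \<Rightarrow>\<^sub>0 'k"
  assume "p - q \<in> relations" "p' - q' \<in> relations"
  then have "monomial_prod k (p - q) p' + monomial_prod k q (p' - q') \<in> relations"
    by (intro rel_add rel_monomial_prod_left rel_monomial_prod_right)
  then show "monomial_prod k p p' - monomial_prod k q q' \<in> relations"
    by (simp add: lmap_diff[OF linop_monomial_prod_left] lmap_diff[OF linop_monomial_prod_right])
qed

lift_definition fa_class :: "(monomial \<Rightarrow>\<^sub>0 'k::field) \<Rightarrow> 'k free_algebra" is "\<lambda>p. p" .

lemma vector_space_fa_scale: "vector_space fa_scale"
  by unfold_locales (transfer; simp add: algebra_simps rel_zero pm.scale_right_distrib pm.scale_left_distrib)+

lemma monomial_prod_prelie:
  "monomial_prod k (monomial_prod k p q) r - monomial_prod k p (monomial_prod k q r) - (monomial_prod k (monomial_prod k p r) q - monomial_prod k p (monomial_prod k r q)) \<in> relations"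
proof -
  let ?A = "\<lambda>p q r. monomial_prod k (monomial_prod k p q) r - monomial_prod k p (monomial_prod k q r)"
  have lin1: "linop (\<lambda>p. ?A p q r)" for q r
    by (intro lmap_fun_diff linop_monomial_prod_left lmap_compose[OF linop_monomial_prod_left linop_monomial_prod_left])
  have lin2: "linop (\<lambda>q. ?A p q r)" for p r
    by (intro lmap_fun_diff lmap_compose[OF linop_monomial_prod_right linop_monomial_prod_left]
        lmap_compose[OF linop_monomial_prod_left linop_monomial_prod_right])
  have lin3: "linop (\<lambda>r. ?A p q r)" for p q
    by (intro lmap_fun_diff linop_monomial_prod_right lmap_compose[OF linop_monomial_prod_right linop_monomial_prod_right])
  have 1: "?A (basis a) (basis b) (basis c) - ?A (basis a) (basis c) (basis b) \<in> relations" for a b c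
    using rel_prelie[of k a b c] by simp
  have 2: "?A (basis a) (basis b) r - ?A (basis a) r (basis b) \<in> relations" for a b
    by (rule rel_linop[where H = "\<lambda>r. ?A (basis a) (basis b) r - ?A (basis a) r (basis b)", OF lmap_fun_diff[OF lin3 lin2]]) (rule 1)
  have 3: "?A (basis a) q r - ?A (basis a) r q \<in> relations" for a
    by (rule rel_linop[where H = "\<lambda>q. ?A (basis a) q r - ?A (basis a) r q", OF lmap_fun_diff[OF lin2 lin3]]) (rule 2)
  show ?thesis
    by (rule rel_linop[where H = "\<lambda>p. ?A p q r - ?A p r q", OF lmap_fun_diff[OF lin1 lin1]]) (rule 3)
qed

lemma monomial_prod_bracket:
  "monomial_prod k p q - monomial_prod 0 p q - (monomial_prod k q p - monomial_prod 0 q p) \<in> relations"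
proof -
  have 1: "monomial_prod k (basis a) q - monomial_prod 0 (basis a) q - (monomial_prod k q (basis a) - monomial_prod 0 q (basis a)) \<in> relations" for a
    by (rule rel_linop[where H = "\<lambda>q. monomial_prod k (basis a) q - monomial_prod 0 (basis a) q - (monomial_prod k q (basis a) - monomial_prod 0 q (basis a))"])
       (auto intro!: lmap_fun_diff linop_monomial_prod_left linop_monomial_prod_right rel_bracket)
  show ?thesis
    by (rule rel_linop[where H = "\<lambda>p. monomial_prod k p q - monomial_prod 0 p q - (monomial_prod k q p - monomial_prod 0 q p)"])
       (auto intro!: lmap_fun_diff linop_monomial_prod_left linop_monomial_prod_right 1)
qed

theorem shared_bracket_free_algebra: "shared_bracket (fa_scale :: 'k::field \<Rightarrow> _) fa_prod"
proof (intro shared_bracket.intro shared_bracket_axioms.intro vector_space_fa_scale)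
  fix k and a b c :: "'k free_algebra"
  show "lmap fa_scale fa_scale (\<lambda>a. fa_prod k a b)"
    by (intro lmapI vector_space_fa_scale)
       (transfer, simp add: lmap_add[OF linop_monomial_prod_left] lmap_scale[OF linop_monomial_prod_left] rel_zero)+
  show "lmap fa_scale fa_scale (fa_prod k a)"
    by (intro lmapI vector_space_fa_scale)
       (transfer, simp add: lmap_add[OF linop_monomial_prod_right] lmap_scale[OF linop_monomial_prod_right] rel_zero)+
  show "fa_prod k (fa_prod k a b) c - fa_prod k a (fa_prod k b c) = fa_prod k (fa_prod k a c) b - fa_prod k a (fa_prod k c b)"
    by transfer (rule monomial_prod_prelie)
  show "fa_prod k a b - fa_prod k b a = fa_prod 0 a b - fa_prod 0 b a"
  proof transfer
    fix k and p q :: "monomial \<Rightarrow>\<^sub>0 'k"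
    show "monomial_prod k p q - monomial_prod k q p - (monomial_prod 0 p q - monomial_prod 0 q p) \<in> relations"
      using monomial_prod_bracket[of k p q] by (simp add: algebra_simps)
  qed
qed

interpretation U: shared_bracket "fa_scale :: 'k::field \<Rightarrow> _" fa_prod
  by (rule shared_bracket_free_algebra)

primrec leaves :: "monomial \<Rightarrow> nat list" where
  "leaves (Var i) = [i]"
| "leaves (Prod k s t) = leaves s @ leaves t"

primrec bounded_by :: "nat \<Rightarrow> monomial \<Rightarrow> bool" where
  "bounded_by n (Var i) \<longleftrightarrow> True"
| "bounded_by n (Prod k s t) \<longleftrightarrow> k \<le> n \<and> bounded_by n s \<and> bounded_by n t"

context shared_bracket
begin

primrec term_eval :: "(nat \<Rightarrow> 'a) \<Rightarrow> monomial \<Rightarrow> 'a" where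
  "term_eval f (Var i) = f i"
| "term_eval f (Prod k s t) = pr k (term_eval f s) (term_eval f t)"

lemma lext_term_eval_monomial_prod: "lext scale (term_eval f) (monomial_prod k p q) = pr k (lext scale (term_eval f) p) (lext scale (term_eval f) q)"
proof -
  have 1: "lext scale (term_eval f) (monomial_prod k (basis s) q) = pr k (term_eval f s) (lext scale (term_eval f) q)" for s
    by (rule lmap_basis_eqI[where s = scale and f = "\<lambda>q. lext scale (term_eval f) (monomial_prod k (basis s) q)"
          and g = "\<lambda>q. pr k (term_eval f s) (lext scale (term_eval f) q)"])
       (auto intro: lmap_compose[OF linop_monomial_prod_right lmap_lext] lmap_compose[OF lmap_lext lmap_pr_right])
  show ?thesis
    by (rule lmap_basis_eqI[where s = scale and f = "\<lambda>p. lext scale (term_eval f) (monomial_prod k p q)"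
          and g = "\<lambda>p. pr k (lext scale (term_eval f) p) (lext scale (term_eval f) q)"])
       (auto intro: lmap_compose[OF linop_monomial_prod_left lmap_lext] lmap_compose[OF lmap_lext lmap_pr_left] simp: 1)
qed

end

lemma term_eval_greg_span: "G.term_eval n dot t \<in> greg_span n"
  by (induction t) (auto intro: gprod_greg_span dot_greg_span)

lemma term_eval_labels: "G.term_eval n dot t \<in> supported (graded_trees {1..n} (mset (leaves t)) 0)"
proof (induction t)
  case (Prod k s t)
  then show ?case using gprod_supported[OF Prod.IH] by simp
qed (simp add: graded_trees_def)

text \<open>
  Only products up to \<open>n\<close> are recovered, since the algebra of trees repeats its \<open>n\<close>-th product.
\<close>

lemma hom_term_eval:
  assumes "bounded_by n t"
  shows "U.hom (\<lambda>i. fa_class (basis (Var i))) (G.term_eval n dot t) = fa_class (basis t)"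
  using assms
proof (induction t)
  case (Prod k s t)
  have "fa_prod k (fa_class (basis s)) (fa_class (basis t)) = fa_class (basis (Prod k s t))"
    by transfer (simp add: rel_zero)
  then show ?case
    using Prod by (simp add: U.hom_gprod[OF term_eval_greg_span] min_absorb1)
qed simp

lemma lmap_fa_class: "lmap lscale fa_scale fa_class"
  by (intro lmapI vector_space_fa_scale vector_space_lscale) (transfer, simp add: rel_zero)+

text \<open>
  Evaluating trees in the free algebra recovers the class of a combination of monomials from its value
  in trees.
\<close>

theorem term_eval_kernel:
  assumes p: "p \<in> supported {t. bounded_by n t}" and 0: "lext lscale (G.term_eval n dot) p = 0"
  shows "p \<in> relations"
proof -
  let ?u = "\<lambda>i. fa_class (basis (Var i)) :: 'a free_algebra"
  have "U.hom ?u (lext lscale (G.term_eval n dot) p)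
      = lext fa_scale (\<lambda>t. U.hom ?u (lext lscale (G.term_eval n dot) (basis t))) p"
    by (rule lmap_eq_lext[OF lmap_compose[OF pm.lmap_lext U.lmap_lext]])
  also have "\<dots> = lext fa_scale (\<lambda>t. U.hom ?u (G.term_eval n dot t)) p" by simp
  also have "\<dots> = lext fa_scale (\<lambda>t. fa_class (basis t)) p"
    by (rule U.lext_cong, rule hom_term_eval) (use p in \<open>auto simp: supported_def\<close>)
  also have "\<dots> = fa_class p" by (rule lmap_eq_lext[OF lmap_fa_class, symmetric])
  finally have "fa_class p = 0" using 0 by simp
  then show ?thesis by transfer simp
qed

text \<open>
  Nodes are braces, and braces are combinations of iterated products; so every tree lies in the
  subalgebra generated by the one-vertex trees.
\<close>

lemma tree_generated:
  assumes "greg {1..n} T"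
  shows "\<exists>p \<in> supported {t. bounded_by n t}. basis T = (lext lscale (G.term_eval n dot) p :: _ \<Rightarrow>\<^sub>0 'k::field)"
proof -
  let ?E = "lext lscale (G.term_eval n dot) :: _ \<Rightarrow> (nat, nat) gtree \<Rightarrow>\<^sub>0 'k"
  let ?B = "supported {t. bounded_by n t} :: (monomial \<Rightarrow>\<^sub>0 'k) set"
  let ?Y = "?E ` ?B"
  have diff: "a - b \<in> ?Y" if ab: "a \<in> ?Y" "b \<in> ?Y" for a b
  proof -
    obtain p q where "p \<in> ?B" "q \<in> ?B" "a = ?E p" "b = ?E q" using ab by blast
    then have "p - q \<in> ?B" "a - b = ?E (p - q)" by (auto intro: supported_diff simp: lmap_diff[OF pm.lmap_lext])
    then show ?thesis by blast
  qed
  have prod: "gprod n k a b \<in> ?Y" if "a \<in> ?Y" "b \<in> ?Y" for k a b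
  proof -
    obtain p q where pq: "p \<in> ?B" "q \<in> ?B" "a = ?E p" "b = ?E q" using \<open>a \<in> ?Y\<close> \<open>b \<in> ?Y\<close> by blast
    have "monomial_prod (min k n) p q \<in> ?B"
      unfolding monomial_prod_def by (rule supported_lext[OF pq(1)], rule supported_lext[OF pq(2)]) simp
    moreover have "gprod n k a b = ?E (monomial_prod (min k n) p q)"
      by (simp add: G.lext_term_eval_monomial_prod pq(3,4) gprod_clip)
    ultimately show ?thesis by blast
  qed
  have zero: "0 \<in> ?Y" by (rule image_eqI[of _ _ 0]) simp_all
  have minus: "- a \<in> ?Y" if "a \<in> ?Y" for a using diff[OF zero that] by simp
  have plus: "a + b \<in> ?Y" if "a \<in> ?Y" "b \<in> ?Y" for a b using diff[OF that(1) minus[OF that(2)]] by simp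
  have sl: "- sum_list L \<in> ?Y" if "set L \<subseteq> ?Y" for L
    by (rule minus) (use that in \<open>induction L; auto intro: zero plus\<close>)
  have "basis T \<in> ?Y"
    using assms
  proof induction
    case (1 F w)
    obtain L where L: "mset L = image_mset (basis :: _ \<Rightarrow> _ \<Rightarrow>\<^sub>0 'k) F" using ex_mset by blast
    have "set L = basis ` set_mset F" using arg_cong[OF L, of set_mset] by simp
    then have LY: "set L \<subseteq> ?Y" using 1 by auto
    have "dot w \<in> ?Y" by (rule image_eqI[of _ _ "basis (Var w)"]) simp_all
    then have "G.tower n 0 0 (\<lambda>_. dot w) L \<in> ?Y"
      by (intro G.tower_closed[where Y = ?Y] diff prod LY)
    also have "G.tower n 0 0 (\<lambda>_. dot w) L = basis (White w F)"
      by (simp only: G.white_brace_mset[symmetric] L white_brace_dot)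
    finally show ?case .
  next
    case (2 c F)
    obtain L where L: "mset L = image_mset (basis :: _ \<Rightarrow> _ \<Rightarrow>\<^sub>0 'k) F" using ex_mset by blast
    have "set L = basis ` set_mset F" using arg_cong[OF L, of set_mset] by simp
    then have LY: "set L \<subseteq> ?Y" using 2 by auto
    have "G.tower n k 1 (\<lambda>L. - sum_list L) L \<in> ?Y" for k
      by (intro G.tower_closed[where Y = ?Y] diff prod LY sl)
    then have "G.black_brace n c (mset L) - G.black_brace n (c - 1) (mset L) \<in> ?Y"
      unfolding G.black_brace_mset by (intro diff)
    then show ?case using 2(1,2) by (simp only: L black_brace_Black)
  qed
  then show ?thesis by blast
qed


section \<open>Linear combinations and composites in an operad\<close>

text \<open>
  The counterpart of \<open>lext\<close> for a module with an explicit carrier.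
\<close>

definition mext :: "('k::field, 'a) module \<Rightarrow> ('x \<Rightarrow> 'a) \<Rightarrow> ('x \<Rightarrow>\<^sub>0 'k) \<Rightarrow> 'a" where
  "mext M g p = (\<Oplus>\<^bsub>M\<^esub>t\<in>Poly_Mapping.keys p. Poly_Mapping.lookup p t \<odot>\<^bsub>M\<^esub> g t)"

locale kspace = Module.module "scalars :: 'k::field ring" M for M :: "('k::field, 'a) module"
begin

lemma sm_closed: "x \<in> carrier M \<Longrightarrow> c \<odot>\<^bsub>M\<^esub> x \<in> carrier M"
  using smult_closed[of c x] by (simp add: ring_of_type_algebra_def)

lemma sm_left_distrib: "x \<in> carrier M \<Longrightarrow> (c + d) \<odot>\<^bsub>M\<^esub> x = c \<odot>\<^bsub>M\<^esub> x \<oplus>\<^bsub>M\<^esub> d \<odot>\<^bsub>M\<^esub> x"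
  using smult_l_distr[of c d x] by (simp add: ring_of_type_algebra_def)

lemma sm_right_distrib:
  "x \<in> carrier M \<Longrightarrow> y \<in> carrier M \<Longrightarrow> c \<odot>\<^bsub>M\<^esub> (x \<oplus>\<^bsub>M\<^esub> y) = c \<odot>\<^bsub>M\<^esub> x \<oplus>\<^bsub>M\<^esub> c \<odot>\<^bsub>M\<^esub> y"
  using smult_r_distr[of c x y] by (simp add: ring_of_type_algebra_def)

lemma sm_assoc: "x \<in> carrier M \<Longrightarrow> (c * d) \<odot>\<^bsub>M\<^esub> x = c \<odot>\<^bsub>M\<^esub> (d \<odot>\<^bsub>M\<^esub> x)"
  using smult_assoc1[of c d x] by (simp add: ring_of_type_algebra_def)

lemma sm_one: "x \<in> carrier M \<Longrightarrow> 1 \<odot>\<^bsub>M\<^esub> x = x"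
  using smult_one[of x] by (simp add: ring_of_type_algebra_def)

lemma sm_zero_left: "x \<in> carrier M \<Longrightarrow> 0 \<odot>\<^bsub>M\<^esub> x = \<zero>\<^bsub>M\<^esub>"
  using smult_l_null[of x] by (simp add: ring_of_type_algebra_def)

lemma sm_zero_right: "c \<odot>\<^bsub>M\<^esub> \<zero>\<^bsub>M\<^esub> = \<zero>\<^bsub>M\<^esub>"
  using smult_r_null[of c] by (simp add: ring_of_type_algebra_def)

definition dif :: "'a \<Rightarrow> 'a \<Rightarrow> 'a" where
  "dif x y = x \<oplus>\<^bsub>M\<^esub> (-1) \<odot>\<^bsub>M\<^esub> y"

lemma dif_closed: "x \<in> carrier M \<Longrightarrow> y \<in> carrier M \<Longrightarrow> dif x y \<in> carrier M"
  by (simp add: dif_def sm_closed)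

lemma dif_self: "x \<in> carrier M \<Longrightarrow> dif x x = \<zero>\<^bsub>M\<^esub>"
  unfolding dif_def using sm_left_distrib[of x 1 "-1"] sm_one[of x] sm_zero_left[of x] by simp

lemma dif_cancel: "x \<in> carrier M \<Longrightarrow> y \<in> carrier M \<Longrightarrow> dif x y \<oplus>\<^bsub>M\<^esub> y = x"
  using dif_self[of y] a_comm[of y "(-1) \<odot>\<^bsub>M\<^esub> y"] by (simp add: dif_def sm_closed a_assoc)

lemma dif_zero_imp_eq: "x \<in> carrier M \<Longrightarrow> y \<in> carrier M \<Longrightarrow> dif x y = \<zero>\<^bsub>M\<^esub> \<Longrightarrow> x = y"
  using dif_cancel[of x y] by simp

context
  fixes g :: "'x \<Rightarrow> 'a"
  assumes g: "\<And>t. g t \<in> carrier M"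
begin

lemma mext_closed: "mext M g p \<in> carrier M"
  unfolding mext_def by (intro finsum_closed) (auto intro: sm_closed g)

lemma mext_superset:
  assumes "finite S" "Poly_Mapping.keys p \<subseteq> S"
  shows "mext M g p = (\<Oplus>\<^bsub>M\<^esub>t\<in>S. Poly_Mapping.lookup p t \<odot>\<^bsub>M\<^esub> g t)"
proof -
  let ?f = "\<lambda>t. Poly_Mapping.lookup p t \<odot>\<^bsub>M\<^esub> g t" and ?K = "Poly_Mapping.keys p"
  have f: "?f \<in> A \<rightarrow> carrier M" for A by (auto intro: sm_closed g)
  have "(\<Oplus>\<^bsub>M\<^esub>t\<in>S - ?K. ?f t) = (\<Oplus>\<^bsub>M\<^esub>t\<in>S - ?K. \<zero>\<^bsub>M\<^esub>)"
    by (rule finsum_cong') (auto simp: in_keys_iff sm_zero_left g)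
  then have "(\<Oplus>\<^bsub>M\<^esub>t\<in>S - ?K. ?f t) = \<zero>\<^bsub>M\<^esub>" by simp
  moreover have "finsum M ?f (?K \<union> (S - ?K)) = finsum M ?f ?K \<oplus>\<^bsub>M\<^esub> finsum M ?f (S - ?K)"
    using assms by (intro finsum_Un_disjoint f) auto
  moreover have "?K \<union> (S - ?K) = S" using assms by auto
  moreover have "finsum M ?f ?K \<in> carrier M" by (intro finsum_closed f)
  ultimately show ?thesis by (simp add: mext_def)
qed

lemma mext_add: "mext M g (p + q) = mext M g p \<oplus>\<^bsub>M\<^esub> mext M g q"
proof -
  let ?S = "Poly_Mapping.keys p \<union> Poly_Mapping.keys q"
  have "Poly_Mapping.keys (p + q) \<subseteq> ?S" by (rule keys_add)
  then have "mext M g (p + q) = (\<Oplus>\<^bsub>M\<^esub>t\<in>?S. Poly_Mapping.lookup p t \<odot>\<^bsub>M\<^esub> g t \<oplus>\<^bsub>M\<^esub> Poly_Mapping.lookup q t \<odot>\<^bsub>M\<^esub> g t)"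
    by (subst mext_superset[of ?S]) (simp_all add: lookup_add sm_left_distrib g)
  also have "\<dots> = mext M g p \<oplus>\<^bsub>M\<^esub> mext M g q"
    by (subst finsum_addf) (auto intro: sm_closed g simp: mext_superset[of ?S])
  finally show ?thesis .
qed

lemma mext_zero: "mext M g 0 = \<zero>\<^bsub>M\<^esub>"
  by (simp add: mext_def)

lemma mext_basis: "mext M g (basis t) = g t"
  using finsum_insert[of "{}" t "\<lambda>s. Poly_Mapping.lookup (basis t :: _ \<Rightarrow>\<^sub>0 'k) s \<odot>\<^bsub>M\<^esub> g s"]
  by (simp add: mext_def sm_one g)

lemma finsum_additive:
  assumes "finite S" "f \<in> S \<rightarrow> carrier M"
    and "\<And>x y. x \<in> carrier M \<Longrightarrow> y \<in> carrier M \<Longrightarrow> H (x \<oplus>\<^bsub>M\<^esub> y) = H x \<oplus>\<^bsub>N\<^esub> H y" "H \<zero>\<^bsub>M\<^esub> = \<zero>\<^bsub>N\<^esub>"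
    and "\<And>x. x \<in> carrier M \<Longrightarrow> H x \<in> carrier N" "abelian_monoid N"
  shows "H (finsum M f S) = finsum N (\<lambda>t. H (f t)) S"
proof -
  interpret N: abelian_monoid N by fact
  show ?thesis
    using assms(1,2)
  proof (induction S)
    case (insert x S)
    have fS: "f \<in> S \<rightarrow> carrier M" and fx: "f x \<in> carrier M" using insert.prems by auto
    then have "finsum M f S \<in> carrier M" by (intro finsum_closed)
    then show ?case
      using insert fS fx assms(3)[OF fx \<open>finsum M f S \<in> carrier M\<close>]
      by (subst finsum_insert; simp) (subst N.finsum_insert; auto intro: assms(5))
  qed (simp add: assms(4))
qed

lemma mext_lscale: "mext M g (lscale c p) = c \<odot>\<^bsub>M\<^esub> mext M g p"
proof -
  have "Poly_Mapping.keys (lscale c p) \<subseteq> Poly_Mapping.keys p"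
    by (auto simp: in_keys_iff lookup_lscale)
  then have "mext M g (lscale c p) = (\<Oplus>\<^bsub>M\<^esub>t\<in>Poly_Mapping.keys p. c \<odot>\<^bsub>M\<^esub> (Poly_Mapping.lookup p t \<odot>\<^bsub>M\<^esub> g t))"
    by (subst mext_superset[of "Poly_Mapping.keys p"]) (simp_all add: lookup_lscale sm_assoc g)
  also have "\<dots> = c \<odot>\<^bsub>M\<^esub> mext M g p"
    unfolding mext_def
    by (rule finsum_additive[symmetric])
       (auto intro: sm_closed g abelian_monoid_axioms simp: sm_right_distrib sm_zero_right)
  finally show ?thesis .
qed

lemma mext_diff: "mext M g (p - q) = dif (mext M g p) (mext M g q)"
  using mext_add[of p "- q"] mext_lscale[of "-1" q] by (simp add: dif_def)

lemma mext_hom: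
  assumes "kspace N" "\<And>x. x \<in> carrier M \<Longrightarrow> H x \<in> carrier N"
    and "\<And>x y. x \<in> carrier M \<Longrightarrow> y \<in> carrier M \<Longrightarrow> H (x \<oplus>\<^bsub>M\<^esub> y) = H x \<oplus>\<^bsub>N\<^esub> H y"
    and "\<And>c x. x \<in> carrier M \<Longrightarrow> H (c \<odot>\<^bsub>M\<^esub> x) = c \<odot>\<^bsub>N\<^esub> H x"
  shows "H (mext M g p) = mext N (\<lambda>t. H (g t)) p"
proof -
  interpret N: kspace N by fact
  have "H \<zero>\<^bsub>M\<^esub> = \<zero>\<^bsub>N\<^esub>"
    using assms(4)[of "\<zero>\<^bsub>M\<^esub>" 0] sm_zero_left[of "\<zero>\<^bsub>M\<^esub>"] N.sm_zero_left[OF assms(2)[of "\<zero>\<^bsub>M\<^esub>"]] by simp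
  then have "H (mext M g p) = finsum N (\<lambda>t. H (Poly_Mapping.lookup p t \<odot>\<^bsub>M\<^esub> g t)) (Poly_Mapping.keys p)"
    unfolding mext_def by (intro finsum_additive) (auto intro: assms sm_closed g N.abelian_monoid_axioms)
  then show ?thesis by (simp add: mext_def assms(4) g)
qed

lemma mext_subspace:
  assumes "\<zero>\<^bsub>M\<^esub> \<in> W" "\<And>x y. x \<in> W \<Longrightarrow> y \<in> W \<Longrightarrow> x \<oplus>\<^bsub>M\<^esub> y \<in> W" "\<And>c x. x \<in> W \<Longrightarrow> c \<odot>\<^bsub>M\<^esub> x \<in> W"
    and "\<And>t. t \<in> Poly_Mapping.keys p \<Longrightarrow> g t \<in> W"
  shows "mext M g p \<in> W"
proof -
  have "(\<Oplus>\<^bsub>M\<^esub>t\<in>S. Poly_Mapping.lookup p t \<odot>\<^bsub>M\<^esub> g t) \<in> W" if "finite S" "S \<subseteq> Poly_Mapping.keys p" for S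
    using that
  proof (induction S)
    case (insert x S)
    then show ?case by (subst finsum_insert) (auto intro!: assms sm_closed g)
  qed (simp add: assms(1))
  then show ?thesis by (simp add: mext_def)
qed

lemma mext_lext_basis: "mext M g (lext lscale (\<lambda>s. basis (h s)) p) = mext M (\<lambda>s. g (h s)) p"
proof -
  have "mext M g (\<Sum>s\<in>S. lscale (c s) (basis (h s))) = (\<Oplus>\<^bsub>M\<^esub>s\<in>S. c s \<odot>\<^bsub>M\<^esub> g (h s))" if "finite S" for S c
    using that
    by (induction S) (auto simp: mext_zero mext_add mext_lscale mext_basis finsum_insert sm_closed g Pi_I)
  then show ?thesis by (simp add: lext_def mext_def)
qed

end

end

text \<open>
  Behind the first \<open>a\<close> positions, a block of length \<open>c\<close> and a block of length \<open>b\<close> change places.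
\<close>

definition block_swap :: "nat \<Rightarrow> nat \<Rightarrow> nat \<Rightarrow> nat \<Rightarrow> nat" where
  "block_swap a b c r = (if a < r \<and> r \<le> a + c then r + b else if a + c < r \<and> r \<le> a + c + b then r - c else r)"

context operad
begin

lemma kspace_sp: "kspace (sp P m)"
  using module_sp by (simp add: kspace_def)

abbreviation odif :: "nat \<Rightarrow> 'a \<Rightarrow> 'a \<Rightarrow> 'a" where "odif m \<equiv> kspace.dif (sp P m)"

lemmas odif_def = kspace.dif_def[OF kspace_sp]
lemmas odif_closed = kspace.dif_closed[OF kspace_sp]
lemmas sm_closed = kspace.sm_closed[OF kspace_sp]

lemma sp_zero_closed: "\<zero>\<^bsub>sp P m\<^esub> \<in> els P m"
proof -
  interpret kspace "sp P m" by (rule kspace_sp)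
  show ?thesis by simp
qed

lemma act_dif:
  "x \<in> els P m \<Longrightarrow> y \<in> els P m \<Longrightarrow> \<sigma> permutes {1..m} \<Longrightarrow> act P m (odif m x y) \<sigma> = odif m (act P m x \<sigma>) (act P m y \<sigma>)"
  by (simp add: odif_def act_add act_smult sm_closed)

lemma pcomp_dif_left:
  "x \<in> els P m \<Longrightarrow> x' \<in> els P m \<Longrightarrow> y \<in> els P k \<Longrightarrow> i \<in> {1..m} \<Longrightarrow> l = m + k - 1 \<Longrightarrow>
    pcomp P m k i (odif m x x') y = odif l (pcomp P m k i x y) (pcomp P m k i x' y)"
  by (simp only: odif_def pcomp_add_left pcomp_smult_left sm_closed)

lemma pcomp_closed_eq: "x \<in> els P m \<Longrightarrow> y \<in> els P k \<Longrightarrow> i \<in> {1..m} \<Longrightarrow> l = m + k - 1 \<Longrightarrow> pcomp P m k i x y \<in> els P l"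
  using pcomp_closed by blast

lemma sequential_eq:
  assumes "x \<in> els P m" "y \<in> els P k" "z \<in> els P p" "i \<in> {1..m}" "j \<in> {1..k}"
    and "mk = m + k - 1" "kp = k + p - 1" "ij = i - 1 + j"
  shows "pcomp P m kp i x (pcomp P k p j y z) = pcomp P mk p ij (pcomp P m k i x y) z"
  using sequential[OF assms(1-5)] assms(6-) by simp

lemma parallel_eq:
  assumes "x \<in> els P m" "y \<in> els P k" "z \<in> els P p" "i \<in> {1..m}" "r \<in> {1..m}" "i < r"
    and "mk = m + k - 1" "mp = m + p - 1" "rk = r - 1 + k"
  shows "pcomp P mk p rk (pcomp P m k i x y) z = pcomp P mp k i (pcomp P m p r x z) y"
  using parallel[OF assms(1-6)] assms(7-) by simp

lemma equivariant_left:
  assumes "x \<in> els P m" "y \<in> els P k" "i \<in> {1..m}" "\<sigma> permutes {1..m}" "l = m + k - 1"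
  shows "pcomp P m k i (act P m x \<sigma>) y = act P l (pcomp P m k (\<sigma> i) x y) (perm_comp k i \<sigma> id)"
  using equivariant[OF assms(1-4) permutes_id] act_id[OF assms(2)] assms(5) by simp

lemma equivariant_right:
  assumes "x \<in> els P m" "y \<in> els P k" "i \<in> {1..m}" "\<tau> permutes {1..k}" "l = m + k - 1"
  shows "pcomp P m k i x (act P k y \<tau>) = act P l (pcomp P m k i x y) (perm_comp k i id \<tau>)"
  using equivariant[OF assms(1-3) permutes_id assms(4)] act_id[OF assms(1)] assms(5) by simp

lemma act_zero: "\<sigma> permutes {1..m} \<Longrightarrow> act P m \<zero>\<^bsub>sp P m\<^esub> \<sigma> = \<zero>\<^bsub>sp P m\<^esub>"
  using act_smult[OF sp_zero_closed, of \<sigma> m 0] kspace.sm_zero_left[OF kspace_sp] sp_zero_closed act_closed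
  by metis

lemma pcomp_zero_left: "y \<in> els P k \<Longrightarrow> i \<in> {1..m} \<Longrightarrow> pcomp P m k i \<zero>\<^bsub>sp P m\<^esub> y = \<zero>\<^bsub>sp P (m + k - 1)\<^esub>"
  using pcomp_smult_left[OF sp_zero_closed, of y k i m 0] kspace.sm_zero_left[OF kspace_sp] sp_zero_closed pcomp_closed
  by metis

lemma pcomp_zero_right: "x \<in> els P m \<Longrightarrow> i \<in> {1..m} \<Longrightarrow> pcomp P m k i x \<zero>\<^bsub>sp P k\<^esub> = \<zero>\<^bsub>sp P (m + k - 1)\<^esub>"
  using pcomp_smult_right[OF _ sp_zero_closed, of x m i k 0] kspace.sm_zero_left[OF kspace_sp] sp_zero_closed pcomp_closed
  by metis

text \<open>
  The composite \<open>v(x, y)\<close>, for \<open>x\<close> of arity \<open>a\<close> and \<open>y\<close> of arity \<open>b\<close>.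
\<close>

definition bin_op :: "'a \<Rightarrow> nat \<Rightarrow> nat \<Rightarrow> 'a \<Rightarrow> 'a \<Rightarrow> 'a" where
  "bin_op v a b x y = pcomp P (a + 1) b (a + 1) (pcomp P 2 a 1 v x) y"

text \<open>
  The composite \<open>r(x, y, z)\<close> of an operation \<open>r\<close> of arity three.
\<close>

definition tri_op :: "nat \<Rightarrow> nat \<Rightarrow> nat \<Rightarrow> 'a \<Rightarrow> 'a \<Rightarrow> 'a \<Rightarrow> 'a \<Rightarrow> 'a" where
  "tri_op a b c r x y z = pcomp P (a + b + 1) c (a + b + 1) (pcomp P (a + 2) b (a + 1) (pcomp P 3 a 1 r x) y) z"

lemma pcomp2_closed: "v \<in> els P 2 \<Longrightarrow> x \<in> els P a \<Longrightarrow> pcomp P 2 a 1 v x \<in> els P (a + 1)"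
  by (rule pcomp_closed_eq) auto

lemma bin_op_closed: "v \<in> els P 2 \<Longrightarrow> x \<in> els P a \<Longrightarrow> y \<in> els P b \<Longrightarrow> bin_op v a b x y \<in> els P (a + b)"
  unfolding bin_op_def by (rule pcomp_closed_eq[OF pcomp2_closed]) auto

lemma bin_op_bin_op_left:
  assumes "v \<in> els P 2" "x \<in> els P a" "y \<in> els P b" "z \<in> els P c"
  shows "bin_op v (a + b) c (bin_op v a b x y) z = tri_op a b c (pcomp P 2 2 1 v v) x y z"
proof -
  have "pcomp P 2 (a + 1) 1 v (pcomp P 2 a 1 v x) = pcomp P 3 a 1 (pcomp P 2 2 1 v v) x"
    by (rule sequential_eq) (use assms in auto)
  moreover have "pcomp P 2 (a + b) 1 v (bin_op v a b x y) = pcomp P (a + 2) b (a + 1) (pcomp P 2 (a + 1) 1 v (pcomp P 2 a 1 v x)) y"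
    unfolding bin_op_def by (rule sequential_eq) (use assms pcomp2_closed in auto)
  ultimately show ?thesis by (simp add: bin_op_def[of v "a + b"] tri_op_def)
qed

lemma bin_op_bin_op_right:
  assumes "v \<in> els P 2" "x \<in> els P a" "y \<in> els P b" "z \<in> els P c"
  shows "bin_op v a (b + c) x (bin_op v b c y z) = tri_op a b c (pcomp P 2 2 2 v v) x y z"
proof -
  let ?x = "pcomp P 2 a 1 v x" and ?y = "pcomp P 2 b 1 v y"
  note x = pcomp2_closed[OF assms(1,2)] and y = pcomp2_closed[OF assms(1,3)]
  have "pcomp P (a + 1) (b + c) (a + 1) ?x (bin_op v b c y z)
      = pcomp P (a + b + 1) c (a + b + 1) (pcomp P (a + 1) (b + 1) (a + 1) ?x ?y) z"
    unfolding bin_op_def by (rule sequential_eq) (use assms x y in auto)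
  moreover have "pcomp P (a + 1) (b + 1) (a + 1) ?x ?y = pcomp P (a + 2) b (a + 1) (pcomp P (a + 1) 2 (a + 1) ?x v) y"
    by (rule sequential_eq) (use assms x in auto)
  moreover have "pcomp P (a + 1) 2 (a + 1) ?x v = pcomp P 3 a 1 (pcomp P 2 2 2 v v) x"
    by (rule parallel_eq) (use assms in auto)
  ultimately show ?thesis by (simp add: bin_op_def[of v a "b + c"] tri_op_def)
qed

text \<open>
  Inserting operations in two exchanged inputs exchanges blocks of inputs: equivariance for each of
  the insertions, and independence of their order.
\<close>

lemma swap_blocks:
  assumes x: "x \<in> els P (a + 2)" and y: "y \<in> els P b" and z: "z \<in> els P c"
  shows "pcomp P (a + c + 1) b (a + c + 1) (pcomp P (a + 2) c (a + 1) (act P (a + 2) x (transpose (a + 1) (a + 2))) z) y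
    = act P (a + b + c) (pcomp P (a + b + 1) c (a + b + 1) (pcomp P (a + 2) b (a + 1) x y) z) (block_swap a b c)"
proof -
  let ?s = "transpose (a + 1) (a + 2)"
  let ?t = "perm_comp c (a + 1) ?s id"
  have s: "?s permutes {1..a + 2}" by (rule permutes_swap_id) auto
  have t: "?t permutes {1..a + c + 1}"
    using perm_comp_permutes[OF s permutes_id, of "a + 1" c] by (simp add: add_ac)
  have t1: "?t (a + c + 1) = a + 1" by (simp add: perm_comp_def shift_def)
  have xz: "pcomp P (a + 2) c (a + 2) x z \<in> els P (a + c + 1)"
    by (rule pcomp_closed_eq[OF x z]) auto
  have "pcomp P (a + 2) c (a + 1) (act P (a + 2) x ?s) z = act P (a + c + 1) (pcomp P (a + 2) c (?s (a + 1)) x z) ?t"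
    by (rule equivariant_left[OF x z _ s]) auto
  also have "?s (a + 1) = a + 2" by simp
  finally have 1: "pcomp P (a + 2) c (a + 1) (act P (a + 2) x ?s) z = act P (a + c + 1) (pcomp P (a + 2) c (a + 2) x z) ?t" .
  have "pcomp P (a + c + 1) b (a + c + 1) (act P (a + c + 1) (pcomp P (a + 2) c (a + 2) x z) ?t) y
      = act P (a + b + c) (pcomp P (a + c + 1) b (?t (a + c + 1)) (pcomp P (a + 2) c (a + 2) x z) y) (perm_comp b (a + c + 1) ?t id)"
    by (rule equivariant_left[OF xz y _ t]) auto
  also have "pcomp P (a + c + 1) b (?t (a + c + 1)) (pcomp P (a + 2) c (a + 2) x z) y
      = pcomp P (a + b + 1) c (a + b + 1) (pcomp P (a + 2) b (a + 1) x y) z"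
    unfolding t1 by (rule parallel_eq[OF x y z, symmetric]) auto
  also have "perm_comp b (a + c + 1) ?t id = block_swap a b c"
    by (rule ext) (auto simp: perm_comp_def shift_def block_swap_def transpose_def)
  finally show ?thesis unfolding 1 .
qed

lemma tri_op_swap:
  assumes r: "r \<in> els P 3" and x: "x \<in> els P a" and y: "y \<in> els P b" and z: "z \<in> els P c"
    and sym: "r = act P 3 r (transpose 2 3)"
  shows "tri_op a c b r x z y = act P (a + b + c) (tri_op a b c r x y z) (block_swap a b c)"
proof -
  let ?rx = "pcomp P 3 a 1 r x"
  have p: "transpose 2 (3::nat) permutes {1..3}" by (rule permutes_swap_id) auto
  have rx: "?rx \<in> els P (a + 2)" by (rule pcomp_closed_eq[OF r x]) auto
  have "?rx = pcomp P 3 a 1 (act P 3 r (transpose 2 3)) x" using sym by simp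
  also have "\<dots> = act P (a + 2) (pcomp P 3 a (transpose 2 3 1) r x) (perm_comp a 1 (transpose 2 3) id)"
    by (rule equivariant_left[OF r x _ p]) auto
  also have "transpose 2 (3::nat) 1 = 1" by (simp add: transpose_def)
  also have "perm_comp a 1 (transpose 2 3) id = transpose (a + 1) (a + 2)"
    by (rule ext) (auto simp: perm_comp_def shift_def transpose_def)
  finally have "?rx = act P (a + 2) ?rx (transpose (a + 1) (a + 2))" .
  then show ?thesis unfolding tri_op_def using swap_blocks[OF rx y z] by simp
qed

lemma bin_op_swap:
  assumes v: "v \<in> els P 2" and x: "x \<in> els P a" and y: "y \<in> els P b" and sym: "v = act P 2 v (transpose 1 2)"
  shows "bin_op v b a y x = act P (a + b) (bin_op v a b x y) (block_swap 0 a b)"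
  using swap_blocks[of v 0 x a y b] v x y sym by (simp add: bin_op_def numeral_2_eq_2)

lemma bin_op_act_left:
  assumes v: "v \<in> els P 2" and x: "x \<in> els P a" and y: "y \<in> els P b" and \<tau>: "\<tau> permutes {1..a}"
  shows "bin_op v a b (act P a x \<tau>) y = act P (a + b) (bin_op v a b x y) \<tau>"
proof -
  have \<tau>': "\<tau> permutes {1..a + 1}" by (rule permutes_subset[OF \<tau>]) auto
  have out: "\<tau> r = r" if "r = 0 \<or> a < r" for r by (rule permutes_not_in[OF \<tau>]) (use that in auto)
  have "perm_comp a 1 id \<tau> = \<tau>"
    by (rule ext) (auto simp: perm_comp_def shift_def out)
  then have 1: "pcomp P 2 a 1 v (act P a x \<tau>) = act P (a + 1) (pcomp P 2 a 1 v x) \<tau>"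
    using equivariant_right[OF v x _ \<tau>, of 1 "a + 1"] by simp
  have in_: "\<tau> r \<le> a" if "r \<le> a" for r using permutes_in_image[OF \<tau>, of r] that out[of 0] by (cases "r = 0") auto
  have "perm_comp b (a + 1) \<tau> id = \<tau>"
  proof
    fix r
    have "\<tau> r < Suc a" if "r < Suc a" using in_[of r] that by simp
    then show "perm_comp b (a + 1) \<tau> id r = \<tau> r"
      by (auto simp: perm_comp_def shift_def out)
  qed
  then show ?thesis
    unfolding bin_op_def 1
    using equivariant_left[OF pcomp2_closed[OF v x] y _ \<tau>', of "a + 1" "a + b"] by (simp add: out)
qed

lemma bin_op_act_right:
  assumes v: "v \<in> els P 2" and x: "x \<in> els P a" and y: "y \<in> els P b" and \<tau>: "\<tau> permutes {1..b}"
  shows "bin_op v a b x (act P b y \<tau>) = act P (a + b) (bin_op v a b x y) (perm_comp b (a + 1) id \<tau>)"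
  unfolding bin_op_def by (rule equivariant_right[OF pcomp2_closed[OF v x] y _ \<tau>]) auto

end

section \<open>Words and permutations\<close>

text \<open>
  Reading \<open>us\<close> through the permutation \<open>\<tau>\<close> gives \<open>ws\<close>.  If the letters of \<open>us\<close> name the inputs of an
  operation from left to right, then the right action of \<open>\<tau>\<close> turns it into the operation whose
  inputs are named by \<open>ws\<close>.
\<close>

definition matches :: "(nat \<Rightarrow> nat) \<Rightarrow> 'w list \<Rightarrow> 'w list \<Rightarrow> bool" where
  "matches \<tau> ws us \<longleftrightarrow> length us = length ws \<and> \<tau> permutes {1..length ws}
     \<and> (\<forall>i\<in>{1..length ws}. us ! (\<tau> i - 1) = ws ! (i - 1))"

lemma matches_exists:
  assumes "mset us = mset ws"
  shows "\<exists>\<tau>. matches \<tau> ws us"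
proof -
  obtain p where p: "p permutes {..<length us}" "permute_list p us = ws"
    using mset_eq_permutation[OF HOL.sym[OF assms]] by blast
  have len: "length us = length ws" using assms by (metis size_mset)
  let ?m = "length ws"
  define \<tau> where "\<tau> i = (if i \<in> {1..?m} then Suc (p (i - 1)) else i)" for i
  have lt: "p i < ?m" if "i < ?m" for i
    using permutes_in_image[OF p(1), of i] that len by simp
  have "\<tau> permutes {1..?m}"
  proof (rule bij_imp_permutes)
    have "inj_on \<tau> {1..?m}"
    proof (rule inj_onI)
      fix i j assume ij: "i \<in> {1..?m}" "j \<in> {1..?m}" "\<tau> i = \<tau> j"
      then have "p (i - 1) = p (j - 1)" by (simp add: \<tau>_def)
      then have "i - 1 = j - 1" using permutes_inj[OF p(1)] by (simp add: inj_eq)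
      then show "i = j" using ij by auto
    qed
    moreover have "\<tau> ` {1..?m} \<subseteq> {1..?m}"
    proof
      fix y assume "y \<in> \<tau> ` {1..?m}"
      then obtain i where "i \<in> {1..?m}" "y = Suc (p (i - 1))" by (auto simp: \<tau>_def)
      moreover from this have "i - 1 < ?m" by auto
      ultimately show "y \<in> {1..?m}" using lt[of "i - 1"] by simp
    qed
    ultimately show "bij_betw \<tau> {1..?m} {1..?m}"
      by (simp add: bij_betw_def endo_inj_surj)
  qed (auto simp: \<tau>_def)
  moreover have "us ! (\<tau> i - 1) = ws ! (i - 1)" if "i \<in> {1..?m}" for i
  proof -
    have "i - 1 < length us" using that len by auto
    then show ?thesis using that permute_list_nth[OF p(1), of "i - 1"] p(2) by (simp add: \<tau>_def)
  qed
  ultimately show ?thesis using len by (auto simp: matches_def)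
qed

lemma matches_unique:
  assumes "distinct us" "matches \<tau> ws us" "matches \<tau>' ws us"
  shows "\<tau> = \<tau>'"
proof
  fix i
  show "\<tau> i = \<tau>' i"
  proof (cases "i \<in> {1..length ws}")
    case True
    have p: "\<tau> permutes {1..length ws}" "\<tau>' permutes {1..length ws}" using assms by (auto simp: matches_def)
    have m: "\<tau> i \<in> {1..length ws}" "\<tau>' i \<in> {1..length ws}"
      using permutes_in_image[OF p(1)] permutes_in_image[OF p(2)] True by blast+
    have "us ! (\<tau> i - 1) = us ! (\<tau>' i - 1)" using assms True by (simp add: matches_def)
    then have "\<tau> i - 1 = \<tau>' i - 1"
      using assms m by (subst (asm) nth_eq_iff_index_eq) (auto simp: matches_def)
    then show ?thesis using m by auto
  next
    case False
    have "\<tau> i = i" by (rule permutes_not_in[OF _ False]) (use assms in \<open>auto simp: matches_def\<close>)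
    moreover have "\<tau>' i = i" by (rule permutes_not_in[OF _ False]) (use assms in \<open>auto simp: matches_def\<close>)
    ultimately show ?thesis by simp
  qed
qed

lemma matches_trans:
  assumes "matches \<tau> ws us" "matches \<pi> us vs"
  shows "matches (\<pi> \<circ> \<tau>) ws vs"
proof -
  have \<tau>: "\<tau> permutes {1..length ws}" using assms by (simp add: matches_def)
  have "vs ! (\<pi> (\<tau> i) - 1) = ws ! (i - 1)" if i: "i \<in> {1..length ws}" for i
  proof -
    have "\<tau> i \<in> {1..length ws}" using permutes_in_image[OF \<tau>] i by blast
    then show ?thesis using assms i by (simp add: matches_def)
  qed
  then show ?thesis using assms by (auto simp: matches_def intro: permutes_compose)
qed

lemma matches_append_left:
  assumes "matches \<tau> us us'" shows "matches \<tau> (us @ vs) (us' @ vs)"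
proof -
  have \<tau>: "\<tau> permutes {1..length us}" and len: "length us' = length us" using assms by (auto simp: matches_def)
  have "(us' @ vs) ! (\<tau> i - 1) = (us @ vs) ! (i - 1)" if i: "i \<in> {1..length (us @ vs)}" for i
  proof (cases "i \<le> length us")
    case True
    then have "\<tau> i \<in> {1..length us}" using permutes_in_image[OF \<tau>, of i] i by auto
    moreover have "us' ! (\<tau> i - 1) = us ! (i - 1)" using assms i True by (auto simp: matches_def)
    ultimately show ?thesis using i True len by (auto simp: nth_append)
  next
    case False
    then have "\<tau> i = i" by (intro permutes_not_in[OF \<tau>]) auto
    then show ?thesis using False len by (auto simp: nth_append)
  qed
  moreover have "\<tau> permutes {1..length (us @ vs)}" by (rule permutes_subset[OF \<tau>]) auto
  ultimately show ?thesis using len by (auto simp: matches_def)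
qed

lemma matches_append_right:
  assumes "matches \<tau> vs vs'"
  shows "matches (perm_comp (length vs) (length us + 1) id \<tau>) (us @ vs) (us @ vs')"
proof -
  let ?a = "length us" and ?b = "length vs"
  let ?\<pi> = "perm_comp ?b (?a + 1) id \<tau>"
  have \<tau>: "\<tau> permutes {1..?b}" and len: "length vs' = ?b" using assms by (auto simp: matches_def)
  have "?\<pi> permutes {1..?a + 1 + ?b - 1}" by (rule perm_comp_permutes[OF permutes_id \<tau>]) auto
  then have p: "?\<pi> permutes {1..length (us @ vs)}" by simp
  have "(us @ vs') ! (?\<pi> i - 1) = (us @ vs) ! (i - 1)" if i: "i \<in> {1..length (us @ vs)}" for i
  proof (cases "i \<le> ?a")
    case True
    then have "?\<pi> i = i" by (simp add: perm_comp_def shift_def)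
    then show ?thesis using True i by (auto simp: nth_append)
  next
    case False
    then have "i - ?a \<in> {1..?b}" using i by auto
    then have "\<tau> (i - ?a) \<in> {1..?b}" "vs' ! (\<tau> (i - ?a) - 1) = vs ! (i - ?a - 1)"
      using permutes_in_image[OF \<tau>, of "i - ?a"] assms by (auto simp: matches_def)
    moreover have "?\<pi> i = ?a + \<tau> (i - ?a)" using False i by (simp add: perm_comp_def)
    moreover have "i - 1 - ?a = i - ?a - 1" by simp
    ultimately show ?thesis using False by (auto simp: nth_append)
  qed
  then show ?thesis using p len by (auto simp: matches_def)
qed

lemma matches_block_swap:
  "matches (block_swap (length us) (length vs) (length ws)) (us @ ws @ vs) (us @ vs @ ws)"
proof -
  let ?a = "length us" and ?b = "length vs" and ?c = "length ws"
  let ?s = "block_swap ?a ?b ?c"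
  have "?s permutes {1..?a + (?c + ?b)}"
  proof (rule bij_imp_permutes)
    have "inj_on ?s {1..?a + (?c + ?b)}"
      by (auto simp: inj_on_def block_swap_def split: if_splits)
    moreover have "?s ` {1..?a + (?c + ?b)} \<subseteq> {1..?a + (?c + ?b)}"
      by (auto simp: block_swap_def)
    ultimately show "bij_betw ?s {1..?a + (?c + ?b)} {1..?a + (?c + ?b)}"
      by (simp add: bij_betw_def endo_inj_surj)
  qed (auto simp: block_swap_def)
  moreover have "(us @ vs @ ws) ! (?s i - 1) = (us @ ws @ vs) ! (i - 1)" if "i \<in> {1..?a + (?c + ?b)}" for i
  proof -
    consider "i \<le> ?a" | "?a < i" "i \<le> ?a + ?c" | "?a + ?c < i" by linarith
    then show ?thesis
    proof cases
      case 1
      then have "i - 1 < ?a" using that by auto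
      then show ?thesis using 1 by (simp add: block_swap_def nth_append)
    next
      case 2
      define j where "j = i - ?a - 1"
      have j: "i = ?a + Suc j" "j < ?c" using 2 by (auto simp: j_def)
      then have "?s i - 1 = ?a + (?b + j)" "i - 1 = ?a + j" by (auto simp: block_swap_def)
      moreover have "(us @ vs @ ws) ! (?a + (?b + j)) = ws ! j" by (simp only: nth_append_length_plus)
      moreover have "(us @ ws @ vs) ! (?a + j) = ws ! j" using j(2) by (simp add: nth_append)
      ultimately show ?thesis by simp
    next
      case 3
      define j where "j = i - ?a - ?c - 1"
      have j: "i = ?a + (?c + Suc j)" "j < ?b" using 3 that by (auto simp: j_def)
      then have "?s i - 1 = ?a + j" "i - 1 = ?a + (?c + j)" by (auto simp: block_swap_def)
      moreover have "(us @ ws @ vs) ! (?a + (?c + j)) = vs ! j" by (simp only: nth_append_length_plus)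
      moreover have "(us @ vs @ ws) ! (?a + j) = vs ! j" using j(2) by (simp add: nth_append)
      ultimately show ?thesis by simp
    qed
  qed
  ultimately show ?thesis by (simp add: matches_def)
qed


section \<open>Iterated products in an operad\<close>

definition standard_word :: "nat \<Rightarrow> nat list" where
  "standard_word m = [1..<Suc m]"

lemma length_standard_word [simp]: "length (standard_word m) = m"
  by (simp add: standard_word_def)

lemma distinct_standard_word [simp]: "distinct (standard_word m)"
  unfolding standard_word_def by (rule distinct_upt)

lemma standard_word_nth: "i \<in> {1..m} \<Longrightarrow> standard_word m ! (i - 1) = i"
  by (auto simp del: upt_Suc simp add: standard_word_def)

lemma mset_standard_word: "mset (standard_word m) = mset_set {1..m}"
  unfolding standard_word_def by (simp add: mset_upt atLeastLessThanSuc_atLeastAtMost del: upt_Suc)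

text \<open>
  The identities of \<open>shared_bracket\<close> for operations of an operad, the second one in terms of the
  differences with the operation \<open>mu 0\<close>.
\<close>

locale shared_bracket_operad = operad P for P :: "('k::field, 'a) operad" +
  fixes mu :: "nat \<Rightarrow> 'a"
  assumes mu_closed: "mu k \<in> els P 2"
    and mu_prelie: "odif 3 (pcomp P 2 2 1 (mu k) (mu k)) (pcomp P 2 2 2 (mu k) (mu k))
      = act P 3 (odif 3 (pcomp P 2 2 1 (mu k) (mu k)) (pcomp P 2 2 2 (mu k) (mu k))) (transpose 2 3)"
    and mu_bracket: "odif 2 (mu k) (mu 0) = act P 2 (odif 2 (mu k) (mu 0)) (transpose 1 2)"
begin

abbreviation nleaves :: "monomial \<Rightarrow> nat" where "nleaves t \<equiv> length (leaves t)"

text \<open>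
  The variables are disregarded; the inputs are numbered from left to right.
\<close>

primrec planar :: "monomial \<Rightarrow> 'a" where
  "planar (Var i) = ident P"
| "planar (Prod k s t) = bin_op (mu k) (nleaves s) (nleaves t) (planar s) (planar t)"

lemma planar_closed: "planar t \<in> els P (nleaves t)"
  by (induction t) (auto intro: bin_op_closed mu_closed simp: ident_closed[simplified])

text \<open>
  The operation given by a monomial, with the \<open>j\<close>-th letter of \<open>ws\<close> naming the \<open>j\<close>-th input.  It is
  zero unless every letter occurs exactly once, which makes linear extension over all monomials
  possible.
\<close>

definition monomial_op :: "nat list \<Rightarrow> monomial \<Rightarrow> 'a" where
  "monomial_op ws t = (if distinct ws \<and> mset (leaves t) = mset ws
     then act P (length ws) (planar t) (SOME \<tau>. matches \<tau> ws (leaves t)) else \<zero>\<^bsub>sp P (length ws)\<^esub>)"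

lemma monomial_op_eq:
  assumes "distinct ws" "mset (leaves t) = mset ws" "matches \<tau> ws (leaves t)"
  shows "monomial_op ws t = act P (length ws) (planar t) \<tau>"
proof -
  have "distinct (leaves t)" using assms(1,2) by (metis mset_eq_imp_distinct_iff)
  moreover have "matches (SOME \<tau>. matches \<tau> ws (leaves t)) ws (leaves t)"
    using assms(3) by (rule someI[where P = "\<lambda>\<tau>. matches \<tau> ws (leaves t)"])
  ultimately have "(SOME \<tau>. matches \<tau> ws (leaves t)) = \<tau>" using matches_unique assms(3) by blast
  then show ?thesis using assms by (simp add: monomial_op_def)
qed

lemma monomial_op_zero: "\<not> (distinct ws \<and> mset (leaves t) = mset ws) \<Longrightarrow> monomial_op ws t = \<zero>\<^bsub>sp P (length ws)\<^esub>"
  unfolding monomial_op_def by (rule if_not_P)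

lemma monomial_op_closed: "monomial_op ws t \<in> els P (length ws)"
proof (cases "distinct ws \<and> mset (leaves t) = mset ws")
  case True
  then obtain \<tau> where \<tau>: "matches \<tau> ws (leaves t)" using matches_exists by blast
  then have "nleaves t = length ws" by (simp add: matches_def)
  then show ?thesis using True monomial_op_eq[OF _ _ \<tau>] \<tau> planar_closed[of t] by (auto simp: matches_def intro!: act_closed)
qed (simp add: monomial_op_zero sp_zero_closed)

lemma monomial_op_context_left:
  assumes ws: "distinct ws" and mset: "mset (us @ leaves t) = mset ws" and \<sigma>: "matches \<sigma> ws (us @ leaves t)"
  shows "monomial_op ws (Prod k s t) = act P (length ws) (bin_op (mu k) (length us) (nleaves t) (monomial_op us s) (planar t)) \<sigma>"
proof -
  have len: "length us + nleaves t = length ws" using \<sigma> by (simp add: matches_def)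
  have \<sigma>p: "\<sigma> permutes {1..length us + nleaves t}" using \<sigma> len by (simp add: matches_def)
  have us: "distinct us" using ws mset by (metis distinct_append mset_eq_imp_distinct_iff)
  show ?thesis
  proof (cases "mset (leaves s) = mset us")
    case True
    then obtain \<tau> where \<tau>: "matches \<tau> us (leaves s)" using matches_exists by blast
    have nls: "nleaves s = length us" using \<tau> by (simp add: matches_def)
    have m: "matches (\<tau> \<circ> \<sigma>) ws (leaves (Prod k s t))"
      using matches_trans[OF \<sigma> matches_append_left[OF \<tau>]] by simp
    have \<tau>p: "\<tau> permutes {1..length us}" using \<tau> by (simp add: matches_def)
    have \<tau>p': "\<tau> permutes {1..length us + nleaves t}" by (rule permutes_subset[OF \<tau>p]) auto
    have s: "planar s \<in> els P (length us)" using planar_closed[of s] nls by simp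
    have "bin_op (mu k) (length us) (nleaves t) (monomial_op us s) (planar t) = act P (length us + nleaves t) (bin_op (mu k) (length us) (nleaves t) (planar s) (planar t)) \<tau>"
      unfolding monomial_op_eq[OF us True \<tau>] by (rule bin_op_act_left[OF mu_closed s planar_closed \<tau>p])
    moreover have "monomial_op ws (Prod k s t) = act P (length ws) (planar (Prod k s t)) (\<tau> \<circ> \<sigma>)"
      by (rule monomial_op_eq[OF ws _ m]) (use True mset in simp)
    ultimately show ?thesis
      using act_act[OF bin_op_closed[OF mu_closed s planar_closed] \<tau>p' \<sigma>p] by (simp add: nls len[symmetric])
  next
    case False
    then have "mset (leaves (Prod k s t)) \<noteq> mset ws" using HOL.sym[OF mset] by simp
    moreover have "bin_op (mu k) (length us) (nleaves t) \<zero>\<^bsub>sp P (length us)\<^esub> (planar t) = \<zero>\<^bsub>sp P (length us + nleaves t)\<^esub>"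
      unfolding bin_op_def using pcomp_zero_right[OF mu_closed[of k], of 1 "length us"] pcomp_zero_left[OF planar_closed[of t], of "length us + 1" "length us + 1"]
      by simp
    ultimately show ?thesis
      using False act_zero[OF \<sigma>p] by (simp add: monomial_op_zero len)
  qed
qed

lemma monomial_op_context_right:
  assumes ws: "distinct ws" and mset: "mset (leaves t @ us) = mset ws" and \<sigma>: "matches \<sigma> ws (leaves t @ us)"
  shows "monomial_op ws (Prod k t s) = act P (length ws) (bin_op (mu k) (nleaves t) (length us) (planar t) (monomial_op us s)) \<sigma>"
proof -
  have len: "nleaves t + length us = length ws" using \<sigma> by (simp add: matches_def)
  have \<sigma>p: "\<sigma> permutes {1..nleaves t + length us}" using \<sigma> len by (simp add: matches_def)
  have us: "distinct us" using ws mset by (metis distinct_append mset_eq_imp_distinct_iff)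
  show ?thesis
  proof (cases "mset (leaves s) = mset us")
    case True
    then obtain \<tau> where \<tau>: "matches \<tau> us (leaves s)" using matches_exists by blast
    let ?\<tau> = "perm_comp (length us) (nleaves t + 1) id \<tau>"
    have nls: "nleaves s = length us" using \<tau> by (simp add: matches_def)
    note mr = matches_append_right[OF \<tau>, of "leaves t"]
    have m: "matches (?\<tau> \<circ> \<sigma>) ws (leaves (Prod k t s))"
      using matches_trans[OF \<sigma> mr] by simp
    have \<tau>p: "\<tau> permutes {1..length us}" using \<tau> by (simp add: matches_def)
    have \<tau>p': "?\<tau> permutes {1..nleaves t + length us}" using mr by (simp add: matches_def)
    have s: "planar s \<in> els P (length us)" using planar_closed[of s] nls by simp
    have "bin_op (mu k) (nleaves t) (length us) (planar t) (monomial_op us s) = act P (nleaves t + length us) (bin_op (mu k) (nleaves t) (length us) (planar t) (planar s)) ?\<tau>"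
      unfolding monomial_op_eq[OF us True \<tau>] by (rule bin_op_act_right[OF mu_closed planar_closed s \<tau>p])
    moreover have "monomial_op ws (Prod k t s) = act P (length ws) (planar (Prod k t s)) (?\<tau> \<circ> \<sigma>)"
      by (rule monomial_op_eq[OF ws _ m]) (use True mset in simp)
    ultimately show ?thesis
      using act_act[OF bin_op_closed[OF mu_closed planar_closed s] \<tau>p' \<sigma>p] by (simp add: nls len[symmetric])
  next
    case False
    then have "mset (leaves (Prod k t s)) \<noteq> mset ws" using HOL.sym[OF mset] by simp
    moreover have "bin_op (mu k) (nleaves t) (length us) (planar t) \<zero>\<^bsub>sp P (length us)\<^esub> = \<zero>\<^bsub>sp P (nleaves t + length us)\<^esub>"
      unfolding bin_op_def using pcomp_zero_right[OF pcomp2_closed[OF mu_closed planar_closed], of "nleaves t + 1" t "length us"] by simp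
    ultimately show ?thesis
      using False act_zero[OF \<sigma>p] by (simp add: monomial_op_zero len)
  qed
qed

abbreviation polynomial_op :: "nat list \<Rightarrow> (monomial \<Rightarrow>\<^sub>0 'k) \<Rightarrow> 'a" where
  "polynomial_op ws \<equiv> mext (sp P (length ws)) (monomial_op ws)"

lemma polynomial_op_closed: "polynomial_op ws p \<in> els P (length ws)"
  by (rule kspace.mext_closed[OF kspace_sp monomial_op_closed])

lemma polynomial_op_zero: "polynomial_op ws 0 = \<zero>\<^bsub>sp P (length ws)\<^esub>"
  by (rule kspace.mext_zero[OF kspace_sp monomial_op_closed])

lemma polynomial_op_add: "polynomial_op ws (p + q) = polynomial_op ws p \<oplus>\<^bsub>sp P (length ws)\<^esub> polynomial_op ws q"
  by (rule kspace.mext_add[OF kspace_sp monomial_op_closed])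

lemma polynomial_op_diff: "polynomial_op ws (p - q) = odif (length ws) (polynomial_op ws p) (polynomial_op ws q)"
  by (rule kspace.mext_diff[OF kspace_sp monomial_op_closed])

lemma polynomial_op_lscale: "polynomial_op ws (lscale c p) = c \<odot>\<^bsub>sp P (length ws)\<^esub> polynomial_op ws p"
  by (rule kspace.mext_lscale[OF kspace_sp monomial_op_closed])

lemma polynomial_op_basis: "polynomial_op ws (basis t) = monomial_op ws t"
  by (rule kspace.mext_basis[OF kspace_sp monomial_op_closed])

lemma mext_const_zero: "mext (sp P m) (\<lambda>t. \<zero>\<^bsub>sp P m\<^esub>) p = \<zero>\<^bsub>sp P m\<^esub>"
proof -
  interpret kspace "sp P m" by (rule kspace_sp)
  show ?thesis by (simp add: mext_def sm_zero_right)
qed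

text \<open>
  Vanishing for all words \<open>us\<close> is needed because a factor of a monomial only sees part of the letters.
\<close>

lemma polynomial_op_context:
  fixes p :: "monomial \<Rightarrow>\<^sub>0 'k"
  assumes "\<And>us. polynomial_op us p = \<zero>\<^bsub>sp P (length us)\<^esub>"
  shows "polynomial_op ws (monomial_prod k p (basis t)) = \<zero>\<^bsub>sp P (length ws)\<^esub>"
    and "polynomial_op ws (monomial_prod k (basis t) p) = \<zero>\<^bsub>sp P (length ws)\<^esub>"
proof -
  have eq1: "polynomial_op ws (monomial_prod k p (basis t)) = mext (sp P (length ws)) (\<lambda>s. monomial_op ws (Prod k s t)) p"
    unfolding monomial_prod_def pm.lext_basis by (rule kspace.mext_lext_basis[OF kspace_sp monomial_op_closed])
  have eq2: "polynomial_op ws (monomial_prod k (basis t) p) = mext (sp P (length ws)) (\<lambda>s. monomial_op ws (Prod k t s)) p"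
    unfolding monomial_prod_def pm.lext_basis by (rule kspace.mext_lext_basis[OF kspace_sp monomial_op_closed])
  show "polynomial_op ws (monomial_prod k p (basis t)) = \<zero>\<^bsub>sp P (length ws)\<^esub>"
  proof (cases "distinct ws \<and> (\<exists>us. mset (us @ leaves t) = mset ws)")
    case True
    then obtain us \<sigma> where us: "mset (us @ leaves t) = mset ws" "matches \<sigma> ws (us @ leaves t)"
      using matches_exists by blast
    have len: "length us + nleaves t = length ws" using us(2) by (simp add: matches_def)
    have \<sigma>: "\<sigma> permutes {1..length ws}" using us(2) by (simp add: matches_def)
    let ?H = "\<lambda>x. act P (length ws) (bin_op (mu k) (length us) (nleaves t) x (planar t)) \<sigma>"
    note c2 = pcomp2_closed[OF mu_closed[of k]]
    have bc: "bin_op (mu k) (length us) (nleaves t) x (planar t) \<in> els P (length ws)" if "x \<in> els P (length us)" for x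
      using bin_op_closed[OF mu_closed that planar_closed, of k t] len by simp
    have "?H (polynomial_op us p) = mext (sp P (length ws)) (\<lambda>s. ?H (monomial_op us s)) p"
    proof (rule kspace.mext_hom[OF kspace_sp monomial_op_closed kspace_sp])
      fix x assume x: "x \<in> els P (length us)"
      show "?H x \<in> els P (length ws)" by (rule act_closed[OF bc[OF x] \<sigma>])
      show "?H (c \<odot>\<^bsub>sp P (length us)\<^esub> x) = c \<odot>\<^bsub>sp P (length ws)\<^esub> ?H x" for c
      proof -
        have "bin_op (mu k) (length us) (nleaves t) (c \<odot>\<^bsub>sp P (length us)\<^esub> x) (planar t)
          = c \<odot>\<^bsub>sp P (length ws)\<^esub> bin_op (mu k) (length us) (nleaves t) x (planar t)"
          using pcomp_smult_right[OF mu_closed x, of 1 k c] pcomp_smult_left[OF c2[OF x] planar_closed[of t], of "length us + 1" c] len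
          by (simp add: bin_op_def)
        then show ?thesis by (simp add: act_smult[OF bc[OF x] \<sigma>])
      qed
      fix y assume y: "y \<in> els P (length us)"
      have "bin_op (mu k) (length us) (nleaves t) (x \<oplus>\<^bsub>sp P (length us)\<^esub> y) (planar t)
        = bin_op (mu k) (length us) (nleaves t) x (planar t) \<oplus>\<^bsub>sp P (length ws)\<^esub> bin_op (mu k) (length us) (nleaves t) y (planar t)"
        using pcomp_add_right[OF mu_closed x y, of 1 k] pcomp_add_left[OF c2[OF x] c2[OF y] planar_closed[of t], of "length us + 1"] len
        by (simp add: bin_op_def)
      then show "?H (x \<oplus>\<^bsub>sp P (length us)\<^esub> y) = ?H x \<oplus>\<^bsub>sp P (length ws)\<^esub> ?H y"
        by (simp add: act_add[OF bc[OF x] bc[OF y] \<sigma>])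
    qed
    also have "(\<lambda>s. ?H (monomial_op us s)) = (\<lambda>s. monomial_op ws (Prod k s t))"
      using monomial_op_context_left[OF _ us] True by (simp add: fun_eq_iff)
    finally have "polynomial_op ws (monomial_prod k p (basis t)) = ?H \<zero>\<^bsub>sp P (length us)\<^esub>" unfolding eq1 assms by simp
    also have "bin_op (mu k) (length us) (nleaves t) \<zero>\<^bsub>sp P (length us)\<^esub> (planar t) = \<zero>\<^bsub>sp P (length ws)\<^esub>"
      unfolding bin_op_def using pcomp_zero_right[OF mu_closed[of k], of 1 "length us"] pcomp_zero_left[OF planar_closed[of t], of "length us + 1" "length us + 1"] len
      by simp
    also have "act P (length ws) \<zero>\<^bsub>sp P (length ws)\<^esub> \<sigma> = \<zero>\<^bsub>sp P (length ws)\<^esub>" by (rule act_zero[OF \<sigma>])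
    finally show ?thesis .
  next
    case False
    then have "monomial_op ws (Prod k s t) = \<zero>\<^bsub>sp P (length ws)\<^esub>" for s
      by (intro monomial_op_zero) auto
    then show ?thesis unfolding eq1 by (simp add: mext_const_zero)
  qed
  show "polynomial_op ws (monomial_prod k (basis t) p) = \<zero>\<^bsub>sp P (length ws)\<^esub>"
  proof (cases "distinct ws \<and> (\<exists>us. mset (leaves t @ us) = mset ws)")
    case True
    then obtain us \<sigma> where us: "mset (leaves t @ us) = mset ws" "matches \<sigma> ws (leaves t @ us)"
      using matches_exists by blast
    have len: "nleaves t + length us = length ws" using us(2) by (simp add: matches_def)
    have \<sigma>: "\<sigma> permutes {1..length ws}" using us(2) by (simp add: matches_def)
    let ?H = "\<lambda>x. act P (length ws) (bin_op (mu k) (nleaves t) (length us) (planar t) x) \<sigma>"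
    note ct = pcomp2_closed[OF mu_closed[of k] planar_closed[of t]]
    have bc: "bin_op (mu k) (nleaves t) (length us) (planar t) x \<in> els P (length ws)" if "x \<in> els P (length us)" for x
      using bin_op_closed[OF mu_closed planar_closed that, of k t] len by simp
    have "?H (polynomial_op us p) = mext (sp P (length ws)) (\<lambda>s. ?H (monomial_op us s)) p"
    proof (rule kspace.mext_hom[OF kspace_sp monomial_op_closed kspace_sp])
      fix x assume x: "x \<in> els P (length us)"
      show "?H x \<in> els P (length ws)" by (rule act_closed[OF bc[OF x] \<sigma>])
      show "?H (c \<odot>\<^bsub>sp P (length us)\<^esub> x) = c \<odot>\<^bsub>sp P (length ws)\<^esub> ?H x" for c
      proof -
        have "bin_op (mu k) (nleaves t) (length us) (planar t) (c \<odot>\<^bsub>sp P (length us)\<^esub> x)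
          = c \<odot>\<^bsub>sp P (length ws)\<^esub> bin_op (mu k) (nleaves t) (length us) (planar t) x"
          using pcomp_smult_right[OF ct x, of "nleaves t + 1" c] len by (simp add: bin_op_def)
        then show ?thesis by (simp add: act_smult[OF bc[OF x] \<sigma>])
      qed
      fix y assume y: "y \<in> els P (length us)"
      have "bin_op (mu k) (nleaves t) (length us) (planar t) (x \<oplus>\<^bsub>sp P (length us)\<^esub> y)
        = bin_op (mu k) (nleaves t) (length us) (planar t) x \<oplus>\<^bsub>sp P (length ws)\<^esub> bin_op (mu k) (nleaves t) (length us) (planar t) y"
        using pcomp_add_right[OF ct x y, of "nleaves t + 1"] len by (simp add: bin_op_def)
      then show "?H (x \<oplus>\<^bsub>sp P (length us)\<^esub> y) = ?H x \<oplus>\<^bsub>sp P (length ws)\<^esub> ?H y"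
        by (simp add: act_add[OF bc[OF x] bc[OF y] \<sigma>])
    qed
    also have "(\<lambda>s. ?H (monomial_op us s)) = (\<lambda>s. monomial_op ws (Prod k t s))"
      using monomial_op_context_right[OF _ us] True by (simp add: fun_eq_iff)
    finally have "polynomial_op ws (monomial_prod k (basis t) p) = ?H \<zero>\<^bsub>sp P (length us)\<^esub>" unfolding eq2 assms by simp
    also have "bin_op (mu k) (nleaves t) (length us) (planar t) \<zero>\<^bsub>sp P (length us)\<^esub> = \<zero>\<^bsub>sp P (length ws)\<^esub>"
      unfolding bin_op_def using pcomp_zero_right[OF ct, of "nleaves t + 1" "length us"] len by simp
    also have "act P (length ws) \<zero>\<^bsub>sp P (length ws)\<^esub> \<sigma> = \<zero>\<^bsub>sp P (length ws)\<^esub>" by (rule act_zero[OF \<sigma>])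
    finally show ?thesis .
  next
    case False
    then have "monomial_op ws (Prod k t s) = \<zero>\<^bsub>sp P (length ws)\<^esub>" for s
      by (intro monomial_op_zero) auto
    then show ?thesis unfolding eq2 by (simp add: mext_const_zero)
  qed
qed

lemma polynomial_op_zeroI:
  assumes "odif (length ws) (monomial_op ws s1) (monomial_op ws s2) = odif (length ws) (monomial_op ws s3) (monomial_op ws s4)"
  shows "polynomial_op ws ((basis s1 - basis s2) - (basis s3 - basis s4)) = \<zero>\<^bsub>sp P (length ws)\<^esub>"
  unfolding polynomial_op_diff polynomial_op_basis assms by (intro kspace.dif_self[OF kspace_sp] odif_closed monomial_op_closed)

lemma polynomial_op_prelie:
  "polynomial_op ws ((basis (Prod k (Prod k a b) c) - basis (Prod k a (Prod k b c)))
    - (basis (Prod k (Prod k a c) b) - basis (Prod k a (Prod k c b)))) = \<zero>\<^bsub>sp P (length ws)\<^esub>"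
proof (rule polynomial_op_zeroI)
  let ?t1 = "Prod k (Prod k a b) c" and ?t2 = "Prod k a (Prod k b c)"
    and ?t3 = "Prod k (Prod k a c) b" and ?t4 = "Prod k a (Prod k c b)"
  show "odif (length ws) (monomial_op ws ?t1) (monomial_op ws ?t2) = odif (length ws) (monomial_op ws ?t3) (monomial_op ws ?t4)"
  proof (cases "distinct ws \<and> mset (leaves ?t1) = mset ws")
    case False
    then show ?thesis by (simp add: monomial_op_zero add_ac)
  next
    case True
    let ?L = "leaves a @ leaves b @ leaves c" and ?L' = "leaves a @ leaves c @ leaves b"
    have ms: "mset ?L = mset ws" "mset ?L' = mset ws" using True by (simp_all add: add_ac)
    obtain \<tau>' where \<tau>': "matches \<tau>' ws ?L'" using matches_exists[OF ms(2)] by blast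
    let ?\<pi> = "block_swap (nleaves a) (nleaves b) (nleaves c)"
    have \<tau>: "matches (?\<pi> \<circ> \<tau>') ws ?L"
      using matches_trans[OF \<tau>' matches_block_swap] .
    have len: "length ws = nleaves a + nleaves b + nleaves c" using \<tau> by (simp add: matches_def)
    let ?m = "length ws"
    have p: "\<tau>' permutes {1..?m}" "?\<pi> \<circ> \<tau>' permutes {1..?m}" "?\<pi> permutes {1..?m}"
      using \<tau> \<tau>' matches_block_swap[of "leaves a" "leaves b" "leaves c"] by (simp_all add: matches_def len add_ac)
    have 1: "monomial_op ws ?t1 = act P ?m (planar ?t1) (?\<pi> \<circ> \<tau>')" "monomial_op ws ?t2 = act P ?m (planar ?t2) (?\<pi> \<circ> \<tau>')"
      "monomial_op ws ?t3 = act P ?m (planar ?t3) \<tau>'" "monomial_op ws ?t4 = act P ?m (planar ?t4) \<tau>'"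
      using True ms \<tau> \<tau>' by (intro monomial_op_eq; simp)+
    let ?u = "pcomp P 2 2 1 (mu k) (mu k)" and ?v = "pcomp P 2 2 2 (mu k) (mu k)"
    let ?d = "odif 3 ?u ?v"
    have uv: "?u \<in> els P 3" "?v \<in> els P 3" by (rule pcomp_closed_eq[OF mu_closed mu_closed]; simp)+
    have d: "?d \<in> els P 3" by (rule odif_closed[OF uv])
    have tri_op_closed: "tri_op x y z r A B C \<in> els P (x + y + z)" if "r \<in> els P 3" "A \<in> els P x" "B \<in> els P y" "C \<in> els P z"
      for x y z r A B C
    proof -
      have "pcomp P 3 x 1 r A \<in> els P (x + 2)" by (rule pcomp_closed_eq) (use that in auto)
      then have "pcomp P (x + 2) y (x + 1) (pcomp P 3 x 1 r A) B \<in> els P (x + y + 1)"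
        by (rule pcomp_closed_eq) (use that in auto)
      then show ?thesis unfolding tri_op_def by (rule pcomp_closed_eq) (use that in auto)
    qed
    have tri_op_dif: "odif (x + y + z) (tri_op x y z ?u A B C) (tri_op x y z ?v A B C) = tri_op x y z ?d A B C"
      if A: "A \<in> els P x" and B: "B \<in> els P y" and C: "C \<in> els P z" for x y z A B C
    proof -
      have c1: "pcomp P 3 x 1 r A \<in> els P (x + 2)" if "r \<in> els P 3" for r
        by (rule pcomp_closed_eq[OF that A]) auto
      have c2: "pcomp P (x + 2) y (x + 1) (pcomp P 3 x 1 r A) B \<in> els P (x + y + 1)" if "r \<in> els P 3" for r
        by (rule pcomp_closed_eq[OF c1[OF that] B]) auto
      have "pcomp P 3 x 1 ?d A = odif (x + 2) (pcomp P 3 x 1 ?u A) (pcomp P 3 x 1 ?v A)"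
        by (rule pcomp_dif_left[OF uv A]) auto
      moreover have "pcomp P (x + 2) y (x + 1) (odif (x + 2) (pcomp P 3 x 1 ?u A) (pcomp P 3 x 1 ?v A)) B
          = odif (x + y + 1) (pcomp P (x + 2) y (x + 1) (pcomp P 3 x 1 ?u A) B) (pcomp P (x + 2) y (x + 1) (pcomp P 3 x 1 ?v A) B)"
        by (rule pcomp_dif_left[OF c1[OF uv(1)] c1[OF uv(2)] B]) auto
      ultimately show ?thesis unfolding tri_op_def
        by (simp only:) (rule pcomp_dif_left[OF c2[OF uv(1)] c2[OF uv(2)] C, symmetric]; simp)
    qed
    have "odif ?m (monomial_op ws ?t1) (monomial_op ws ?t2) = act P ?m (odif ?m (planar ?t1) (planar ?t2)) (?\<pi> \<circ> \<tau>')"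
      unfolding 1 using planar_closed[of ?t1] planar_closed[of ?t2] p
      by (intro act_dif[symmetric]) (simp_all add: len add_ac del: planar.simps)
    also have "odif ?m (planar ?t1) (planar ?t2) = tri_op (nleaves a) (nleaves b) (nleaves c) ?d (planar a) (planar b) (planar c)"
      using tri_op_dif[OF planar_closed planar_closed planar_closed, of a b c] bin_op_bin_op_left[OF mu_closed planar_closed planar_closed planar_closed, of k a b c]
        bin_op_bin_op_right[OF mu_closed planar_closed planar_closed planar_closed, of k a b c] by (simp add: len)
    also have "act P ?m \<dots> (?\<pi> \<circ> \<tau>') = act P ?m (act P ?m (tri_op (nleaves a) (nleaves b) (nleaves c) ?d (planar a) (planar b) (planar c)) ?\<pi>) \<tau>'"
      using tri_op_closed[OF d planar_closed planar_closed planar_closed, of a b c] p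
      by (intro act_act[symmetric]) (simp_all add: len)
    also have "act P ?m (tri_op (nleaves a) (nleaves b) (nleaves c) ?d (planar a) (planar b) (planar c)) ?\<pi> = tri_op (nleaves a) (nleaves c) (nleaves b) ?d (planar a) (planar c) (planar b)"
      unfolding len by (rule tri_op_swap[OF d planar_closed planar_closed planar_closed mu_prelie, symmetric])
    also have "\<dots> = odif ?m (planar ?t3) (planar ?t4)"
      using tri_op_dif[OF planar_closed planar_closed planar_closed, of a c b] bin_op_bin_op_left[OF mu_closed planar_closed planar_closed planar_closed, of k a c b]
        bin_op_bin_op_right[OF mu_closed planar_closed planar_closed planar_closed, of k a c b] by (simp add: len add_ac)
    also have "act P ?m \<dots> \<tau>' = odif ?m (monomial_op ws ?t3) (monomial_op ws ?t4)"
      unfolding 1 using planar_closed[of ?t3] planar_closed[of ?t4] p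
      by (intro act_dif) (simp_all add: len add_ac del: planar.simps)
    finally show ?thesis .
  qed
qed

lemma polynomial_op_bracket:
  "polynomial_op ws ((basis (Prod k a b) - basis (Prod 0 a b)) - (basis (Prod k b a) - basis (Prod 0 b a)))
    = \<zero>\<^bsub>sp P (length ws)\<^esub>"
proof (rule polynomial_op_zeroI)
  show "odif (length ws) (monomial_op ws (Prod k a b)) (monomial_op ws (Prod 0 a b))
      = odif (length ws) (monomial_op ws (Prod k b a)) (monomial_op ws (Prod 0 b a))"
  proof (cases "distinct ws \<and> mset (leaves (Prod k a b)) = mset ws")
    case False
    then show ?thesis by (simp add: monomial_op_zero add_ac)
  next
    case True
    have ms: "mset (leaves a @ leaves b) = mset ws" "mset (leaves b @ leaves a) = mset ws" using True by (simp_all add: add_ac)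
    obtain \<tau>' where \<tau>': "matches \<tau>' ws (leaves b @ leaves a)" using matches_exists[OF ms(2)] by blast
    let ?\<pi> = "block_swap 0 (nleaves a) (nleaves b)"
    have sw: "matches ?\<pi> (leaves b @ leaves a) (leaves a @ leaves b)"
      using matches_block_swap[of "[]" "leaves a" "leaves b"] by simp
    have \<tau>: "matches (?\<pi> \<circ> \<tau>') ws (leaves a @ leaves b)"
      using matches_trans[OF \<tau>' sw] .
    have len: "length ws = nleaves a + nleaves b" using \<tau> by (simp add: matches_def)
    let ?m = "length ws"
    have p: "\<tau>' permutes {1..?m}" "?\<pi> \<circ> \<tau>' permutes {1..?m}" "?\<pi> permutes {1..?m}"
      using \<tau> \<tau>' sw by (simp_all add: matches_def len add_ac)
    have 1: "monomial_op ws (Prod l a b) = act P ?m (planar (Prod l a b)) (?\<pi> \<circ> \<tau>')"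
      "monomial_op ws (Prod l b a) = act P ?m (planar (Prod l b a)) \<tau>'" for l
      using True ms \<tau> \<tau>' by (intro monomial_op_eq; simp)+
    let ?d = "odif 2 (mu k) (mu 0)"
    have d: "?d \<in> els P 2" by (rule odif_closed[OF mu_closed mu_closed])
    have bin_op_dif: "odif (x + y) (bin_op (mu k) x y A B) (bin_op (mu 0) x y A B) = bin_op ?d x y A B"
      if A: "A \<in> els P x" and B: "B \<in> els P y" for x y A B
    proof -
      have "pcomp P 2 x 1 ?d A = odif (x + 1) (pcomp P 2 x 1 (mu k) A) (pcomp P 2 x 1 (mu 0) A)"
        by (rule pcomp_dif_left[OF mu_closed mu_closed A]) auto
      then show ?thesis unfolding bin_op_def
        by (simp only:) (rule pcomp_dif_left[OF pcomp2_closed[OF mu_closed A] pcomp2_closed[OF mu_closed A] B, symmetric]; simp)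
    qed
    have "odif ?m (monomial_op ws (Prod k a b)) (monomial_op ws (Prod 0 a b))
        = act P ?m (odif ?m (planar (Prod k a b)) (planar (Prod 0 a b))) (?\<pi> \<circ> \<tau>')"
      unfolding 1 using planar_closed[of "Prod k a b"] planar_closed[of "Prod 0 a b"] p
      by (intro act_dif[symmetric]) (simp_all add: len add_ac del: planar.simps)
    also have "odif ?m (planar (Prod k a b)) (planar (Prod 0 a b)) = bin_op ?d (nleaves a) (nleaves b) (planar a) (planar b)"
      using bin_op_dif[OF planar_closed planar_closed, of a b] by (simp add: len)
    also have "act P ?m \<dots> (?\<pi> \<circ> \<tau>') = act P ?m (act P ?m (bin_op ?d (nleaves a) (nleaves b) (planar a) (planar b)) ?\<pi>) \<tau>'"
      using bin_op_closed[OF d planar_closed planar_closed, of a b] p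
      by (intro act_act[symmetric]) (simp_all add: len)
    also have "act P ?m (bin_op ?d (nleaves a) (nleaves b) (planar a) (planar b)) ?\<pi> = bin_op ?d (nleaves b) (nleaves a) (planar b) (planar a)"
      unfolding len by (rule bin_op_swap[OF d planar_closed planar_closed mu_bracket, symmetric])
    also have "\<dots> = odif ?m (planar (Prod k b a)) (planar (Prod 0 b a))"
      using bin_op_dif[OF planar_closed planar_closed, of b a] by (simp add: len add_ac)
    also have "act P ?m \<dots> \<tau>' = odif ?m (monomial_op ws (Prod k b a)) (monomial_op ws (Prod 0 b a))"
      unfolding 1 using planar_closed[of "Prod k b a"] planar_closed[of "Prod 0 b a"] p
      by (intro act_dif) (simp_all add: len add_ac del: planar.simps)
    finally show ?thesis .
  qed
qed

text \<open>
  The identities hold in the operad also when operations are substituted for the variables, and they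
  persist in larger monomials.
\<close>

theorem polynomial_op_relations:
  assumes "p \<in> relations" shows "polynomial_op ws p = \<zero>\<^bsub>sp P (length ws)\<^esub>"
  using assms
proof (induction arbitrary: ws)
  case rel_zero
  show ?case by (rule polynomial_op_zero)
next
  case (rel_add p q)
  interpret kspace "sp P (length ws)" by (rule kspace_sp)
  show ?case unfolding polynomial_op_add rel_add.IH by simp
next
  case (rel_scale p c)
  show ?case unfolding polynomial_op_lscale rel_scale.IH by (rule kspace.sm_zero_right[OF kspace_sp])
qed (auto intro: polynomial_op_context polynomial_op_prelie polynomial_op_bracket)

section \<open>Operads generated by their products\<close>

text \<open>
  Composition of planar composites is substitution of monomials for leaves.
\<close>

lemma planar_subst:
  assumes "i \<in> {1..nleaves s}"
  shows "\<exists>u. nleaves u = nleaves s + nleaves t - 1 \<and> (bounded_by n s \<longrightarrow> bounded_by n t \<longrightarrow> bounded_by n u)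
    \<and> pcomp P (nleaves s) (nleaves t) i (planar s) (planar t) = planar u"
  using assms
proof (induction s arbitrary: i)
  case (Var w)
  then show ?case using ident_left[OF planar_closed, of t] by (intro exI[of _ t]) simp
next
  case (Prod k a b)
  let ?x = "pcomp P 2 (nleaves a) 1 (mu k) (planar a)"
  have x: "?x \<in> els P (nleaves a + 1)" by (rule pcomp2_closed[OF mu_closed planar_closed])
  show ?case
  proof (cases "i \<le> nleaves a")
    case True
    then have i: "i \<in> {1..nleaves a}" using Prod.prems by auto
    obtain u where u: "nleaves u = nleaves a + nleaves t - 1" "bounded_by n a \<longrightarrow> bounded_by n t \<longrightarrow> bounded_by n u"
      "pcomp P (nleaves a) (nleaves t) i (planar a) (planar t) = planar u" using Prod.IH(1)[OF i] by blast
    have nu: "nleaves u + 1 = nleaves a + nleaves t" using u(1) i unfolding atLeastAtMost_iff by linarith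
    have "pcomp P (nleaves a + 1) (nleaves t) i ?x (planar t) = pcomp P 2 (nleaves u) 1 (mu k) (planar u)"
      unfolding u(3)[symmetric]
      by (rule sequential_eq[OF mu_closed planar_closed planar_closed, symmetric]) (use i u(1) in auto)
    moreover have "pcomp P (nleaves u + 1) (nleaves b) (nleaves u + 1) (pcomp P (nleaves a + 1) (nleaves t) i ?x (planar t)) (planar b)
        = pcomp P (nleaves a + nleaves b) (nleaves t) i (pcomp P (nleaves a + 1) (nleaves b) (nleaves a + 1) ?x (planar b)) (planar t)"
      by (rule parallel_eq[OF x planar_closed planar_closed]) (use i nu in auto)
    ultimately have "pcomp P (nleaves (Prod k a b)) (nleaves t) i (planar (Prod k a b)) (planar t) = planar (Prod k u b)"
      by (simp add: bin_op_def)
    moreover have "nleaves (Prod k u b) = nleaves (Prod k a b) + nleaves t - 1" using nu by simp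
    ultimately show ?thesis using u(2) by (intro exI[of _ "Prod k u b"]) auto
  next
    case False
    define j where "j = i - nleaves a"
    have j: "j \<in> {1..nleaves b}" "i = nleaves a + j" using False Prod.prems by (auto simp: j_def)
    obtain u where u: "nleaves u = nleaves b + nleaves t - 1" "bounded_by n b \<longrightarrow> bounded_by n t \<longrightarrow> bounded_by n u"
      "pcomp P (nleaves b) (nleaves t) j (planar b) (planar t) = planar u" using Prod.IH(2)[OF j(1)] by blast
    have "pcomp P (nleaves a + 1) (nleaves u) (nleaves a + 1) ?x (pcomp P (nleaves b) (nleaves t) j (planar b) (planar t))
        = pcomp P (nleaves a + nleaves b) (nleaves t) i (pcomp P (nleaves a + 1) (nleaves b) (nleaves a + 1) ?x (planar b)) (planar t)"
      by (rule sequential_eq[OF x planar_closed planar_closed]) (use j u(1) in auto)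
    then have "pcomp P (nleaves (Prod k a b)) (nleaves t) i (planar (Prod k a b)) (planar t) = planar (Prod k a u)"
      by (simp add: bin_op_def u(3))
    moreover have "nleaves (Prod k a u) = nleaves (Prod k a b) + nleaves t - 1" using u(1) j by auto
    ultimately show ?thesis using u(2) by (intro exI[of _ "Prod k a u"]) auto
  qed
qed

lemma planar_rename_leaves: "length us = nleaves t \<Longrightarrow> \<exists>t'. leaves t' = us \<and> planar t' = planar t \<and> (bounded_by n t' \<longleftrightarrow> bounded_by n t)"
proof (induction t arbitrary: us)
  case (Var w)
  then obtain v where "us = [v]" by (auto simp: length_Suc_conv)
  then show ?case by (intro exI[of _ "Var v"]) simp
next
  case (Prod k a b)
  obtain a' where a': "leaves a' = take (nleaves a) us" "planar a' = planar a" "bounded_by n a' \<longleftrightarrow> bounded_by n a"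
    using Prod.IH(1)[of "take (nleaves a) us"] Prod.prems by auto
  obtain b' where b': "leaves b' = drop (nleaves a) us" "planar b' = planar b" "bounded_by n b' \<longleftrightarrow> bounded_by n b"
    using Prod.IH(2)[of "drop (nleaves a) us"] Prod.prems by auto
  show ?case using a' b' Prod.prems by (intro exI[of _ "Prod k a' b'"]) (auto simp: min_absorb2)
qed

text \<open>
  The permutation is absorbed by naming the leaves of the monomial accordingly.
\<close>

lemma monomial_op_onto:
  assumes \<sigma>: "\<sigma> permutes {1..nleaves t}"
  shows "\<exists>t'. (bounded_by n t' \<longleftrightarrow> bounded_by n t) \<and> mset (leaves t') = mset (standard_word (nleaves t)) \<and> monomial_op (standard_word (nleaves t)) t' = act P (nleaves t) (planar t) \<sigma>"
proof -
  let ?m = "nleaves t"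
  let ?us = "map (Hilbert_Choice.inv \<sigma>) (standard_word ?m)"
  obtain t' where t': "leaves t' = ?us" "planar t' = planar t" "bounded_by n t' \<longleftrightarrow> bounded_by n t"
    using planar_rename_leaves[of ?us t n] by auto
  have inv: "Hilbert_Choice.inv \<sigma> permutes {1..?m}" by (rule permutes_inv[OF \<sigma>])
  have "mset ?us = image_mset (Hilbert_Choice.inv \<sigma>) (mset_set {1..?m})"
    by (simp add: mset_standard_word)
  also have "\<dots> = mset_set (Hilbert_Choice.inv \<sigma> ` {1..?m})"
    by (rule image_mset_mset_set[OF permutes_inj_on[OF inv]])
  also have "\<dots> = mset (standard_word ?m)"
    unfolding permutes_image[OF inv] by (simp add: mset_standard_word)
  finally have ms: "mset (leaves t') = mset (standard_word ?m)" unfolding t'(1) .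
  have "?us ! (\<sigma> i - 1) = standard_word ?m ! (i - 1)" if i: "i \<in> {1..?m}" for i
  proof -
    have si: "\<sigma> i \<in> {1..?m}" using permutes_in_image[OF \<sigma>] i by blast
    then have "\<sigma> i - 1 < length (standard_word ?m)" by auto
    then have "?us ! (\<sigma> i - 1) = Hilbert_Choice.inv \<sigma> (\<sigma> i)" using standard_word_nth[OF si] by simp
    also have "\<dots> = i" using permutes_inverses(2)[OF \<sigma>] .
    finally show ?thesis using standard_word_nth[OF i] by simp
  qed
  then have m: "matches \<sigma> (standard_word ?m) (leaves t')" unfolding t'(1) matches_def using \<sigma> by simp
  show ?thesis
    using monomial_op_eq[OF _ ms m] ms t' by (intro exI[of _ t']) simp
qed

definition multilinear_terms :: "nat \<Rightarrow> nat \<Rightarrow> monomial set" where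
  "multilinear_terms n m = {t. bounded_by n t \<and> mset (leaves t) = mset (standard_word m)}"

text \<open>
  The combinations of iterated products of \<open>mu 0, \<dots>, mu n\<close> with permuted inputs.
\<close>

definition spanned :: "nat \<Rightarrow> nat \<Rightarrow> 'a set" where
  "spanned n m = polynomial_op (standard_word m) ` supported (multilinear_terms n m)"

lemma spanned_zero: "\<zero>\<^bsub>sp P m\<^esub> \<in> spanned n m"
  unfolding spanned_def by (rule image_eqI[of _ _ 0]) (use polynomial_op_zero[of "standard_word m"] in simp_all)

lemma spanned_add:
  assumes "x \<in> spanned n m" "y \<in> spanned n m"
  shows "x \<oplus>\<^bsub>sp P m\<^esub> y \<in> spanned n m"
proof -
  obtain p q where "p \<in> supported (multilinear_terms n m)" "q \<in> supported (multilinear_terms n m)"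
    "x = polynomial_op (standard_word m) p" "y = polynomial_op (standard_word m) q" using assms by (auto simp: spanned_def)
  then show ?thesis
    unfolding spanned_def using polynomial_op_add[of "standard_word m" p q] by (intro image_eqI[of _ _ "p + q"]) (simp_all add: supported_add)
qed

lemma spanned_smult:
  assumes "x \<in> spanned n m"
  shows "c \<odot>\<^bsub>sp P m\<^esub> x \<in> spanned n m"
proof -
  obtain p where "p \<in> supported (multilinear_terms n m)" "x = polynomial_op (standard_word m) p"
    using assms by (auto simp: spanned_def)
  then show ?thesis
    unfolding spanned_def using polynomial_op_lscale[of "standard_word m" c p] by (intro image_eqI[of _ _ "lscale c p"]) (simp_all add: supported_lscale)
qed

lemma spanned_closed: "x \<in> spanned n m \<Longrightarrow> x \<in> els P m"
  unfolding spanned_def using polynomial_op_closed[of "standard_word m"] by auto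

lemma spanned_act_planar:
  assumes "bounded_by n t" "nleaves t = m" "\<sigma> permutes {1..m}"
  shows "act P m (planar t) \<sigma> \<in> spanned n m"
proof -
  obtain t' where t': "bounded_by n t'" "mset (leaves t') = mset (standard_word m)" "monomial_op (standard_word m) t' = act P m (planar t) \<sigma>"
    using monomial_op_onto[of \<sigma> t n] assms by auto
  then show ?thesis unfolding spanned_def
    using polynomial_op_basis[of "standard_word m" t'] by (intro image_eqI[of _ _ "basis t'"]) (simp_all add: multilinear_terms_def)
qed

lemma spanned_induct:
  assumes x: "x \<in> spanned n m"
    and W: "\<zero>\<^bsub>sp P m\<^esub> \<in> W" "\<And>x y. x \<in> W \<Longrightarrow> y \<in> W \<Longrightarrow> x \<oplus>\<^bsub>sp P m\<^esub> y \<in> W" "\<And>c x. x \<in> W \<Longrightarrow> c \<odot>\<^bsub>sp P m\<^esub> x \<in> W"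
    and act: "\<And>t \<sigma>. bounded_by n t \<Longrightarrow> nleaves t = m \<Longrightarrow> \<sigma> permutes {1..m} \<Longrightarrow> act P m (planar t) \<sigma> \<in> W"
  shows "x \<in> W"
proof -
  obtain p where p: "p \<in> supported (multilinear_terms n m)" "x = polynomial_op (standard_word m) p"
    using x by (auto simp: spanned_def)
  have "polynomial_op (standard_word m) p \<in> W"
  proof (rule kspace.mext_subspace[OF kspace_sp monomial_op_closed])
    fix t assume "t \<in> Poly_Mapping.keys p"
    then have t: "bounded_by n t" "mset (leaves t) = mset (standard_word m)"
      using p(1) by (auto simp: supported_def multilinear_terms_def)
    obtain \<tau> where \<tau>: "matches \<tau> (standard_word m) (leaves t)" using matches_exists[OF t(2)] by blast
    have "monomial_op (standard_word m) t = act P m (planar t) \<tau>" using monomial_op_eq[OF _ t(2) \<tau>] by simp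
    then show "monomial_op (standard_word m) t \<in> W" using act[OF t(1)] \<tau> by (auto simp: matches_def)
  qed (use W in simp_all)
  then show ?thesis using p by simp
qed

lemma spanned_act:
  assumes "x \<in> spanned n m" "\<sigma> permutes {1..m}" shows "act P m x \<sigma> \<in> spanned n m"
proof -
  have "x \<in> {x \<in> els P m. act P m x \<sigma> \<in> spanned n m}"
  proof (rule spanned_induct[OF assms(1)])
    interpret kspace "sp P m" by (rule kspace_sp)
    show "\<zero>\<^bsub>sp P m\<^esub> \<in> {x \<in> els P m. act P m x \<sigma> \<in> spanned n m}"
      using act_zero[OF assms(2)] spanned_zero by simp
    fix x y assume "x \<in> {x \<in> els P m. act P m x \<sigma> \<in> spanned n m}" "y \<in> {x \<in> els P m. act P m x \<sigma> \<in> spanned n m}"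
    then show "x \<oplus>\<^bsub>sp P m\<^esub> y \<in> {x \<in> els P m. act P m x \<sigma> \<in> spanned n m}"
      using act_add[OF _ _ assms(2)] spanned_add by simp
  next
    interpret kspace "sp P m" by (rule kspace_sp)
    fix c x assume "x \<in> {x \<in> els P m. act P m x \<sigma> \<in> spanned n m}"
    then show "c \<odot>\<^bsub>sp P m\<^esub> x \<in> {x \<in> els P m. act P m x \<sigma> \<in> spanned n m}"
      using act_smult[OF _ assms(2)] spanned_smult sm_closed by simp
  next
    fix t \<tau> assume t: "bounded_by n t" "nleaves t = m" "\<tau> permutes {1..m}"
    have "planar t \<in> els P m" using planar_closed[of t] t(2) by simp
    then show "act P m (planar t) \<tau> \<in> {x \<in> els P m. act P m x \<sigma> \<in> spanned n m}"
      using t assms(2) act_act[OF _ t(3) assms(2)] spanned_act_planar[OF t(1,2) permutes_compose[OF assms(2) t(3)]] act_closed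
      by simp
  qed
  then show ?thesis by simp
qed

text \<open>
  By bilinearity and equivariance it is enough to compose planar composites.
\<close>

lemma spanned_pcomp:
  assumes x: "x \<in> spanned n m" and y: "y \<in> spanned n k" and i: "i \<in> {1..m}"
  shows "pcomp P m k i x y \<in> spanned n (m + k - 1)"
proof -
  have 1: "y \<in> {y \<in> els P k. pcomp P m k i (act P m (planar s) \<sigma>) y \<in> spanned n (m + k - 1)}"
    if s: "bounded_by n s" "nleaves s = m" "\<sigma> permutes {1..m}" for s \<sigma>
  proof (rule spanned_induct[OF y])
    interpret kspace "sp P k" by (rule kspace_sp)
    have ps: "planar s \<in> els P m" using planar_closed[of s] s(2) by simp
    have as: "act P m (planar s) \<sigma> \<in> els P m" by (rule act_closed[OF ps s(3)])
    show "\<zero>\<^bsub>sp P k\<^esub> \<in> {y \<in> els P k. pcomp P m k i (act P m (planar s) \<sigma>) y \<in> spanned n (m + k - 1)}"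
      using pcomp_zero_right[OF as i] spanned_zero by simp
    show "x \<oplus>\<^bsub>sp P k\<^esub> y \<in> {y \<in> els P k. pcomp P m k i (act P m (planar s) \<sigma>) y \<in> spanned n (m + k - 1)}"
      if "x \<in> {y \<in> els P k. pcomp P m k i (act P m (planar s) \<sigma>) y \<in> spanned n (m + k - 1)}"
        "y \<in> {y \<in> els P k. pcomp P m k i (act P m (planar s) \<sigma>) y \<in> spanned n (m + k - 1)}" for x y
      using that pcomp_add_right[OF as _ _ i] spanned_add by simp
    show "c \<odot>\<^bsub>sp P k\<^esub> x \<in> {y \<in> els P k. pcomp P m k i (act P m (planar s) \<sigma>) y \<in> spanned n (m + k - 1)}"
      if "x \<in> {y \<in> els P k. pcomp P m k i (act P m (planar s) \<sigma>) y \<in> spanned n (m + k - 1)}" for c x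
      using that pcomp_smult_right[OF as _ i] spanned_smult sm_closed by simp
    fix t \<tau> assume t: "bounded_by n t" "nleaves t = k" "\<tau> permutes {1..k}"
    have pt: "planar t \<in> els P k" using planar_closed[of t] t(2) by simp
    have si: "\<sigma> i \<in> {1..m}" using permutes_in_image[OF s(3)] i by blast
    obtain u where u: "nleaves u = m + k - 1" "bounded_by n u" "pcomp P m k (\<sigma> i) (planar s) (planar t) = planar u"
      using planar_subst[of "\<sigma> i" s t n] si s t by auto
    have "pcomp P m k i (act P m (planar s) \<sigma>) (act P k (planar t) \<tau>) = act P (m + k - 1) (planar u) (perm_comp k i \<sigma> \<tau>)"
      using equivariant[OF ps pt i s(3) t(3)] u(3) by simp
    then show "act P k (planar t) \<tau> \<in> {y \<in> els P k. pcomp P m k i (act P m (planar s) \<sigma>) y \<in> spanned n (m + k - 1)}"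
      using spanned_act_planar[OF u(2,1) perm_comp_permutes[OF s(3) t(3) i]] act_closed[OF pt t(3)] by simp
  qed
  note yk = spanned_closed[OF y]
  have "x \<in> {x \<in> els P m. pcomp P m k i x y \<in> spanned n (m + k - 1)}"
  proof (rule spanned_induct[OF x])
    interpret kspace "sp P m" by (rule kspace_sp)
    show "\<zero>\<^bsub>sp P m\<^esub> \<in> {x \<in> els P m. pcomp P m k i x y \<in> spanned n (m + k - 1)}"
      using pcomp_zero_left[OF yk i] spanned_zero by simp
    show "x \<oplus>\<^bsub>sp P m\<^esub> x' \<in> {x \<in> els P m. pcomp P m k i x y \<in> spanned n (m + k - 1)}"
      if "x \<in> {x \<in> els P m. pcomp P m k i x y \<in> spanned n (m + k - 1)}"
        "x' \<in> {x \<in> els P m. pcomp P m k i x y \<in> spanned n (m + k - 1)}" for x x'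
      using that pcomp_add_left[OF _ _ yk i] spanned_add by simp
    show "c \<odot>\<^bsub>sp P m\<^esub> x \<in> {x \<in> els P m. pcomp P m k i x y \<in> spanned n (m + k - 1)}"
      if "x \<in> {x \<in> els P m. pcomp P m k i x y \<in> spanned n (m + k - 1)}" for c x
      using that pcomp_smult_left[OF _ yk i] spanned_smult sm_closed by simp
    fix s \<sigma> assume s: "bounded_by n s" "nleaves s = m" "\<sigma> permutes {1..m}"
    have "planar s \<in> els P m" using planar_closed[of s] s(2) by simp
    then show "act P m (planar s) \<sigma> \<in> {x \<in> els P m. pcomp P m k i x y \<in> spanned n (m + k - 1)}"
      using 1[OF s] act_closed[OF _ s(3)] by simp
  qed
  then show ?thesis by simp
qed

lemma spanned_ident: "ident P \<in> spanned n 1"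
  using spanned_act_planar[of n "Var 1" 1 id] act_id[OF ident_closed] by (simp add: permutes_id)

lemma planar_mu: "planar (Prod k (Var i) (Var j)) = mu k"
proof -
  have "pcomp P 2 1 1 (mu k) (ident P) = mu k" "pcomp P 2 1 2 (mu k) (ident P) = mu k"
    by (rule ident_right[OF mu_closed]; simp)+
  then show ?thesis by (simp add: bin_op_def numeral_2_eq_2)
qed

lemma spanned_mu: "k \<le> n \<Longrightarrow> mu k \<in> spanned n 2"
  using spanned_act_planar[of n "Prod k (Var 1) (Var 2)" 2 id] act_id[OF mu_closed] planar_mu[of k 1 2]
  by (simp add: permutes_id del: planar.simps)

end


section \<open>Comparison with the operad of Greg trees\<close>

lemma operad_hom_zero:
  assumes "operad P" "operad Q" "operad_hom P Q \<phi>"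
  shows "\<phi> m \<zero>\<^bsub>sp P m\<^esub> = \<zero>\<^bsub>sp Q m\<^esub>"
proof -
  have z: "\<zero>\<^bsub>sp P m\<^esub> \<in> els P m" by (rule operad.sp_zero_closed[OF assms(1)])
  then have "\<phi> m (0 \<odot>\<^bsub>sp P m\<^esub> \<zero>\<^bsub>sp P m\<^esub>) = 0 \<odot>\<^bsub>sp Q m\<^esub> \<phi> m \<zero>\<^bsub>sp P m\<^esub>"
    by (rule operad_homD(3)[OF assms(3)])
  then show ?thesis
    using kspace.sm_zero_left[OF operad.kspace_sp[OF assms(1)] z]
      kspace.sm_zero_left[OF operad.kspace_sp[OF assms(2)] operad_homD(1)[OF assms(3) z]] by simp
qed

lemma operad_hom_dif:
  assumes "operad P" "operad Q" "operad_hom P Q \<phi>" "x \<in> els P m" "y \<in> els P m"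
  shows "\<phi> m (kspace.dif (sp P m) x y) = kspace.dif (sp Q m) (\<phi> m x) (\<phi> m y)"
  unfolding operad.odif_def[OF assms(1)] operad.odif_def[OF assms(2)]
  by (simp add: operad_homD(2,3)[OF assms(3)] assms(4,5) operad.sm_closed[OF assms(1)])

lemma operad_hom_compose:
  assumes "operad_hom P Q \<phi>" "operad_hom Q R \<psi>"
  shows "operad_hom P R (\<lambda>m x. \<psi> m (\<phi> m x))"
  by (rule operad_homI)
     (simp_all add: operad_homD(1-6)[OF assms(1)] operad_homD(1-6)[OF assms(2)] del: One_nat_def)

text \<open>
  Induction over operadic expressions: a suboperad containing the images of the generators contains the
  image of the morphism.
\<close>

lemma presented_suboperad:
  assumes \<phi>: "operad_hom (presented_operad E a R) Q \<phi>" and Q: "operad Q"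
    and W: "\<And>m. \<zero>\<^bsub>sp Q m\<^esub> \<in> W m" "\<And>m x y. x \<in> W m \<Longrightarrow> y \<in> W m \<Longrightarrow> x \<oplus>\<^bsub>sp Q m\<^esub> y \<in> W m"
      "\<And>m c x. x \<in> W m \<Longrightarrow> c \<odot>\<^bsub>sp Q m\<^esub> x \<in> W m"
      "\<And>m x \<sigma>. x \<in> W m \<Longrightarrow> \<sigma> permutes {1..m} \<Longrightarrow> act Q m x \<sigma> \<in> W m"
      "\<And>m k i x y. x \<in> W m \<Longrightarrow> y \<in> W k \<Longrightarrow> i \<in> {1..m} \<Longrightarrow> pcomp Q m k i x y \<in> W (m + k - 1)"
      "ident Q \<in> W 1"
    and gens: "\<And>g. g \<in> E \<Longrightarrow> \<phi> (a g) (oclass E a R (TGen g)) \<in> W (a g)"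
    and x: "x \<in> els (presented_operad E a R) m"
  shows "\<phi> m x \<in> W m"
proof -
  have "\<phi> (arity a t) (oclass E a R t) \<in> W (arity a t)" if "wf_oterm E a t" for t
    using that
  proof (induction t)
    case (TComp i s t)
    then show ?case
      using operad_homD(5)[OF \<phi>, of "oclass E a R s" "arity a s" "oclass E a R t" "arity a t" i] W(5)
      by (simp add: oclass_in_els presented_pcomp)
  next
    case (TAct t \<sigma>)
    then show ?case
      using operad_homD(4)[OF \<phi>, of "oclass E a R t" "arity a t" \<sigma>] W(4)
      by (simp add: oclass_in_els presented_act del: One_nat_def)
  next
    case (TZero m)
    then show ?case using operad_hom_zero[OF operad_presented Q \<phi>, of m] W(1) by (simp add: presented_zero)
  next
    case (TAdd s t)
    then show ?case
      using operad_homD(2)[OF \<phi>, of "oclass E a R s" "arity a s" "oclass E a R t"] W(2)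
      by (simp add: oclass_in_els presented_add)
  next
    case (TScal c t)
    then show ?case
      using operad_homD(3)[OF \<phi>, of "oclass E a R t" "arity a t" c] W(3)
      by (simp add: oclass_in_els presented_smult)
  next
    case TId
    then show ?case using operad_homD(6)[OF \<phi>] W(6) by (simp add: presented_ident)
  qed (simp add: gens)
  with x show ?thesis by (elim els_presentedE) auto
qed

definition proj :: "'x set \<Rightarrow> ('x \<Rightarrow>\<^sub>0 'k::field) \<Rightarrow> ('x \<Rightarrow>\<^sub>0 'k)" where
  "proj A = lext lscale (\<lambda>t. if t \<in> A then basis t else 0)"

lemma linop_proj: "linop (proj A)"
  unfolding proj_def by (rule pm.lmap_lext)

lemma proj_supported: "proj A p \<in> supported A"
  unfolding proj_def by (rule supported_lext[of p UNIV]) (simp_all add: supported_def)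

lemma proj_subset: "p \<in> supported B \<Longrightarrow> proj A p \<in> supported (A \<inter> B)"
  unfolding proj_def by (rule supported_lext) auto

lemma proj_id: "p \<in> supported A \<Longrightarrow> proj A p = p"
  unfolding proj_def
  by (subst pm.lext_cong[where h = basis]) (auto simp: supported_def)

lemma proj_disjoint: "p \<in> supported B \<Longrightarrow> A \<inter> B = {} \<Longrightarrow> proj A p = 0"
  using proj_subset[of p B A] by (simp add: supported_def)

context shared_bracket
begin

text \<open>
  Here \<open>f\<close> gives elements to the positions of the leaves, counted from the left, and not to the
  variables.
\<close>

primrec positional_eval :: "(nat \<Rightarrow> 'a) \<Rightarrow> monomial \<Rightarrow> 'a" where
  "positional_eval f (Var i) = f 1"
| "positional_eval f (Prod k s t) = pr k (positional_eval f s) (positional_eval (\<lambda>j. f (length (leaves s) + j)) t)"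

lemma positional_eval_eq_term_eval: "(\<And>j. j < length (leaves t) \<Longrightarrow> f (Suc j) = g (leaves t ! j)) \<Longrightarrow> positional_eval f t = term_eval g t"
proof (induction t arbitrary: f)
  case (Prod k s t)
  have "positional_eval f s = term_eval g s"
    using Prod.prems by (intro Prod.IH(1)) (auto simp: nth_append)
  moreover have "positional_eval (\<lambda>j. f (length (leaves s) + j)) t = term_eval g t"
  proof (rule Prod.IH(2))
    fix j assume "j < length (leaves t)"
    then show "f (length (leaves s) + Suc j) = g (leaves t ! j)"
      using Prod.prems[of "length (leaves s) + j"] by simp
  qed
  ultimately show ?case by simp
qed simp

end

lemma hom_gprod_G: "p \<in> greg_span n \<Longrightarrow> G.hom n f (gprod n k p q) = gprod n k (G.hom n f p) (G.hom n f q)"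
  using G.hom_gprod[of p n n f k q] by (simp add: gprod_clip)

abbreviation generator :: "nat \<Rightarrow> nat \<Rightarrow> ((nat, nat) gtree \<Rightarrow>\<^sub>0 'k::field)" where
  "generator n k \<equiv> gprod n k (dot 1) (dot 2)"

lemma generator_arity_space: "generator n k \<in> arity_space n {1..2}"
proof -
  have "generator n k \<in> supported (graded_trees {1..n} ({#1#} + {#2#}) (0 + 0))"
    by (rule gprod_supported) (simp_all add: graded_trees_def)
  moreover have "mset_set {1..2::nat} = {#1, 2#}"
  proof -
    have "{1..2::nat} = insert 1 {2}" by auto
    then show ?thesis by (simp add: add_mset_commute)
  qed
  ultimately show ?thesis by (simp add: arity_space_graded_trees add_mset_commute del: One_nat_def)
qed

lemma hom_generator: "G.hom n f (generator n k) = gprod n k (f 1) (f 2)"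
  by (simp add: hom_gprod_G dot_greg_span)

text \<open>
  Composites in the operad of trees become products of values.
\<close>

lemma hom_pcomp_pcomp:
  fixes f :: "nat \<Rightarrow> ((nat, nat) gtree \<Rightarrow>\<^sub>0 'k::field)"
  assumes x: "x \<in> arity_space n {1..a}" and y: "y \<in> arity_space n {1..b}"
  shows "G.hom n f (pcomp (gop n) (a + 1) b (a + 1) (pcomp (gop n) 2 a 1 (generator n k) x) y)
    = gprod n k (G.hom n f x) (G.hom n (\<lambda>j. f (a + j)) y)"
proof -
  note g = generator_arity_space[of n k]
  have a1: "a + 1 \<in> {1..a + 1}" "1 \<in> {1..2::nat}" by auto
  have "G.hom n (plug n a 1 x) (generator n k) \<in> arity_space n {1..2 + a - 1}"
    by (rule pcomp_gop_closed[OF g x a1(2)])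
  moreover have "2 + a - 1 = a + 1" by simp
  ultimately have gx: "pcomp (gop n) 2 a 1 (generator n k) x \<in> arity_space n {1..a + 1}"
    unfolding pcomp_gop[OF g x a1(2)] by (simp only:)
  let ?p2 = "plug n b (a + 1) y" and ?p1 = "plug n a 1 x"
  have sp: "?p2 w \<in> greg_span n" "?p1 w \<in> greg_span n" for w by (rule plug_greg_span[OF y] plug_greg_span[OF x])+
  have "G.hom n f (pcomp (gop n) (a + 1) b (a + 1) (pcomp (gop n) 2 a 1 (generator n k) x) y)
      = G.hom n (\<lambda>w. G.hom n f (?p2 w)) (G.hom n ?p1 (generator n k))"
    unfolding pcomp_gop[OF gx y a1(1)] hom_hom[OF gx finite_atLeastAtMost sp(1)] unfolding pcomp_gop[OF g x a1(2)] ..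
  also have "\<dots> = gprod n k (G.hom n (\<lambda>w. G.hom n f (?p2 w)) (?p1 1)) (G.hom n (\<lambda>w. G.hom n f (?p2 w)) (?p1 2))"
    unfolding hom_generator by (rule hom_gprod_G[OF sp(2)])
  also have "?p1 1 = x"
    using hom_dot[OF arity_space_greg_span[OF x]] by (simp add: plug_def)
  also have "G.hom n (\<lambda>w. G.hom n f (?p2 w)) x = G.hom n f x"
    by (rule hom_cong[OF x]) (auto simp: plug_def shift_def)
  also have "?p1 2 = dot (a + 1)" by (simp add: plug_def shift_def)
  also have "G.hom n (\<lambda>w. G.hom n f (?p2 w)) (dot (a + 1)) = G.hom n (\<lambda>j. f (a + j)) y"
    using hom_hom[OF y finite_atLeastAtMost dot_greg_span, of f "\<lambda>j. a + j"] by (simp add: plug_def)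
  finally show ?thesis .
qed

text \<open>
  An operad generated by \<open>mu 0, \<dots>, mu n\<close> together with a morphism to the operad of Greg trees that
  sends them to its products.
\<close>

locale greg_presentation = shared_bracket_operad P mu for P :: "('k::field, 'a) operad" and mu +
  fixes n :: nat and \<Phi> :: "nat \<Rightarrow> 'a \<Rightarrow> ((nat, nat) gtree \<Rightarrow>\<^sub>0 'k)"
  assumes hom: "operad_hom P (gop n) \<Phi>"
    and \<Phi>_mu: "\<Phi> 2 (mu k) = generator n k"
    and generated: "x \<in> els P m \<Longrightarrow> x \<in> spanned n m"
begin

lemma \<Phi>_closed: "x \<in> els P m \<Longrightarrow> \<Phi> m x \<in> arity_space n {1..m}"
  using operad_homD(1)[OF hom] by (simp only: els_gop)

lemma hom_\<Phi>_planar: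
  fixes f :: "nat \<Rightarrow> ((nat, nat) gtree \<Rightarrow>\<^sub>0 'k)"
  shows "G.hom n f (\<Phi> (nleaves t) (planar t)) = G.positional_eval n f t"
proof (induction t arbitrary: f)
  case (Var i)
  have "\<Phi> 1 (ident P) = dot 1" using operad_homD(6)[OF hom] by (simp only: greg_operad_simps)
  then show ?case by (simp del: One_nat_def) simp
next
  case (Prod k s t)
  have c: "pcomp P 2 (nleaves s) 1 (mu k) (planar s) \<in> els P (nleaves s + 1)" by (rule pcomp2_closed[OF mu_closed planar_closed])
  have "\<Phi> (nleaves s + nleaves t) (bin_op (mu k) (nleaves s) (nleaves t) (planar s) (planar t))
      = pcomp (gop n) (nleaves s + 1) (nleaves t) (nleaves s + 1) (pcomp (gop n) 2 (nleaves s) 1 (generator n k) (\<Phi> (nleaves s) (planar s))) (\<Phi> (nleaves t) (planar t))"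
  proof -
    have "\<Phi> (2 + nleaves s - 1) (pcomp P 2 (nleaves s) 1 (mu k) (planar s)) = pcomp (gop n) 2 (nleaves s) 1 (\<Phi> 2 (mu k)) (\<Phi> (nleaves s) (planar s))"
      by (rule operad_homD(5)[OF hom mu_closed planar_closed]) simp
    moreover have "2 + nleaves s - 1 = nleaves s + 1" "nleaves s + 1 + nleaves t - 1 = nleaves s + nleaves t" by simp_all
    moreover have "\<Phi> (nleaves s + 1 + nleaves t - 1) (pcomp P (nleaves s + 1) (nleaves t) (nleaves s + 1) (pcomp P 2 (nleaves s) 1 (mu k) (planar s)) (planar t))
      = pcomp (gop n) (nleaves s + 1) (nleaves t) (nleaves s + 1) (\<Phi> (nleaves s + 1) (pcomp P 2 (nleaves s) 1 (mu k) (planar s))) (\<Phi> (nleaves t) (planar t))"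
      by (rule operad_homD(5)[OF hom c planar_closed]) simp
    ultimately show ?thesis by (simp only: bin_op_def \<Phi>_mu)
  qed
  then have "G.hom n f (\<Phi> (nleaves s + nleaves t) (bin_op (mu k) (nleaves s) (nleaves t) (planar s) (planar t)))
      = gprod n k (G.hom n f (\<Phi> (nleaves s) (planar s))) (G.hom n (\<lambda>j. f (nleaves s + j)) (\<Phi> (nleaves t) (planar t)))"
    by (simp only: hom_pcomp_pcomp[OF \<Phi>_closed[OF planar_closed] \<Phi>_closed[OF planar_closed]])
  then show ?case by (simp add: Prod.IH)
qed

lemma \<Phi>_monomial_op:
  assumes "t \<in> multilinear_terms n m"
  shows "\<Phi> m (monomial_op (standard_word m) t) = G.term_eval n dot t"
proof -
  have t: "mset (leaves t) = mset (standard_word m)" using assms by (simp add: multilinear_terms_def)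
  obtain \<tau> where \<tau>: "matches \<tau> (standard_word m) (leaves t)" using matches_exists[OF t] by blast
  then have nleaves: "nleaves t = m" and \<tau>p: "\<tau> permutes {1..m}" by (auto simp: matches_def)
  have planar: "planar t \<in> els P m" using planar_closed[of t] nleaves by simp
  have "monomial_op (standard_word m) t = act P m (planar t) \<tau>" using monomial_op_eq[OF _ t \<tau>] by simp
  then have "\<Phi> m (monomial_op (standard_word m) t) = act (gop n) m (\<Phi> m (planar t)) \<tau>"
    using operad_homD(4)[OF hom planar \<tau>p] by simp
  also have "\<dots> = G.positional_eval n (\<lambda>w. dot (Hilbert_Choice.inv \<tau> w)) t"
    using act_gop[OF \<Phi>_closed[OF planar]] hom_\<Phi>_planar[of _ t] nleaves by simp
  also have "\<dots> = G.term_eval n dot t"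
  proof (rule G.positional_eval_eq_term_eval)
    fix j assume "j < nleaves t"
    then have j: "Suc j \<in> {1..m}" using nleaves by auto
    define i where "i = Hilbert_Choice.inv \<tau> (Suc j)"
    have i: "i \<in> {1..m}" "\<tau> i = Suc j"
      using permutes_in_image[OF permutes_inv[OF \<tau>p]] j permutes_inverses(1)[OF \<tau>p] unfolding i_def by blast+
    have "leaves t ! (\<tau> i - 1) = standard_word m ! (i - 1)" using \<tau> i(1) by (simp add: matches_def)
    then have "leaves t ! j = i" using standard_word_nth[OF i(1)] i(2) by simp
    then show "dot (Hilbert_Choice.inv \<tau> (Suc j)) = dot (leaves t ! j)" by (simp add: i_def)
  qed
  finally show ?thesis .
qed

lemma \<Phi>_polynomial_op:
  assumes "p \<in> supported (multilinear_terms n m)"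
  shows "\<Phi> m (polynomial_op (standard_word m) p) = lext lscale (G.term_eval n dot) p"
proof -
  have "\<Phi> m (polynomial_op (standard_word m) (\<Sum>t\<in>S. lscale (c t) (basis t))) = (\<Sum>t\<in>S. lscale (c t) (\<Phi> m (monomial_op (standard_word m) t)))"
    if "finite S" for S c
    using that
  proof (induction S)
    case empty
    show ?case
      using operad_hom_zero[OF operad_axioms operad_gop hom, of m] polynomial_op_zero[of "standard_word m"] by (simp add: greg_operad_simps)
  next
    case (insert t S)
    let ?p = "\<Sum>t\<in>S. lscale (c t) (basis t) :: _ \<Rightarrow>\<^sub>0 'k"
    have cl: "polynomial_op (standard_word m) ?p \<in> els P m" "monomial_op (standard_word m) t \<in> els P m" "c t \<odot>\<^bsub>sp P m\<^esub> monomial_op (standard_word m) t \<in> els P m"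
      using polynomial_op_closed[of "standard_word m"] monomial_op_closed[of "standard_word m"] sm_closed by simp_all
    have "polynomial_op (standard_word m) (lscale (c t) (basis t) + ?p) = (c t \<odot>\<^bsub>sp P m\<^esub> monomial_op (standard_word m) t) \<oplus>\<^bsub>sp P m\<^esub> polynomial_op (standard_word m) ?p"
      using polynomial_op_add[of "standard_word m"] polynomial_op_lscale[of "standard_word m"] polynomial_op_basis[of "standard_word m"] by simp
    then show ?case
      using insert operad_homD(2)[OF hom cl(3,1)] operad_homD(3)[OF hom cl(2)] by (simp add: greg_operad_simps(2,3))
  qed
  from this[of "Poly_Mapping.keys p" "Poly_Mapping.lookup p"]
  have "\<Phi> m (polynomial_op (standard_word m) p) = lext lscale (\<lambda>t. \<Phi> m (monomial_op (standard_word m) t)) p"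
    using lext_lscale_basis[of p] by (simp add: lext_def)
  also have "\<dots> = lext lscale (G.term_eval n dot) p"
    by (rule pm.lext_cong, rule \<Phi>_monomial_op) (use assms in \<open>auto simp: supported_def\<close>)
  finally show ?thesis .
qed

text \<open>
  Values of monomials with other leaves are supported on trees with other labels, so such monomials
  can be dropped from a combination whose value is \<open>T\<close>.
\<close>

lemma multilinear_tree:
  assumes T: "greg {1..n} T" "white_labels T = mset_set {1..m}"
  shows "\<exists>p\<in>supported (multilinear_terms n m). basis T = (lext lscale (G.term_eval n dot) p :: _ \<Rightarrow>\<^sub>0 'k)"
proof -
  let ?E = "lext lscale (G.term_eval n dot) :: _ \<Rightarrow> _ \<Rightarrow>\<^sub>0 'k"
  obtain p where p: "p \<in> supported {t. bounded_by n t}" "basis T = ?E p"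
    using tree_generated[OF T(1)] by blast
  define A where "A = {t. mset (leaves t) = mset_set {1..m}}"
  define B where "B = {T :: (nat, nat) gtree. white_labels T = mset_set {1..m}}"
  have "proj B (G.term_eval n dot t) = (if t \<in> A then G.term_eval n dot t else 0 :: _ \<Rightarrow>\<^sub>0 'k)" for t
  proof -
    have "G.term_eval n dot t \<in> (supported (graded_trees {1..n} (mset (leaves t)) 0) :: (_ \<Rightarrow>\<^sub>0 'k) set)" by (rule term_eval_labels)
    then have sup: "G.term_eval n dot t \<in> (supported {T. white_labels T = mset (leaves t)} :: (_ \<Rightarrow>\<^sub>0 'k) set)"
      by (auto simp: supported_def graded_trees_def)
    show ?thesis
    proof (cases "t \<in> A")
      case True
      then have "B = {T. white_labels T = mset (leaves t)}" by (simp add: A_def B_def)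
      then show ?thesis using True proj_id sup by simp
    next
      case False
      then have "B \<inter> {T. white_labels T = mset (leaves t)} = {}" by (auto simp: A_def B_def)
      then show ?thesis using proj_disjoint[OF sup] False by simp
    qed
  qed
  then have "proj B (?E p) = lext lscale (\<lambda>t. if t \<in> A then G.term_eval n dot t else 0) p"
    unfolding proj_def pm.lext_compose by simp
  also have "\<dots> = ?E (proj A p)"
    unfolding proj_def pm.lext_compose by (intro pm.lext_cong) simp
  finally have "?E (proj A p) = proj B (basis T)" unfolding p(2) by simp
  also have "\<dots> = basis T" using T(2) by (intro proj_id) (simp add: B_def)
  finally have "basis T = ?E (proj A p)" by simp
  moreover have "proj A p \<in> supported (multilinear_terms n m)"
    using proj_subset[OF p(1), of A] by (simp add: multilinear_terms_def A_def mset_standard_word Int_def conj_commute)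
  ultimately show ?thesis by blast
qed

text \<open>
  For injectivity, two combinations of monomials with the same value differ by relations
  (\<open>term_eval_kernel\<close>), hence give the same operation.  Surjectivity is \<open>multilinear_tree\<close>.
\<close>

theorem operad_iso_\<Phi>: "operad_iso P (gop n) \<Phi>"
proof -
  let ?E = "lext lscale (G.term_eval n dot) :: _ \<Rightarrow> (nat, nat) gtree \<Rightarrow>\<^sub>0 'k"
  have "bij_betw (\<Phi> m) (els P m) (els (gop n) m)" for m
    unfolding bij_betw_def
  proof
    let ?M = "supported (multilinear_terms n m) :: (monomial \<Rightarrow>\<^sub>0 'k) set"
    show "inj_on (\<Phi> m) (els P m)"
    proof (rule inj_onI)
      fix x y assume xy: "x \<in> els P m" "y \<in> els P m" "\<Phi> m x = \<Phi> m y"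
      obtain p q where p: "p \<in> ?M" "x = polynomial_op (standard_word m) p" and q: "q \<in> ?M" "y = polynomial_op (standard_word m) q"
        using generated[OF xy(1)] generated[OF xy(2)] by (auto simp: spanned_def)
      have "?E (p - q) = 0"
        using xy(3) unfolding p(2) q(2) \<Phi>_polynomial_op[OF p(1)] \<Phi>_polynomial_op[OF q(1)] lmap_diff[OF pm.lmap_lext] by simp
      moreover have "p - q \<in> supported {t. bounded_by n t}"
        using supported_diff[OF p(1) q(1)] by (auto simp: supported_def multilinear_terms_def)
      ultimately have "p - q \<in> relations" by (intro term_eval_kernel)
      then have "odif m x y = \<zero>\<^bsub>sp P m\<^esub>"
        using polynomial_op_relations[of "p - q" "standard_word m"] polynomial_op_diff[of "standard_word m" p q] p q by simp
      then show "x = y" by (rule kspace.dif_zero_imp_eq[OF kspace_sp xy(1,2)])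
    qed
    show "\<Phi> m ` els P m = els (gop n) m"
    proof
      show "\<Phi> m ` els P m \<subseteq> els (gop n) m" using operad_homD(1)[OF hom] by blast
      show "els (gop n) m \<subseteq> \<Phi> m ` els P m"
      proof
        fix q :: "(nat, nat) gtree \<Rightarrow>\<^sub>0 'k" assume "q \<in> els (gop n) m"
        then have q: "q \<in> arity_space n {1..m}" by (simp only: els_gop)
        define r where "r T = (SOME p. p \<in> ?M \<and> basis T = ?E p)" for T
        have r: "r T \<in> ?M" "basis T = ?E (r T)" if "T \<in> greg_trees {1..n} {1..m}" for T
        proof -
          have "\<exists>p. p \<in> ?M \<and> basis T = ?E p"
            using multilinear_tree[of T m] that by (auto simp: greg_trees_def)
          from someI_ex[OF this] show "r T \<in> ?M" "basis T = ?E (r T)" by (auto simp: r_def)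
        qed
        have mem: "lext lscale r q \<in> ?M"
          using q unfolding arity_space_def by (rule supported_lext) (rule r(1))
        have "?E (lext lscale r q) = lext lscale (\<lambda>T. ?E (r T)) q" by (rule pm.lext_compose)
        also have "\<dots> = lext lscale basis q"
          by (rule pm.lext_cong, rule r(2)[symmetric]) (use q in \<open>auto simp: arity_space_def supported_def\<close>)
        finally have "\<Phi> m (polynomial_op (standard_word m) (lext lscale r q)) = q" using \<Phi>_polynomial_op[OF mem] by simp
        moreover have "polynomial_op (standard_word m) (lext lscale r q) \<in> els P m" using polynomial_op_closed[of "standard_word m"] by simp
        ultimately show "q \<in> \<Phi> m ` els P m" by (metis image_eqI)
      qed
    qed
  qed
  then show ?thesis using hom by (simp add: operad_iso_def)
qed

end

section \<open>The fibered coproduct\<close>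

abbreviation PL_class :: "('k::field, unit) oterm \<Rightarrow> ('k, unit) oterm set" where
  "PL_class \<equiv> oclass UNIV (\<lambda>_. 2) PreLie_rels"

abbreviation swap12 :: "nat \<Rightarrow> nat" where "swap12 \<equiv> transpose 1 2"

lemma swap12_permutes: "swap12 permutes {1..2}"
  by (rule permutes_swap_id) auto

lemma swap23_permutes: "transpose 2 (3::nat) permutes {1..3}"
  by (rule permutes_swap_id) auto

lemma PL_bin_closed: "PL_class bin \<in> els (PreLie :: ('k::field, _) operad) 2"
  unfolding PreLie_def by (rule oclass_in_els) auto

lemma PL_prelie:
  fixes x defines "x \<equiv> PL_class bin :: ('k::field, unit) oterm set"
  shows "kspace.dif (sp PreLie 3) (pcomp PreLie 2 2 1 x x) (pcomp PreLie 2 2 2 x x)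
    = act PreLie 3 (kspace.dif (sp PreLie 3) (pcomp PreLie 2 2 1 x x) (pcomp PreLie 2 2 2 x x)) (transpose 2 3)"
proof -
  let ?A = "TSub (TComp 1 bin bin) (TComp 2 bin bin) :: ('k, unit) oterm"
  have "PL_class ?A = PL_class (TAct ?A (transpose 2 3))"
    by (rule oclass_eqI, rule oequiv.base) (use swap23_permutes in \<open>auto simp: PreLie_rels_def Let_def\<close>)
  moreover have "PL_class ?A = kspace.dif (sp PreLie 3) (pcomp PreLie 2 2 1 x x) (pcomp PreLie 2 2 2 x x)"
    unfolding operad.odif_def[OF operad_PreLie] unfolding x_def PreLie_def
    by (simp add: presented_pcomp presented_smult presented_add)
  moreover have "PL_class (TAct ?A (transpose 2 3)) = act PreLie 3 (PL_class ?A) (transpose 2 3)"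
    unfolding PreLie_def using swap23_permutes by (simp add: presented_act del: One_nat_def)
  ultimately show ?thesis by simp
qed

lemma PL_bracket_class:
  "PL_class (TSub bin (TAct bin swap12)) = kspace.dif (sp PreLie 2) (PL_class bin) (act PreLie 2 (PL_class bin) swap12 :: ('k::field, unit) oterm set)"
  unfolding operad.odif_def[OF operad_PreLie] unfolding PreLie_def
  using swap12_permutes by (simp add: presented_act presented_smult presented_add del: One_nat_def)

definition Lie_rels :: "(('k::field, unit) oterm \<times> ('k, unit) oterm) set" where
  "Lie_rels = (let J = TComp 1 bin bin; c = transpose 1 2 \<circ> transpose 2 3
      in {(TAct bin (transpose 1 2), TScal (-1) bin),
          (TAdd J (TAdd (TAct J c) (TAct J (c \<circ> c))), TZero 3)})"

lemma Lie_presented: "Lie = presented_operad UNIV (\<lambda>_. 2) Lie_rels"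
  by (simp only: Lie_def Lie_rels_def)

lemma Lie_to_PreLie_bin:
  "Lie_to_PreLie 2 (oclass UNIV (\<lambda>_. 2) Lie_rels bin) = PL_class (TSub bin (TAct bin swap12) :: ('k::field, unit) oterm)"
proof -
  let ?P = "PreLie :: ('k, _) operad" and ?x = "PL_class bin :: ('k, unit) oterm set"
  note x = PL_bin_closed[where ?'k = 'k]
  note jac = bracket_jacobi[OF operad_PreLie x PL_prelie[unfolded operad.odif_def[OF operad_PreLie]]]
  show ?thesis
    unfolding Lie_to_PreLie_def Lie_rels_def Let_def
  proof (rule presented_operad_universal(2)[OF operad_PreLie])
    show "PL_class (TSub bin (TAct bin swap12)) \<in> els ?P 2"
      unfolding PreLie_def using swap12_permutes by (intro oclass_in_els) auto
  qed (use bracket_skew[OF operad_PreLie x] jac PL_bracket_class[where ?'k = 'k] in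
        \<open>auto simp: operad.odif_def[OF operad_PreLie] simp del: One_nat_def\<close>)
qed

text \<open>
  Operations with the same commutator have a symmetric difference.
\<close>

lemma bracket_shared:
  fixes P :: "('k::field, 'a) operad"
  assumes P: "operad P" and x: "x \<in> els P 2" and y: "y \<in> els P 2"
    and eq: "kspace.dif (sp P 2) x (act P 2 x swap12) = kspace.dif (sp P 2) y (act P 2 y swap12)"
  shows "kspace.dif (sp P 2) x y = act P 2 (kspace.dif (sp P 2) x y) swap12"
proof -
  interpret operad P by (rule P)
  interpret kspace "sp P 2" by (rule kspace_sp)
  let ?x = "act P 2 x swap12" and ?y = "act P 2 y swap12"
  let ?n = "\<lambda>z. (-1) \<odot>\<^bsub>sp P 2\<^esub> z"
  have cl: "?x \<in> els P 2" "?y \<in> els P 2" "?n x \<in> els P 2" "?n y \<in> els P 2" "?n ?x \<in> els P 2" "?n ?y \<in> els P 2"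
    using x y act_closed[OF x swap12_permutes] act_closed[OF y swap12_permutes] by (auto intro!: sm_closed)
  have nx: "?x \<oplus>\<^bsub>sp P 2\<^esub> ?n ?x = \<zero>\<^bsub>sp P 2\<^esub>" and ny: "y \<oplus>\<^bsub>sp P 2\<^esub> ?n y = \<zero>\<^bsub>sp P 2\<^esub>"
    using dif_self cl y by (simp_all add: dif_def)
  have "dif x y = dif x y \<oplus>\<^bsub>sp P 2\<^esub> (?x \<oplus>\<^bsub>sp P 2\<^esub> ?n ?x)" unfolding nx using x y by (simp add: dif_closed)
  also have "\<dots> = dif x ?x \<oplus>\<^bsub>sp P 2\<^esub> (?x \<oplus>\<^bsub>sp P 2\<^esub> ?n y)"
    unfolding dif_def using x y cl by (simp add: a_ac)
  also have "\<dots> = dif y ?y \<oplus>\<^bsub>sp P 2\<^esub> (?x \<oplus>\<^bsub>sp P 2\<^esub> ?n y)" unfolding eq ..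
  also have "\<dots> = dif ?x ?y \<oplus>\<^bsub>sp P 2\<^esub> (y \<oplus>\<^bsub>sp P 2\<^esub> ?n y)"
    unfolding dif_def using x y cl by (simp add: a_ac)
  also have "\<dots> = dif ?x ?y" unfolding ny using cl by (simp add: dif_closed)
  also have "\<dots> = act P 2 (dif x y) swap12" by (rule act_dif[OF x y swap12_permutes, symmetric])
  finally show ?thesis .
qed

text \<open>
  What a morphism out of the operad of pre-Lie algebras amounts to, and its restriction to the bracket.
\<close>

lemma operad_hom_mu:
  fixes Q :: "('k::field, 'a) operad"
  assumes \<phi>: "operad_hom PreLie Q \<phi>" and Q: "operad Q"
  defines "v \<equiv> \<phi> 2 (PL_class bin)"
  shows "v \<in> els Q 2"
    and "kspace.dif (sp Q 3) (pcomp Q 2 2 1 v v) (pcomp Q 2 2 2 v v)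
      = act Q 3 (kspace.dif (sp Q 3) (pcomp Q 2 2 1 v v) (pcomp Q 2 2 2 v v)) (transpose 2 3)"
    and "\<phi> 2 (Lie_to_PreLie 2 (oclass UNIV (\<lambda>_. 2) Lie_rels bin)) = kspace.dif (sp Q 2) v (act Q 2 v swap12)"
proof -
  let ?x = "PL_class bin :: ('k, unit) oterm set"
  note x = PL_bin_closed[where ?'k = 'k]
  let ?u = "\<lambda>i. pcomp PreLie 2 2 i ?x ?x"
  have u: "?u 1 \<in> els PreLie 3" "?u 2 \<in> els PreLie 3"
    using operad.pcomp_closed_eq[OF operad_PreLie x x, of _ 3] by simp_all
  have pu: "\<phi> 3 (?u i) = pcomp Q 2 2 i v v" if "i \<in> {1..2}" for i
    using operad_homD(5)[OF \<phi> x x that] by (simp add: v_def)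
  show "v \<in> els Q 2" unfolding v_def by (rule operad_homD(1)[OF \<phi> x])
  have d: "kspace.dif (sp PreLie 3) (?u 1) (?u 2) \<in> els PreLie 3"
    by (rule operad.odif_closed[OF operad_PreLie u])
  have "\<phi> 3 (kspace.dif (sp PreLie 3) (?u 1) (?u 2)) = kspace.dif (sp Q 3) (pcomp Q 2 2 1 v v) (pcomp Q 2 2 2 v v)"
    using operad_hom_dif[OF operad_PreLie Q \<phi> u] pu[of 1] pu[of 2] by simp
  then show "kspace.dif (sp Q 3) (pcomp Q 2 2 1 v v) (pcomp Q 2 2 2 v v)
      = act Q 3 (kspace.dif (sp Q 3) (pcomp Q 2 2 1 v v) (pcomp Q 2 2 2 v v)) (transpose 2 3)"
    using operad_homD(4)[OF \<phi> d swap23_permutes] PL_prelie[where ?'k = 'k] by metis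
  have "act PreLie 2 ?x swap12 \<in> els PreLie 2"
    by (rule operad.act_closed[OF operad_PreLie x swap12_permutes])
  then show "\<phi> 2 (Lie_to_PreLie 2 (oclass UNIV (\<lambda>_. 2) Lie_rels bin)) = kspace.dif (sp Q 2) v (act Q 2 v swap12)"
    unfolding Lie_to_PreLie_bin PL_bracket_class v_def
    using operad_hom_dif[OF operad_PreLie Q \<phi> x] operad_homD(4)[OF \<phi> x swap12_permutes] by simp
qed

context
  fixes n :: nat
begin

abbreviation coproduct_operad :: "('k::field, _) operad" where
  "coproduct_operad \<equiv> PreLie_coproduct (n + 1)"

definition copy_incl :: "nat \<Rightarrow> nat \<Rightarrow> ('k::field, unit) oterm set \<Rightarrow> ('k, nat \<times> nat \<times> ('k, unit) oterm set) oterm set" where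
  "copy_incl = coproduct_incl {1..n + 1} Lie (\<lambda>_. PreLie) (\<lambda>_. Lie_to_PreLie)"

text \<open>
  The copies are numbered from \<open>1\<close>, the products from \<open>0\<close>; the last product is repeated.
\<close>

definition copy_product :: "nat \<Rightarrow> ('k::field, nat \<times> nat \<times> ('k, unit) oterm set) oterm set" where
  "copy_product k = copy_incl (min k n + 1) 2 (PL_class bin)"

lemma operad_coproduct: "operad coproduct_operad"
  unfolding PreLie_coproduct_def fibered_coproduct_def by (rule operad_presented)

lemma hom_copy_incl: "i \<in> {1..n + 1} \<Longrightarrow> operad_hom PreLie coproduct_operad (copy_incl i)"
  unfolding PreLie_coproduct_def copy_incl_def
  by (rule operad_hom_coproduct_incl) (rule operad_PreLie operad_hom_Lie_to_PreLie | assumption)+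

lemma shared_bracket_operad_coproduct: "shared_bracket_operad coproduct_operad copy_product"
proof (intro shared_bracket_operad.intro shared_bracket_operad_axioms.intro operad_coproduct)
  fix k
  have i: "min k n + 1 \<in> {1..n + 1}" "1 \<in> {1..n + 1}" by auto
  note m = operad_hom_mu[OF hom_copy_incl[OF i(1)] operad_coproduct, folded copy_product_def]
  have z: "copy_product 0 = copy_incl 1 2 (PL_class bin)" by (simp add: copy_product_def)
  note m0 = operad_hom_mu[OF hom_copy_incl[OF i(2)] operad_coproduct, folded z]
  show "copy_product k \<in> els coproduct_operad 2" by (rule m(1))
  show "kspace.dif (sp coproduct_operad 3) (pcomp coproduct_operad 2 2 1 (copy_product k) (copy_product k)) (pcomp coproduct_operad 2 2 2 (copy_product k) (copy_product k))
    = act coproduct_operad 3 (kspace.dif (sp coproduct_operad 3) (pcomp coproduct_operad 2 2 1 (copy_product k) (copy_product k)) (pcomp coproduct_operad 2 2 2 (copy_product k) (copy_product k))) (transpose 2 3)"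
    by (rule m(2))
  have lb: "oclass UNIV (\<lambda>_. 2) Lie_rels bin \<in> els Lie 2"
    unfolding Lie_presented by (rule oclass_in_els) auto
  have "copy_incl (min k n + 1) 2 (Lie_to_PreLie 2 (oclass UNIV (\<lambda>_. 2) Lie_rels bin)) = copy_incl 1 2 (Lie_to_PreLie 2 (oclass UNIV (\<lambda>_. 2) Lie_rels bin))"
    unfolding copy_incl_def
    by (rule coproduct_incl_glue[OF _ _ i lb]) (rule operad_PreLie operad_hom_Lie_to_PreLie)+
  then show "kspace.dif (sp coproduct_operad 2) (copy_product k) (copy_product 0) = act coproduct_operad 2 (kspace.dif (sp coproduct_operad 2) (copy_product k) (copy_product 0)) swap12"
    unfolding m(3) m0(3) by (rule bracket_shared[OF operad_coproduct m(1) m0(1)])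
qed

lemma coproduct_generated:
  assumes "x \<in> els coproduct_operad m"
  shows "x \<in> shared_bracket_operad.spanned coproduct_operad copy_product n m"
proof -
  interpret S: shared_bracket_operad coproduct_operad copy_product by (rule shared_bracket_operad_coproduct)
  note W = S.spanned_zero S.spanned_add S.spanned_smult S.spanned_act S.spanned_pcomp S.spanned_ident
  \<comment> \<open>Each copy lands in the span, since it is generated by its product.\<close>
  have base: "copy_incl i k y \<in> S.spanned n k" if i: "i \<in> {1..n + 1}" and y: "y \<in> els PreLie k" for i k y
  proof (rule presented_suboperad[OF hom_copy_incl[OF i, unfolded PreLie_def] operad_coproduct W])
    have "min (i - 1) n + 1 = i" using i by auto
    then have "copy_incl i 2 (PL_class (TGen ())) = copy_product (i - 1)" by (simp add: copy_product_def)
    moreover have "copy_product (i - 1) \<in> S.spanned n 2" by (rule S.spanned_mu) (use i in auto)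
    ultimately have "copy_incl i 2 (PL_class (TGen ())) \<in> S.spanned n 2" by (rule ssubst)
    then show "copy_incl i 2 (PL_class (TGen g)) \<in> S.spanned n 2" for g by (cases g) (simp only:)
    show "y \<in> els (presented_operad UNIV (\<lambda>_. 2) PreLie_rels) k" using y by (simp add: PreLie_def)
  qed
  show ?thesis
  proof (rule presented_suboperad[where \<phi> = "\<lambda>m x. x", OF _ operad_coproduct W])
    show "operad_hom (presented_operad (coproduct_gens {1..n + 1} (\<lambda>_. PreLie)) (\<lambda>(i, m, x). m)
        (fibered_coproduct_rels {1..n + 1} Lie (\<lambda>_. PreLie) (\<lambda>_. Lie_to_PreLie))) coproduct_operad (\<lambda>m x. x)"
      unfolding PreLie_coproduct_def fibered_coproduct_def operad_hom_def
      using operad_presented by auto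
    show "x \<in> els (presented_operad (coproduct_gens {1..n + 1} (\<lambda>_. PreLie)) (\<lambda>(i, m, x). m)
        (fibered_coproduct_rels {1..n + 1} Lie (\<lambda>_. PreLie) (\<lambda>_. Lie_to_PreLie))) m"
      using assms unfolding PreLie_coproduct_def fibered_coproduct_def .
    fix g assume "g \<in> coproduct_gens {1..n + 1} (\<lambda>_. PreLie)"
    then obtain i k y where g: "g = (i, k, y)" "i \<in> {1..n + 1}" "y \<in> els PreLie k" by (auto simp: coproduct_gens_def)
    show "oclass (coproduct_gens {1..n + 1} (\<lambda>_. PreLie)) (\<lambda>(i, m, x). m)
        (fibered_coproduct_rels {1..n + 1} Lie (\<lambda>_. PreLie) (\<lambda>_. Lie_to_PreLie)) (TGen g) \<in> S.spanned n ((\<lambda>(i, m, x). m) g)"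
      using base[OF g(2,3)] by (simp add: g(1) copy_incl_def coproduct_incl_def)
  qed
qed

definition copy_hom :: "nat \<Rightarrow> nat \<Rightarrow> ('k::field, unit) oterm set \<Rightarrow> ((nat, nat) gtree \<Rightarrow>\<^sub>0 'k)" where
  "copy_hom k = presented_hom (gop n) (\<lambda>_. 2) (\<lambda>_. generator n k)"

lemma generator_closed: "generator n k \<in> els (gop n) 2"
  unfolding els_gop by (rule generator_arity_space)

lemma pcomp_generator:
  "pcomp (gop n) 2 2 1 (generator n k) (generator n k) = (gprod n k (gprod n k (dot 1) (dot 2)) (dot 3) :: _ \<Rightarrow>\<^sub>0 'k::field)"
  "pcomp (gop n) 2 2 2 (generator n k) (generator n k) = (gprod n k (dot 1) (gprod n k (dot 2) (dot 3)) :: _ \<Rightarrow>\<^sub>0 'k)"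
proof -
  note g = generator_arity_space[of n k]
  have i: "1 \<in> {1..2::nat}" "2 \<in> {1..2::nat}" by auto
  show "pcomp (gop n) 2 2 1 (generator n k) (generator n k) = (gprod n k (gprod n k (dot 1) (dot 2)) (dot 3) :: _ \<Rightarrow>\<^sub>0 'k)"
    unfolding pcomp_gop[OF g g i(1)] hom_generator by (simp add: plug_def shift_def hom_gprod_G dot_greg_span)
  show "pcomp (gop n) 2 2 2 (generator n k) (generator n k) = (gprod n k (dot 1) (gprod n k (dot 2) (dot 3)) :: _ \<Rightarrow>\<^sub>0 'k)"
    unfolding pcomp_gop[OF g g i(2)] hom_generator by (simp add: plug_def shift_def hom_gprod_G dot_greg_span numeral_eq_Suc)
qed

lemma copy_hom:
  "operad_hom PreLie (gop n :: ('k::field, _) operad) (copy_hom k)"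
  "copy_hom k 2 (PL_class bin) = (generator n k :: _ \<Rightarrow>\<^sub>0 'k)"
proof -
  let ?ev = "oeval (gop n :: ('k, _) operad) (\<lambda>_. 2) (\<lambda>_ :: unit. generator n k)"
  have R: "?ev s = ?ev t" if "(s, t) \<in> PreLie_rels" for s t
  proof -
    let ?d = "gprod n k (gprod n k (dot 1) (dot 2)) (dot 3) - gprod n k (dot 1) (gprod n k (dot 2) (dot 3)) :: (nat, nat) gtree \<Rightarrow>\<^sub>0 'k"
    let ?A = "TSub (TComp 1 bin bin) (TComp 2 bin bin) :: ('k, unit) oterm"
    have st: "s = ?A" "t = TAct ?A (transpose 2 3)" using that by (auto simp: PreLie_rels_def Let_def)
    have evA: "?ev ?A = ?d"
      using pcomp_generator[of k, where ?'k = 'k] by (simp add: greg_operad_simps(2,3) del: One_nat_def)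
    have "?d \<in> arity_space n {1..3}"
    proof -
      have "pcomp (gop n) 2 2 i (generator n k) (generator n k) \<in> (arity_space n {1..3} :: (_ \<Rightarrow>\<^sub>0 'k) set)" if "i \<in> {1..2}" for i
        using operad.pcomp_closed_eq[OF operad_gop generator_closed generator_closed that, of 3] by (simp add: els_gop del: One_nat_def)
      from this[of 1] this[of 2] show ?thesis
        unfolding pcomp_generator[symmetric] arity_space_def by (intro supported_diff) simp_all
    qed
    then have "act (gop n) 3 ?d (transpose 2 3) = G.hom n (\<lambda>w. dot (Hilbert_Choice.inv (transpose 2 3) w)) ?d"
      by (rule act_gop)
    also have "\<dots> = gprod n k (gprod n k (dot 1) (dot 3)) (dot 2) - gprod n k (dot 1) (gprod n k (dot 3) (dot 2))"
      by (simp add: lmap_diff[OF pm.lmap_lext] hom_gprod_G dot_greg_span gprod_greg_span transpose_def)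
    also have "\<dots> = ?d" by (rule G.prelie[symmetric])
    finally have act: "act (gop n) 3 ?d (transpose 2 3) = ?d" .
    have "?ev t = act (gop n) 3 (?ev ?A) (transpose 2 3)" unfolding st by (simp del: One_nat_def)
    then show ?thesis unfolding st(1) evA act by simp
  qed
  show "operad_hom PreLie (gop n :: ('k, _) operad) (copy_hom k)"
    unfolding copy_hom_def PreLie_def
    by (rule presented_operad_universal(1)[OF operad_gop]) (use generator_closed R in auto)
  show "copy_hom k 2 (PL_class bin) = (generator n k :: _ \<Rightarrow>\<^sub>0 'k)"
    unfolding copy_hom_def
    by (rule presented_operad_universal(2)[OF operad_gop]) (use generator_closed R in auto)
qed

text \<open>
  Both sides are morphisms out of the operad of Lie algebras, so it is enough to compare the brackets;
  these agree because the products on trees have a common commutator.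
\<close>

lemma copy_hom_glue:
  assumes z: "z \<in> els Lie m"
  shows "copy_hom k m (Lie_to_PreLie m z) = (copy_hom l m (Lie_to_PreLie m z) :: _ \<Rightarrow>\<^sub>0 'k::field)"
proof -
  let ?Q = "gop n :: ('k, _) operad"
  let ?h = "\<lambda>k. copy_hom k 2 (Lie_to_PreLie 2 (oclass UNIV (\<lambda>_. 2) Lie_rels bin)) :: _ \<Rightarrow>\<^sub>0 'k"
  have hh: "?h k = gprod n 0 (dot 1) (dot 2) - gprod n 0 (dot 2) (dot 1)" for k
  proof -
    have "?h k = kspace.dif (sp ?Q 2) (generator n k) (act ?Q 2 (generator n k) swap12)"
      using operad_hom_mu(3)[OF copy_hom(1) operad_gop, of k] by (simp only: copy_hom(2))
    also have "act ?Q 2 (generator n k) swap12 = gprod n k (dot 2) (dot 1)"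
      unfolding act_gop[OF generator_arity_space] hom_generator by (simp add: transpose_def)
    finally have "?h k = generator n k - gprod n k (dot 2) (dot 1)"
      by (simp add: operad.odif_def[OF operad_gop] greg_operad_simps(2,3) del: One_nat_def)
    also have "\<dots> = gprod n 0 (dot 1) (dot 2) - gprod n 0 (dot 2) (dot 1)" by (rule G.bracket)
    finally show ?thesis .
  qed
  have hom: "operad_hom (presented_operad UNIV (\<lambda>_. 2) Lie_rels) ?Q (\<lambda>m z. copy_hom k m (Lie_to_PreLie m z))" for k
    using operad_hom_compose[OF operad_hom_Lie_to_PreLie copy_hom(1)] by (simp add: Lie_presented)
  obtain t where t: "wf_oterm UNIV (\<lambda>_. 2) t" "arity (\<lambda>_. 2) t = m" "z = oclass UNIV (\<lambda>_. 2) Lie_rels t"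
    using z unfolding Lie_presented by (rule els_presentedE)
  have cl: "?h 0 \<in> els ?Q 2"
    by (rule operad_homD(1)[OF hom]) (rule oclass_in_els, auto)
  have "copy_hom k (arity (\<lambda>_. 2) t) (Lie_to_PreLie (arity (\<lambda>_. 2) t) (oclass UNIV (\<lambda>_. 2) Lie_rels t)) = oeval ?Q (\<lambda>_. 2) (\<lambda>_. ?h 0) t" for k
    by (rule operad_hom_presented_unique[OF operad_gop _ hom _ t(1)]) (use cl hh in auto)
  from this[of k] this[of l] show ?thesis using t by simp
qed

text \<open>
  The products on trees give compatible morphisms from the copies, hence a morphism from their
  coproduct over the operad of Lie algebras.
\<close>

theorem coproduct_iso_greg:
  "\<exists>\<Phi>. operad_iso (coproduct_operad :: ('k::field, _) operad) (gop n) \<Phi>"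
proof -
  let ?P = "coproduct_operad :: ('k, _) operad"
  obtain \<Phi> where \<Phi>: "operad_hom ?P (gop n) \<Phi>"
    "\<And>i m x. i \<in> {1..n + 1} \<Longrightarrow> x \<in> els PreLie m \<Longrightarrow> \<Phi> m (copy_incl i m x) = copy_hom (i - 1) m x"
    using fibered_coproduct_universal[of "{1..n + 1}" "\<lambda>_. PreLie" Lie "\<lambda>_. Lie_to_PreLie" "gop n :: ('k, _) operad" "\<lambda>i. copy_hom (i - 1)",
        OF operad_PreLie operad_hom_Lie_to_PreLie operad_gop copy_hom(1) copy_hom_glue]
    unfolding PreLie_coproduct_def copy_incl_def by blast
  have "greg_presentation ?P copy_product n \<Phi>"
  proof (intro greg_presentation.intro greg_presentation_axioms.intro shared_bracket_operad_coproduct \<Phi>(1))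
    show "\<Phi> 2 (copy_product k) = generator n k" for k
      unfolding copy_product_def using \<Phi>(2)[OF _ PL_bin_closed, of "min k n + 1"] by (simp add: copy_hom(2) gprod_clip)
  qed (rule coproduct_generated)
  then show ?thesis using greg_presentation.operad_iso_\<Phi> by blast
qed

end


section \<open>Leading parts\<close>

text \<open>
  The terms of \<open>p\<close> with \<open>r\<close> black vertices form \<open>q\<close>, and all its other terms have more.
\<close>

definition leading :: "nat \<Rightarrow> (('w, 'c) gtree \<Rightarrow>\<^sub>0 'k::field) \<Rightarrow> (('w, 'c) gtree \<Rightarrow>\<^sub>0 'k) \<Rightarrow> bool" where
  "leading r p q \<longleftrightarrow> q \<in> supported {t. num_black t = r} \<and> p - q \<in> supported {t. r < num_black t}"

lemma supported_mono: "p \<in> supported A \<Longrightarrow> A \<subseteq> A' \<Longrightarrow> p \<in> supported A'"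
  by (auto simp: supported_def)

lemma leading_zero: "leading r 0 0"
  by (simp add: leading_def)

lemma leading_basis: "num_black t = r \<Longrightarrow> leading r (basis t) (basis t)"
  by (simp add: leading_def)

lemma leading_higher: "p \<in> supported {t. r < num_black t} \<Longrightarrow> leading r p 0"
  by (simp add: leading_def)

lemma leading_add: "leading r p q \<Longrightarrow> leading r p' q' \<Longrightarrow> leading r (p + p') (q + q')"
  unfolding leading_def using supported_add[of "p - q" _ "p' - q'"] by (auto intro: supported_add simp: algebra_simps)

lemma leading_diff: "leading r p q \<Longrightarrow> leading r p' q' \<Longrightarrow> leading r (p - p') (q - q')"
  unfolding leading_def using supported_diff[of "p - q" _ "p' - q'"] by (auto intro: supported_diff simp: algebra_simps)

lemma leading_sum: "(\<And>x. x \<in> S \<Longrightarrow> leading r (g x) (h x)) \<Longrightarrow> leading r (sum g S) (sum h S)"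
  by (induction S rule: infinite_finite_induct) (auto intro: leading_add leading_zero)

lemma leading_sum_mset: "(\<And>x. x \<in># M \<Longrightarrow> leading r (g x) (h x)) \<Longrightarrow> leading r (\<Sum>x\<in>#M. g x) (\<Sum>x\<in>#M. h x)"
  by (induction M) (auto intro: leading_add leading_zero)

lemma leading_supported: "leading r p q \<Longrightarrow> p \<in> supported {t. r \<le> num_black t}"
proof -
  assume "leading r p q"
  then have "p - q \<in> supported {t. r \<le> num_black t}" "q \<in> supported {t. r \<le> num_black t}"
    unfolding leading_def by (auto intro: supported_mono)
  then show ?thesis using supported_add by fastforce
qed

lemma leading_lext:
  fixes g :: "('v, 'd) gtree \<Rightarrow> (('w, 'c) gtree \<Rightarrow>\<^sub>0 'k::field)"
  assumes p: "leading a p q" and g: "\<And>t. leading (num_black t + b) (g t) (h t)"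
  shows "leading (a + b) (lext lscale g p) (lext lscale h q)"
proof -
  have q: "q \<in> supported {t. num_black t = a}" and pq: "p - q \<in> supported {t. a < num_black t}"
    using p by (simp_all add: leading_def)
  have "lext lscale h q \<in> supported {t. num_black t = a + b}"
    using q by (rule supported_lext) (use g in \<open>auto simp: leading_def\<close>)
  moreover have "lext lscale g (p - q) \<in> supported {t. a + b < num_black t}"
  proof (rule supported_lext[OF pq])
    fix t :: "('v, 'd) gtree" assume "t \<in> {t. a < num_black t}"
    then show "g t \<in> supported {t. a + b < num_black t}"
      using leading_supported[OF g[of t]] by (rule_tac supported_mono) auto
  qed
  moreover have "lext lscale (\<lambda>t. g t - h t) q \<in> supported {t. a + b < num_black t}"
    using q by (rule supported_lext) (use g in \<open>auto simp: leading_def\<close>)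
  moreover have "lext lscale g p - lext lscale h q = lext lscale g (p - q) + lext lscale (\<lambda>t. g t - h t) q"
    by (simp add: pm.lext_pointwise_diff lmap_diff[OF pm.lmap_lext])
  ultimately show ?thesis unfolding leading_def by (simp add: supported_add)
qed

lemma num_black_replace:
  "s \<in># F \<Longrightarrow> \<Sum>\<^sub># (image_mset num_black (F - {#s#})) + num_black s = \<Sum>\<^sub># (image_mset num_black F)"
  by (auto dest!: multi_member_split)

lemma leading_in_forest:
  assumes "leading (num_black s + b) p q" "s \<in># F"
    and node: "\<And>M. num_black (node M) = c + \<Sum>\<^sub># (image_mset num_black M)"
  shows "leading (num_black (node F) + b) (in_forest node F s p) (in_forest node F s q)"
proof -
  let ?e = "c + \<Sum>\<^sub># (image_mset num_black (F - {#s#}))"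
  have "leading (num_black s + b + ?e) (in_forest node F s p) (in_forest node F s q)"
    unfolding in_forest_eq by (rule leading_lext[OF assms(1)], rule leading_basis) (simp add: node)
  moreover have "num_black s + b + ?e = num_black (node F) + b"
    using num_black_replace[OF assms(2)] by (simp add: node)
  ultimately show ?thesis by simp
qed

text \<open>
  Only the splitting of a black vertex involves the coproduct, and it adds a black vertex.
\<close>

lemma leading_fall: "leading (num_black S + num_black T) (fall \<Delta> S T) (fall (\<lambda>_. 0) S T)"
proof (induction S)
  case (White w F)
  show ?case
    unfolding fall.simps
    by (intro leading_add leading_basis leading_sum_mset leading_in_forest[where c = 0] White.IH) auto
next
  case (Black c F)
  have split: "leading (num_black (Black c F) + num_black T)
      (lin (\<lambda>(c1, c2). basis (Black c1 (F - {#s#} + {#Black c2 {#s, T#}#}))) (\<Delta> c))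
      (lin (\<lambda>(c1, c2). basis (Black c1 (F - {#s#} + {#Black c2 {#s, T#}#}))) 0)" if s: "s \<in># F" for s
    unfolding lin_eq_lext pm.lext_zero
  proof (rule leading_higher, rule supported_lext[where A = UNIV])
    fix c' show "(case c' of (c1, c2) \<Rightarrow> basis (Black c1 (F - {#s#} + {#Black c2 {#s, T#}#})))
        \<in> supported {t. num_black (Black c F) + num_black T < num_black t}"
      using num_black_replace[OF s] by (cases c') simp
  qed (simp add: supported_def)
  show ?case
    unfolding fall.simps
    by (intro leading_add leading_basis leading_sum_mset leading_in_forest[where c = 1] Black.IH split) auto
qed

lemma sum_list_update_num_black:
  fixes Ts :: "('w, 'c) gtree list"
  assumes "i < length Ts"
  shows "(\<Sum>t\<leftarrow>Ts[i := U]. num_black t) + num_black (Ts ! i) = (\<Sum>t\<leftarrow>Ts. num_black t) + num_black U"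
  using assms by (induction Ts arbitrary: i) (auto split: nat.split)

lemma leading_brace:
  "leading (num_black S + (\<Sum>t\<leftarrow>Ts. num_black t)) (brace \<Delta> S Ts) (brace (\<lambda>_. 0) S Ts)"
proof (induction \<Delta> S Ts rule: brace.induct)
  case (1 \<Delta> S)
  show ?case by (simp add: leading_basis)
next
  case (2 \<Delta> S Ts T)
  let ?r = "num_black S + (\<Sum>t\<leftarrow>Ts. num_black t)"
  have "leading (?r + num_black T) (lin (\<lambda>U. fall \<Delta> U T) (brace \<Delta> S Ts)) (lin (\<lambda>U. fall (\<lambda>_. 0) U T) (brace (\<lambda>_. 0) S Ts))"
    unfolding lin_eq_lext by (rule leading_lext[OF 2(1) leading_fall])
  moreover have "leading (?r + num_black T) (lin (\<lambda>U. brace \<Delta> S (Ts[i := U])) (fall \<Delta> (Ts ! i) T))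
      (lin (\<lambda>U. brace (\<lambda>_. 0) S (Ts[i := U])) (fall (\<lambda>_. 0) (Ts ! i) T))" if i: "i < length Ts" for i
  proof -
    \<comment> \<open>What the trees other than the one in position \<open>i\<close> contribute to the degree.\<close>
    let ?e = "?r - num_black (Ts ! i)"
    have e: "num_black S + (\<Sum>t\<leftarrow>Ts[i := U]. num_black t) = num_black U + ?e" "num_black (Ts ! i) + num_black T + ?e = ?r + num_black T" for U
      using sum_list_update_num_black[OF i, of U] member_le_sum_list[of "num_black (Ts ! i)" "map num_black Ts"] i by auto
    have "leading (num_black U + ?e) (brace \<Delta> S (Ts[i := U])) (brace (\<lambda>_. 0) S (Ts[i := U]))" for U
      using 2(2)[of i U] i unfolding e(1) by simp
    from leading_lext[OF leading_fall[of "Ts ! i" T \<Delta>] this] show ?thesis unfolding e(2) lin_eq_lext .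
  qed
  ultimately show ?case
    unfolding brace.simps by (simp add: add.assoc) (intro leading_diff leading_sum; simp)
qed

text \<open>
  The list of children chosen by the Hilbert operator does not depend on the coproduct.
\<close>

lemma leading_insert_tree:
  "leading (num_black T + num_black S) (insert_tree \<Delta> i S T) (insert_tree (\<lambda>_. 0) i S T)"
proof (induction T)
  case (White w F)
  show ?case
  proof (cases "w = i")
    case True
    define Ts where "Ts = (SOME Ts. mset Ts = F)"
    have "mset Ts = F" unfolding Ts_def by (rule someI_ex) (rule ex_mset)
    then have "(\<Sum>t\<leftarrow>Ts. num_black t) = num_black (White w F)"
      by (metis mset_map num_black.simps(1) sum_mset_sum_list)
    then show ?thesis using leading_brace[of S Ts \<Delta>] True by (simp add: Ts_def add.commute)
  next
    case False
    then show ?thesis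
      unfolding insert_tree.simps if_not_P[OF False]
      by (intro leading_sum_mset leading_in_forest[where c = 0] White.IH) auto
  qed
next
  case (Black c F)
  show ?case
    unfolding insert_tree.simps
    by (intro leading_sum_mset leading_in_forest[where c = 1] Black.IH) auto
qed

lemma leading_pcomp:
  fixes p p' q q' :: "(nat, nat) gtree \<Rightarrow>\<^sub>0 'k::field"
  assumes "leading a p p'" "leading b q q'"
  shows "leading (a + b) (pcomp (greg_operad B \<Delta>) m k i p q) (pcomp (greg_operad B (\<lambda>_. 0)) m k i p' q')"
  unfolding greg_operad_simps
proof (rule leading_lext[OF assms(1)])
  fix T :: "(nat, nat) gtree"
  show "leading (num_black T + b)
      (lext lscale (\<lambda>S. insert_tree \<Delta> i (relabel (\<lambda>j. i - 1 + j) S) (relabel ((shift i k)(i := i)) T)) q)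
      (lext lscale (\<lambda>S. insert_tree (\<lambda>_. 0) i (relabel (\<lambda>j. i - 1 + j) S) (relabel ((shift i k)(i := i)) T)) q')"
    unfolding add.commute[of _ b]
  proof (rule leading_lext[OF assms(2)])
    fix S :: "(nat, nat) gtree"
    show "leading (num_black S + num_black T) (insert_tree \<Delta> i (relabel (\<lambda>j. i - 1 + j) S) (relabel ((shift i k)(i := i)) T))
      (insert_tree (\<lambda>_. 0) i (relabel (\<lambda>j. i - 1 + j) S) (relabel ((shift i k)(i := i)) T))"
      using leading_insert_tree[of "relabel ((shift i k)(i := i)) T" "relabel (\<lambda>j. i - 1 + j) S" \<Delta> i]
      unfolding num_black_relabel by (simp only: add.commute)
  qed
qed

abbreviation degree_part :: "nat \<Rightarrow> (('w, 'c) gtree \<Rightarrow>\<^sub>0 'k::field) \<Rightarrow> (('w, 'c) gtree \<Rightarrow>\<^sub>0 'k)" where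
  "degree_part k \<equiv> proj {t. num_black t = k}"

lemma lookup_proj: "Poly_Mapping.lookup (proj A p) t = (if t \<in> A then Poly_Mapping.lookup p t else 0)"
proof -
  have "Poly_Mapping.lookup (proj A p) t
      = (\<Sum>s\<in>Poly_Mapping.keys p. if s = t then (if t \<in> A then Poly_Mapping.lookup p t else 0) else 0)"
    unfolding proj_def lin_eq_lext[symmetric] lookup_lin
    by (rule sum.cong) (auto simp: lookup_single when_def)
  then show ?thesis by (simp add: sum.delta in_keys_iff)
qed

lemmas proj_add = lmap_add[OF linop_proj]
lemmas proj_diff = lmap_diff[OF linop_proj]
lemmas proj_zero = lmap_zero[OF linop_proj]
lemmas proj_scale = lmap_scale[OF linop_proj]
lemmas proj_sum = lmap_sum[OF linop_proj]

lemma degree_parts_eqI: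
  fixes p q :: "('w, 'c) gtree \<Rightarrow>\<^sub>0 'k::field"
  assumes "\<And>k. degree_part k p = degree_part k q"
  shows "p = q"
proof (rule poly_mapping_eqI)
  fix t :: "('w, 'c) gtree"
  from arg_cong[where f = "\<lambda>r. Poly_Mapping.lookup r t", OF assms[of "num_black t"]]
  show "Poly_Mapping.lookup p t = Poly_Mapping.lookup q t" by (simp add: lookup_proj)
qed

lemma finite_degree_parts: "finite {k. degree_part k p \<noteq> 0}"
proof (rule finite_subset)
  show "{k. degree_part k p \<noteq> 0} \<subseteq> num_black ` Poly_Mapping.keys p"
  proof
    fix k assume "k \<in> {k. degree_part k p \<noteq> 0}"
    then obtain t where "Poly_Mapping.lookup (degree_part k p) t \<noteq> 0" by (auto simp: poly_mapping_eq_iff fun_eq_iff)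
    then show "k \<in> num_black ` Poly_Mapping.keys p" by (auto simp: lookup_proj in_keys_iff split: if_splits)
  qed
qed simp

lemma leading_degree_part: "leading r p q \<Longrightarrow> degree_part r p = q"
  unfolding leading_def
  using proj_diff[of "{t. num_black t = r}" p q] proj_id[of q "{t. num_black t = r}"]
    proj_disjoint[of "p - q" "{t. r < num_black t}" "{t. num_black t = r}"] by auto

lemma degree_part_leading: "p \<in> supported {t. r \<le> num_black t} \<Longrightarrow> leading r p (degree_part r p)"
  unfolding leading_def
  by (auto simp: supported_def in_keys_iff lookup_proj lookup_minus split: if_splits)

lemma degree_part_zero: "p \<in> supported {t. r \<le> num_black t} \<Longrightarrow> degree_part r p = 0 \<Longrightarrow> p \<in> supported {t. Suc r \<le> num_black t}"
  using degree_part_leading[of p r] by (simp add: leading_def Suc_le_eq)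

lemma degree_part_act:
  fixes p :: "(nat, nat) gtree \<Rightarrow>\<^sub>0 'k::field"
  shows "degree_part r (act (greg_operad B \<Delta>) m p \<sigma>) = act (greg_operad B \<Delta>') m (degree_part r p) \<sigma>"
  unfolding greg_operad_simps proj_def pm.lext_compose
  by (rule pm.lext_cong) (simp add: num_black_relabel)

text \<open>
  For the zero coproduct the number of black vertices is a grading.
\<close>

lemma degree_part_pcomp:
  fixes p q :: "(nat, nat) gtree \<Rightarrow>\<^sub>0 'k::field"
  shows "degree_part r (pcomp (greg_operad B (\<lambda>_. 0)) m k i p q)
    = (\<Sum>a\<le>r. pcomp (greg_operad B (\<lambda>_. 0)) m k i (degree_part a p) (degree_part (r - a) q))"
proof -
  let ?I = "\<lambda>T S. insert_tree (\<lambda>_. 0) i (relabel (\<lambda>j. i - 1 + j) S) (relabel ((shift i k)(i := i)) T) :: (nat, nat) gtree \<Rightarrow>\<^sub>0 'k"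
  have I: "degree_part r (?I T S) = (if num_black T + num_black S = r then ?I T S else 0)" for T S :: "(nat, nat) gtree"
  proof -
    have *: "?I T S \<in> supported {t. num_black t = num_black T + num_black S}"
      using leading_insert_tree[of "relabel ((shift i k)(i := i)) T" "relabel (\<lambda>j. i - 1 + j) S" "\<lambda>_. 0" i]
      unfolding num_black_relabel leading_def by simp
    show ?thesis
    proof (cases "num_black T + num_black S = r")
      case True
      show ?thesis unfolding if_P[OF True] by (rule proj_id[OF *[unfolded True]])
    next
      case False
      then have "{t. num_black t = r} \<inter> {t. num_black t = num_black T + num_black S} = {}" by auto
      from proj_disjoint[OF * this] show ?thesis using False by (simp only: if_False)
    qed
  qed
  have if_lext: "lext lscale (\<lambda>t. lext lscale g (if P t then basis t else 0)) x = lext lscale (\<lambda>t. if P t then g t else 0) x"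
    for P :: "(nat, nat) gtree \<Rightarrow> bool" and g :: "(nat, nat) gtree \<Rightarrow> ((nat, nat) gtree \<Rightarrow>\<^sub>0 'k)" and x
    by (rule pm.lext_cong) simp
  have T: "(\<Sum>a\<le>r. if num_black T = a then lext lscale (\<lambda>S. if num_black S = r - a then ?I T S else 0) q else 0)
      = lext lscale (\<lambda>S. if num_black T + num_black S = r then ?I T S else 0) q" for T
  proof -
    have "(\<Sum>a\<le>r. if num_black T = a then lext lscale (\<lambda>S. if num_black S = r - a then ?I T S else 0) q else 0)
      = (if num_black T \<le> r then lext lscale (\<lambda>S. if num_black S = r - num_black T then ?I T S else 0) q else 0)"
      by (simp add: sum.delta)
    also have "\<dots> = lext lscale (\<lambda>S. if num_black T + num_black S = r then ?I T S else 0) q"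
    proof (cases "num_black T \<le> r")
      case True
      then show ?thesis by (simp, intro pm.lext_cong) auto
    next
      case False
      have "lext lscale (\<lambda>S. if num_black T + num_black S = r then ?I T S else 0) q = lext lscale (\<lambda>S. 0) q"
        by (rule pm.lext_cong) (use False in auto)
      also have "\<dots> = 0" by (simp add: lext_def)
      finally show ?thesis using False by simp
    qed
    finally show ?thesis .
  qed
  have "degree_part r (pcomp (greg_operad B (\<lambda>_. 0)) m k i p q)
      = lext lscale (\<lambda>T. lext lscale (\<lambda>S. degree_part r (?I T S)) q) p"
    unfolding greg_operad_simps proj_def pm.lext_compose ..
  also have "\<dots> = lext lscale (\<lambda>T. \<Sum>a\<le>r. if num_black T = a then lext lscale (\<lambda>S. if num_black S = r - a then ?I T S else 0) q else 0) p"
    unfolding I T ..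
  also have "\<dots> = (\<Sum>a\<le>r. pcomp (greg_operad B (\<lambda>_. 0)) m k i (degree_part a p) (degree_part (r - a) q))"
    unfolding greg_operad_simps proj_def pm.lext_compose pm.lext_pointwise_sum if_lext mem_Collect_eq ..
  finally show ?thesis .
qed


section \<open>The associated graded operad\<close>

text \<open>
  An operad identified with an operad of Greg trees, for an arbitrary coproduct.
\<close>

locale greg_model = operad P for P :: "('k::field, 'a) operad" +
  fixes B :: "nat set" and \<Delta> :: "(nat, 'k) coproduct" and \<Phi> :: "nat \<Rightarrow> 'a \<Rightarrow> ((nat, nat) gtree \<Rightarrow>\<^sub>0 'k)"
  assumes iso: "operad_iso P (greg_operad B \<Delta>) \<Phi>"
begin

abbreviation "F \<equiv> black_filtration P \<Phi>"

text \<open>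
  On the \<open>k\<close>-th step of the filtration this is the principal symbol.
\<close>

definition symbol :: "nat \<Rightarrow> nat \<Rightarrow> 'a \<Rightarrow> ((nat, nat) gtree \<Rightarrow>\<^sub>0 'k)" where
  "symbol k m x = degree_part k (\<Phi> m x)"

lemma hom: "operad_hom P (greg_operad B \<Delta>) \<Phi>"
  using iso by (simp add: operad_iso_def)

lemma \<Phi>_closed: "x \<in> els P m \<Longrightarrow> \<Phi> m x \<in> supported (greg_trees B {1..m})"
  using operad_homD(1)[OF hom] by (simp only: greg_operad_simps)

lemma \<Phi>_add: "x \<in> els P m \<Longrightarrow> y \<in> els P m \<Longrightarrow> \<Phi> m (x \<oplus>\<^bsub>sp P m\<^esub> y) = \<Phi> m x + \<Phi> m y"
  using operad_homD(2)[OF hom] by (simp only: greg_operad_simps)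

lemma \<Phi>_smult: "x \<in> els P m \<Longrightarrow> \<Phi> m (c \<odot>\<^bsub>sp P m\<^esub> x) = lscale c (\<Phi> m x)"
  using operad_homD(3)[OF hom] by (simp only: greg_operad_simps)

lemma \<Phi>_zero: "\<Phi> m \<zero>\<^bsub>sp P m\<^esub> = 0"
  using \<Phi>_smult[OF sp_zero_closed, of m 0] kspace.sm_zero_left[OF kspace_sp sp_zero_closed] by simp

lemma F_iff: "x \<in> F k m \<longleftrightarrow> x \<in> els P m \<and> \<Phi> m x \<in> supported {t. k \<le> num_black t}"
  by (auto simp: black_filtration_def supported_def)

lemma F_els: "x \<in> F k m \<Longrightarrow> x \<in> els P m"
  by (simp add: F_iff)

lemma F_leading: "x \<in> F k m \<Longrightarrow> leading k (\<Phi> m x) (symbol k m x)"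
  unfolding symbol_def by (rule degree_part_leading) (simp add: F_iff)

lemma F_zero: "\<zero>\<^bsub>sp P m\<^esub> \<in> F k m"
  by (simp add: F_iff \<Phi>_zero sp_zero_closed)

lemma F_add: "x \<in> F k m \<Longrightarrow> y \<in> F k m \<Longrightarrow> x \<oplus>\<^bsub>sp P m\<^esub> y \<in> F k m"
proof -
  interpret kspace "sp P m" by (rule kspace_sp)
  show "x \<in> F k m \<Longrightarrow> y \<in> F k m \<Longrightarrow> x \<oplus>\<^bsub>sp P m\<^esub> y \<in> F k m"
    by (simp add: F_iff \<Phi>_add supported_add)
qed

lemma F_smult: "x \<in> F k m \<Longrightarrow> c \<odot>\<^bsub>sp P m\<^esub> x \<in> F k m"
  by (simp add: F_iff \<Phi>_smult supported_lscale sm_closed)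

lemma F_act: "x \<in> F k m \<Longrightarrow> \<sigma> permutes {1..m} \<Longrightarrow> act P m x \<sigma> \<in> F k m"
  unfolding F_iff
proof (elim conjE, intro conjI act_closed)
  assume x: "x \<in> els P m" "\<Phi> m x \<in> supported {t. k \<le> num_black t}" and \<sigma>: "\<sigma> permutes {1..m}"
  show "\<Phi> m (act P m x \<sigma>) \<in> supported {t. k \<le> num_black t}"
    unfolding operad_homD(4)[OF hom x(1) \<sigma>] greg_operad_simps
    using x(2) by (rule supported_lext) (simp add: num_black_relabel)
qed

lemma F_pcomp:
  assumes "x \<in> F k m" "y \<in> F l j" "i \<in> {1..m}"
  shows "pcomp P m j i x y \<in> F (k + l) (m + j - 1)"
    and "symbol (k + l) (m + j - 1) (pcomp P m j i x y)
      = pcomp (greg_operad B (\<lambda>_. 0)) m j i (symbol k m x) (symbol l j y)"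
proof -
  have xy: "x \<in> els P m" "y \<in> els P j" using assms by (auto dest: F_els)
  have "leading (k + l) (\<Phi> (m + j - 1) (pcomp P m j i x y))
      (pcomp (greg_operad B (\<lambda>_. 0)) m j i (symbol k m x) (symbol l j y))"
    unfolding operad_homD(5)[OF hom xy assms(3)] by (intro leading_pcomp F_leading assms)
  then show "pcomp P m j i x y \<in> F (k + l) (m + j - 1)" "symbol (k + l) (m + j - 1) (pcomp P m j i x y)
      = pcomp (greg_operad B (\<lambda>_. 0)) m j i (symbol k m x) (symbol l j y)"
    using pcomp_closed[OF xy assms(3)] leading_supported leading_degree_part by (auto simp: F_iff symbol_def)
qed

lemma operad_filtration_F: "operad_filtration P F"
  unfolding operad_filtration_def
proof (intro conjI allI ballI impI)
  fix k m
  show "F 0 m = els P m" by (auto simp: F_iff supported_def)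
  show "F (Suc k) m \<subseteq> F k m" by (auto simp: F_iff elim!: supported_mono)
  interpret M: kspace "sp P m" by (rule kspace_sp)
  show "submodule (F k m) scalars (sp P m)"
  proof (rule M.submoduleI)
    show "\<ominus>\<^bsub>sp P m\<^esub> x \<in> F k m" if x: "x \<in> F k m" for x
    proof -
      have "(-1) \<odot>\<^bsub>sp P m\<^esub> x \<oplus>\<^bsub>sp P m\<^esub> x = \<zero>\<^bsub>sp P m\<^esub>"
        using M.dif_self[OF F_els[OF x]] M.sm_closed[OF F_els[OF x], of "-1"] F_els[OF x] by (simp add: M.dif_def M.a_comm)
      then have "\<ominus>\<^bsub>sp P m\<^esub> x = (-1) \<odot>\<^bsub>sp P m\<^esub> x"
        using F_els[OF x] M.sm_closed[OF F_els[OF x], of "-1"] by (simp add: M.minus_equality)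
      then show ?thesis using F_smult[OF x] by simp
    qed
  qed (auto intro: F_zero F_add F_smult F_els)
next
  fix k m \<sigma> x assume "\<sigma> permutes {1..m}" "x \<in> F k m"
  then show "act P m x \<sigma> \<in> F k m" by (intro F_act)
next
  fix k l m j i x y assume "i \<in> {1..m}" "x \<in> F k m" "y \<in> F l j"
  then show "pcomp P m j i x y \<in> F (k + l) (m + j - 1)" by (intro F_pcomp(1))
qed

lemma symbol_simps:
  "x \<in> els P m \<Longrightarrow> y \<in> els P m \<Longrightarrow> symbol k m (x \<oplus>\<^bsub>sp P m\<^esub> y) = symbol k m x + symbol k m y"
  "x \<in> els P m \<Longrightarrow> symbol k m (c \<odot>\<^bsub>sp P m\<^esub> x) = lscale c (symbol k m x)"
  "symbol k m \<zero>\<^bsub>sp P m\<^esub> = 0"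
  by (simp_all add: symbol_def \<Phi>_add \<Phi>_smult \<Phi>_zero proj_add proj_scale proj_zero)

lemma symbol_act: "x \<in> els P m \<Longrightarrow> \<sigma> permutes {1..m} \<Longrightarrow>
    symbol k m (act P m x \<sigma>) = act (greg_operad B (\<lambda>_. 0)) m (symbol k m x) \<sigma>"
  unfolding symbol_def operad_homD(4)[OF hom] by (rule degree_part_act)

lemma F_Suc_iff: "x \<in> F (Suc k) m \<longleftrightarrow> x \<in> F k m \<and> symbol k m x = 0"
proof
  assume x: "x \<in> F (Suc k) m"
  then have "leading k (\<Phi> m x) 0" by (intro leading_higher) (simp add: F_iff Suc_le_eq)
  then show "x \<in> F k m \<and> symbol k m x = 0"
    using x leading_supported leading_degree_part by (auto simp: F_iff symbol_def)
next
  assume "x \<in> F k m \<and> symbol k m x = 0"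
  then show "x \<in> F (Suc k) m" using degree_part_zero by (auto simp: F_iff symbol_def)
qed

text \<open>
  Two elements of the \<open>k\<close>-th step have the same symbol iff their difference lies in the next step.
\<close>

lemma gr_class_symbol:
  assumes x: "x \<in> F k m"
  shows "gr_class P F k m x = {y \<in> F k m. symbol k m y = symbol k m x}"
proof -
  interpret kspace "sp P m" by (rule kspace_sp)
  have "y \<in> F k m \<and> symbol k m y = symbol k m x \<longleftrightarrow> (\<exists>h\<in>F (Suc k) m. y = h \<oplus>\<^bsub>sp P m\<^esub> x)" for y
  proof
    assume y: "y \<in> F k m \<and> symbol k m y = symbol k m x"
    then have yx: "y \<in> els P m" "x \<in> els P m" using x F_els by blast+
    from y have "odif m y x \<in> F k m" using x F_add F_smult by (simp add: dif_def)
    moreover have "symbol k m (odif m y x) = 0"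
      using y yx by (simp add: dif_def symbol_simps sm_closed)
    moreover have "y = odif m y x \<oplus>\<^bsub>sp P m\<^esub> x" using dif_cancel[OF yx] by simp
    ultimately show "\<exists>h\<in>F (Suc k) m. y = h \<oplus>\<^bsub>sp P m\<^esub> x" using F_Suc_iff by blast
  next
    assume "\<exists>h\<in>F (Suc k) m. y = h \<oplus>\<^bsub>sp P m\<^esub> x"
    then obtain h where "h \<in> F k m" "symbol k m h = 0" "y = h \<oplus>\<^bsub>sp P m\<^esub> x" using F_Suc_iff by blast
    then show "y \<in> F k m \<and> symbol k m y = symbol k m x"
      using x F_add F_els by (simp add: symbol_simps)
  qed
  then show ?thesis by (auto simp: gr_class_def a_r_coset_def' dest: F_els)
qed

lemma F_gr_class: "F (Suc k) m = gr_class P F k m \<zero>\<^bsub>sp P m\<^esub>"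
  unfolding gr_class_symbol[OF F_zero] using F_Suc_iff by (auto simp: symbol_simps)

lemma rep_gr_class:
  assumes "x \<in> F k m"
  shows "rep (gr_class P F k m x) \<in> F k m" "symbol k m (rep (gr_class P F k m x)) = symbol k m x"
proof -
  have "rep (gr_class P F k m x) \<in> gr_class P F k m x"
    unfolding rep_def by (rule someI[of _ x]) (use assms in \<open>simp add: gr_class_symbol\<close>)
  then show "rep (gr_class P F k m x) \<in> F k m" "symbol k m (rep (gr_class P F k m x)) = symbol k m x"
    by (simp_all add: gr_class_symbol[OF assms])
qed

abbreviation gr :: "('k, nat \<Rightarrow> 'a set) operad" where "gr \<equiv> gr_operad P F"
abbreviation greg0 :: "('k, (nat, nat) gtree \<Rightarrow>\<^sub>0 'k) operad" where "greg0 \<equiv> greg_operad B (\<lambda>_. 0)"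

definition coset_symbol :: "nat \<Rightarrow> (nat \<Rightarrow> 'a set) \<Rightarrow> nat \<Rightarrow> ((nat, nat) gtree \<Rightarrow>\<^sub>0 'k)" where
  "coset_symbol m u k = symbol k m (rep (u k))"

definition \<Psi> :: "nat \<Rightarrow> (nat \<Rightarrow> 'a set) \<Rightarrow> ((nat, nat) gtree \<Rightarrow>\<^sub>0 'k)" where
  "\<Psi> m u = (\<Sum>k | coset_symbol m u k \<noteq> 0. coset_symbol m u k)"

lemma coset_symbol_gr_class: "u k = gr_class P F k m x \<Longrightarrow> x \<in> F k m \<Longrightarrow> coset_symbol m u k = symbol k m x"
  unfolding coset_symbol_def by (simp only: rep_gr_class(2))

lemma coset_symbol_zero: "u k = F (Suc k) m \<Longrightarrow> coset_symbol m u k = 0"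
  using coset_symbol_gr_class[OF _ F_zero] by (simp add: F_gr_class symbol_simps)

lemma degree_part_degree_part: "degree_part k (degree_part l p) = (if k = l then degree_part k p else 0)"
  by (rule poly_mapping_eqI) (auto simp: lookup_proj)

lemma degree_part_\<Psi>: "finite {k. coset_symbol m u k \<noteq> 0} \<Longrightarrow> degree_part k (\<Psi> m u) = coset_symbol m u k"
  unfolding \<Psi>_def proj_sum by (simp add: coset_symbol_def symbol_def degree_part_degree_part sum.delta cong: if_cong)

lemma \<Psi>_eqI: "(\<And>k. coset_symbol m u k = degree_part k p) \<Longrightarrow> \<Psi> m u = p"
  by (rule degree_parts_eqI) (simp add: degree_part_\<Psi> finite_degree_parts)

lemma gr_elsE:
  assumes "u \<in> els gr m"
  shows "rep (u k) \<in> F k m" "u k = gr_class P F k m (rep (u k))" "finite {k. coset_symbol m u k \<noteq> 0}"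
    "degree_part k (\<Psi> m u) = coset_symbol m u k"
proof -
  have u: "u k \<in> gr_class P F k m ` F k m" "finite {k. u k \<noteq> F (Suc k) m}" for k
    using assms by (auto simp: gr_operad_def linear_space_def)
  obtain x where x: "x \<in> F k m" "u k = gr_class P F k m x" using u(1) by blast
  show r: "rep (u k) \<in> F k m" unfolding x(2) by (rule rep_gr_class(1)[OF x(1)])
  show "u k = gr_class P F k m (rep (u k))"
    unfolding gr_class_symbol[OF r] unfolding x(2) rep_gr_class(2)[OF x(1)] by (rule gr_class_symbol[OF x(1)])
  show fin: "finite {k. coset_symbol m u k \<noteq> 0}"
    by (rule finite_subset[OF _ u(2)]) (auto dest: coset_symbol_zero)
  show "degree_part k (\<Psi> m u) = coset_symbol m u k" by (rule degree_part_\<Psi>[OF fin])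
qed

lemma finsum_symbol:
  assumes "finite S" "\<And>a. a \<in> S \<Longrightarrow> f a \<in> F k m"
  shows "(\<Oplus>\<^bsub>sp P m\<^esub>a\<in>S. f a) \<in> F k m \<and> symbol k m (\<Oplus>\<^bsub>sp P m\<^esub>a\<in>S. f a) = (\<Sum>a\<in>S. symbol k m (f a))"
proof -
  interpret kspace "sp P m" by (rule kspace_sp)
  show ?thesis
    using assms
  proof (induction S)
    case empty
    show ?case by (simp add: F_zero symbol_simps)
  next
    case (insert a S)
    then have "(\<Oplus>\<^bsub>sp P m\<^esub>b\<in>insert a S. f b) = f a \<oplus>\<^bsub>sp P m\<^esub> (\<Oplus>\<^bsub>sp P m\<^esub>b\<in>S. f b)"
      by (intro finsum_insert) (auto intro: F_els)
    moreover have s: "f a \<in> F k m" "(\<Oplus>\<^bsub>sp P m\<^esub>b\<in>S. f b) \<in> F k m" using insert by auto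
    ultimately show ?case using insert F_add[OF s] F_els[OF s(1)] F_els[OF s(2)] by (simp add: symbol_simps)
  qed
qed

text \<open>
  An element of the associated graded operad is determined by the symbols of its entries, and a
  combination of trees by its parts of each degree.  Both are matched by \<open>\<Psi>\<close>.
\<close>

theorem operad_iso_\<Psi>: "operad_iso gr greg0 \<Psi>"
proof -
  have "operad_hom gr greg0 \<Psi>"
  proof (rule operad_homI)
    fix m u assume u: "u \<in> els gr m"
    have "coset_symbol m u k \<in> supported (greg_trees B {1..m})" for k
      unfolding coset_symbol_def symbol_def
      by (rule supported_mono[OF proj_subset[OF \<Phi>_closed[OF F_els[OF gr_elsE(1)[OF u]]]]]) simp
    then show "\<Psi> m u \<in> els greg0 m" unfolding greg_operad_simps \<Psi>_def by (intro supported_sum)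
    show "\<Psi> m (c \<odot>\<^bsub>sp gr m\<^esub> u) = c \<odot>\<^bsub>sp greg0 m\<^esub> \<Psi> m u" for c
    proof (rule \<Psi>_eqI)
      fix k
      have "coset_symbol m (c \<odot>\<^bsub>sp gr m\<^esub> u) k = symbol k m (c \<odot>\<^bsub>sp P m\<^esub> rep (u k))"
        by (rule coset_symbol_gr_class) (simp_all add: gr_operad_def linear_space_def F_smult gr_elsE(1)[OF u])
      then show "coset_symbol m (c \<odot>\<^bsub>sp gr m\<^esub> u) k = degree_part k (c \<odot>\<^bsub>sp greg0 m\<^esub> \<Psi> m u)"
        using F_els[OF gr_elsE(1)[OF u]] gr_elsE(4)[OF u]
        by (simp add: symbol_simps greg_operad_simps proj_scale coset_symbol_def)
    qed
    show "\<Psi> m (act gr m u \<sigma>) = act greg0 m (\<Psi> m u) \<sigma>" if \<sigma>: "\<sigma> permutes {1..m}" for \<sigma>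
    proof (rule \<Psi>_eqI)
      fix k
      have "coset_symbol m (act gr m u \<sigma>) k = symbol k m (act P m (rep (u k)) \<sigma>)"
        by (rule coset_symbol_gr_class) (simp_all only: gr_operad_def operad.simps F_act[OF gr_elsE(1)[OF u] \<sigma>])
      also have "\<dots> = act greg0 m (coset_symbol m u k) \<sigma>"
        unfolding coset_symbol_def by (rule symbol_act[OF F_els[OF gr_elsE(1)[OF u]] \<sigma>])
      also have "\<dots> = degree_part k (act greg0 m (\<Psi> m u) \<sigma>)"
        unfolding degree_part_act[where \<Delta>' = "\<lambda>_. 0"] gr_elsE(4)[OF u] ..
      finally show "coset_symbol m (act gr m u \<sigma>) k = degree_part k (act greg0 m (\<Psi> m u) \<sigma>)" .
    qed
    show "\<Psi> m (u \<oplus>\<^bsub>sp gr m\<^esub> v) = \<Psi> m u \<oplus>\<^bsub>sp greg0 m\<^esub> \<Psi> m v" if v: "v \<in> els gr m" for v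
    proof (rule \<Psi>_eqI)
      fix k
      have "coset_symbol m (u \<oplus>\<^bsub>sp gr m\<^esub> v) k = symbol k m (rep (u k) \<oplus>\<^bsub>sp P m\<^esub> rep (v k))"
        by (rule coset_symbol_gr_class) (simp_all add: gr_operad_def linear_space_def F_add gr_elsE(1)[OF u] gr_elsE(1)[OF v])
      then show "coset_symbol m (u \<oplus>\<^bsub>sp gr m\<^esub> v) k = degree_part k (\<Psi> m u \<oplus>\<^bsub>sp greg0 m\<^esub> \<Psi> m v)"
        using F_els[OF gr_elsE(1)[OF u]] F_els[OF gr_elsE(1)[OF v]] gr_elsE(4)[OF u] gr_elsE(4)[OF v]
        by (simp add: symbol_simps greg_operad_simps proj_add coset_symbol_def)
    qed
    show "\<Psi> (m + j - 1) (pcomp gr m j i u v) = pcomp greg0 m j i (\<Psi> m u) (\<Psi> j v)"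
      if i: "i \<in> {1..m}" and v: "v \<in> els gr j" for j i v
    proof (rule \<Psi>_eqI)
      fix k
      let ?l = "m + j - 1" and ?f = "\<lambda>a. pcomp P m j i (rep (u a)) (rep (v (k - a)))"
      have f: "?f a \<in> F k ?l" "symbol k ?l (?f a) = pcomp greg0 m j i (coset_symbol m u a) (coset_symbol j v (k - a))" if "a \<in> {..k}" for a
        using F_pcomp[OF gr_elsE(1)[OF u, of a] gr_elsE(1)[OF v, of "k - a"] i] that by (simp_all add: coset_symbol_def del: One_nat_def)
      note s = finsum_symbol[OF finite_atMost[of k], of ?f, OF f(1)]
      have "coset_symbol ?l (pcomp gr m j i u v) k = symbol k ?l (\<Oplus>\<^bsub>sp P ?l\<^esub>a\<in>{..k}. ?f a)"
        by (rule coset_symbol_gr_class) (simp_all only: gr_operad_def operad.simps s)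
      also have "\<dots> = (\<Sum>a\<le>k. pcomp greg0 m j i (coset_symbol m u a) (coset_symbol j v (k - a)))"
        using s f(2) by simp
      also have "\<dots> = degree_part k (pcomp greg0 m j i (\<Psi> m u) (\<Psi> j v))"
        unfolding degree_part_pcomp gr_elsE(4)[OF u] gr_elsE(4)[OF v] ..
      finally show "coset_symbol ?l (pcomp gr m j i u v) k = degree_part k (pcomp greg0 m j i (\<Psi> m u) (\<Psi> j v))" .
    qed
  next
    show "\<Psi> 1 (ident gr) = ident greg0"
    proof (rule \<Psi>_eqI)
      fix k
      have i: "\<Phi> 1 (ident P) = dot 1" using operad_homD(6)[OF hom] by (simp only: greg_operad_simps)
      have d: "dot 1 \<in> (supported {t. num_black t = 0} :: ((nat, nat) gtree \<Rightarrow>\<^sub>0 'k) set)" by simp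
      show "coset_symbol 1 (ident gr) k = degree_part k (ident greg0)"
      proof (cases "k = 0")
        case True
        have "coset_symbol 1 (ident gr) 0 = symbol 0 1 (ident P)"
        proof (rule coset_symbol_gr_class)
          show "ident P \<in> F 0 1" using ident_closed i by (simp add: F_iff del: One_nat_def)
        qed (simp add: gr_operad_def)
        then show ?thesis using True by (simp only: symbol_def i greg_operad_simps)
      next
        case False
        then have "coset_symbol 1 (ident gr) k = 0" by (intro coset_symbol_zero) (simp add: gr_operad_def)
        moreover have "degree_part k (dot 1) = (0 :: (nat, nat) gtree \<Rightarrow>\<^sub>0 'k)" by (rule proj_disjoint[OF d]) (use False in auto)
        ultimately show ?thesis by (simp only: greg_operad_simps)
      qed
    qed
  qed
  moreover have "bij_betw (\<Psi> m) (els gr m) (els greg0 m)" for m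
    unfolding bij_betw_def
  proof
    show "inj_on (\<Psi> m) (els gr m)"
    proof (rule inj_onI, rule ext)
      fix u v k assume u: "u \<in> els gr m" and v: "v \<in> els gr m" and eq: "\<Psi> m u = \<Psi> m v"
      have "coset_symbol m u k = coset_symbol m v k" using gr_elsE(4)[OF u, of k] gr_elsE(4)[OF v, of k] eq by simp
      then have "gr_class P F k m (rep (u k)) = gr_class P F k m (rep (v k))"
        using gr_elsE(1)[OF u, of k] gr_elsE(1)[OF v, of k] by (simp add: gr_class_symbol coset_symbol_def)
      then show "u k = v k" using gr_elsE(2)[OF u, of k] gr_elsE(2)[OF v, of k] by simp
    qed
    show "\<Psi> m ` els gr m = els greg0 m"
    proof
      show "\<Psi> m ` els gr m \<subseteq> els greg0 m" using operad_homD(1)[OF \<open>operad_hom gr greg0 \<Psi>\<close>] by blast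
      show "els greg0 m \<subseteq> \<Psi> m ` els gr m"
      proof
        fix q assume "q \<in> els greg0 m"
        then have q: "q \<in> supported (greg_trees B {1..m})" by (simp only: greg_operad_simps)
        have surj: "\<Phi> m ` els P m = supported (greg_trees B {1..m})"
          using iso by (simp only: operad_iso_def bij_betw_def greg_operad_simps)
        have "\<exists>x\<in>els P m. \<Phi> m x = degree_part k q" for k
          using supported_mono[OF proj_subset[OF q, of "{t. num_black t = k}"]] surj by (metis (no_types, lifting) imageE inf_le2)
        then obtain y where y: "\<And>k. y k \<in> els P m" "\<And>k. \<Phi> m (y k) = degree_part k q" by metis
        have yF: "y k \<in> F k m" for k
          unfolding F_iff y(2) by (intro conjI y(1) supported_mono[OF proj_supported]) auto
        have ys: "symbol k m (y k) = degree_part k q" for k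
          using degree_part_degree_part[of k k q] by (simp add: symbol_def y(2))
        define u where "u k = gr_class P F k m (y k)" for k
        have "{k. u k \<noteq> F (Suc k) m} \<subseteq> {k. degree_part k q \<noteq> 0}"
          using gr_class_symbol[OF yF] gr_class_symbol[OF F_zero] by (auto simp: u_def F_gr_class ys symbol_simps)
        then have "u \<in> els gr m"
          using finite_subset[OF _ finite_degree_parts] yF by (auto simp: gr_operad_def linear_space_def u_def)
        moreover have "\<Psi> m u = q"
          by (rule \<Psi>_eqI) (simp only: coset_symbol_gr_class[of u _ m, OF u_def yF] ys)
        ultimately show "q \<in> \<Psi> m ` els gr m" by blast
      qed
    qed
  qed
  ultimately show ?thesis by (simp add: operad_iso_def)
qed

lemma preserves_black_grading_\<Psi>: "preserves_black_grading P F \<Psi>"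
  unfolding preserves_black_grading_def
proof (intro allI ballI impI)
  fix m k u t assume u: "u \<in> els gr m" and k: "\<forall>l. l \<noteq> k \<longrightarrow> u l = F (Suc l) m" and t: "t \<in> Poly_Mapping.keys (\<Psi> m u)"
  have "coset_symbol m u (num_black t) \<noteq> 0"
    using t lookup_proj[of "{s. num_black s = num_black t}" "\<Psi> m u" t]
    unfolding gr_elsE(4)[OF u, symmetric] by (auto simp: in_keys_iff)
  then show "num_black t = k" using k coset_symbol_zero by blast
qed

end

theorem corollary5p4:
  fixes n :: nat
  defines "P \<equiv> PreLie_coproduct (n + 1) :: ('k::field_char_0, _) operad"
  shows "\<exists>\<Phi>. operad_iso P (greg_operad {1..n} (delta_max n)) \<Phi> \<and>
     (let F = black_filtration P \<Phi> in
        operad_filtration P F \<and>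
        (\<exists>\<Psi>. operad_iso (gr_operad P F) (greg_operad {1..n} (\<lambda>_. 0)) \<Psi> \<and>
             preserves_black_grading P F \<Psi>))"
proof -
  obtain \<Phi> where \<Phi>: "operad_iso P (greg_operad {1..n} (delta_max n)) \<Phi>"
    using coproduct_iso_greg[of n] unfolding P_def by blast
  interpret greg_model P "{1..n}" "delta_max n" \<Phi>
    using \<Phi> operad_coproduct[of n] by (simp add: greg_model_def greg_model_axioms_def P_def del: One_nat_def)
  show ?thesis
    unfolding Let_def using \<Phi> operad_filtration_F operad_iso_\<Psi> preserves_black_grading_\<Psi> by blast
qed

end
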